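(* For any fixed prime $p$, as $\epsilon \to 0$, $$\epsilon^{-1/c_p + 1 + o(1)} \le \log_p M_p(\epsilon) \le \epsilon^{-2/c_p - 2 + o(1)}.$$
   Context: For a prime $p$, the constant $0<c_p<1$ is defined by $$p^{1-c_p} = \inf_{0 < t < 1} t^{-(p-1)/3}(1 + t + t^2 + \cdots + t^{p-1}).$$ Given $X,Y,Z \subseteq \mathbb{F}_p^n$, a triangle in $X \times Y \times Z$ is a triple $(x,y,z) \in X \times Y \times Z$ with $x+y+z = 0$; $X\times Y\times Z$ is triangle-free if it contains no triangle. For $\epsilon>0$, $m_p(\epsilon)$ is the smallest positive integer $m$ such that whenever $X,Y,Z \subseteq \mathbb{F}_p^n$ (for any $n$) are such that $X\times Y \times Z$ is triangle-free, there exist $X',Y',Z' \subseteq \mathbb{F}_p^m$ with $X' \times Y' \times Z'$ triangle-free, and a linear map $\phi \colon \mathbb{F}_p^n \to \mathbb{F}_p^m$ such that at most $\epsilon p^n$ elements from each of $X,Y,Z$ do not get mapped by $\phi$ to $X',Y',Z'$ respectively (such $m$ exists). Set $M_p(\epsilon) = p^{m_p(\epsilon)}$. Here $o(1)$ denotes a quantity tending to $0$ as $\epsilon\to 0^+$ with $p$ fixed (possibly different in the two bounds). *)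

theory Defs
  imports
    Complex_Main
    "Berlekamp_Zassenhaus.Finite_Field"
    "Jordan_Normal_Form.VS_Connect"
begin

text \<open>
  The prime p is CARD('p) for a type 'p of class prime_card, the field F_p is the type
  'p mod_ring, and F_p^n is the set carrier_vec n of vectors over this field, so that the
  dimension n is an ordinary natural number.
\<close>

definition growth_fun :: "nat \<Rightarrow> real \<Rightarrow> real" where
  "growth_fun p t = t powr (- ((real p - 1) / 3)) * (\<Sum>k<p. t ^ k)"

text \<open>
  The equation p powr (1 - c) = (INF t\<in>{0<..<1}. growth_fun p t) solved for c; see
  the lemmas powr_removal_const, removal_const_bounds and removal_const_unique below.
\<close>

definition removal_const :: "nat \<Rightarrow> real" where
  "removal_const p = 1 - log (real p) (INF t\<in>{0<..<1}. growth_fun p t)"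

lemma growth_fun_lower:
  assumes p: "p \<ge> 2" and t: "t \<in> {0<..<1}"
  shows "growth_fun p t \<ge> min (3/2) (2 powr (1/3))"
proof -
  define a where "a = (real p - 1) / 3"
  have a: "a \<ge> 1/3" using p by (auto simp: a_def)
  have t0: "0 < t" "t < 1" using t by auto
  have "(\<Sum>k<2. t ^ k) \<le> (\<Sum>k<p. t ^ k)"
    by (rule sum_mono2) (use p t0 in auto)
  hence s: "1 + t \<le> (\<Sum>k<p. t ^ k)" by (simp add: numeral_2_eq_2)
  have inv: "t powr (- a) = (1 / t) powr a"
    using t0 by (simp add: powr_minus powr_divide inverse_eq_divide)
  show ?thesis
  proof (cases "t \<ge> 1/2")
    case True
    have "1 \<le> t powr (- a)"
      unfolding inv using a t0 by (intro ge_one_powr_ge_zero) auto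
    hence "1 * (3/2) \<le> t powr (- a) * (\<Sum>k<p. t ^ k)"
      using s True by (intro mult_mono) auto
    thus ?thesis by (simp add: growth_fun_def a_def)
  next
    case False
    have "2 powr (1/3) \<le> (2::real) powr a" using a by simp
    also have "\<dots> \<le> (1 / t) powr a"
      using False t0 a by (intro powr_mono2) (auto simp: field_simps)
    finally have "2 powr (1/3) * 1 \<le> t powr (- a) * (\<Sum>k<p. t ^ k)"
      unfolding inv[symmetric] using s t0 by (intro mult_mono) auto
    thus ?thesis by (simp add: growth_fun_def a_def)
  qed
qed

lemma growth_fun_Inf_gt_1:
  assumes "p \<ge> 2"
  shows "(INF t\<in>{0<..<1}. growth_fun p t) > 1"
proof -
  have "min (3/2) (2 powr (1/3)) \<le> (INF t\<in>{0<..<1}. growth_fun p t)"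
    using growth_fun_lower[OF assms] by (intro cINF_greatest) auto
  moreover have "(1::real) < min (3/2) (2 powr (1/3))" by simp
  ultimately show ?thesis by (rule less_le_trans[rotated])
qed

lemma growth_fun_Inf_less:
  assumes p: "p \<ge> 2"
  shows "(INF t\<in>{0<..<1}. growth_fun p t) < real p"
proof -
  have sum_nat: "(\<Sum>k<p. real k) = real p * (real p - 1) / 2"
    by (induction p) (auto simp: field_simps)
  have "(growth_fun p has_real_derivative
          (- ((real p - 1) / 3)) * real p + (\<Sum>k<p. real k)) (at 1)"
    unfolding growth_fun_def
    by (rule derivative_eq_intros refl | simp)+
  moreover have "(- ((real p - 1) / 3)) * real p + (\<Sum>k<p. real k) > 0"
    unfolding sum_nat using p by (simp add: field_simps)
  ultimately obtain d where d: "d > 0" "\<And>h. 0 < h \<Longrightarrow> h < d \<Longrightarrow> growth_fun p (1 - h) < growth_fun p 1"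
    using DERIV_pos_inc_left by blast
  define h where "h = min (d/2) (1/2)"
  have h: "0 < h" "h < d" "h < 1" using d(1) by (auto simp: h_def)
  have "bdd_below (growth_fun p ` {0<..<1})"
    using growth_fun_lower[OF p] by (intro bdd_belowI2)
  hence "(INF t\<in>{0<..<1}. growth_fun p t) \<le> growth_fun p (1 - h)"
    using h by (intro cINF_lower) auto
  also have "\<dots> < growth_fun p 1" using d(2) h by auto
  also have "\<dots> = real p" by (simp add: growth_fun_def)
  finally show ?thesis .
qed

lemma powr_removal_const:
  assumes "p \<ge> 2"
  shows "real p powr (1 - removal_const p) = (INF t\<in>{0<..<1}. growth_fun p t)"
  using growth_fun_Inf_gt_1[OF assms] assms by (simp add: removal_const_def)

lemma removal_const_bounds:
  assumes "p \<ge> 2"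
  shows "0 < removal_const p" "removal_const p < 1"
  using growth_fun_Inf_gt_1[OF assms] growth_fun_Inf_less[OF assms] assms
  by (auto simp: removal_const_def)

lemma removal_const_unique:
  assumes "p \<ge> 2" "real p powr (1 - c) = (INF t\<in>{0<..<1}. growth_fun p t)"
  shows "c = removal_const p"
proof -
  have "real p powr (1 - c) = real p powr (1 - removal_const p)"
    using assms powr_removal_const by simp
  thus ?thesis using assms(1) powr_inj[of "real p" "1 - c" "1 - removal_const p"] by auto
qed

definition triangle_free ::
  "nat \<Rightarrow> 'p::prime_card mod_ring vec set \<Rightarrow> 'p mod_ring vec set \<Rightarrow> 'p mod_ring vec set \<Rightarrow> bool" where
  "triangle_free n X Y Z \<longleftrightarrow> \<not> (\<exists>x\<in>X. \<exists>y\<in>Y. \<exists>z\<in>Z. x + y + z = 0\<^sub>v n)"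

definition linear_vec_map ::
  "nat \<Rightarrow> nat \<Rightarrow> ('p::prime_card mod_ring vec \<Rightarrow> 'p mod_ring vec) \<Rightarrow> bool" where
  "linear_vec_map n m \<phi> \<longleftrightarrow>
     linear_map class_ring (module_vec TYPE('p mod_ring) n) (module_vec TYPE('p mod_ring) m) \<phi>"

definition almost_maps_into ::
  "real \<Rightarrow> nat \<Rightarrow> ('p::prime_card mod_ring vec \<Rightarrow> 'p mod_ring vec) \<Rightarrow>
     'p mod_ring vec set \<Rightarrow> 'p mod_ring vec set \<Rightarrow> bool" where
  "almost_maps_into \<epsilon> n \<phi> X X' \<longleftrightarrow> real (card {x \<in> X. \<phi> x \<notin> X'}) \<le> \<epsilon> * real CARD('p) ^ n"

definition removal_dim_ok :: "'p::prime_card itself \<Rightarrow> real \<Rightarrow> nat \<Rightarrow> bool" where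
  "removal_dim_ok _ \<epsilon> m \<longleftrightarrow>
     (\<forall>n. \<forall>X Y Z :: 'p mod_ring vec set.
        X \<subseteq> carrier_vec n \<longrightarrow> Y \<subseteq> carrier_vec n \<longrightarrow> Z \<subseteq> carrier_vec n \<longrightarrow> triangle_free n X Y Z \<longrightarrow>
        (\<exists>X' Y' Z' \<phi>.
           X' \<subseteq> carrier_vec m \<and> Y' \<subseteq> carrier_vec m \<and> Z' \<subseteq> carrier_vec m \<and>
           triangle_free m X' Y' Z' \<and> linear_vec_map n m \<phi> \<and>
           almost_maps_into \<epsilon> n \<phi> X X' \<and> almost_maps_into \<epsilon> n \<phi> Y Y' \<and>
           almost_maps_into \<epsilon> n \<phi> Z Z'))"

text \<open>
  For \<epsilon> > 0 a suitable m exists by Green's arithmetic removal lemma; LEAST would be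
  unspecified otherwise.
\<close>

definition removal_dim :: "'p::prime_card itself \<Rightarrow> real \<Rightarrow> nat" where
  "removal_dim P \<epsilon> = (LEAST m. 0 < m \<and> removal_dim_ok P \<epsilon> m)"

definition removal_size :: "'p::prime_card itself \<Rightarrow> real \<Rightarrow> nat" where
  "removal_size P \<epsilon> = CARD('p) ^ removal_dim P \<epsilon>"

text \<open>
  The library notion of linear map between these coordinate spaces is the usual
  one, and its domain and codomain are the coordinate spaces themselves.
\<close>

lemma linear_vec_map_iff:
  fixes \<phi> :: "'p::prime_card mod_ring vec \<Rightarrow> 'p mod_ring vec"
  shows "linear_vec_map n m \<phi> \<longleftrightarrow>
     (\<forall>v\<in>carrier_vec n. \<phi> v \<in> carrier_vec m) \<and>
     (\<forall>v\<in>carrier_vec n. \<forall>w\<in>carrier_vec n. \<phi> (v + w) = \<phi> v + \<phi> w) \<and>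
     (\<forall>a. \<forall>v\<in>carrier_vec n. \<phi> (a \<cdot>\<^sub>v v) = a \<cdot>\<^sub>v \<phi> v)"
  unfolding linear_vec_map_def linear_map_def mod_hom_def mod_hom_axioms_def LinearCombinations.module_hom_def
  using vec_vs[of n, where 'a="'p mod_ring"] vec_vs[of m, where 'a="'p mod_ring"]
    vec_module[of n, where 'a="'p mod_ring"] vec_module[of m, where 'a="'p mod_ring"]
  by (auto simp: module_vec_simps class_ring_simps)

end

theory Submission
  imports Defs "HOL-Analysis.Analysis" "HOL-Library.Function_Algebras" "HOL-Combinatorics.Multiset_Permutations"
begin

text \<open>
  Write \<open>c\<close> for \<^const>\<open>removal_const\<close> of \<open>p\<close>. A tricolored set of size \<open>s\<close> in \<open>F_p^n\<close> consists of \<open>s\<close> triangles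
  such that no triangle mixes vertices of two of them. Both bounds rest on the fact that the largest
  tricolored sets in \<open>F_p^n\<close> have \<open>p^((1 - c + o(1)) n)\<close> elements.

  Upper bound. The slice rank method gives at most \<open>3 p^((1 - c) n)\<close> triangles in a tricolored set. Sampling the
  space by random affine images of \<open>F_p^d\<close> turns this into a removal lemma with a polynomial bound for
  functions with values in \<open>[0,1]\<close>: if the weighted number of triangles is at most a constant times
  \<open>\<epsilon>^(1 + 1/c) p^(2n)\<close>, then deleting mass \<open>\<epsilon> p^n\<close> from each function destroys all of them
  (\<open>weighted_removal\<close>). For a triangle-free \<open>X \<times> Y \<times> Z\<close>, let \<open>K\<close> be the subspace orthogonal to
  the Fourier coefficients of \<open>X\<close> that exceed \<open>\<delta> p^n\<close>. By Parseval there are at most \<open>1/\<delta>^2\<close> of them, and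
  averaging the three indicator functions over the cosets of \<open>K\<close> creates a density of at most \<open>\<delta>\<close> of triangles. With
  \<open>\<delta>\<close> of order \<open>\<epsilon>^(1 + 1/c)\<close> the weighted removal lemma, applied to the averaged functions, cleans up at the level of
  cosets, so that the quotient map by \<open>K\<close> has the required properties (\<open>dimension_upper_bound\<close>). Hence
  \<open>m\<close> may be taken to be of order \<open>\<delta>^(-2)\<close>, that is \<open>\<epsilon>^(-2/c - 2)\<close>.

  Lower bound. Let \<open>(x_i, y_i, z_i)\<close>, \<open>i < s\<close>, be tricolored in \<open>F_p^k\<close>, and work in \<open>F_p^k \<times> F_p^s\<close>. The pairs
  \<open>(x_i, v)\<close> and \<open>(y_i, v)\<close> with \<open>v_i = 0\<close>, and \<open>(z_i, v)\<close> with \<open>v_i \<noteq> 0\<close>, form a triangle-free triple of sets. A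
  linear map to \<open>F_p^m\<close> with \<open>m < s\<close> has a kernel on \<open>F_p^s\<close> in which all but \<open>m\<close> coordinates are
  not identically zero; in each of these coordinates the images of the three sets would contain many triangles, so a
  fraction of order \<open>(s - m) p^(-k)\<close> of the space must be lost (\<open>removal_dim_lower\<close>). Balancing \<open>\<epsilon>\<close> against \<open>s = p^((1 - c - o(1)) k)\<close>
  yields \<open>m \<ge> \<epsilon>^(-1/c + 1 + o(1))\<close>.

  Large tricolored sets come from the maximal entropy among distributions on \<open>{0..p-1}\<close> of mean \<open>(p-1)/3\<close>. It is
  attained by a truncated geometric distribution \<open>\<psi>\<close>, its entropy is the logarithm of \<open>p^(1 - c)\<close>, and one needs
  three random variables, each distributed as \<open>\<psi>\<close>, whose sum is always \<open>p - 1\<close>. That they exist is, by linear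
  programming duality, the inequality \<open>decreasing_mean_third_dual\<close>. Rounding gives a multiset \<open>A\<close> of
  digits such that many triples of rearrangements of \<open>A\<close> add up to \<open>p - 1\<close> in each position. A random linear hash into
  a set without three-term progressions selects among these triples a large subfamily of
  isolated ones (\<open>isolated_triangles\<close>), and this is the tricolored set up to a shift of the third coordinate.
\<close>

section \<open>Decreasing distributions of mean one third of the maximum\<close>

text \<open>Both sides count the subsets of size \<open>i + k + 1\<close> of a set
  of \<open>i + k + q + 1\<close> elements, the left one by the position of the element with exactly \<open>i\<close> selected predecessors.\<close>

lemma choose_convolution:
  "(\<Sum>l\<le>q. ((i + l) choose i) * ((k + q - l) choose k)) = (i + k + 1 + q) choose q"
proof (induction i arbitrary: q)
  case 0
  have "(\<Sum>l\<le>q. ((0 + l) choose 0) * ((k + q - l) choose k)) = (\<Sum>l\<le>q. (k + (q - l)) choose k)"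
    by (intro sum.cong) auto
  also have "\<dots> = (\<Sum>l\<le>q. (k + l) choose k)"
    using sum.nat_diff_reindex[of "\<lambda>l. (k + l) choose k" "Suc q"] by (simp add: lessThan_Suc_atMost)
  also have "\<dots> = (k + q + 1) choose q"
    using sum_choose_lower[of k q] by (simp add: binomial_symmetric[of k] )
  finally show ?case by (simp add: add_ac)
next
  case (Suc i)
  note IH = Suc
  show ?case
  proof (induction q)
    case 0
    show ?case by simp
  next
    case (Suc q)
    have "(\<Sum>l\<le>Suc q. ((Suc i + l) choose Suc i) * ((k + Suc q - l) choose k))
        = (\<Sum>l\<le>Suc q. ((i + l) choose i) * ((k + Suc q - l) choose k))
          + (\<Sum>l\<le>Suc q. ((i + l) choose Suc i) * ((k + Suc q - l) choose k))"
      by (simp add: sum.distrib algebra_simps)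
    also have "(\<Sum>l\<le>Suc q. ((i + l) choose Suc i) * ((k + Suc q - l) choose k))
        = (\<Sum>l\<le>q. ((Suc i + l) choose Suc i) * ((k + q - l) choose k))"
      by (subst sum.atMost_Suc_shift) (simp del: sum.atMost_Suc)
    finally show ?case unfolding IH Suc.IH by (simp add: add_ac)
  qed
qed

text \<open>Weight the inequality at \<open>(i, l)\<close> by the number of monotone lattice paths from \<open>(0, 0)\<close> to \<open>(p, q)\<close> through that
  point and add up. Then all rows have equal weight, all columns have equal weight, and so do all antidiagonals, since
  each path meets each antidiagonal once.\<close>

lemma grid_inequality:
  fixes a b c :: "nat \<Rightarrow> real"
  assumes "\<And>i l. i \<le> p \<Longrightarrow> l \<le> q \<Longrightarrow> a i + b l + c (i + l) \<ge> 0"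
  shows "real ((p + q + 1) choose q) * (\<Sum>i\<le>p. a i) + real ((p + q + 1) choose p) * (\<Sum>l\<le>q. b l)
           + real ((p + q) choose p) * (\<Sum>s\<le>p+q. c s) \<ge> 0"
proof -
  define w where "w i l = ((i + l) choose i) * ((p - i + q - l) choose (p - i))" for i l
  have row: "(\<Sum>l\<le>q. w i l) = (p + q + 1) choose q" if "i \<le> p" for i
    using choose_convolution[of i "p - i" q] that by (simp add: w_def)
  have col: "(\<Sum>i\<le>p. w i l) = (p + q + 1) choose p" if "l \<le> q" for l
  proof -
    have "(\<Sum>i\<le>p. w i l) = (\<Sum>i\<le>p. ((l + i) choose l) * ((q - l + p - i) choose (q - l)))"
    proof (intro sum.cong refl)
      fix i assume "i \<in> {..p}"
      hence "i \<le> p" by simp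
      thus "w i l = ((l + i) choose l) * ((q - l + p - i) choose (q - l))"
        using that binomial_symmetric[of i "i + l"] binomial_symmetric[of "p - i" "p - i + q - l"]
        by (simp add: w_def add.commute)
    qed
    also have "\<dots> = (p + q + 1) choose p"
      using choose_convolution[of l "q - l" p] that by (simp add: add_ac)
    finally show ?thesis .
  qed
  have diag: "(\<Sum>(i,l)\<in>{x\<in>{..p}\<times>{..q}. fst x + snd x = s}. real (w i l) * c s)
      = real ((p + q) choose p) * c s" if "s \<le> p + q" for s
  proof -
    have "(\<Sum>(i,l)\<in>{x\<in>{..p}\<times>{..q}. fst x + snd x = s}. real (w i l) * c s)
       = (\<Sum>i\<in>{i. i \<le> p \<and> i \<le> s \<and> s - i \<le> q}. real (w i (s - i)) * c s)"
      by (rule sum.reindex_bij_witness[of _ "\<lambda>i. (i, s - i)" fst]) auto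
    also have "\<dots> = (\<Sum>i\<in>{i. i \<le> p \<and> i \<le> s \<and> s - i \<le> q}. real ((s choose i) * ((p + q - s) choose (p - i))) * c s)"
      by (intro sum.cong) (auto simp: w_def)
    also have "\<dots> = (\<Sum>i\<le>p. real ((s choose i) * ((p + q - s) choose (p - i))) * c s)"
      using that by (intro sum.mono_neutral_left) (auto simp: not_le binomial_eq_0)
    also have "\<dots> = real (\<Sum>i\<le>p. (s choose i) * ((p + q - s) choose (p - i))) * c s"
      by (simp add: sum_distrib_right)
    also have "(\<Sum>i\<le>p. (s choose i) * ((p + q - s) choose (p - i))) = (p + q) choose p"
      using vandermonde[of s "p + q - s" p] that by simp
    finally show ?thesis .
  qed
  have "0 \<le> (\<Sum>i\<le>p. \<Sum>l\<le>q. real (w i l) * (a i + b l + c (i + l)))"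
    using assms by (intro sum_nonneg mult_nonneg_nonneg) auto
  also have "\<dots> = (\<Sum>i\<le>p. \<Sum>l\<le>q. real (w i l) * a i) + (\<Sum>i\<le>p. \<Sum>l\<le>q. real (w i l) * b l)
      + (\<Sum>i\<le>p. \<Sum>l\<le>q. real (w i l) * c (i + l))"
    by (simp add: sum.distrib algebra_simps)
  also have "(\<Sum>i\<le>p. \<Sum>l\<le>q. real (w i l) * a i) = (\<Sum>i\<le>p. real (\<Sum>l\<le>q. w i l) * a i)"
    by (simp add: sum_distrib_right)
  also have "\<dots> = real ((p + q + 1) choose q) * (\<Sum>i\<le>p. a i)"
    unfolding sum_distrib_left by (intro sum.cong) (auto simp: row)
  also have "(\<Sum>i\<le>p. \<Sum>l\<le>q. real (w i l) * b l) = (\<Sum>l\<le>q. real (\<Sum>i\<le>p. w i l) * b l)"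
    by (subst sum.swap) (simp add: sum_distrib_right)
  also have "\<dots> = real ((p + q + 1) choose p) * (\<Sum>l\<le>q. b l)"
    unfolding sum_distrib_left by (intro sum.cong) (auto simp: col)
  also have "(\<Sum>i\<le>p. \<Sum>l\<le>q. real (w i l) * c (i + l)) = (\<Sum>x\<in>{..p}\<times>{..q}. real (w (fst x) (snd x)) * c (fst x + snd x))"
    by (simp add: sum.cartesian_product case_prod_beta)
  also have "\<dots> = (\<Sum>s\<le>p+q. \<Sum>x\<in>{x\<in>{..p}\<times>{..q}. fst x + snd x = s}. real (w (fst x) (snd x)) * c (fst x + snd x))"
    by (rule sum.group[symmetric]) auto
  also have "\<dots> = (\<Sum>s\<le>p+q. real ((p + q) choose p) * c s)"
  proof (intro sum.cong refl)
    fix s assume "s \<in> {..p+q}"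
    hence s: "s \<le> p + q" by simp
    show "(\<Sum>x\<in>{x\<in>{..p}\<times>{..q}. fst x + snd x = s}. real (w (fst x) (snd x)) * c (fst x + snd x))
      = real ((p + q) choose p) * c s"
      unfolding diag[OF s, symmetric] by (intro sum.cong) auto
  qed
  also have "\<dots> = real ((p + q) choose p) * (\<Sum>s\<le>p+q. c s)"
    by (simp add: sum_distrib_left)
  finally show ?thesis .
qed

lemma continuous_on_Min_image:
  fixes f :: "'i \<Rightarrow> real \<Rightarrow> real"
  assumes "finite A" "A \<noteq> {}" "\<And>a. a \<in> A \<Longrightarrow> continuous_on S (f a)"
  shows "continuous_on S (\<lambda>x. Min ((\<lambda>a. f a x) ` A))"
  using assms
proof (induction A rule: finite_ne_induct)
  case (insert a A)
  thus ?case by (simp add: continuous_on_min)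
qed auto

lemma abel_summation:
  fixes w \<psi> :: "nat \<Rightarrow> real"
  shows "(\<Sum>i\<le>m. \<psi> i * w i) = \<psi> m * (\<Sum>i\<le>m. w i) + (\<Sum>i<m. (\<psi> i - \<psi> (Suc i)) * (\<Sum>l\<le>i. w l))"
  by (induction m) (auto simp: algebra_simps)

text \<open>The core of the duality argument. The partial sums \<open>W\<close> of \<open>w\<close> attain their minimum once to the left of \<open>2m/3\<close>,
  at \<open>j\<close>, and once to the right of it, at \<open>k\<close>. Sums of \<open>w\<close> over intervals that end at \<open>j\<close> or \<open>k\<close> are then at most
  \<open>0\<close>, and the proof looks for a combination of the inequalities \<open>w a + w b + w c \<ge> 0\<close> that involves only such
  intervals and the sum over \<open>{..j}\<close>, which is negative. If \<open>j + k \<le> m\<close>, pairing the entries of an interval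
  ending at \<open>k\<close> shows that \<open>w\<close> is nonnegative on \<open>{..j}\<close>. If \<open>2j \<le> m < j + k\<close>, the path weights of
  \<open>grid_inequality\<close> provide the combination. If \<open>2j > m\<close>, reversing \<open>w\<close> on \<open>{..j}\<close> leads to triples of sum
  \<open>3j - m < m\<close>, to which the induction hypothesis \<open>IH\<close> applies.\<close>

lemma negative_common_minimum_False:
  fixes w :: "nat \<Rightarrow> real"
  defines "W \<equiv> (\<lambda>n. \<Sum>i\<le>n. w i)"
  assumes IH: "\<And>m' v \<psi>. m' < m \<Longrightarrow> (\<And>a b c. a + b + c = m' \<Longrightarrow> 0 \<le> v a + v b + v c) \<Longrightarrow>
      (\<And>i. i \<le> m' \<Longrightarrow> (0::real) \<le> \<psi> i) \<Longrightarrow> (\<And>i. i < m' \<Longrightarrow> \<psi> (Suc i) \<le> \<psi> i) \<Longrightarrow>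
      (\<Sum>i\<le>m'. \<psi> i * (real m' - 3 * real i)) = 0 \<Longrightarrow> 0 \<le> (\<Sum>i\<le>m'. \<psi> i * v i)"
  assumes triple: "\<And>a b c. a + b + c = m \<Longrightarrow> w a + w b + w c \<ge> 0"
    and j: "3 * j < 2 * m" and k: "2 * m \<le> 3 * k" "k \<le> m"
    and min: "\<And>x. x \<le> m \<Longrightarrow> W j \<le> W x" and jk: "W k = W j" and neg: "W j < 0"
  shows False
proof -
  have below: "(\<Sum>i\<in>{x..e}. w i) \<le> 0" if "e = j \<or> e = k" "x \<le> e" for x e
  proof (cases x)
    case 0
    thus ?thesis using that neg jk by (auto simp: W_def atLeast0AtMost)
  next
    case (Suc y)
    have "{..e} = {..y} \<union> {x..e}" using Suc that by auto
    hence "W e = W y + (\<Sum>i\<in>{x..e}. w i)"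
      unfolding W_def using Suc by (subst sum.union_disjoint[symmetric]) auto
    moreover have "W e \<le> W y" using min[of y] that Suc jk j k by auto
    ultimately show ?thesis by simp
  qed
  consider (small) "j + k \<le> m" | (medium) "j + k > m" "2 * j \<le> m" | (large) "2 * j > m" by linarith
  thus False
  proof cases
    case small
    have "w c \<ge> 0" if "c \<le> m - k" for c
    proof -
      define x where "x = m - c - k"
      have x: "x \<le> k" "m = x + c + k" using that k j by (auto simp: x_def)
      have "0 \<le> (\<Sum>i\<in>{x..k}. w i + w (x + k - i) + w c)"
        using x by (intro sum_nonneg triple) auto
      also have "\<dots> = (\<Sum>i\<in>{x..k}. w i) + (\<Sum>i\<in>{x..k}. w (x + k - i)) + real (k - x + 1) * w c"
        using x by (simp add: sum.distrib Suc_diff_le)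
      also have "(\<Sum>i\<in>{x..k}. w (x + k - i)) = (\<Sum>i\<in>{x..k}. w i)"
        by (rule sum.reindex_bij_witness[of _ "\<lambda>i. x + k - i" "\<lambda>i. x + k - i"]) auto
      finally have "0 \<le> real (k - x + 1) * w c" using below[of k x] x by simp
      thus ?thesis by (simp add: zero_le_mult_iff)
    qed
    hence "W j \<ge> 0" using small unfolding W_def by (intro sum_nonneg) auto
    thus False using neg by simp
  next
    case medium
    define q where "q = j + k - m"
    have "0 \<le> real ((j + q + 1) choose q) * (\<Sum>i\<le>j. w i) + real ((j + q + 1) choose j) * (\<Sum>l\<le>q. w (m - k + l))
           + real ((j + q) choose j) * (\<Sum>s\<le>j+q. w (k - s))"
      using medium k j by (intro grid_inequality triple) (auto simp: q_def)
    moreover have "(\<Sum>l\<le>q. w (m - k + l)) = (\<Sum>i\<in>{m-k..j}. w i)"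
      using medium k j
      by (intro sum.reindex_bij_witness[of _ "\<lambda>i. i - (m - k)" "\<lambda>i. m - k + i"]) (auto simp: q_def)
    moreover have "(\<Sum>s\<le>j+q. w (k - s)) = (\<Sum>i\<in>{m-2*j..k}. w i)"
      using medium k j
      by (intro sum.reindex_bij_witness[of _ "\<lambda>i. k - i" "\<lambda>i. k - i"]) (auto simp: q_def)
    moreover have "(\<Sum>i\<in>{m-k..j}. w i) \<le> 0" "(\<Sum>i\<in>{m-2*j..k}. w i) \<le> 0"
      using medium k j by (auto intro!: below)
    moreover have "real ((j + q + 1) choose q) * (\<Sum>i\<le>j. w i) < 0"
      using neg by (intro mult_pos_neg) (auto simp: W_def zero_less_binomial_iff)
    ultimately show False
      using mult_nonneg_nonpos[of "real ((j + q + 1) choose j)" "\<Sum>i\<in>{m-k..j}. w i"]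
        mult_nonneg_nonpos[of "real ((j + q) choose j)" "\<Sum>i\<in>{m-2*j..k}. w i"] by simp
  next
    case large
    \<comment> \<open>If \<open>a + b + c = 3 * j - m\<close>, then \<open>j - a\<close>, \<open>j - b\<close>, \<open>j - c\<close> add up to \<open>m\<close>; \<open>B\<close> is so large that triples with an entry above \<open>j\<close> are harmless.\<close>
    define m' where "m' = 3 * j - m"
    have m': "m' < m" "j \<le> m'" "m' > 0" using j large by (auto simp: m'_def)
    define B where "B = 2 * (\<Sum>i\<le>m. \<bar>w i\<bar>)"
    have wB: "- w i \<le> B / 2" if "i \<le> m" for i
      using member_le_sum[of i "{..m}" "\<lambda>i. \<bar>w i\<bar>"] that by (simp add: B_def)
    have B0: "B \<ge> 0" by (auto simp: B_def intro!: sum_nonneg)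
    define v where "v i = (if i \<le> j then w (j - i) else B)" for i
    \<comment> \<open>The extra mass \<open>\<alpha>\<close> at \<open>0\<close> corrects the mean of the uniform weights on \<open>{..j}\<close>.\<close>
    define \<alpha> where "\<alpha> = (real j + 1) * (3 * real j / 2 - real m') / real m'"
    have \<alpha>0: "\<alpha> \<ge> 0" using j large by (auto simp: \<alpha>_def m'_def intro!: divide_nonneg_nonneg mult_nonneg_nonneg)
    define \<psi> where "\<psi> i = (if i = 0 then 1 + \<alpha> else if i \<le> j then 1 else 0)" for i
    have split: "(\<Sum>i\<le>m'. \<psi> i * f i) = \<alpha> * f 0 + (\<Sum>i\<le>j. f i)" for f
    proof -
      have "(\<Sum>i\<le>m'. \<psi> i * f i) = (\<Sum>i\<le>m'. (if i = 0 then \<alpha> * f 0 else 0) + (if i \<in> {..j} then f i else 0))"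
        by (intro sum.cong) (auto simp: \<psi>_def algebra_simps)
      also have "\<dots> = \<alpha> * f 0 + (\<Sum>i\<in>{..m'} \<inter> {..j}. f i)"
        by (simp only: sum.distrib sum.inter_restrict[symmetric] finite_atMost) (simp add: sum.delta)
      also have "{..m'} \<inter> {..j} = {..j}" using m' by auto
      finally show ?thesis .
    qed
    have "0 \<le> (\<Sum>i\<le>m'. \<psi> i * v i)"
    proof (rule IH)
      show "m' < m" by fact
      show "0 \<le> v a + v b + v c" if "a + b + c = m'" for a b c
      proof (cases "a \<le> j \<and> b \<le> j \<and> c \<le> j")
        case True
        thus ?thesis using that large by (auto simp: v_def m'_def intro!: triple)
      next
        case False
        have "j - x \<le> m" for x using j by linarith
        hence "v x \<ge> - (B / 2)" for x using wB[of "j - x"] B0 by (auto simp: v_def)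
        moreover have "v x = B" if "\<not> x \<le> j" for x using that by (simp add: v_def)
        ultimately show ?thesis using False by (smt (verit, best) field_sum_of_halves)
      qed
      show "0 \<le> \<psi> i" for i using \<alpha>0 by (auto simp: \<psi>_def)
      show "\<psi> (Suc i) \<le> \<psi> i" for i using \<alpha>0 by (auto simp: \<psi>_def)
      have "(\<Sum>i\<le>j. real m' - 3 * real i) = (real j + 1) * (real m' - 3 * real j / 2)"
        by (induction j) (auto simp: field_simps)
      thus "(\<Sum>i\<le>m'. \<psi> i * (real m' - 3 * real i)) = 0"
        unfolding split using m' by (simp add: \<alpha>_def) (simp add: field_simps)
    qed
    also have "\<dots> = \<alpha> * w j + (\<Sum>i\<le>j. w (j - i))" unfolding split by (simp add: v_def)
    also have "(\<Sum>i\<le>j. w (j - i)) = W j"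
      unfolding W_def by (rule sum.reindex_bij_witness[of _ "\<lambda>i. j - i" "\<lambda>i. j - i"]) auto
    also have "\<alpha> * w j \<le> 0" using below[of j j] \<alpha>0 by (simp add: mult_nonneg_nonpos)
    finally show False using neg by simp
  qed
qed

text \<open>Adding a multiple of \<open>real m - 3 * real i\<close> to \<open>w i\<close> changes neither the hypothesis nor the conclusion. The multiple is
  chosen by the intermediate value theorem so that the minimum of the partial sums of \<open>w\<close> below \<open>2m/3\<close> equals the
  one above. This common minimum cannot be negative, so all partial sums are nonnegative, and summation
  by parts against the decreasing \<open>\<psi>\<close> finishes the proof.\<close>

theorem decreasing_mean_third_dual:
  fixes w \<psi> :: "nat \<Rightarrow> real"
  assumes "\<And>a b c. a + b + c = m \<Longrightarrow> 0 \<le> w a + w b + w c"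
    and "\<And>i. i \<le> m \<Longrightarrow> 0 \<le> \<psi> i" "\<And>i. i < m \<Longrightarrow> \<psi> (Suc i) \<le> \<psi> i"
    and "(\<Sum>i\<le>m. \<psi> i * (real m - 3 * real i)) = 0"
  shows "0 \<le> (\<Sum>i\<le>m. \<psi> i * w i)"
  using assms
proof (induction m arbitrary: w \<psi> rule: less_induct)
  case (less m)
  note triple = less.prems(1) and \<psi>0 = less.prems(2) and dec = less.prems(3) and mean = less.prems(4)
  show ?case
  proof (cases "m = 0")
    case True
    thus ?thesis using triple[of 0 0 0] \<psi>0[of 0] by simp
  next
    case False
    define W where "W n = (\<Sum>i\<le>n. w i)" for n
    define C where "C n = (\<Sum>i\<le>n. real m - 3 * real i)" for n
    have C: "C n = (real n + 1) * (2 * real m - 3 * real n) / 2" for n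
      unfolding C_def by (induction n) (auto simp: field_simps)
    define J where "J = {j. 3 * j < 2 * m}"
    define K where "K = {k. k \<le> m \<and> 2 * m \<le> 3 * k}"
    have J: "finite J" "0 \<in> J" and K: "finite K" "m \<in> K" and JK: "J \<union> K = {..m}"
      using False by (auto simp: J_def K_def intro: finite_subset[of _ "{..m}"])
    define F where "F s = Min ((\<lambda>j. W j + s * C j) ` J)" for s
    define G where "G s = Min ((\<lambda>k. W k + s * C k) ` K)" for s
    define b where "b = 4 * (\<Sum>i\<le>m. \<bar>W i\<bar>)"
    have Wb: "\<bar>W i\<bar> \<le> b / 4" if "i \<le> m" for i
      using member_le_sum[of i "{..m}" "\<lambda>i. \<bar>W i\<bar>"] that by (simp add: b_def)
    have b0: "b \<ge> 0" by (auto simp: b_def intro!: sum_nonneg)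
    have CJ: "C j \<ge> 1/2" if "j \<in> J" for j
    proof -
      have "1 * 1 \<le> (real j + 1) * (2 * real m - 3 * real j)"
        using that by (intro mult_mono) (auto simp: J_def)
      thus ?thesis by (simp add: C)
    qed
    have CK: "C k \<le> 0" if "k \<in> K" for k
      using that by (auto simp: C K_def intro!: mult_nonneg_nonpos)
    have cont: "continuous_on {-b..b} (\<lambda>x. F x - G x)"
      unfolding F_def G_def using J K
      by (intro continuous_on_diff continuous_on_Min_image continuous_intros) auto
    have "F b \<ge> G b"
      unfolding F_def
    proof (intro Min.boundedI)
      fix y assume "y \<in> (\<lambda>j. W j + b * C j) ` J"
      then obtain j where j: "j \<in> J" "y = W j + b * C j" by auto
      have jm: "j \<le> m" using j JK by auto
      have "G b \<le> W m + b * C m" unfolding G_def using K by (intro Min_le) auto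
      also have "\<dots> \<le> W m" using CK[of m] K b0 by (simp add: mult_nonneg_nonpos)
      also have "\<dots> \<le> W j + b * (1/2)" using Wb[of m] Wb[of j] jm b0 by auto
      also have "\<dots> \<le> y" unfolding j using CJ[OF j(1)] b0 by (intro add_left_mono mult_left_mono) auto
      finally show "G b \<le> y" .
    qed (use J in auto)
    moreover have "F (-b) \<le> G (-b)"
      unfolding G_def
    proof (intro Min.boundedI)
      fix y assume "y \<in> (\<lambda>k. W k + (-b) * C k) ` K"
      then obtain k where k: "k \<in> K" "y = W k + (-b) * C k" by auto
      have km: "k \<le> m" using k JK by auto
      have "F (-b) \<le> W 0 + (-b) * C 0" unfolding F_def using J by (intro Min_le) auto
      also have "(-b) * C 0 \<le> (-b) * (1/2)" using CJ[of 0] J b0 by (intro mult_left_mono_neg) auto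
      also have "W 0 + (-b) * (1/2) \<le> W k" using Wb[of 0] Wb[of k] km b0 by auto
      also have "\<dots> \<le> y" unfolding k using CK[OF k(1)] b0 by (auto intro!: mult_nonneg_nonpos)
      finally show "F (-b) \<le> y" by simp
    qed (use K in auto)
    ultimately obtain s where s: "F s = G s"
      using IVT'[of "\<lambda>x. F x - G x" "-b" 0 b] cont b0 by auto
    define v where "v i = w i + s * (real m - 3 * real i)" for i
    have V: "(\<Sum>i\<le>n. v i) = W n + s * C n" for n
      by (simp add: v_def W_def C_def sum.distrib sum_distrib_left)
    have vtriple: "0 \<le> v a + v b + v c" if "a + b + c = m" for a b c
    proof -
      have "v a + v b + v c = w a + w b + w c + s * (3 * (real m - real a - real b - real c))"
        unfolding v_def by (simp add: algebra_simps)
      also have "real m - real a - real b - real c = 0" using that by auto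
      finally have "v a + v b + v c = w a + w b + w c" by simp
      thus ?thesis using triple[OF that] by simp
    qed
    obtain j where j: "j \<in> J" "F s = W j + s * C j"
      using Min_in[of "(\<lambda>j. W j + s * C j) ` J"] J unfolding F_def by blast
    obtain k where k: "k \<in> K" "G s = W k + s * C k"
      using Min_in[of "(\<lambda>j. W j + s * C j) ` K"] K unfolding G_def by blast
    have min: "F s \<le> W x + s * C x" if "x \<le> m" for x
    proof -
      have "x \<in> J \<or> x \<in> K" using that JK by auto
      thus ?thesis
      proof
        assume "x \<in> J" thus ?thesis unfolding F_def using J by (intro Min_le) auto
      next
        assume "x \<in> K" thus ?thesis unfolding s unfolding G_def using K by (intro Min_le) auto
      qed
    qed
    have "F s \<ge> 0"
    proof (rule ccontr)
      assume "\<not> ?thesis"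
      hence "False" using j k s min
        by (intro negative_common_minimum_False[of m v j k, OF less.IH vtriple])
           (auto simp: V J_def K_def)
      thus False .
    qed
    hence pos: "0 \<le> (\<Sum>i\<le>n. v i)" if "n \<le> m" for n
      using min[OF that] by (simp add: V)
    have "0 \<le> \<psi> m * (\<Sum>i\<le>m. v i) + (\<Sum>i<m. (\<psi> i - \<psi> (Suc i)) * (\<Sum>l\<le>i. v l))"
    proof (intro add_nonneg_nonneg sum_nonneg[where A = "{..<m}"] mult_nonneg_nonneg pos)
    qed (use \<psi>0 dec in auto)
    also have "\<dots> = (\<Sum>i\<le>m. \<psi> i * v i)" by (rule abel_summation[symmetric])
    also have "\<dots> = (\<Sum>i\<le>m. \<psi> i * w i) + s * (\<Sum>i\<le>m. \<psi> i * (real m - 3 * real i))"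
      by (simp add: v_def sum.distrib sum_distrib_left distrib_left mult.left_commute)
    finally show ?thesis by (simp add: mean)
  qed
qed

section \<open>Couplings with constant sum\<close>

definition hits :: "nat \<Rightarrow> nat \<times> nat \<times> nat \<Rightarrow> nat" where
  "hits i = (\<lambda>(a, b, c). of_bool (a = i) + of_bool (b = i) + of_bool (c = i))"

definition triples :: "nat \<Rightarrow> (nat \<times> nat \<times> nat) set" where
  "triples m = {(a, b, c). a + b + c = m}"

lemma finite_triples: "finite (triples m)"
  by (rule finite_subset[of _ "{..m} \<times> {..m} \<times> {..m}"]) (auto simp: triples_def)

lemma sum_hits:
  fixes f :: "nat \<Rightarrow> real"
  assumes "(a, b, c) \<in> triples m"
  shows "(\<Sum>i\<le>m. real (hits i (a, b, c)) * f i) = f a + f b + f c"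
proof -
  have "(\<Sum>i\<le>m. real (hits i (a, b, c)) * f i)
     = (\<Sum>i\<le>m. if a = i then f i else 0) + (\<Sum>i\<le>m. if b = i then f i else 0) + (\<Sum>i\<le>m. if c = i then f i else 0)"
    unfolding sum.distrib[symmetric] by (intro sum.cong) (auto simp: hits_def)
  thus ?thesis using assms by (simp add: triples_def)
qed

text \<open>Farkas' lemma applied to \<open>decreasing_mean_third_dual\<close>: a hyperplane that separates \<open>3\<psi>\<close> from the incidence vectors of
  the triples of sum \<open>m\<close> would violate it. The weights \<open>\<pi>\<close> describe a random triple of constant sum whose
  three entries together have frequencies \<open>3\<psi>\<close>. The bijection \<open>h\<close> serves to index coordinates of a Euclidean space
  by a type with \<open>m + 1\<close> elements.\<close>

lemma decreasing_mean_third_coupling: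
  fixes \<psi> :: "nat \<Rightarrow> real" and h :: "'a::finite \<Rightarrow> nat"
  assumes h: "bij_betw h UNIV {..m}"
    and nonneg: "\<And>i. i \<le> m \<Longrightarrow> 0 \<le> \<psi> i" and dec: "\<And>i. i < m \<Longrightarrow> \<psi> (Suc i) \<le> \<psi> i"
    and mean: "(\<Sum>i\<le>m. \<psi> i * (real m - 3 * real i)) = 0" and total: "(\<Sum>i\<le>m. \<psi> i) = 1"
  obtains \<pi> where "\<And>\<tau>. \<tau> \<in> triples m \<Longrightarrow> 0 \<le> \<pi> \<tau>"
    and "\<And>i. i \<le> m \<Longrightarrow> (\<Sum>\<tau>\<in>triples m. \<pi> \<tau> * real (hits i \<tau>)) = 3 * \<psi> i"
proof -
  define point :: "nat \<times> nat \<times> nat \<Rightarrow> real ^ 'a" where "point \<tau> = (\<chi> k. real (hits (h k) \<tau>))" for \<tau>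
  define target :: "real ^ 'a" where "target = (\<chi> k. 3 * \<psi> (h k))"
  have inner_sum: "v \<bullet> (\<chi> k. f (h k)) = (\<Sum>i\<le>m. (v $ (inv_into UNIV h i)) * f i)" for v :: "real ^ 'a" and f
  proof -
    have "v \<bullet> (\<chi> k. f (h k)) = (\<Sum>k\<in>UNIV. v $ (inv_into UNIV h (h k)) * f (h k))"
      using h by (simp add: inner_vec_def bij_betw_def)
    also have "\<dots> = (\<Sum>i\<le>m. (v $ (inv_into UNIV h i)) * f i)"
      by (rule sum.reindex_bij_betw[OF h])
    finally show ?thesis .
  qed
  have "target \<in> convex hull (point ` triples m)"
  proof (rule ccontr)
    assume "target \<notin> convex hull (point ` triples m)"
    then obtain v b where sep: "v \<bullet> target < b" "\<And>x. x \<in> convex hull (point ` triples m) \<Longrightarrow> b < v \<bullet> x"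
      using separating_hyperplane_closed_point[OF convex_convex_hull compact_imp_closed
          [OF finite_imp_compact_convex_hull[OF finite_imageI[OF finite_triples]]], of target point m]
      by blast
    define w where "w i = v $ (inv_into UNIV h i) - b / 3" for i
    have "0 \<le> (\<Sum>i\<le>m. \<psi> i * w i)"
    proof (rule decreasing_mean_third_dual[of m w \<psi>, OF _ nonneg dec mean])
      fix x y z assume "x + y + z = m"
      hence T: "(x, y, z) \<in> triples m" by (simp add: triples_def)
      have "b < v \<bullet> point (x, y, z)" using T by (intro sep(2) hull_inc) auto
      also have "\<dots> = (\<Sum>i\<le>m. real (hits i (x, y, z)) * (v $ (inv_into UNIV h i)))"
        unfolding point_def inner_sum[of v "\<lambda>i. real (hits i (x, y, z))"] by (simp add: mult.commute)
      also have "\<dots> = v $ (inv_into UNIV h x) + v $ (inv_into UNIV h y) + v $ (inv_into UNIV h z)"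
        by (rule sum_hits[OF T])
      finally show "0 \<le> w x + w y + w z" by (simp add: w_def)
    qed
    also have "(\<Sum>i\<le>m. \<psi> i * w i) = (\<Sum>i\<le>m. v $ (inv_into UNIV h i) * (3 * \<psi> i)) / 3 - b / 3 * (\<Sum>i\<le>m. \<psi> i)"
      by (simp add: w_def sum_subtractf sum_distrib_left sum_divide_distrib algebra_simps)
    also have "\<dots> = (v \<bullet> target - b) / 3"
      unfolding target_def inner_sum[of v "\<lambda>i. 3 * \<psi> i"] total by simp
    finally show False using sep(1) by simp
  qed
  then obtain u where u: "\<And>x. x \<in> point ` triples m \<Longrightarrow> 0 \<le> u x" "(\<Sum>x\<in>point ` triples m. u x *\<^sub>R x) = target"
    by (auto simp: convex_hull_finite finite_triples)
  define fiber where "fiber x = {\<tau>\<in>triples m. point \<tau> = x}" for x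
  define \<pi> where "\<pi> \<tau> = u (point \<tau>) / real (card (fiber (point \<tau>)))" for \<tau>
  show ?thesis
  proof
    show "0 \<le> \<pi> \<tau>" if "\<tau> \<in> triples m" for \<tau> using u(1) that by (auto simp: \<pi>_def)
    fix i assume i: "i \<le> m"
    then obtain k where k: "h k = i" using h unfolding bij_betw_def by (metis atMost_iff rangeE)
    have "(\<Sum>\<tau>\<in>triples m. \<pi> \<tau> * real (hits i \<tau>))
        = (\<Sum>x\<in>point ` triples m. \<Sum>\<tau>\<in>fiber x. \<pi> \<tau> * real (hits i \<tau>))"
      unfolding fiber_def by (rule sum.image_gen[OF finite_triples])
    also have "\<dots> = (\<Sum>x\<in>point ` triples m. u x * x $ k)"
    proof (intro sum.cong refl)
      fix x assume x: "x \<in> point ` triples m"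
      have "(\<Sum>\<tau>\<in>fiber x. \<pi> \<tau> * real (hits i \<tau>)) = (\<Sum>\<tau>\<in>fiber x. u x / real (card (fiber x)) * x $ k)"
        by (intro sum.cong) (auto simp: fiber_def \<pi>_def point_def k)
      moreover have "finite (fiber x)" "fiber x \<noteq> {}" using x finite_triples by (auto simp: fiber_def)
      ultimately show "(\<Sum>\<tau>\<in>fiber x. \<pi> \<tau> * real (hits i \<tau>)) = u x * x $ k" by auto
    qed
    also have "\<dots> = target $ k" unfolding u(2)[symmetric] by simp
    finally show "(\<Sum>\<tau>\<in>triples m. \<pi> \<tau> * real (hits i \<tau>)) = 3 * \<psi> i"
      by (simp add: target_def k)
  qed
qed

text \<open>The weights \<open>t ^ i\<close> have mean \<open>0\<close> for \<open>t = 0\<close> and \<open>m/2\<close> for \<open>t = 1\<close>, so the mean is \<open>m/3\<close> somewhere in between.\<close>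

lemma geometric_mean_third:
  assumes m: "m \<ge> 1"
  obtains t :: real where "0 < t" "t < 1" "(\<Sum>i\<le>m. t ^ i * (real m - 3 * real i)) = 0"
proof -
  define f where "f t = (\<Sum>i\<le>m. t ^ i * (real m - 3 * real i))" for t :: real
  have f0: "f 0 = real m"
    unfolding f_def by (simp add: power_0_left if_distrib if_distribR cong: if_cong)
  have "f 1 = (real m + 1) * (real m - 3 * real m / 2)"
  proof -
    have "(\<Sum>i\<le>n. real m - 3 * real i) = (real n + 1) * (real m - 3 * real n / 2)" for n
      by (induction n) (auto simp: field_simps)
    thus ?thesis by (simp add: f_def)
  qed
  hence f1: "f 1 < 0" using m by (simp add: mult_pos_neg)
  have "\<exists>t. 0 \<le> t \<and> t \<le> 1 \<and> f t = 0"
    using f0 f1 by (intro IVT2') (auto simp: f_def intro!: continuous_intros)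
  then obtain t where t: "0 \<le> t" "t \<le> 1" "f t = 0" by auto
  have "t \<noteq> 0" "t \<noteq> 1" using t(3) f0 f1 m by auto
  thus ?thesis using t that[of t] by (auto simp: f_def)
qed

section \<open>Vectors as finitely supported functions\<close>

definition supp_on :: "'i set \<Rightarrow> ('i \<Rightarrow> 'a::zero) set" where
  "supp_on I = {v. \<forall>i. i \<notin> I \<longrightarrow> v i = 0}"

lemma supp_onI: "(\<And>i. i \<notin> I \<Longrightarrow> v i = 0) \<Longrightarrow> v \<in> supp_on I"
  and supp_onD: "v \<in> supp_on I \<Longrightarrow> i \<notin> I \<Longrightarrow> v i = 0"
  by (auto simp: supp_on_def)

lemma supp_on_closed [simp]:
  fixes v w :: "'i \<Rightarrow> 'a::ab_group_add"
  shows "0 \<in> supp_on I" "v \<in> supp_on I \<Longrightarrow> w \<in> supp_on I \<Longrightarrow> v + w \<in> supp_on I"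
    "v \<in> supp_on I \<Longrightarrow> w \<in> supp_on I \<Longrightarrow> v - w \<in> supp_on I" "v \<in> supp_on I \<Longrightarrow> - v \<in> supp_on I"
  by (auto simp: supp_on_def)

lemma bij_betw_supp_on: "bij_betw (\<lambda>v i. if i \<in> I then v i else 0) (PiE I (\<lambda>_. UNIV)) (supp_on I :: ('i \<Rightarrow> 'a::zero) set)"
  by (rule bij_betwI[where g = "\<lambda>v. restrict v I"]) (auto simp: supp_on_def fun_eq_iff PiE_def extensional_def)

lemma finite_supp_on [simp]: "finite I \<Longrightarrow> finite (supp_on I :: ('i \<Rightarrow> 'p::prime_card mod_ring) set)"
  by (rule bij_betw_finite[OF bij_betw_supp_on, THEN iffD1]) (auto intro: finite_PiE)

lemma card_supp_on: "finite I \<Longrightarrow> card (supp_on I :: ('i \<Rightarrow> 'p::prime_card mod_ring) set) = CARD('p) ^ card I"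
  by (subst bij_betw_same_card[OF bij_betw_supp_on, symmetric]) (simp add: card_PiE)

text \<open>A substitute for the rank theorem that needs no linear structure: the fibres of an additive map are no larger than its kernel.\<close>

lemma card_le_card_kernel_mult:
  fixes \<phi> :: "'a::ab_group_add \<Rightarrow> 'b::ab_group_add"
  assumes "finite A" "finite B" and minus: "\<And>x y. x \<in> A \<Longrightarrow> y \<in> A \<Longrightarrow> x - y \<in> A"
    and "\<phi> ` A \<subseteq> B" and hom: "\<And>x y. x \<in> A \<Longrightarrow> y \<in> A \<Longrightarrow> \<phi> (x - y) = \<phi> x - \<phi> y"
  shows "card A \<le> card {x\<in>A. \<phi> x = 0} * card B"
proof -
  have "card A = (\<Sum>b\<in>\<phi> ` A. card {x\<in>A. \<phi> x = b})"
    using sum.image_gen[of A "\<lambda>_. 1::nat" \<phi>] assms(1) by simp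
  also have "\<dots> \<le> (\<Sum>b\<in>\<phi> ` A. card {x\<in>A. \<phi> x = 0})"
  proof (rule sum_mono)
    fix b assume "b \<in> \<phi> ` A"
    then obtain x0 where x0: "x0 \<in> A" "\<phi> x0 = b" by auto
    show "card {x\<in>A. \<phi> x = b} \<le> card {x\<in>A. \<phi> x = 0}"
      by (rule card_inj_on_le[of "\<lambda>x. x - x0"]) (use x0 minus hom assms(1) in \<open>auto simp: inj_on_def\<close>)
  qed
  also have "\<dots> \<le> card {x\<in>A. \<phi> x = 0} * card B"
    using card_mono[OF assms(2,4)] by simp
  finally show ?thesis .
qed

text \<open>These sets are also known as multicolored sum-free sets. The second clause says that a triangle formed from first,
  second and third vertices of members of \<open>S\<close> is itself a member of \<open>S\<close>; the first clause turns this into an equivalence.\<close>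

definition tricolored :: "nat \<Rightarrow> ((nat \<Rightarrow> 'a::ab_group_add) \<times> (nat \<Rightarrow> 'a) \<times> (nat \<Rightarrow> 'a)) set \<Rightarrow> bool" where
  "tricolored n S \<longleftrightarrow>
     (\<forall>(x, y, z)\<in>S. x \<in> supp_on {..<n} \<and> y \<in> supp_on {..<n} \<and> z \<in> supp_on {..<n} \<and> x + y + z = 0) \<and>
     (\<forall>s\<in>S. \<forall>s'\<in>S. \<forall>s''\<in>S. fst s + fst (snd s') + snd (snd s'') = 0 \<longrightarrow> s = s' \<and> s' = s'')"

lemma finite_tricolored:
  fixes S :: "((nat \<Rightarrow> 'p::prime_card mod_ring) \<times> (nat \<Rightarrow> 'p mod_ring) \<times> (nat \<Rightarrow> 'p mod_ring)) set"
  assumes "tricolored n S" shows "finite S"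
  by (rule finite_subset[of _ "supp_on {..<n} \<times> supp_on {..<n} \<times> supp_on {..<n}"])
     (use assms in \<open>auto simp: tricolored_def\<close>)

section \<open>The slice rank bound\<close>

lemma fermat_mod_ring:
  fixes a :: "'p::prime_card mod_ring"
  assumes "a \<noteq> 0" shows "a ^ (CARD('p) - 1) = 1"
proof -
  let ?U = "UNIV - {0 :: 'p mod_ring}"
  have "(\<Prod>b\<in>?U. b) = (\<Prod>b\<in>?U. a * b)"
    by (rule prod.reindex_bij_witness[of _ "\<lambda>b. a * b" "\<lambda>b. b / a"]) (use assms in auto)
  also have "\<dots> = a ^ card ?U * (\<Prod>b\<in>?U. b)" by (simp add: prod.distrib)
  finally have "a ^ card ?U = 1" by (simp add: prod_zero_iff)
  thus ?thesis by (simp add: card_Diff_singleton)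
qed

text \<open>For nonzero \<open>x + y + z\<close> in the field with \<open>m + 1\<close> elements the left side vanishes, by Fermat, and for \<open>x + y + z = 0\<close> it is \<open>1\<close>;
  what matters below is that the right side has degree at most \<open>m\<close>.\<close>

lemma trinomial_expansion:
  fixes x y z :: "'a::comm_ring_1"
  assumes "m > 0"
  defines "\<kappa> \<equiv> (\<lambda>(a, b, c). (if a + b + c = 0 then 1 else 0)
      - (if a + b + c = m then of_nat ((m choose (a + b)) * ((a + b) choose a)) else 0) :: 'a)"
  shows "1 - (x + y + z) ^ m = (\<Sum>(a, b, c)\<in>{(a, b, c). a + b + c \<le> m}. \<kappa> (a, b, c) * (x ^ a * y ^ b * z ^ c))"
proof -
  let ?T = "{(a, b, c). a + b + c \<le> m} :: (nat \<times> nat \<times> nat) set"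
  have fin: "finite ?T" by (rule finite_subset[of _ "{..m} \<times> {..m} \<times> {..m}"]) auto
  have "(x + y + z) ^ m = (\<Sum>k\<le>m. \<Sum>a\<le>k. of_nat (m choose k) * (of_nat (k choose a) * x ^ a * y ^ (k - a)) * z ^ (m - k))"
    unfolding binomial_ring[of "x + y" z] binomial_ring[of x y] by (simp add: sum_distrib_left sum_distrib_right)
  also have "\<dots> = (\<Sum>(k, a)\<in>(SIGMA k:{..m}. {..k}). of_nat (m choose k) * (of_nat (k choose a) * x ^ a * y ^ (k - a)) * z ^ (m - k))"
    by (rule sum.Sigma) auto
  also have "\<dots> = (\<Sum>(a, b, c)\<in>{\<tau>\<in>?T. case \<tau> of (a, b, c) \<Rightarrow> a + b + c = m}.
       of_nat ((m choose (a + b)) * ((a + b) choose a)) * (x ^ a * y ^ b * z ^ c))"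
    by (rule sum.reindex_bij_witness[of _ "\<lambda>(a, b, c). (a + b, a)" "\<lambda>(k, a). (a, k - a, m - k)"])
       (auto simp: algebra_simps)
  also have "\<dots> = (\<Sum>(a, b, c)\<in>?T. if a + b + c = m then of_nat ((m choose (a + b)) * ((a + b) choose a)) * (x ^ a * y ^ b * z ^ c) else 0)"
    using fin by (subst sum.inter_filter) (auto intro!: sum.cong)
  finally have 1: "(x + y + z) ^ m = \<dots>" .
  have "(\<Sum>(a, b, c)\<in>?T. if a + b + c = 0 then x ^ a * y ^ b * z ^ c else 0)
      = (\<Sum>\<tau>\<in>{(0, 0, 0) :: nat \<times> nat \<times> nat}. 1)"
    by (rule sum.mono_neutral_cong_right) (use fin in \<open>auto split: if_splits\<close>)
  hence 2: "1 = (\<Sum>(a, b, c)\<in>?T. if a + b + c = 0 then x ^ a * y ^ b * z ^ c else 0)" by simp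
  show ?thesis
    unfolding 1 by (subst 2, unfold sum_subtractf[symmetric], intro sum.cong) (auto simp: \<kappa>_def algebra_simps)
qed

text \<open>Exponents of monomials of degree at most a third of \<open>n * (p - 1)\<close>. In a product of three monomials of total degree at
  most \<open>n * (p - 1)\<close>, one of the factors is of this kind.\<close>

definition low_monomials :: "nat \<Rightarrow> nat \<Rightarrow> (nat \<Rightarrow> nat) set" where
  "low_monomials p n = {e \<in> PiE {..<n} (\<lambda>_. {..<p}). 3 * (\<Sum>l<n. e l) \<le> n * (p - 1)}"

lemma finite_low_monomials [simp]: "finite (low_monomials p n)"
  unfolding low_monomials_def by (rule finite_subset[of _ "PiE {..<n} (\<lambda>_. {..<p})"]) (auto intro: finite_PiE)

definition monomial :: "nat \<Rightarrow> (nat \<Rightarrow> nat) \<Rightarrow> (nat \<Rightarrow> 'a::comm_monoid_mult) \<Rightarrow> 'a" where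
  "monomial n e x = (\<Prod>l<n. x l ^ e l)"

text \<open>The indicator of \<open>x + y + z = 0\<close> as a polynomial: the product over the coordinates of \<open>1 - (x_l + y_l + z_l)^(p-1)\<close>, expanded.
  Its total degree is at most \<open>n * (p - 1)\<close>.\<close>

lemma zero_indicator_expansion:
  fixes n :: nat
  defines "\<Sigma> \<equiv> PiE {..<n} (\<lambda>_. {(a, b, c). a + b + c \<le> CARD('p::prime_card) - 1})"
  obtains K :: "(nat \<Rightarrow> nat \<times> nat \<times> nat) \<Rightarrow> 'p::prime_card mod_ring"
  where "\<And>x y z. x \<in> supp_on {..<n} \<Longrightarrow> y \<in> supp_on {..<n} \<Longrightarrow> z \<in> supp_on {..<n} \<Longrightarrow>
     (\<Sum>\<sigma>\<in>\<Sigma>. K \<sigma> * (monomial n (\<lambda>l\<in>{..<n}. fst (\<sigma> l)) x * monomial n (\<lambda>l\<in>{..<n}. fst (snd (\<sigma> l))) y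
         * monomial n (\<lambda>l\<in>{..<n}. snd (snd (\<sigma> l))) z)) = (if x + y + z = 0 then 1 else 0)"
proof -
  define m where "m = CARD('p) - 1"
  have m: "m > 0" using prime_card[where 'a = 'p] prime_gt_1_nat by (auto simp: m_def)
  define \<kappa> :: "nat \<times> nat \<times> nat \<Rightarrow> 'p mod_ring" where "\<kappa> = (\<lambda>(a, b, c). (if a + b + c = 0 then 1 else 0)
      - (if a + b + c = m then of_nat ((m choose (a + b)) * ((a + b) choose a)) else 0))"
  let ?T = "{(a, b, c). a + b + c \<le> m} :: (nat \<times> nat \<times> nat) set"
  have fin: "finite ?T" by (rule finite_subset[of _ "{..m} \<times> {..m} \<times> {..m}"]) auto
  have tri: "1 - (x + y + z) ^ m = (\<Sum>(a, b, c)\<in>?T. \<kappa> (a, b, c) * (x ^ a * y ^ b * z ^ c))" for x y z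
    unfolding \<kappa>_def by (rule trinomial_expansion[OF m])
  show ?thesis
  proof (rule that[of "\<lambda>\<sigma>. \<Prod>l<n. \<kappa> (\<sigma> l)"])
    fix x y z :: "nat \<Rightarrow> 'p mod_ring"
    assume xyz: "x \<in> supp_on {..<n}" "y \<in> supp_on {..<n}" "z \<in> supp_on {..<n}"
    have "(if x + y + z = 0 then 1 else 0) = (\<Prod>l<n. 1 - (x l + y l + z l) ^ m)"
    proof (cases "x + y + z = 0")
      case True
      hence z: "x l + y l + z l = 0" for l by (metis plus_fun_apply zero_fun_apply)
      show ?thesis using True m by (simp add: z zero_power)
    next
      case False
      then obtain l where l: "x l + y l + z l \<noteq> 0" by (auto simp: fun_eq_iff)
      hence "l < n" using supp_onD[OF xyz(1), of l] supp_onD[OF xyz(2), of l] supp_onD[OF xyz(3), of l] by (cases "l < n") auto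
      moreover have "1 - (x l + y l + z l) ^ m = 0" using fermat_mod_ring[OF l] by (simp add: m_def)
      ultimately have "(\<Prod>l<n. 1 - (x l + y l + z l) ^ m) = 0" by (intro prod_zero) auto
      thus ?thesis using False by simp
    qed
    also have "\<dots> = (\<Prod>l<n. \<Sum>\<tau>\<in>?T. \<kappa> \<tau> * (x l ^ fst \<tau> * y l ^ fst (snd \<tau>) * z l ^ snd (snd \<tau>)))"
      by (simp add: tri case_prod_unfold)
    also have "\<dots> = (\<Sum>\<sigma>\<in>PiE {..<n} (\<lambda>_. ?T). \<Prod>l<n. \<kappa> (\<sigma> l) * (x l ^ fst (\<sigma> l) * y l ^ fst (snd (\<sigma> l)) * z l ^ snd (snd (\<sigma> l))))"
      by (rule prod_sum_PiE) (use fin in auto)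
    also have "\<dots> = (\<Sum>\<sigma>\<in>\<Sigma>. (\<Prod>l<n. \<kappa> (\<sigma> l)) * (monomial n (\<lambda>l\<in>{..<n}. fst (\<sigma> l)) x * monomial n (\<lambda>l\<in>{..<n}. fst (snd (\<sigma> l))) y
         * monomial n (\<lambda>l\<in>{..<n}. snd (snd (\<sigma> l))) z))"
      unfolding \<Sigma>_def m_def[symmetric] monomial_def by (intro sum.cong refl) (simp add: prod.distrib)
    finally show "(\<Sum>\<sigma>\<in>\<Sigma>. (\<Prod>l<n. \<kappa> (\<sigma> l)) * (monomial n (\<lambda>l\<in>{..<n}. fst (\<sigma> l)) x * monomial n (\<lambda>l\<in>{..<n}. fst (snd (\<sigma> l))) y
         * monomial n (\<lambda>l\<in>{..<n}. snd (snd (\<sigma> l))) z)) = (if x + y + z = 0 then 1 else 0)" ..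
  qed
qed

text \<open>The identity tensor on \<open>S\<close> is the tensor of \<open>zero_indicator_expansion\<close>, and each monomial of the latter
  contains a factor from \<open>low_monomials\<close> in \<open>x\<close>, in \<open>y\<close> or in \<open>z\<close>. Contracting the first
  variable with a vector \<open>v\<close> that is orthogonal to the low monomials in \<open>x\<close> kills the terms of the first kind; the
  vectors \<open>v\<close> form a space of codimension at most the number of low monomials, so one of them has support \<open>R\<close> of at least
  the dimension of this space. Contracting the second variable in the same way on \<open>R\<close> leaves
  a diagonal tensor that factors through the low monomials in \<open>z\<close>. Dimensions are expressed by
  cardinalities of the finite spaces.\<close>

lemma slice_rank_bound:
  fixes X Y Z :: "'i \<Rightarrow> nat \<Rightarrow> 'p::prime_card mod_ring"
  assumes finS: "finite S"
    and V_in: "\<And>i. i \<in> S \<Longrightarrow> X i \<in> supp_on {..<n} \<and> Y i \<in> supp_on {..<n} \<and> Z i \<in> supp_on {..<n}"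
    and diagonal: "\<And>i j k. i \<in> S \<Longrightarrow> j \<in> S \<Longrightarrow> k \<in> S \<Longrightarrow> X i + Y j + Z k = 0 \<longleftrightarrow> i = j \<and> j = k"
  shows "card S \<le> 3 * card (low_monomials CARD('p) n)"
proof -
  define L where "L = low_monomials CARD('p) n"
  have finL: "finite L" by (simp add: L_def)
  have p1: "CARD('p) > 1" using prime_card[where 'a = 'p] prime_gt_1_nat by auto
  define \<Sigma> where "\<Sigma> = PiE {..<n} (\<lambda>_. {(a, b, c). a + b + c \<le> CARD('p) - 1} :: (nat \<times> nat \<times> nat) set)"
  obtain K :: "(nat \<Rightarrow> nat \<times> nat \<times> nat) \<Rightarrow> 'p mod_ring" where
    K: "\<And>x y z. x \<in> supp_on {..<n} \<Longrightarrow> y \<in> supp_on {..<n} \<Longrightarrow> z \<in> supp_on {..<n} \<Longrightarrow>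
     (\<Sum>\<sigma>\<in>\<Sigma>. K \<sigma> * (monomial n (\<lambda>l\<in>{..<n}. fst (\<sigma> l)) x * monomial n (\<lambda>l\<in>{..<n}. fst (snd (\<sigma> l))) y
         * monomial n (\<lambda>l\<in>{..<n}. snd (snd (\<sigma> l))) z)) = (if x + y + z = 0 then 1 else 0)"
    by (rule zero_indicator_expansion[of n, where 'p = 'p, folded \<Sigma>_def]) (rule that)
  define A where "A \<sigma> = (\<lambda>l\<in>{..<n}. fst (\<sigma> l))" for \<sigma> :: "nat \<Rightarrow> nat \<times> nat \<times> nat"
  define B where "B \<sigma> = (\<lambda>l\<in>{..<n}. fst (snd (\<sigma> l)))" for \<sigma> :: "nat \<Rightarrow> nat \<times> nat \<times> nat"
  define C where "C \<sigma> = (\<lambda>l\<in>{..<n}. snd (snd (\<sigma> l)))" for \<sigma> :: "nat \<Rightarrow> nat \<times> nat \<times> nat"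
  have fin\<Sigma>: "finite \<Sigma>" unfolding \<Sigma>_def
    by (intro finite_PiE) (auto intro: finite_subset[of _ "{..CARD('p) - 1} \<times> {..CARD('p) - 1} \<times> {..CARD('p) - 1}"])
  have low: "A \<sigma> \<in> L \<or> B \<sigma> \<in> L \<or> C \<sigma> \<in> L" if "\<sigma> \<in> \<Sigma>" for \<sigma>
  proof -
    have le: "fst (\<sigma> l) + fst (snd (\<sigma> l)) + snd (snd (\<sigma> l)) \<le> CARD('p) - 1" if "l < n" for l
      using \<open>\<sigma> \<in> \<Sigma>\<close> that by (force simp: \<Sigma>_def PiE_def Pi_def case_prod_unfold)
    hence le': "fst (\<sigma> l) < CARD('p) \<and> fst (snd (\<sigma> l)) < CARD('p) \<and> snd (snd (\<sigma> l)) < CARD('p)" if "l < n" for l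
      using le[OF that] p1 by linarith
    have "(\<Sum>l<n. A \<sigma> l) + (\<Sum>l<n. B \<sigma> l) + (\<Sum>l<n. C \<sigma> l) \<le> (\<Sum>l<n. CARD('p) - 1)"
      unfolding sum.distrib[symmetric] using le by (intro sum_mono) (auto simp: A_def B_def C_def)
    hence "3 * (\<Sum>l<n. A \<sigma> l) \<le> n * (CARD('p) - 1) \<or> 3 * (\<Sum>l<n. B \<sigma> l) \<le> n * (CARD('p) - 1) \<or> 3 * (\<Sum>l<n. C \<sigma> l) \<le> n * (CARD('p) - 1)"
      by simp linarith
    moreover have "A \<sigma> \<in> PiE {..<n} (\<lambda>_. {..<CARD('p)})" "B \<sigma> \<in> PiE {..<n} (\<lambda>_. {..<CARD('p)})" "C \<sigma> \<in> PiE {..<n} (\<lambda>_. {..<CARD('p)})"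
      using le' by (auto simp: A_def B_def C_def)
    ultimately show ?thesis by (auto simp: L_def low_monomials_def)
  qed
  have delta: "(\<Sum>\<sigma>\<in>\<Sigma>. K \<sigma> * (monomial n (A \<sigma>) (X i) * monomial n (B \<sigma>) (Y j) * monomial n (C \<sigma>) (Z k)))
      = (if i = j \<and> j = k then 1 else 0)" if "i \<in> S" "j \<in> S" "k \<in> S" for i j k
    using K[of "X i" "Y j" "Z k"] V_in[of i] V_in[of j] V_in[of k] that diagonal
    unfolding A_def B_def C_def by simp
  \<comment> \<open>The vectors that are orthogonal to the low monomials in the first variable.\<close>
  define \<phi> where "\<phi> v = (\<lambda>e. if e \<in> L then \<Sum>s\<in>S. v s * monomial n e (X s) else 0)" for v :: "'i \<Rightarrow> 'p mod_ring"
  define V where "V = {v\<in>supp_on S. \<phi> v = 0}"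
  have "card (supp_on S :: (_ \<Rightarrow> 'p mod_ring) set) \<le> card V * card (supp_on L :: (_ \<Rightarrow> 'p mod_ring) set)"
    unfolding V_def
    by (rule card_le_card_kernel_mult) (use finS finL in \<open>auto simp: \<phi>_def fun_eq_iff sum_subtractf algebra_simps intro!: supp_onI\<close>)
  hence 1: "CARD('p) ^ card S \<le> card V * CARD('p) ^ card L" by (simp add: card_supp_on finS finL)
  have V0: "(\<Sum>s\<in>S. v s * monomial n e (X s)) = 0" if "v \<in> V" "e \<in> L" for v e
    using that by (auto simp: V_def \<phi>_def fun_eq_iff split: if_splits)
  have Vadd: "v + w \<in> V" "v - w \<in> V" if "v \<in> V" "w \<in> V" for v w
  proof -
    have "\<phi> (v + w) = \<phi> v + \<phi> w" "\<phi> (v - w) = \<phi> v - \<phi> w"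
      by (auto simp: \<phi>_def fun_eq_iff sum.distrib sum_subtractf distrib_right left_diff_distrib)
    thus "v + w \<in> V" "v - w \<in> V" using that by (auto simp: V_def)
  qed
  have finV: "finite V" using finS by (simp add: V_def)
  have "0 \<in> V" by (simp add: V_def \<phi>_def fun_eq_iff)
  hence neV: "V \<noteq> {}" by auto
  define sup where "sup v = {s\<in>S. v s \<noteq> 0}" for v :: "'i \<Rightarrow> 'p mod_ring"
  have "Max ((\<lambda>v. card (sup v)) ` V) \<in> (\<lambda>v. card (sup v)) ` V" using finV neV by (intro Max_in) auto
  then obtain v where v: "v \<in> V" "Max ((\<lambda>v. card (sup v)) ` V) = card (sup v)" by blast
  have vmax: "card (sup w) \<le> card (sup v)" if "w \<in> V" for w
    unfolding v(2)[symmetric] using that finV by (intro Max_ge) auto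
  define R where "R = sup v"
  have finR: "finite R" "R \<subseteq> S" using finS by (auto simp: R_def sup_def)
  have zero: "w = 0" if w: "w \<in> V" "\<And>s. s \<in> R \<Longrightarrow> w s = 0" for w
  proof (rule ccontr)
    assume "w \<noteq> 0"
    then obtain s where s: "w s \<noteq> 0" by (auto simp: fun_eq_iff)
    hence "s \<in> S" "s \<notin> R" using w by (auto simp: V_def supp_on_def)
    hence "insert s R \<subseteq> sup (v + w)" using s w by (auto simp: R_def sup_def)
    hence "card (insert s R) \<le> card (sup (v + w))" using finS by (intro card_mono) (auto simp: sup_def)
    also have "\<dots> \<le> card R" unfolding R_def using v(1) w by (intro vmax Vadd)
    finally show False using finR \<open>s \<notin> R\<close> by simp
  qed
  have "card V \<le> card (supp_on R :: (_ \<Rightarrow> 'p mod_ring) set)"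
  proof (rule card_inj_on_le[of "\<lambda>w s. if s \<in> R then w s else 0"])
    show "inj_on (\<lambda>w s. if s \<in> R then w s else 0) V"
    proof (rule inj_onI)
      fix w w' assume ww: "w \<in> V" "w' \<in> V" and eq: "(\<lambda>s. if s \<in> R then w s else 0) = (\<lambda>s. if s \<in> R then w' s else 0)"
      have "w - w' = 0" using ww eq by (intro zero Vadd) (auto simp: fun_eq_iff split: if_splits)
      thus "w = w'" by simp
    qed
  qed (use finR in \<open>auto intro: finite_subset finS intro!: supp_onI\<close>)
  hence 2: "card V \<le> CARD('p) ^ card R" by (simp add: card_supp_on finR)
  \<comment> \<open>The same in the second variable, restricted to the support of a suitable vector of the first stage.\<close>
  define \<xi> where "\<xi> u = (\<lambda>e. if e \<in> L then \<Sum>s\<in>R. u s * monomial n e (Y s) else 0)" for u :: "'i \<Rightarrow> 'p mod_ring"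
  define U where "U = {u\<in>supp_on R. \<xi> u = 0}"
  have "card (supp_on R :: (_ \<Rightarrow> 'p mod_ring) set) \<le> card U * card (supp_on L :: (_ \<Rightarrow> 'p mod_ring) set)"
    unfolding U_def
    by (rule card_le_card_kernel_mult) (use finR finL in \<open>auto simp: \<xi>_def fun_eq_iff sum_subtractf algebra_simps intro!: supp_onI\<close>)
  hence 3: "CARD('p) ^ card R \<le> card U * CARD('p) ^ card L" by (simp add: card_supp_on finR finL)
  have U0: "(\<Sum>s\<in>R. u s * monomial n e (Y s)) = 0" if "u \<in> U" "e \<in> L" for u e
    using that by (auto simp: U_def \<xi>_def fun_eq_iff split: if_splits)
  define \<gamma> where "\<gamma> u = (\<lambda>g. if g \<in> L then \<Sum>\<sigma>\<in>{\<sigma>\<in>{\<sigma>\<in>\<Sigma>. C \<sigma> \<in> L}. C \<sigma> = g}. K \<sigma> * (\<Sum>i\<in>S. v i * monomial n (A \<sigma>) (X i)) * (\<Sum>j\<in>R. u j * monomial n (B \<sigma>) (Y j)) else 0)" for u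
  have rec: "u k * v k = (\<Sum>g\<in>L. \<gamma> u g * monomial n g (Z k))" if "u \<in> U" "k \<in> R" for u k
  proof -
    have kS: "k \<in> S" using that finR by auto
    have "(\<Sum>i\<in>S. \<Sum>j\<in>R. v i * u j * (if i = j \<and> j = k then 1 else 0)) = (\<Sum>i\<in>S. if i = k then v k * u k else 0)"
    proof (intro sum.cong refl)
      fix i
      have "(\<Sum>j\<in>R. v i * u j * (if i = j \<and> j = k then 1 else 0)) = (\<Sum>j\<in>R. if j = k then (if i = k then v k * u k else 0) else 0)"
        by (intro sum.cong) auto
      thus "(\<Sum>j\<in>R. v i * u j * (if i = j \<and> j = k then 1 else 0)) = (if i = k then v k * u k else 0)"
        using finR that by simp
    qed
    hence "u k * v k = (\<Sum>i\<in>S. \<Sum>j\<in>R. v i * u j * (if i = j \<and> j = k then 1 else 0))"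
      using finS kS by (simp add: mult.commute)
    also have "\<dots> = (\<Sum>i\<in>S. \<Sum>j\<in>R. v i * u j * (\<Sum>\<sigma>\<in>\<Sigma>. K \<sigma> * (monomial n (A \<sigma>) (X i) * monomial n (B \<sigma>) (Y j) * monomial n (C \<sigma>) (Z k))))"
      using finR kS by (intro sum.cong refl) (subst delta, auto)
    also have "\<dots> = (\<Sum>i\<in>S. \<Sum>j\<in>R. \<Sum>\<sigma>\<in>\<Sigma>. (K \<sigma> * monomial n (C \<sigma>) (Z k)) * ((v i * monomial n (A \<sigma>) (X i)) * (u j * monomial n (B \<sigma>) (Y j))))"
      unfolding sum_distrib_left by (intro sum.cong refl) (simp add: mult_ac)
    also have "\<dots> = (\<Sum>i\<in>S. \<Sum>\<sigma>\<in>\<Sigma>. \<Sum>j\<in>R. (K \<sigma> * monomial n (C \<sigma>) (Z k)) * ((v i * monomial n (A \<sigma>) (X i)) * (u j * monomial n (B \<sigma>) (Y j))))"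
      by (intro sum.cong refl sum.swap)
    also have "\<dots> = (\<Sum>\<sigma>\<in>\<Sigma>. \<Sum>i\<in>S. \<Sum>j\<in>R. (K \<sigma> * monomial n (C \<sigma>) (Z k)) * ((v i * monomial n (A \<sigma>) (X i)) * (u j * monomial n (B \<sigma>) (Y j))))"
      by (rule sum.swap)
    also have "\<dots> = (\<Sum>\<sigma>\<in>\<Sigma>. K \<sigma> * (\<Sum>i\<in>S. v i * monomial n (A \<sigma>) (X i)) * (\<Sum>j\<in>R. u j * monomial n (B \<sigma>) (Y j)) * monomial n (C \<sigma>) (Z k))"
    proof (intro sum.cong refl)
      fix \<sigma>
      show "(\<Sum>i\<in>S. \<Sum>j\<in>R. (K \<sigma> * monomial n (C \<sigma>) (Z k)) * ((v i * monomial n (A \<sigma>) (X i)) * (u j * monomial n (B \<sigma>) (Y j))))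
        = K \<sigma> * (\<Sum>i\<in>S. v i * monomial n (A \<sigma>) (X i)) * (\<Sum>j\<in>R. u j * monomial n (B \<sigma>) (Y j)) * monomial n (C \<sigma>) (Z k)"
        by (simp add: sum_product sum_distrib_left sum_distrib_right mult_ac)
    qed
    also have "\<dots> = (\<Sum>\<sigma>\<in>{\<sigma>\<in>\<Sigma>. C \<sigma> \<in> L}. K \<sigma> * (\<Sum>i\<in>S. v i * monomial n (A \<sigma>) (X i)) * (\<Sum>j\<in>R. u j * monomial n (B \<sigma>) (Y j)) * monomial n (C \<sigma>) (Z k))"
      using fin\<Sigma> low V0[OF v(1)] U0[OF that(1)] by (intro sum.mono_neutral_right) auto
    also have "\<dots> = (\<Sum>g\<in>L. \<Sum>\<sigma>\<in>{\<sigma>\<in>{\<sigma>\<in>\<Sigma>. C \<sigma> \<in> L}. C \<sigma> = g}. K \<sigma> * (\<Sum>i\<in>S. v i * monomial n (A \<sigma>) (X i)) * (\<Sum>j\<in>R. u j * monomial n (B \<sigma>) (Y j)) * monomial n (C \<sigma>) (Z k))"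
      using fin\<Sigma> finL by (intro sum.group[symmetric]) auto
    also have "\<dots> = (\<Sum>g\<in>L. \<gamma> u g * monomial n g (Z k))"
      by (intro sum.cong refl) (simp add: \<gamma>_def sum_distrib_right)
    finally show ?thesis .
  qed
  have "card U \<le> card (supp_on L :: (_ \<Rightarrow> 'p mod_ring) set)"
  proof (rule card_inj_on_le[of \<gamma>])
    show "inj_on \<gamma> U"
    proof (rule inj_onI, rule ext)
      fix u u' k assume u: "u \<in> U" "u' \<in> U" "\<gamma> u = \<gamma> u'"
      show "u k = u' k"
      proof (cases "k \<in> R")
        case True
        hence "u k * v k = u' k * v k" using rec u by simp
        thus ?thesis using True by (simp add: R_def sup_def)
      next
        case False thus ?thesis using u by (auto simp: U_def supp_on_def)
      qed
    qed
  qed (use finL in \<open>auto simp: \<gamma>_def intro!: supp_onI\<close>)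
  hence 4: "card U \<le> CARD('p) ^ card L" by (simp add: card_supp_on finL)
  note 1
  also note 2
  also note 3
  also note 4
  finally have "CARD('p) ^ card S \<le> (CARD('p) ^ card L * CARD('p) ^ card L) * CARD('p) ^ card L" by simp
  also have "\<dots> = CARD('p) ^ (card L + card L + card L)" by (simp only: power_add)
  finally have "card S \<le> card L + card L + card L" using p1 by (simp only: power_increasing_iff)
  thus ?thesis by (simp add: L_def)
qed

theorem tricolored_card_le:
  fixes S :: "((nat \<Rightarrow> 'p::prime_card mod_ring) \<times> (nat \<Rightarrow> 'p mod_ring) \<times> (nat \<Rightarrow> 'p mod_ring)) set"
  assumes "tricolored n S"
  shows "card S \<le> 3 * card (low_monomials CARD('p) n)"
proof (rule slice_rank_bound[of S fst n "\<lambda>s. fst (snd s)" "\<lambda>s. snd (snd s)"])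
  show "finite S" by (rule finite_tricolored[OF assms])
  have 1: "\<forall>s\<in>S. fst s \<in> supp_on {..<n} \<and> fst (snd s) \<in> supp_on {..<n} \<and> snd (snd s) \<in> supp_on {..<n} \<and> fst s + fst (snd s) + snd (snd s) = 0"
    and 2: "\<forall>s\<in>S. \<forall>s'\<in>S. \<forall>s''\<in>S. fst s + fst (snd s') + snd (snd s'') = 0 \<longrightarrow> s = s' \<and> s' = s''"
    using assms unfolding tricolored_def case_prod_unfold by simp_all
  show "fst i \<in> supp_on {..<n} \<and> fst (snd i) \<in> supp_on {..<n} \<and> snd (snd i) \<in> supp_on {..<n}" if "i \<in> S" for i
    using bspec[OF 1 that] by simp
  show "fst i + fst (snd j) + snd (snd k) = 0 \<longleftrightarrow> i = j \<and> j = k" if "i \<in> S" "j \<in> S" "k \<in> S" for i j k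
    using bspec[OF 1 that(1)] bspec[OF bspec[OF bspec[OF 2 that(1)] that(2)] that(3)] by metis
qed

section \<open>Counting monomials of low degree\<close>

text \<open>Chernoff's bound: since \<open>t < 1\<close>, each low monomial \<open>e\<close> contributes at least \<open>t\<close> to the power \<open>n (p - 1) / 3\<close> to
  the sum of \<open>t\<close> to the power of the degree over all exponents, which factorises.\<close>

lemma card_low_monomials_le_growth:
  assumes t: "0 < t" "t < 1" and p: "p \<ge> 1"
  shows "real (card (low_monomials p n)) \<le> growth_fun p t ^ n"
proof -
  define a where "a = (real p - 1) / 3"
  have "real (card (low_monomials p n)) * t powr (real n * a) = (\<Sum>e\<in>low_monomials p n. t powr (real n * a))"
    by simp
  also have "\<dots> \<le> (\<Sum>e\<in>low_monomials p n. \<Prod>l<n. t ^ e l)"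
  proof (rule sum_mono)
    fix e assume "e \<in> low_monomials p n"
    hence "3 * (\<Sum>l<n. e l) \<le> n * (p - 1)" by (simp add: low_monomials_def)
    hence "real (3 * (\<Sum>l<n. e l)) \<le> real (n * (p - 1))" by (simp only: of_nat_le_iff)
    hence "real (\<Sum>l<n. e l) \<le> real n * a" using p by (simp add: a_def of_nat_diff)
    hence "t powr (real n * a) \<le> t powr real (\<Sum>l<n. e l)" using t by (intro powr_mono') auto
    also have "\<dots> = t ^ (\<Sum>l<n. e l)" using t by (intro powr_realpow)
    also have "\<dots> = (\<Prod>l<n. t ^ e l)" by (rule power_sum)
    finally show "t powr (real n * a) \<le> (\<Prod>l<n. t ^ e l)" .
  qed
  also have "\<dots> \<le> (\<Sum>e\<in>PiE {..<n} (\<lambda>_. {..<p}). \<Prod>l<n. t ^ e l)"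
  proof (rule sum_mono2)
    show "finite (PiE {..<n} (\<lambda>_. {..<p}))" by (intro finite_PiE) auto
    show "low_monomials p n \<subseteq> PiE {..<n} (\<lambda>_. {..<p})" by (simp add: low_monomials_def)
    show "0 \<le> (\<Prod>l<n. t ^ e l)" for e using t by (intro prod_nonneg) simp
  qed
  also have "\<dots> = (\<Sum>k<p. t ^ k) ^ n"
    using prod_sum_PiE[of "{..<n}" "\<lambda>_. {..<p}" "\<lambda>_ k. t ^ k"] by simp
  finally have *: "real (card (low_monomials p n)) * t powr (real n * a) \<le> (\<Sum>k<p. t ^ k) ^ n" .
  have "t powr (real n * a) = (t powr a) ^ n"
  proof -
    have "t powr (real n * a) = (t powr a) powr real n" by (simp only: powr_powr mult.commute)
    also have "\<dots> = (t powr a) ^ n" using t by (intro powr_realpow) (simp only: powr_gt_zero)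
    finally show ?thesis .
  qed
  hence "real (card (low_monomials p n)) \<le> (\<Sum>k<p. t ^ k) ^ n / (t powr a) ^ n"
    using * t by (simp add: pos_le_divide_eq)
  also have "\<dots> = ((\<Sum>k<p. t ^ k) / t powr a) ^ n" by (rule power_divide[symmetric])
  also have "(\<Sum>k<p. t ^ k) / t powr a = growth_fun p t"
    unfolding growth_fun_def a_def powr_minus divide_inverse by (rule mult.commute)
  finally show ?thesis .
qed

lemma card_low_monomials_le:
  assumes p: "p \<ge> 2"
  shows "real (card (low_monomials p n)) \<le> real p powr ((1 - removal_const p) * real n)"
proof (cases "n = 0")
  case True
  have "low_monomials p 0 \<subseteq> {\<lambda>_. undefined}" by (auto simp: low_monomials_def)
  hence "card (low_monomials p 0) \<le> 1" using card_mono[of "{\<lambda>_. undefined}" "low_monomials p 0"] by simp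
  thus ?thesis using True p by simp
next
  case False
  define L where "L = real (card (low_monomials p n))"
  have "L powr (1 / real n) \<le> (INF t\<in>{0<..<1}. growth_fun p t)"
  proof (rule cINF_greatest)
    fix t :: real assume t: "t \<in> {0<..<1}"
    have g: "growth_fun p t > 0" by (rule less_le_trans[OF _ growth_fun_lower[OF p t]]) simp
    have "L powr (1 / real n) \<le> (growth_fun p t ^ n) powr (1 / real n)"
      unfolding L_def using t p by (intro powr_mono2 card_low_monomials_le_growth) auto
    also have "\<dots> = (growth_fun p t powr real n) powr (1 / real n)" by (simp only: powr_realpow[OF g])
    also have "\<dots> = growth_fun p t" using g False by (simp only: powr_powr) simp
    finally show "L powr (1 / real n) \<le> growth_fun p t" .
  qed auto
  also have "\<dots> = real p powr (1 - removal_const p)" by (rule powr_removal_const[OF p, symmetric])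
  finally have "(L powr (1 / real n)) powr real n \<le> (real p powr (1 - removal_const p)) powr real n"
    by (intro powr_mono2) auto
  moreover have "(L powr (1 / real n)) powr real n = L" using False by (simp add: powr_powr L_def)
  ultimately show ?thesis by (simp add: powr_powr L_def)
qed

theorem tricolored_upper_bound:
  fixes S :: "((nat \<Rightarrow> 'p::prime_card mod_ring) \<times> (nat \<Rightarrow> 'p mod_ring) \<times> (nat \<Rightarrow> 'p mod_ring)) set"
  assumes "tricolored n S"
  shows "real (card S) \<le> 3 * real CARD('p) powr ((1 - removal_const CARD('p)) * real n)"
proof -
  have "CARD('p) \<ge> 2" using prime_card[where 'a = 'p] prime_ge_2_nat by auto
  hence "real (card (low_monomials CARD('p) n)) \<le> real CARD('p) powr ((1 - removal_const CARD('p)) * real n)"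
    by (rule card_low_monomials_le)
  moreover have "real (card S) \<le> real (3 * card (low_monomials CARD('p) n))"
    using tricolored_card_le[OF assms] by (simp only: of_nat_le_iff)
  ultimately show ?thesis by simp
qed

section \<open>Isolated triangles in a random affine sample\<close>

definition affine_in :: "(real \<Rightarrow> real) \<Rightarrow> bool" where
  "affine_in \<phi> \<longleftrightarrow> (\<exists>A B. \<forall>x. \<phi> x = A + B * x)"

lemma affine_in_const: "affine_in (\<lambda>_. c)"
  unfolding affine_in_def by (intro exI[of _ c] exI[of _ 0]) simp

lemma affine_in_upd: "affine_in (\<lambda>x. (a(i := x)) u)"
  unfolding affine_in_def
  by (cases "u = i", rule exI[of _ 0], rule exI[of _ 1], simp, rule exI[of _ "a u"], rule exI[of _ 0], simp)

text \<open>A product of two different coordinates remains affine in each coordinate; this is where \<open>r \<noteq> 0\<close> enters below.\<close>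

lemma affine_in_upd_mult:
  assumes "u \<noteq> v" shows "affine_in (\<lambda>x. (a(i := x)) u * (a(i := x)) v)"
proof -
  consider "u = i" "v \<noteq> i" | "v = i" "u \<noteq> i" | "u \<noteq> i" "v \<noteq> i" using assms by blast
  thus ?thesis
  proof cases
    case 1 thus ?thesis unfolding affine_in_def by (intro exI[of _ 0] exI[of _ "a v"]) simp
  next
    case 2 thus ?thesis unfolding affine_in_def by (intro exI[of _ 0] exI[of _ "a u"]) simp
  next
    case 3 thus ?thesis unfolding affine_in_def by (intro exI[of _ "a u * a v"] exI[of _ 0]) simp
  qed
qed

lemma affine_in_add: "affine_in \<phi> \<Longrightarrow> affine_in \<psi> \<Longrightarrow> affine_in (\<lambda>x. \<phi> x + \<psi> x)"
proof -
  assume "affine_in \<phi>" "affine_in \<psi>"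
  then obtain A B A' B' where "\<forall>x. \<phi> x = A + B * x" "\<forall>x. \<psi> x = A' + B' * x" by (auto simp: affine_in_def)
  thus ?thesis unfolding affine_in_def by (intro exI[of _ "A + A'"] exI[of _ "B + B'"]) (simp add: algebra_simps)
qed

lemma affine_in_cmult: "affine_in \<phi> \<Longrightarrow> affine_in (\<lambda>x. \<phi> x * c)"
proof -
  assume "affine_in \<phi>"
  then obtain A B where "\<forall>x. \<phi> x = A + B * x" by (auto simp: affine_in_def)
  thus ?thesis unfolding affine_in_def by (intro exI[of _ "A * c"] exI[of _ "B * c"]) (simp add: algebra_simps)
qed

lemma affine_in_diff: "affine_in \<phi> \<Longrightarrow> affine_in \<psi> \<Longrightarrow> affine_in (\<lambda>x. \<phi> x - \<psi> x)"
  using affine_in_add[of \<phi> "\<lambda>x. \<psi> x * (-1)"] affine_in_cmult[of \<psi> "-1"] by simp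

lemma affine_in_sum: "(\<And>k. k \<in> K \<Longrightarrow> affine_in (\<phi> k)) \<Longrightarrow> affine_in (\<lambda>x. \<Sum>k\<in>K. \<phi> k x)"
  by (induction K rule: infinite_finite_induct) (auto intro: affine_in_add affine_in_const)

text \<open>A function that is affine in each variable attains its maximum over a cube at a vertex.\<close>

lemma multiaffine_rounding:
  fixes P :: "('i \<Rightarrow> real) \<Rightarrow> real"
  assumes "finite I" and aff: "\<And>a i. i \<in> I \<Longrightarrow> affine_in (\<lambda>x. P (a(i := x)))"
    and "\<And>i. i \<in> I \<Longrightarrow> 0 \<le> a i \<and> a i \<le> 1"
  shows "\<exists>a'. (\<forall>i\<in>I. a' i = 0 \<or> a' i = 1) \<and> P a \<le> P a'"
proof -
  have "\<exists>a'. (\<forall>i\<in>I. a' i = 0 \<or> a' i = 1) \<and> (\<forall>i. i \<notin> I \<longrightarrow> a' i = a i) \<and> P a \<le> P a'"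
    using assms
  proof (induction I arbitrary: a rule: finite_induct)
    case empty
    thus ?case by (intro exI[of _ a]) auto
  next
    case (insert i I)
    obtain A B where AB: "\<And>x. P (a(i := x)) = A + B * x" using insert.prems(1)[of i a] unfolding affine_in_def by blast
    have ai: "0 \<le> a i" "a i \<le> 1" using insert.prems(2) by auto
    obtain x where x: "x = 0 \<or> x = 1" "P a \<le> P (a(i := x))"
    proof (cases "B \<ge> 0")
      case True
      have "P a \<le> P (a(i := 1))" using AB[of "a i"] AB[of 1] ai True by (simp add: mult_left_le)
      thus ?thesis using that[of 1] by simp
    next
      case False
      have "P a \<le> P (a(i := 0))" using AB[of "a i"] AB[of 0] ai False by (simp add: mult_nonpos_nonneg)
      thus ?thesis using that[of 0] by simp
    qed
    have "\<exists>a'. (\<forall>k\<in>I. a' k = 0 \<or> a' k = 1) \<and> (\<forall>k. k \<notin> I \<longrightarrow> a' k = (a(i := x)) k) \<and> P (a(i := x)) \<le> P a'"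
      using insert.hyps insert.prems by (intro insert.IH) auto
    then obtain a' where "\<forall>k\<in>I. a' k = 0 \<or> a' k = 1" "\<forall>k. k \<notin> I \<longrightarrow> a' k = (a(i := x)) k" "P (a(i := x)) \<le> P a'" by blast
    thus ?case using x insert.hyps by (intro exI[of _ a']) auto
  qed
  thus ?thesis by blast
qed

text \<open>For indicator functions, a triangle \<open>(u, v, - u - v)\<close> that shares no vertex with another triangle contributes
  \<open>1\<close>, and every other triangle contributes at most \<open>0\<close>. The displacement \<open>r\<close> runs over the triangles that share
  a vertex with \<open>(u, v, - u - v)\<close>; only the two vertices that move are tested, which keeps the expression affine in each value.\<close>

definition isolated_count :: "'v::ab_group_add set \<Rightarrow> ('v \<Rightarrow> real) \<Rightarrow> ('v \<Rightarrow> real) \<Rightarrow> ('v \<Rightarrow> real) \<Rightarrow> real" where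
  "isolated_count U F G H = (\<Sum>u\<in>U. \<Sum>v\<in>U. F u * G v * H (- u - v) *
     (1 - (\<Sum>r\<in>U - {0}. G (v + r) * H (- u - v - r) + F (u + r) * H (- u - v - r) + F (u + r) * G (v - r))))"

lemma isolated_count_affine:
  fixes U :: "'v::ab_group_add set"
  shows "affine_in (\<lambda>x. isolated_count U (F(i := x)) G H)"
    and "affine_in (\<lambda>x. isolated_count U F (G(i := x)) H)"
    and "affine_in (\<lambda>x. isolated_count U F G (H(i := x)))"
proof -
  have "isolated_count U F' G H = (\<Sum>u\<in>U. \<Sum>v\<in>U. F' u * (G v * H (- u - v)) -
     (\<Sum>r\<in>U - {0}. F' u * (G v * H (- u - v) * (G (v + r) * H (- u - v - r))) +
        (F' u * F' (u + r)) * (G v * H (- u - v) * (H (- u - v - r) + G (v - r)))))" for F'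
    unfolding isolated_count_def right_diff_distrib sum_distrib_left
    by (intro sum.cong refl arg_cong2[of _ _ _ _ "(-)"]) (auto simp: algebra_simps)
  thus "affine_in (\<lambda>x. isolated_count U (F(i := x)) G H)"
    by (simp only:) (intro affine_in_sum affine_in_diff affine_in_add affine_in_cmult affine_in_upd affine_in_upd_mult, auto)
  have "isolated_count U F G' H = (\<Sum>u\<in>U. \<Sum>v\<in>U. G' v * (F u * H (- u - v)) -
     (\<Sum>r\<in>U - {0}. (G' v * G' (v + r)) * (F u * H (- u - v) * H (- u - v - r)) +
         G' v * (F u * H (- u - v) * (F (u + r) * H (- u - v - r))) + (G' v * G' (v - r)) * (F u * H (- u - v) * F (u + r))))" for G'
    unfolding isolated_count_def right_diff_distrib sum_distrib_left
    by (intro sum.cong refl arg_cong2[of _ _ _ _ "(-)"]) (auto simp: algebra_simps)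
  thus "affine_in (\<lambda>x. isolated_count U F (G(i := x)) H)"
    by (simp only:) (intro affine_in_sum affine_in_diff affine_in_add affine_in_cmult affine_in_upd affine_in_upd_mult, auto)
  have "isolated_count U F G H' = (\<Sum>u\<in>U. \<Sum>v\<in>U. H' (- u - v) * (F u * G v) -
     (\<Sum>r\<in>U - {0}. (H' (- u - v) * H' (- u - v - r)) * (F u * G v * (G (v + r) + F (u + r))) +
        H' (- u - v) * (F u * G v * (F (u + r) * G (v - r)))))" for H'
    unfolding isolated_count_def right_diff_distrib sum_distrib_left
    by (intro sum.cong refl arg_cong2[of _ _ _ _ "(-)"]) (auto simp: algebra_simps)
  thus "affine_in (\<lambda>x. isolated_count U F G (H(i := x)))"
    by (simp only:) (intro affine_in_sum affine_in_diff affine_in_add affine_in_cmult affine_in_upd affine_in_upd_mult, auto)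
qed

text \<open>The triangles that share no vertex with another one form a tricolored set.\<close>

lemma isolated_count_le_01:
  fixes F G H :: "(nat \<Rightarrow> 'p::prime_card mod_ring) \<Rightarrow> real" and d :: nat
  defines "U \<equiv> supp_on {..<d}"
  assumes tri: "\<And>S :: ((nat \<Rightarrow> 'p mod_ring) \<times> (nat \<Rightarrow> 'p mod_ring) \<times> (nat \<Rightarrow> 'p mod_ring)) set. tricolored d S \<Longrightarrow> real (card S) \<le> b"
    and F: "\<forall>u\<in>U. F u = 0 \<or> F u = 1" and G: "\<forall>u\<in>U. G u = 0 \<or> G u = 1" and H: "\<forall>u\<in>U. H u = 0 \<or> H u = 1"
  shows "isolated_count U F G H \<le> b"
proof -
  define N where "N u v r = G (v + r) * H (- u - v - r) + F (u + r) * H (- u - v - r) + F (u + r) * G (v - r)" for u v r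
  have finU: "finite U" by (simp add: U_def)
  have cl: "x + y \<in> U" "x - y \<in> U" "- x \<in> U" if "x \<in> U" "y \<in> U" for x y using that by (auto simp: U_def)
  have F0: "0 \<le> F u" "F u \<le> 1" and G0: "0 \<le> G u" "G u \<le> 1" and H0: "0 \<le> H u" "H u \<le> 1" if "u \<in> U" for u
    using F G H that by force+
  have prods: "0 \<le> G (v + r) * H (- u - v - r)" "0 \<le> F (u + r) * H (- u - v - r)" "0 \<le> F (u + r) * G (v - r)"
    if "u \<in> U" "v \<in> U" "r \<in> U" for u v r
    using that by (auto intro!: mult_nonneg_nonneg F0 G0 H0 cl)
  have terms: "G (v + r) * H (- u - v - r) \<le> N u v r" "F (u + r) * H (- u - v - r) \<le> N u v r" "F (u + r) * G (v - r) \<le> N u v r"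
    and N0: "N u v r \<ge> 0" if "u \<in> U" "v \<in> U" "r \<in> U" for u v r
    using prods[OF that] unfolding N_def by linarith+
  define I where "I = {(u, v). u \<in> U \<and> v \<in> U \<and> F u = 1 \<and> G v = 1 \<and> H (- u - v) = 1 \<and> (\<forall>r\<in>U-{0}. N u v r = 0)}"
  have finI: "finite I" by (rule finite_subset[of _ "U \<times> U"]) (auto simp: I_def finU)
  have "isolated_count U F G H \<le> (\<Sum>u\<in>U. \<Sum>v\<in>U. if (u, v) \<in> I then 1 else 0)"
    unfolding isolated_count_def N_def[symmetric]
  proof (intro sum_mono)
    fix u v assume uv: "u \<in> U" "v \<in> U"
    have sum0: "(\<Sum>r\<in>U-{0}. N u v r) \<ge> 0" using N0 uv by (intro sum_nonneg) auto
    show "F u * G v * H (- u - v) * (1 - (\<Sum>r\<in>U-{0}. N u v r)) \<le> (if (u, v) \<in> I then 1 else 0)"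
    proof (cases "F u = 1 \<and> G v = 1 \<and> H (- u - v) = 1")
      case False
      moreover have "- u - v \<in> U" using uv by (intro cl)
      ultimately have "F u = 0 \<or> G v = 0 \<or> H (- u - v) = 0" using F G H uv by blast
      hence "F u * G v * H (- u - v) = 0" by auto
      thus ?thesis by (simp only: mult_zero_left) simp
    next
      case True
      show ?thesis
      proof (cases "(u, v) \<in> I")
        case True thus ?thesis using sum0 by (simp add: I_def)
      next
        case False
        then obtain r where r: "r \<in> U - {0}" "N u v r \<noteq> 0" using True uv by (auto simp: I_def)
        have cl': "v + r \<in> U" "- u - v - r \<in> U" "u + r \<in> U" "v - r \<in> U" using uv r cl by (auto intro!: cl)
        have "G (v + r) = 0 \<or> G (v + r) = 1" "H (- u - v - r) = 0 \<or> H (- u - v - r) = 1"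
          "F (u + r) = 0 \<or> F (u + r) = 1" "G (v - r) = 0 \<or> G (v - r) = 1"
          using F G H cl' by blast+
        hence "N u v r \<ge> 1" using r(2) unfolding N_def by (elim disjE) simp_all
        also have "N u v r \<le> (\<Sum>r\<in>U-{0}. N u v r)" using r N0 uv finU by (intro member_le_sum) auto
        finally show ?thesis using True False by simp
      qed
    qed
  qed
  also have "\<dots> = real (card I)"
  proof -
    have "(\<Sum>u\<in>U. \<Sum>v\<in>U. if (u, v) \<in> I then 1 else 0 :: real) = (\<Sum>s\<in>U\<times>U. if s \<in> I then 1 else 0)"
      by (simp add: sum.cartesian_product case_prod_unfold)
    also have "\<dots> = (\<Sum>s\<in>U\<times>U \<inter> I. 1)" using finU by (intro sum.inter_restrict[symmetric]) auto
    also have "U\<times>U \<inter> I = I" by (auto simp: I_def)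
    finally show ?thesis by simp
  qed
  also have "card I = card ((\<lambda>(u, v). (u, v, - u - v)) ` I)"
    by (rule card_image[symmetric]) (auto simp: inj_on_def)
  also have "real \<dots> \<le> b"
  proof (rule tri, unfold tricolored_def, intro conjI ballI impI)
    fix s assume "s \<in> (\<lambda>(u, v). (u, v, - u - v)) ` I"
    thus "case s of (x, y, z) \<Rightarrow> x \<in> supp_on {..<d} \<and> y \<in> supp_on {..<d} \<and> z \<in> supp_on {..<d} \<and> x + y + z = 0"
      using cl by (auto simp: I_def U_def)
  next
    fix s s' s'' assume "s \<in> (\<lambda>(u, v). (u, v, - u - v)) ` I" "s' \<in> (\<lambda>(u, v). (u, v, - u - v)) ` I" "s'' \<in> (\<lambda>(u, v). (u, v, - u - v)) ` I"
    then obtain a1 a2 a3 where a: "a1 \<in> I" "a2 \<in> I" "a3 \<in> I" "s = (\<lambda>(u, v). (u, v, - u - v)) a1"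
      "s' = (\<lambda>(u, v). (u, v, - u - v)) a2" "s'' = (\<lambda>(u, v). (u, v, - u - v)) a3" by (elim imageE) blast
    obtain u1 v1 u2 v2 u3 v3 where "a1 = (u1, v1)" "a2 = (u2, v2)" "a3 = (u3, v3)"
      by (cases a1, cases a2, cases a3) blast
    hence s: "s = (u1, v1, - u1 - v1)" "s' = (u2, v2, - u2 - v2)" "s'' = (u3, v3, - u3 - v3)"
      and I: "(u1, v1) \<in> I" "(u2, v2) \<in> I" "(u3, v3) \<in> I" using a by simp_all
    assume "fst s + fst (snd s') + snd (snd s'') = 0"
    hence "u1 + v2 = u3 + v3" by (simp add: s algebra_simps)
    hence e: "v3 = u1 + v2 - u3" by (simp add: algebra_simps)
    have U: "u1 \<in> U" "v1 \<in> U" "u2 \<in> U" "v2 \<in> U" "u3 \<in> U" "v3 \<in> U" using I by (auto simp: I_def)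
    have w: "H (- u1 - v2) = 1" using I(3) e by (auto simp: I_def algebra_simps)
    have one: "F u1 = 1" "G v2 = 1" using I by (auto simp: I_def)
    have zero: "r = 0" if "(u, v) \<in> I" "r \<in> U" "N u v r \<noteq> 0" for u v r using that by (auto simp: I_def)
    have "v1 + (v2 - v1) = v2" "- u1 - v1 - (v2 - v1) = - u1 - v2" by simp_all
    hence "1 \<le> N u1 v1 (v2 - v1)" using terms(1)[of u1 v1 "v2 - v1"] U one w cl by (metis mult_1)
    hence 1: "v2 - v1 = 0" using U cl by (intro zero[OF I(1)]) auto
    have "u2 + (u1 - u2) = u1" "- u2 - v2 - (u1 - u2) = - u1 - v2" by simp_all
    hence "1 \<le> N u2 v2 (u1 - u2)" using terms(2)[of u2 v2 "u1 - u2"] U one w cl by (metis mult_1)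
    hence 2: "u1 - u2 = 0" using U cl by (intro zero[OF I(2)]) auto
    have "u3 + (u1 - u3) = u1" "v3 - (u1 - u3) = v2" using e by simp_all
    hence "1 \<le> N u3 v3 (u1 - u3)" using terms(3)[of u3 v3 "u1 - u3"] U one w cl by (metis mult_1)
    hence 3: "u1 - u3 = 0" using U cl by (intro zero[OF I(3)]) auto
    show "s = s'" "s' = s''" using 1 2 3 e by (auto simp: s)
  qed
  finally show ?thesis .
qed

text \<open>By rounding one function after the other, the bound for indicator functions extends to weights.\<close>

lemma isolated_count_le:
  fixes F G H :: "(nat \<Rightarrow> 'p::prime_card mod_ring) \<Rightarrow> real" and d :: nat
  defines "U \<equiv> supp_on {..<d}"
  assumes tri: "\<And>S :: ((nat \<Rightarrow> 'p mod_ring) \<times> (nat \<Rightarrow> 'p mod_ring) \<times> (nat \<Rightarrow> 'p mod_ring)) set. tricolored d S \<Longrightarrow> real (card S) \<le> b"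
    and F: "\<And>u. u \<in> U \<Longrightarrow> 0 \<le> F u \<and> F u \<le> 1" and G: "\<And>u. u \<in> U \<Longrightarrow> 0 \<le> G u \<and> G u \<le> 1"
    and H: "\<And>u. u \<in> U \<Longrightarrow> 0 \<le> H u \<and> H u \<le> 1"
  shows "isolated_count U F G H \<le> b"
proof -
  have finU: "finite U" by (simp add: U_def)
  obtain F' where F': "\<forall>u\<in>U. F' u = 0 \<or> F' u = 1" "isolated_count U F G H \<le> isolated_count U F' G H"
    using multiaffine_rounding[of U "\<lambda>F. isolated_count U F G H" F] finU isolated_count_affine(1) F by blast
  obtain G' where G': "\<forall>u\<in>U. G' u = 0 \<or> G' u = 1" "isolated_count U F' G H \<le> isolated_count U F' G' H"
    using multiaffine_rounding[of U "\<lambda>G. isolated_count U F' G H" G] finU isolated_count_affine(2) G by blast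
  obtain H' where H': "\<forall>u\<in>U. H' u = 0 \<or> H' u = 1" "isolated_count U F' G' H \<le> isolated_count U F' G' H'"
    using multiaffine_rounding[of U "\<lambda>H. isolated_count U F' G' H" H] finU isolated_count_affine(3) H by blast
  have "isolated_count U F' G' H' \<le> b"
    unfolding U_def using tri F'(1) G'(1) H'(1) by (intro isolated_count_le_01) (auto simp: U_def)
  thus ?thesis using F'(2) G'(2) H'(2) by linarith
qed

section \<open>Random linear combinations\<close>

lemma sum_translate:
  fixes f :: "(nat \<Rightarrow> 'a::ab_group_add) \<Rightarrow> real"
  assumes "t \<in> supp_on I"
  shows "(\<Sum>s\<in>supp_on I. f (s + t)) = (\<Sum>s\<in>supp_on I. f s)"
  by (rule sum.reindex_bij_witness[of _ "\<lambda>s. s - t" "\<lambda>s. s + t"]) (use assms in auto)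

definition lin_comb :: "nat \<Rightarrow> (nat \<Rightarrow> nat \<Rightarrow> 'a::comm_ring_1) \<Rightarrow> (nat \<Rightarrow> 'a) \<Rightarrow> nat \<Rightarrow> 'a" where
  "lin_comb d M u = (\<lambda>j. \<Sum>i<d. u i * M i j)"

lemma lin_comb_add: "lin_comb d M (u + v) = lin_comb d M u + lin_comb d M v"
  by (rule ext) (simp add: lin_comb_def sum.distrib distrib_right)

lemma lin_comb_neg: "lin_comb d M (- u) = - lin_comb d M u"
  by (rule ext) (simp add: lin_comb_def sum_negf)

lemma lin_comb_diff: "lin_comb d M (u - v) = lin_comb d M u - lin_comb d M v"
  by (rule ext) (simp add: lin_comb_def sum_subtractf left_diff_distrib)

lemma lin_comb_in:
  assumes "\<And>i. i < d \<Longrightarrow> M i \<in> supp_on I" shows "lin_comb d M u \<in> supp_on I"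
proof (rule supp_onI)
  fix j assume "j \<notin> I"
  hence "M i j = 0" if "i < d" for i using assms[OF that] by (rule supp_onD[rotated])
  thus "lin_comb d M u j = 0" by (simp add: lin_comb_def)
qed

text \<open>A fixed nontrivial combination of independent uniform vectors is uniform. It suffices to vary the vector of
  one index \<open>i\<close> with \<open>r i \<noteq> 0\<close>.\<close>

lemma lin_comb_equidistributed:
  fixes f :: "(nat \<Rightarrow> 'p::prime_card mod_ring) \<Rightarrow> real" and n d :: nat
  defines "V \<equiv> supp_on {..<n} :: (nat \<Rightarrow> 'p mod_ring) set" and "Hom \<equiv> PiE {..<d} (\<lambda>_. supp_on {..<n} :: (nat \<Rightarrow> 'p mod_ring) set)"
  assumes r: "r \<in> supp_on {..<d}" "r \<noteq> 0"
  shows "real (card V) * (\<Sum>M\<in>Hom. f (lin_comb d M r)) = real (card Hom) * (\<Sum>s\<in>V. f s)"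
proof -
  have "\<exists>i. r i \<noteq> 0"
  proof (rule ccontr)
    assume "\<nexists>i. r i \<noteq> 0"
    hence "r i = 0 i" for i by simp
    hence "r = 0" by (rule ext)
    thus False using r(2) by contradiction
  qed
  then obtain i0 where i0: "r i0 \<noteq> 0" ..
  have "i0 < d"
  proof (rule ccontr)
    assume "\<not> i0 < d"
    hence "r i0 = 0" by (intro supp_onD[OF r(1)]) simp
    thus False using i0 by contradiction
  qed
  have shift: "lin_comb d (M(i0 := M i0 + (\<lambda>j. s j / r i0))) r = lin_comb d M r + s" for M and s :: "nat \<Rightarrow> 'p mod_ring"
  proof
    fix j
    have "(\<Sum>i<d. r i * (M(i0 := M i0 + (\<lambda>j. s j / r i0))) i j) = (\<Sum>i<d. r i * M i j + (if i = i0 then s j else 0))"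
    proof (rule sum.cong[OF refl])
      fix i
      show "r i * (M(i0 := M i0 + (\<lambda>j. s j / r i0))) i j = r i * M i j + (if i = i0 then s j else 0)"
        by (cases "i = i0") (simp_all add: distrib_left i0)
    qed
    thus "lin_comb d (M(i0 := M i0 + (\<lambda>j. s j / r i0))) r j = (lin_comb d M r + s) j"
      using \<open>i0 < d\<close> by (simp add: lin_comb_def sum.distrib)
  qed
  have inv: "(\<Sum>M\<in>Hom. f (lin_comb d M r)) = (\<Sum>M\<in>Hom. f (s + lin_comb d M r))" if s: "s \<in> V" for s
  proof (rule sum.reindex_bij_witness[of _ "\<lambda>M. M(i0 := M i0 + (\<lambda>j. s j / r i0))" "\<lambda>M. M(i0 := M i0 + (\<lambda>j. (- s) j / r i0))"])
    fix M assume M: "M \<in> Hom"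
    have in': "M(i0 := M i0 + (\<lambda>j. s' j / r i0)) \<in> Hom" if "s' \<in> V" for s'
      unfolding Hom_def
    proof (rule PiE_I)
      fix x assume "x \<in> {..<d}"
      thus "(M(i0 := M i0 + (\<lambda>j. s' j / r i0))) x \<in> supp_on {..<n}"
        using M that by (auto simp: Hom_def PiE_def Pi_def V_def supp_on_def)
    next
      fix x assume "x \<notin> {..<d}"
      thus "(M(i0 := M i0 + (\<lambda>j. s' j / r i0))) x = undefined"
        using M \<open>i0 < d\<close> by (auto simp: Hom_def PiE_def extensional_def)
    qed
    have ms: "- s \<in> V" using s by (simp add: V_def)
    show "M(i0 := M i0 + (\<lambda>j. s j / r i0)) \<in> Hom" by (rule in'[OF s])
    show "M(i0 := M i0 + (\<lambda>j. (- s) j / r i0)) \<in> Hom" by (rule in'[OF ms])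
    show "(M(i0 := M i0 + (\<lambda>j. s j / r i0)))(i0 := (M(i0 := M i0 + (\<lambda>j. s j / r i0))) i0 + (\<lambda>j. (- s) j / r i0)) = M"
      by (auto simp: fun_eq_iff)
    show "(M(i0 := M i0 + (\<lambda>j. (- s) j / r i0)))(i0 := (M(i0 := M i0 + (\<lambda>j. (- s) j / r i0))) i0 + (\<lambda>j. s j / r i0)) = M"
      by (auto simp: fun_eq_iff)
    show "f (s + lin_comb d (M(i0 := M i0 + (\<lambda>j. (- s) j / r i0))) r) = f (lin_comb d M r)"
      unfolding shift[of M "- s"] by simp
  qed
  have "real (card V) * (\<Sum>M\<in>Hom. f (lin_comb d M r)) = (\<Sum>s\<in>V. \<Sum>M\<in>Hom. f (s + lin_comb d M r))"
  proof -
    have "(\<Sum>s\<in>V. \<Sum>M\<in>Hom. f (s + lin_comb d M r)) = (\<Sum>s\<in>V. \<Sum>M\<in>Hom. f (lin_comb d M r))"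
      by (rule sum.cong[OF refl], rule inv[symmetric])
    thus ?thesis by simp
  qed
  also have "\<dots> = (\<Sum>M\<in>Hom. \<Sum>s\<in>V. f (s + lin_comb d M r))" by (rule sum.swap)
  also have "\<dots> = (\<Sum>M\<in>Hom. \<Sum>s\<in>V. f s)"
  proof (rule sum.cong[OF refl])
    fix M assume "M \<in> Hom"
    hence "lin_comb d M r \<in> supp_on {..<n}" unfolding Hom_def by (intro lin_comb_in) auto
    thus "(\<Sum>s\<in>V. f (s + lin_comb d M r)) = (\<Sum>s\<in>V. f s)" unfolding V_def by (rule sum_translate)
  qed
  finally show ?thesis by simp
qed

text \<open>Restrict the three functions to random affine images \<open>a + \<theta> u\<close>, \<open>a' + \<theta> v\<close>, \<open>- a - a' + \<theta> w\<close> of \<open>F_p^d\<close> under a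
  common linear map \<open>\<theta>\<close> and average \<open>isolated_count\<close>, which never exceeds \<open>b\<close>. A triangle survives with its weight, while
  its neighbours at displacement \<open>r \<noteq> 0\<close> are moved by the uniform vector \<open>\<theta> r\<close>, so that on average each \<open>r\<close>
  costs at most \<open>3 D / card V\<close> by the degree bounds.\<close>

theorem triangle_count_bound:
  fixes f g h :: "(nat \<Rightarrow> 'p::prime_card mod_ring) \<Rightarrow> real" and n d :: nat
  defines "V \<equiv> supp_on {..<n} :: (nat \<Rightarrow> 'p mod_ring) set" and "U \<equiv> supp_on {..<d} :: (nat \<Rightarrow> 'p mod_ring) set"
  assumes tri: "\<And>S :: ((nat \<Rightarrow> 'p mod_ring) \<times> (nat \<Rightarrow> 'p mod_ring) \<times> (nat \<Rightarrow> 'p mod_ring)) set. tricolored d S \<Longrightarrow> real (card S) \<le> b"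
    and f: "\<And>x. x \<in> V \<Longrightarrow> 0 \<le> f x \<and> f x \<le> 1" and g: "\<And>x. x \<in> V \<Longrightarrow> 0 \<le> g x \<and> g x \<le> 1"
    and h: "\<And>x. x \<in> V \<Longrightarrow> 0 \<le> h x \<and> h x \<le> 1"
    and degf: "\<And>x. x \<in> V \<Longrightarrow> f x > 0 \<Longrightarrow> (\<Sum>y\<in>V. g y * h (- x - y)) \<le> D"
    and degg: "\<And>y. y \<in> V \<Longrightarrow> g y > 0 \<Longrightarrow> (\<Sum>x\<in>V. f x * h (- x - y)) \<le> D"
    and degh: "\<And>z. z \<in> V \<Longrightarrow> h z > 0 \<Longrightarrow> (\<Sum>x\<in>V. f x * g (- x - z)) \<le> D"
    and D: "D \<ge> 0"
  defines "T \<equiv> (\<Sum>x\<in>V. \<Sum>y\<in>V. f x * g y * h (- x - y))"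
  shows "real (card U) ^ 2 * T * (1 - 3 * D * real (card U) / real (card V)) \<le> real (card V) ^ 2 * b"
proof -
  define Hom where "Hom = PiE {..<d} (\<lambda>_. V)"
  have finV: "finite V" unfolding V_def by (rule finite_supp_on) simp
  have finU: "finite U" unfolding U_def by (rule finite_supp_on) simp
  have finH: "finite Hom" unfolding Hom_def by (rule finite_PiE) (simp_all add: finV)
  note fin = finV finU finH
  have cl: "x + y \<in> V" "x - y \<in> V" "- x \<in> V" if "x \<in> V" "y \<in> V" for x y using that unfolding V_def by (simp_all only: supp_on_closed)
  have V0: "0 \<in> V" unfolding V_def by (rule supp_on_closed)
  have N: "card V > 0" unfolding card_gt_0_iff using finV V0 by blast
  have "(\<lambda>i\<in>{..<d}. 0) \<in> Hom" unfolding Hom_def using V0 by (simp only: restrict_PiE_iff) simp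
  hence HomN: "card Hom > 0" unfolding card_gt_0_iff using finH by blast
  have lin: "lin_comb d M u \<in> V" if "M \<in> Hom" for M u
    unfolding V_def by (rule lin_comb_in) (use that in \<open>auto simp: Hom_def V_def\<close>)
  define nb where "nb x y s = g (y + s) * h (- x - y - s) + f (x + s) * h (- x - y - s) + f (x + s) * g (y - s)" for x y s
  define w where "w x y = f x * g y * h (- x - y)" for x y
  have w0: "w x y \<ge> 0" if "x \<in> V" "y \<in> V" for x y
    unfolding w_def using that f g h by (intro mult_nonneg_nonneg) (auto simp: cl)
  have T0: "T \<ge> 0" unfolding T_def w_def[symmetric] using w0 by (intro sum_nonneg) auto
  have count: "isolated_count U (\<lambda>u. f (a + lin_comb d M u)) (\<lambda>v. g (a' + lin_comb d M v)) (\<lambda>v. h (- a - a' + lin_comb d M v)) \<le> b"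
    if "a \<in> V" "a' \<in> V" "M \<in> Hom" for a a' M
    unfolding U_def using tri lin[OF that(3)] that(1,2)
    by (intro isolated_count_le f g h) (auto intro!: cl)
  have expand: "(\<Sum>a\<in>V. \<Sum>a'\<in>V. isolated_count U (\<lambda>u. f (a + lin_comb d M u)) (\<lambda>v. g (a' + lin_comb d M v)) (\<lambda>v. h (- a - a' + lin_comb d M v)))
     = real (card U) ^ 2 * (\<Sum>x\<in>V. \<Sum>y\<in>V. w x y * (1 - (\<Sum>r\<in>U-{0}. nb x y (lin_comb d M r))))" if M: "M \<in> Hom" for M
  proof -
    define \<theta> where "\<theta> = lin_comb d M"
    define k where "k x y = w x y * (1 - (\<Sum>r\<in>U-{0}. nb x y (\<theta> r)))" for x y
    have shift: "(\<Sum>a\<in>V. q (a + \<theta> u)) = (\<Sum>x\<in>V. q x)" for q :: "_ \<Rightarrow> real" and u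
      using sum_translate[of "\<theta> u" "{..<n}" q] lin[OF M] by (simp add: \<theta>_def V_def)
    have "(\<Sum>a\<in>V. \<Sum>a'\<in>V. isolated_count U (\<lambda>u. f (a + \<theta> u)) (\<lambda>v. g (a' + \<theta> v)) (\<lambda>v. h (- a - a' + \<theta> v)))
       = (\<Sum>a\<in>V. \<Sum>a'\<in>V. \<Sum>u\<in>U. \<Sum>v\<in>U. k (a + \<theta> u) (a' + \<theta> v))"
    proof -
      have e: "\<theta> (u + r) = \<theta> u + \<theta> r" "\<theta> (u - r) = \<theta> u - \<theta> r" "\<theta> (- u) = - \<theta> u"
        "- (a + \<theta> u) - (a' + \<theta> v) = - a - a' + (- \<theta> u - \<theta> v)" "s + (t + r) = s + t + r" "s + (t - r) = s + t - r" for a a' u v r s t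
        by (simp_all add: \<theta>_def lin_comb_add lin_comb_diff lin_comb_neg)
      show ?thesis unfolding isolated_count_def k_def w_def nb_def by (simp only: e)
    qed
    also have "\<dots> = (\<Sum>a\<in>V. \<Sum>u\<in>U. \<Sum>a'\<in>V. \<Sum>v\<in>U. k (a + \<theta> u) (a' + \<theta> v))"
      by (rule sum.cong[OF refl], rule sum.swap)
    also have "\<dots> = (\<Sum>a\<in>V. \<Sum>u\<in>U. \<Sum>v\<in>U. \<Sum>a'\<in>V. k (a + \<theta> u) (a' + \<theta> v))"
      by (rule sum.cong[OF refl], rule sum.cong[OF refl], rule sum.swap)
    also have "\<dots> = (\<Sum>u\<in>U. \<Sum>a\<in>V. \<Sum>v\<in>U. \<Sum>y\<in>V. k (a + \<theta> u) y)"
      by (simp only: shift, rule sum.swap)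
    also have "\<dots> = (\<Sum>u\<in>U. \<Sum>x\<in>V. \<Sum>v\<in>U. \<Sum>y\<in>V. k x y)"
      by (rule sum.cong[OF refl], rule shift)
    also have "\<dots> = real (card U) ^ 2 * (\<Sum>x\<in>V. \<Sum>y\<in>V. k x y)"
      by (simp add: sum_distrib_left power2_eq_square mult.assoc)
    finally have "(\<Sum>a\<in>V. \<Sum>a'\<in>V. isolated_count U (\<lambda>u. f (a + \<theta> u)) (\<lambda>v. g (a' + \<theta> v)) (\<lambda>v. h (- a - a' + \<theta> v)))
       = real (card U) ^ 2 * (\<Sum>x\<in>V. \<Sum>y\<in>V. k x y)" .
    thus ?thesis by (simp only: \<theta>_def k_def)
  qed
  have nbsum: "w x y * (\<Sum>s\<in>V. nb x y s) \<le> w x y * (3 * D)" if xy: "x \<in> V" "y \<in> V" for x y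
  proof (cases "w x y = 0")
    case False
    hence pos: "f x > 0" "g y > 0" "h (- x - y) > 0"
      using f[of x] g[of y] h[of "- x - y"] xy cl by (auto simp: w_def less_le)
    have "g (y + s) * h (- x - y - s) = g (s + y) * h (- x - (s + y))" for s
    proof -
      have "y + s = s + y" "- x - y - s = - x - (s + y)" by (simp_all add: algebra_simps)
      thus ?thesis by (simp only:)
    qed
    hence "(\<Sum>s\<in>V. g (y + s) * h (- x - y - s)) = (\<Sum>s\<in>V. g (s + y) * h (- x - (s + y)))" by (simp only:)
    also have "\<dots> \<le> D" using sum_translate[of y "{..<n}" "\<lambda>s. g s * h (- x - s)"] degf[of x] xy pos by (simp add: V_def)
    finally have 1: "(\<Sum>s\<in>V. g (y + s) * h (- x - y - s)) \<le> D" .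
    have "f (x + s) * h (- x - y - s) = f (s + x) * h (- (s + x) - y)" for s
    proof -
      have "x + s = s + x" "- x - y - s = - (s + x) - y" by (simp_all add: algebra_simps)
      thus ?thesis by (simp only:)
    qed
    hence "(\<Sum>s\<in>V. f (x + s) * h (- x - y - s)) = (\<Sum>s\<in>V. f (s + x) * h (- (s + x) - y))" by (simp only:)
    also have "\<dots> \<le> D" using sum_translate[of x "{..<n}" "\<lambda>s. f s * h (- s - y)"] degg[of y] xy pos by (simp add: V_def)
    finally have 2: "(\<Sum>s\<in>V. f (x + s) * h (- x - y - s)) \<le> D" .
    have "f (x + s) * g (y - s) = f (s + x) * g (- (s + x) - (- x - y))" for s
    proof -
      have "x + s = s + x" "y - s = - (s + x) - (- x - y)" by (simp_all add: algebra_simps)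
      thus ?thesis by (simp only:)
    qed
    hence "(\<Sum>s\<in>V. f (x + s) * g (y - s)) = (\<Sum>s\<in>V. f (s + x) * g (- (s + x) - (- x - y)))" by (simp only:)
    also have "\<dots> \<le> D" using sum_translate[of x "{..<n}" "\<lambda>s. f s * g (- s - (- x - y))"] degh[of "- x - y"] xy pos cl by (simp add: V_def)
    finally have 3: "(\<Sum>s\<in>V. f (x + s) * g (y - s)) \<le> D" .
    have "(\<Sum>s\<in>V. nb x y s) \<le> 3 * D" unfolding nb_def sum.distrib using 1 2 3 by linarith
    thus ?thesis using w0[OF xy] by (intro mult_left_mono)
  qed simp
  have "real (card Hom) * (T * (1 - 3 * D * real (card U) / real (card V)))
      \<le> (\<Sum>M\<in>Hom. \<Sum>x\<in>V. \<Sum>y\<in>V. w x y * (1 - (\<Sum>r\<in>U-{0}. nb x y (lin_comb d M r))))"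
  proof -
    have "(\<Sum>M\<in>Hom. \<Sum>x\<in>V. \<Sum>y\<in>V. w x y * (\<Sum>r\<in>U-{0}. nb x y (lin_comb d M r)))
        = (\<Sum>x\<in>V. \<Sum>M\<in>Hom. \<Sum>y\<in>V. w x y * (\<Sum>r\<in>U-{0}. nb x y (lin_comb d M r)))"
      by (rule sum.swap)
    also have "\<dots> = (\<Sum>x\<in>V. \<Sum>y\<in>V. \<Sum>M\<in>Hom. w x y * (\<Sum>r\<in>U-{0}. nb x y (lin_comb d M r)))"
      by (rule sum.cong[OF refl], rule sum.swap)
    also have "\<dots> = (\<Sum>x\<in>V. \<Sum>y\<in>V. w x y * (\<Sum>r\<in>U-{0}. \<Sum>M\<in>Hom. nb x y (lin_comb d M r)))"
    proof (rule sum.cong[OF refl], rule sum.cong[OF refl])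
      fix x y
      have "(\<Sum>M\<in>Hom. \<Sum>r\<in>U-{0}. nb x y (lin_comb d M r)) = (\<Sum>r\<in>U-{0}. \<Sum>M\<in>Hom. nb x y (lin_comb d M r))"
        by (rule sum.swap)
      thus "(\<Sum>M\<in>Hom. w x y * (\<Sum>r\<in>U-{0}. nb x y (lin_comb d M r))) = w x y * (\<Sum>r\<in>U-{0}. \<Sum>M\<in>Hom. nb x y (lin_comb d M r))"
        by (simp only: sum_distrib_left[symmetric])
    qed
    also have "\<dots> = (\<Sum>x\<in>V. \<Sum>y\<in>V. w x y * (\<Sum>r\<in>U-{0}. real (card Hom) / real (card V) * (\<Sum>s\<in>V. nb x y s)))"
    proof (rule sum.cong[OF refl], rule sum.cong[OF refl], rule arg_cong[where f = "(*) _"], rule sum.cong[OF refl])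
      fix x y r assume r: "r \<in> U - {0}"
      have "real (card V) * (\<Sum>M\<in>Hom. nb x y (lin_comb d M r)) = real (card Hom) * (\<Sum>s\<in>V. nb x y s)"
        unfolding V_def Hom_def by (rule lin_comb_equidistributed) (use r in \<open>auto simp: U_def\<close>)
      thus "(\<Sum>M\<in>Hom. nb x y (lin_comb d M r)) = real (card Hom) / real (card V) * (\<Sum>s\<in>V. nb x y s)"
        using N by (simp add: field_simps)
    qed
    also have "\<dots> = real (card Hom) / real (card V) * real (card (U - {0})) * (\<Sum>x\<in>V. \<Sum>y\<in>V. w x y * (\<Sum>s\<in>V. nb x y s))"
      unfolding sum_distrib_left[of "_ * _"] sum_constant
      by (rule sum.cong[OF refl], rule sum.cong[OF refl]) (simp only: mult_ac)
    also have "\<dots> \<le> real (card Hom) / real (card V) * real (card (U - {0})) * (\<Sum>x\<in>V. \<Sum>y\<in>V. w x y * (3 * D))"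
      by (intro mult_left_mono sum_mono nbsum) auto
    also have "(\<Sum>x\<in>V. \<Sum>y\<in>V. w x y * (3 * D)) = T * (3 * D)"
      by (simp add: T_def w_def sum_distrib_right)
    also have "real (card Hom) / real (card V) * real (card (U - {0})) * (T * (3 * D))
        \<le> real (card Hom) / real (card V) * real (card U) * (T * (3 * D))"
      using T0 D fin by (intro mult_right_mono mult_left_mono) (auto intro: card_mono)
    finally have e1: "(\<Sum>M\<in>Hom. \<Sum>x\<in>V. \<Sum>y\<in>V. w x y * (\<Sum>r\<in>U-{0}. nb x y (lin_comb d M r)))
       \<le> real (card Hom) / real (card V) * real (card U) * (T * (3 * D))" .
    have e2: "(\<Sum>M\<in>Hom. \<Sum>x\<in>V. \<Sum>y\<in>V. w x y * (1 - (\<Sum>r\<in>U-{0}. nb x y (lin_comb d M r))))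
       = real (card Hom) * T - (\<Sum>M\<in>Hom. \<Sum>x\<in>V. \<Sum>y\<in>V. w x y * (\<Sum>r\<in>U-{0}. nb x y (lin_comb d M r)))"
      by (simp add: right_diff_distrib sum_subtractf T_def w_def)
    have e3: "real (card Hom) * (T * (1 - 3 * D * real (card U) / real (card V)))
       = real (card Hom) * T - real (card Hom) / real (card V) * real (card U) * (T * (3 * D))"
      by (simp add: right_diff_distrib)
    show ?thesis unfolding e2 e3 by (rule diff_left_mono[OF e1])
  qed
  hence "real (card U) ^ 2 * (real (card Hom) * (T * (1 - 3 * D * real (card U) / real (card V))))
      \<le> real (card U) ^ 2 * (\<Sum>M\<in>Hom. \<Sum>x\<in>V. \<Sum>y\<in>V. w x y * (1 - (\<Sum>r\<in>U-{0}. nb x y (lin_comb d M r))))"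
    by (intro mult_left_mono) auto
  also have "\<dots> = (\<Sum>M\<in>Hom. \<Sum>a\<in>V. \<Sum>a'\<in>V. isolated_count U (\<lambda>u. f (a + lin_comb d M u)) (\<lambda>v. g (a' + lin_comb d M v)) (\<lambda>v. h (- a - a' + lin_comb d M v)))"
    unfolding sum_distrib_left[of _ _ Hom] by (rule sum.cong[OF refl], rule expand[symmetric])
  also have "\<dots> \<le> (\<Sum>M\<in>Hom. \<Sum>a\<in>V. \<Sum>a'\<in>V. b)"
    using count by (intro sum_mono) auto
  also have "\<dots> = real (card Hom) * (real (card V) ^ 2 * b)" by (simp add: power2_eq_square)
  finally have "real (card Hom) * (real (card U) ^ 2 * T * (1 - 3 * D * real (card U) / real (card V)))
      \<le> real (card Hom) * (real (card V) ^ 2 * b)" by (simp only: mult_ac)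
  thus ?thesis using HomN by (simp only: mult_le_cancel_left_pos of_nat_0_less_iff)
qed

section \<open>The weighted removal lemma\<close>

text \<open>Markov's inequality.\<close>

lemma high_degree_mass:
  fixes f deg :: "'x \<Rightarrow> real"
  assumes "finite V" "\<And>x. x \<in> V \<Longrightarrow> f x \<ge> 0" "\<And>x. x \<in> V \<Longrightarrow> deg x \<ge> 0" "D > 0"
    and "(\<Sum>x\<in>V. f x * deg x) \<le> D * E"
  shows "(\<Sum>x\<in>V - {x\<in>V. deg x \<le> D}. f x) \<le> E"
proof -
  have "D * (\<Sum>x\<in>V - {x\<in>V. deg x \<le> D}. f x) = (\<Sum>x\<in>V - {x\<in>V. deg x \<le> D}. f x * D)"
    by (simp only: sum_distrib_left mult.commute)
  also have "\<dots> \<le> (\<Sum>x\<in>V - {x\<in>V. deg x \<le> D}. f x * deg x)"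
    using assms(2) by (intro sum_mono mult_left_mono) auto
  also have "\<dots> \<le> (\<Sum>x\<in>V. f x * deg x)"
    using assms(1-3) by (intro sum_mono2) auto
  finally have "D * (\<Sum>x\<in>V - {x\<in>V. deg x \<le> D}. f x) \<le> D * E" using assms(5) by linarith
  thus ?thesis using assms(4) by simp
qed

text \<open>The sampling dimension \<open>d\<close> in the removal lemma must be small enough for the neighbours of a triangle to be
  rare in a sample (first inequality), and large enough for the slice rank bound to win (second inequality). Both are
  met when \<open>p ^ d\<close> is of order \<open>\<epsilon> powr (- 1 / c)\<close>, up to the factor \<open>p\<close> lost by rounding \<open>d\<close>.\<close>

lemma sampling_constants:
  fixes p c \<rho> :: real
  assumes p: "p \<ge> 2" and c: "0 < c" and \<rho>: "0 < \<rho>" "\<rho> < 1"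
  obtains \<kappa> :: real where "\<kappa> > 0" and
    "\<And>\<epsilon>. 0 < \<epsilon> \<Longrightarrow> \<epsilon> \<le> 1 \<Longrightarrow> \<exists>d::nat.
       p ^ d \<le> (1 - \<rho>) / (6 * \<kappa>) * \<epsilon> powr (- 1 / c) \<and> 12 \<le> (p ^ d) powr (1 + c) * (\<kappa> * \<epsilon> powr (1 + 1 / c))"
proof -
  define A where "A = ((1 - \<rho>) / (6 * p)) powr (1 + c)"
  have A: "A > 0" using \<rho> p by (simp add: A_def)
  define \<kappa> where "\<kappa> = min ((1 - \<rho>) / 6) ((A / 12) powr (1 / c))"
  have \<kappa>1: "\<kappa> > 0" unfolding \<kappa>_def using \<rho> A by simp
  have \<kappa>2: "\<kappa> \<le> (1 - \<rho>) / 6" unfolding \<kappa>_def by (rule min.cobounded1)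
  have \<kappa>3: "\<kappa> \<le> (A / 12) powr (1 / c)" unfolding \<kappa>_def by (rule min.cobounded2)
  note \<kappa> = \<kappa>1 \<kappa>2 \<kappa>3
  have "\<kappa> powr c \<le> ((A / 12) powr (1 / c)) powr c" using \<kappa> c by (intro powr_mono2) auto
  also have "\<dots> = A / 12" using A c by (simp add: powr_powr)
  finally have \<kappa>c: "12 \<le> A * \<kappa> powr (- c)" using \<kappa>(1) A by (simp add: powr_minus field_simps)
  show ?thesis
  proof (rule that[OF \<kappa>(1)])
    fix \<epsilon> :: real assume \<epsilon>: "0 < \<epsilon>" "\<epsilon> \<le> 1"
    define L where "L = (1 - \<rho>) / (6 * \<kappa>) * \<epsilon> powr (- 1 / c)"
    have "1 \<le> (1 - \<rho>) / (6 * \<kappa>)" using \<kappa> by (simp add: field_simps)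
    moreover have "1 \<le> \<epsilon> powr (- 1 / c)"
      using powr_mono'[of "- 1 / c" 0 \<epsilon>] \<epsilon> c by simp
    ultimately have L: "1 \<le> L" unfolding L_def using mult_mono[of 1 "(1 - \<rho>) / (6 * \<kappa>)" 1 "\<epsilon> powr (- 1 / c)"] by simp
    define d where "d = nat \<lfloor>log p L\<rfloor>"
    have "0 \<le> log p L" using L p by simp
    hence d: "real d \<le> log p L" "log p L < real d + 1" unfolding d_def by linarith+
    have "p powr real d \<le> L" "L < p powr (real d + 1)"
      using d L p by (simp_all add: le_log_iff log_less_iff)
    hence pd: "p ^ d \<le> L" "L < p ^ d * p" using p by (simp_all add: powr_realpow powr_add)
    have "12 \<le> A * \<kappa> powr (- c)" by (rule \<kappa>c)
    also have "\<dots> = (L / p) powr (1 + c) * (\<kappa> * \<epsilon> powr (1 + 1 / c))"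
    proof -
      have "L / p = ((1 - \<rho>) / (6 * p)) * (\<kappa> powr (- 1) * \<epsilon> powr (- 1 / c))"
        using \<kappa>(1) by (simp add: L_def powr_minus field_simps)
      hence "(L / p) powr (1 + c) = A * (\<kappa> powr (- (1 + c)) * \<epsilon> powr (- 1 / c * (1 + c)))"
      proof -
        have "(((1 - \<rho>) / (6 * p)) * (\<kappa> powr (- 1) * \<epsilon> powr (- 1 / c))) powr (1 + c)
           = ((1 - \<rho>) / (6 * p)) powr (1 + c) * ((\<kappa> powr (- 1)) powr (1 + c) * (\<epsilon> powr (- 1 / c)) powr (1 + c))"
          by (simp only: powr_mult)
        moreover have "(\<kappa> powr (- 1)) powr (1 + c) = \<kappa> powr (- (1 + c))" "(\<epsilon> powr (- 1 / c)) powr (1 + c) = \<epsilon> powr (- 1 / c * (1 + c))"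
          by (simp_all only: powr_powr) simp
        ultimately show ?thesis using \<open>L / p = _\<close> by (simp only: A_def)
      qed
      moreover have "- 1 / c * (1 + c) = - (1 + 1 / c)" using c by (simp add: field_simps)
      ultimately have "(L / p) powr (1 + c) * (\<kappa> * \<epsilon> powr (1 + 1 / c))
          = A * (\<kappa> powr (- (1 + c)) * \<kappa> powr 1) * (\<epsilon> powr (- (1 + 1 / c)) * \<epsilon> powr (1 + 1 / c))"
        using \<kappa>(1) by simp
      also have "\<kappa> powr (- (1 + c)) * \<kappa> powr 1 = \<kappa> powr (- c)" by (simp only: powr_add[symmetric]) simp
      also have "\<epsilon> powr (- (1 + 1 / c)) * \<epsilon> powr (1 + 1 / c) = 1" using \<epsilon> by (simp only: powr_add[symmetric]) simp
      finally have "(L / p) powr (1 + c) * (\<kappa> * \<epsilon> powr (1 + 1 / c)) = A * \<kappa> powr (- c)" by (simp only: mult_1_right)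
      thus ?thesis ..
    qed
    also have "\<dots> \<le> (p ^ d) powr (1 + c) * (\<kappa> * \<epsilon> powr (1 + 1 / c))"
      using pd p L \<kappa>(1) c by (intro mult_right_mono powr_mono2) (auto simp: field_simps)
    finally show "\<exists>d::nat. p ^ d \<le> (1 - \<rho>) / (6 * \<kappa>) * \<epsilon> powr (- 1 / c) \<and> 12 \<le> (p ^ d) powr (1 + c) * (\<kappa> * \<epsilon> powr (1 + 1 / c))"
      using pd(1) unfolding L_def by blast
  qed
qed

definition weighted_triangles :: "'v::ab_group_add set \<Rightarrow> ('v \<Rightarrow> real) \<Rightarrow> ('v \<Rightarrow> real) \<Rightarrow> ('v \<Rightarrow> real) \<Rightarrow> real" where
  "weighted_triangles V f g h = (\<Sum>x\<in>V. \<Sum>y\<in>V. f x * g y * h (- x - y))"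

lemma weighted_triangles_degrees:
  fixes I :: "nat set" and f g h :: "(nat \<Rightarrow> 'a::ab_group_add) \<Rightarrow> real"
  defines "V \<equiv> supp_on I"
  shows "weighted_triangles V f g h = (\<Sum>x\<in>V. f x * (\<Sum>y\<in>V. g y * h (- x - y)))"
    and "weighted_triangles V f g h = (\<Sum>y\<in>V. g y * (\<Sum>x\<in>V. f x * h (- x - y)))"
    and "weighted_triangles V f g h = (\<Sum>z\<in>V. h z * (\<Sum>x\<in>V. f x * g (- x - z)))"
proof -
  show "weighted_triangles V f g h = (\<Sum>x\<in>V. f x * (\<Sum>y\<in>V. g y * h (- x - y)))"
    unfolding weighted_triangles_def sum_distrib_left by (simp only: mult.assoc)
  have "weighted_triangles V f g h = (\<Sum>y\<in>V. \<Sum>x\<in>V. f x * g y * h (- x - y))"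
    unfolding weighted_triangles_def by (rule sum.swap)
  also have "\<dots> = (\<Sum>y\<in>V. g y * (\<Sum>x\<in>V. f x * h (- x - y)))"
    unfolding sum_distrib_left by (rule sum.cong[OF refl], rule sum.cong[OF refl]) simp
  finally show "weighted_triangles V f g h = (\<Sum>y\<in>V. g y * (\<Sum>x\<in>V. f x * h (- x - y)))" .
  have "weighted_triangles V f g h = (\<Sum>x\<in>V. \<Sum>z\<in>V. f x * g (- x - z) * h z)"
    unfolding weighted_triangles_def
  proof (rule sum.cong[OF refl])
    fix x assume x: "x \<in> V"
    show "(\<Sum>y\<in>V. f x * g y * h (- x - y)) = (\<Sum>z\<in>V. f x * g (- x - z) * h z)"
    proof (rule sum.reindex_bij_witness[of _ "\<lambda>z. - x - z" "\<lambda>y. - x - y"])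
      show "- x - y \<in> V" if "y \<in> V" for y using x that by (simp add: V_def)
      show "- x - y \<in> V" if "y \<in> V" for y using x that by (simp add: V_def)
    qed simp_all
  qed
  also have "\<dots> = (\<Sum>z\<in>V. \<Sum>x\<in>V. f x * g (- x - z) * h z)" by (rule sum.swap)
  also have "\<dots> = (\<Sum>z\<in>V. h z * (\<Sum>x\<in>V. f x * g (- x - z)))"
    unfolding sum_distrib_left by (rule sum.cong[OF refl], rule sum.cong[OF refl]) simp
  finally show "weighted_triangles V f g h = (\<Sum>z\<in>V. h z * (\<Sum>x\<in>V. f x * g (- x - z)))" .
qed

text \<open>Let \<open>\<delta>\<close> be determined by \<open>T = \<kappa> \<delta>^r N^2\<close> for the present number \<open>T\<close> of triangles, where \<open>r = 1 + 1/c\<close>. Delete the points of degree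
  above \<open>D = T / (N \<delta> (1 - \<rho>))\<close>; they carry mass at most \<open>(1 - \<rho>) \<delta> N\<close>. For the remaining functions \<open>triangle_count_bound\<close> and
  the slice rank bound, with \<open>d\<close> from \<open>sampling_constants\<close>, show that at most \<open>T / 2\<close> triangles are left. Since
  \<open>\<rho>^r = 1/2\<close>, the hypothesis holds again with \<open>\<rho> \<delta>\<close> in place of \<open>\<delta>\<close>, so the mass deleted in the whole process is at most
  \<open>(1 - \<rho>) \<delta> N + \<rho> \<delta> N = \<delta> N\<close>, and \<open>\<delta> \<le> \<epsilon>\<close>. The process ends because the supports shrink.

  The last clause of the conclusion records that the sets inherit the periods of the functions: degrees are
  translation invariant. This lets the lemma be used on a quotient space without leaving \<open>F_p^n\<close>.\<close>

theorem weighted_removal: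
  fixes P :: "'p::prime_card itself"
  defines "p \<equiv> real CARD('p)" and "c \<equiv> removal_const CARD('p)"
  obtains \<kappa> :: real where "\<kappa> > 0" and
    "\<And>n (f :: (nat \<Rightarrow> 'p mod_ring) \<Rightarrow> real) g h \<epsilon>. 0 < \<epsilon> \<Longrightarrow> \<epsilon> \<le> 1 \<Longrightarrow>
       \<forall>x\<in>supp_on {..<n}. 0 \<le> f x \<and> f x \<le> 1 \<and> 0 \<le> g x \<and> g x \<le> 1 \<and> 0 \<le> h x \<and> h x \<le> 1 \<Longrightarrow>
       weighted_triangles (supp_on {..<n}) f g h \<le> \<kappa> * \<epsilon> powr (1 + 1 / c) * real (card (supp_on {..<n} :: (nat \<Rightarrow> 'p mod_ring) set)) ^ 2 \<Longrightarrow>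
       \<exists>A B C. A \<subseteq> supp_on {..<n} \<and> B \<subseteq> supp_on {..<n} \<and> C \<subseteq> supp_on {..<n} \<and>
         (\<Sum>x\<in>supp_on {..<n} - A. f x) \<le> \<epsilon> * real (card (supp_on {..<n} :: (nat \<Rightarrow> 'p mod_ring) set)) \<and>
         (\<Sum>x\<in>supp_on {..<n} - B. g x) \<le> \<epsilon> * real (card (supp_on {..<n} :: (nat \<Rightarrow> 'p mod_ring) set)) \<and>
         (\<Sum>x\<in>supp_on {..<n} - C. h x) \<le> \<epsilon> * real (card (supp_on {..<n} :: (nat \<Rightarrow> 'p mod_ring) set)) \<and>
         (\<forall>x\<in>A. \<forall>y\<in>B. - x - y \<in> C \<longrightarrow> f x * g y * h (- x - y) = 0) \<and>
         (\<forall>k\<in>supp_on {..<n}. (\<forall>x\<in>supp_on {..<n}. f (x + k) = f x \<and> g (x + k) = g x \<and> h (x + k) = h x) \<longrightarrow>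
            (\<forall>x\<in>supp_on {..<n}. (x + k \<in> A \<longleftrightarrow> x \<in> A) \<and> (x + k \<in> B \<longleftrightarrow> x \<in> B) \<and> (x + k \<in> C \<longleftrightarrow> x \<in> C)))"
proof -
  have p2: "CARD('p) \<ge> 2" using prime_card[where 'a = 'p] prime_ge_2_nat by auto
  have p: "p \<ge> 2" using p2 by (simp add: p_def)
  have c: "0 < c" "c < 1" using removal_const_bounds[OF p2] by (simp_all add: c_def)
  define r where "r = 1 + 1 / c"
  have r: "r > 1" using c by (simp add: r_def)
  define \<rho> :: real where "\<rho> = 2 powr (- 1 / r)"
  have \<rho>: "0 < \<rho>" "\<rho> < 1"
  proof -
    show "0 < \<rho>" by (simp add: \<rho>_def)
    have "(2::real) powr (- 1 / r) < 2 powr 0" using r by (intro powr_less_mono) auto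
    thus "\<rho> < 1" by (simp add: \<rho>_def)
  qed
  have "\<rho> powr r = 2 powr (- 1 / r * r)" by (simp only: \<rho>_def powr_powr)
  also have "- 1 / r * r = - 1" using r by simp
  finally have \<rho>r: "\<rho> powr r = 1 / 2" by (simp add: powr_minus)
  obtain \<kappa> where \<kappa>: "\<kappa> > 0" and sample': "\<And>\<epsilon>. 0 < \<epsilon> \<Longrightarrow> \<epsilon> \<le> 1 \<Longrightarrow> \<exists>d::nat.
       p ^ d \<le> (1 - \<rho>) / (6 * \<kappa>) * \<epsilon> powr (- 1 / c) \<and> 12 \<le> (p ^ d) powr (1 + c) * (\<kappa> * \<epsilon> powr (1 + 1 / c))"
    by (rule sampling_constants[OF p c(1) \<rho>]) (rule that)
  note sample = sample'[folded r_def]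
  show ?thesis
  proof (rule that[OF \<kappa>], fold r_def)
    fix n :: nat and f g h :: "(nat \<Rightarrow> 'p mod_ring) \<Rightarrow> real" and \<epsilon> :: real
    define V where "V = (supp_on {..<n} :: (nat \<Rightarrow> 'p mod_ring) set)"
    define N where "N = real (card V)"
    have finV: "finite V" by (simp add: V_def)
    have V0: "0 \<in> V" by (simp add: V_def)
    have cl: "x + y \<in> V" "x - y \<in> V" "- x \<in> V" if "x \<in> V" "y \<in> V" for x y
      using that unfolding V_def by (simp_all only: supp_on_closed)
    have N: "N > 0" using finV V0 unfolding N_def by (simp add: card_gt_0_iff) blast
    have shift: "(\<Sum>s\<in>V. q (s + t)) = (\<Sum>s\<in>V. q s)" if "t \<in> V" for q :: "_ \<Rightarrow> real" and t
      using sum_translate[of t "{..<n}" q] that by (simp only: V_def)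
    define good where "good f g h \<epsilon> A B C \<longleftrightarrow> A \<subseteq> V \<and> B \<subseteq> V \<and> C \<subseteq> V \<and>
         (\<Sum>x\<in>V - A. f x) \<le> \<epsilon> * N \<and> (\<Sum>x\<in>V - B. g x) \<le> \<epsilon> * N \<and> (\<Sum>x\<in>V - C. h x) \<le> \<epsilon> * N \<and>
         (\<forall>x\<in>A. \<forall>y\<in>B. - x - y \<in> C \<longrightarrow> f x * g y * h (- x - y) = 0) \<and>
         (\<forall>k\<in>V. (\<forall>x\<in>V. f (x + k) = f x \<and> g (x + k) = g x \<and> h (x + k) = h x) \<longrightarrow>
            (\<forall>x\<in>V. (x + k \<in> A \<longleftrightarrow> x \<in> A) \<and> (x + k \<in> B \<longleftrightarrow> x \<in> B) \<and> (x + k \<in> C \<longleftrightarrow> x \<in> C)))"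
      for f g h \<epsilon> A B C
    define nz where "nz f = card {x\<in>V. f x \<noteq> 0}" for f :: "(nat \<Rightarrow> 'p mod_ring) \<Rightarrow> real"
    have nz_le: "nz (\<lambda>x. if x \<in> A then f x else 0) \<le> nz f" for f A
      unfolding nz_def using finV by (intro card_mono) auto
    have nz_less: "nz (\<lambda>x. if x \<in> A then f x else 0) < nz f" if "x \<in> V" "x \<notin> A" "f x \<noteq> 0" for f A x
      unfolding nz_def using finV that by (intro psubset_card_mono) auto
    have main: "\<exists>A B C. good f g h \<epsilon> A B C"
      if "0 < \<epsilon>" "\<epsilon> \<le> 1" "\<forall>x\<in>V. 0 \<le> f x \<and> f x \<le> 1 \<and> 0 \<le> g x \<and> g x \<le> 1 \<and> 0 \<le> h x \<and> h x \<le> 1"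
        "weighted_triangles V f g h \<le> \<kappa> * \<epsilon> powr r * N ^ 2"
      for f g h \<epsilon>
      using that
    proof (induction "nz f + nz g + nz h" arbitrary: f g h \<epsilon> rule: less_induct)
      case less
      note \<epsilon> = less.prems(1,2) and rng = less.prems(3)
      define T where "T = weighted_triangles V f g h"
      have T0: "T \<ge> 0" unfolding T_def weighted_triangles_def
        using rng cl by (intro sum_nonneg mult_nonneg_nonneg) auto
      show ?case
      proof (cases "T = 0")
        case True
        have "f x * g y * h (- x - y) = 0" if "x \<in> V" "y \<in> V" for x y
        proof -
          have nn: "0 \<le> f x * g y * h (- x - y)" if "x \<in> V" "y \<in> V" for x y
            using rng cl that by (intro mult_nonneg_nonneg) auto
          hence nn2: "0 \<le> (\<Sum>y\<in>V. f x * g y * h (- x - y))" if "x \<in> V" for x using that by (intro sum_nonneg) auto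
          have "(\<Sum>x\<in>V. \<Sum>y\<in>V. f x * g y * h (- x - y)) = 0" using True by (simp add: T_def weighted_triangles_def)
          hence "(\<Sum>y\<in>V. f x * g y * h (- x - y)) = 0"
            using sum_nonneg_eq_0_iff[OF finV, of "\<lambda>x. \<Sum>y\<in>V. f x * g y * h (- x - y)"] nn2 that(1) by blast
          thus ?thesis using sum_nonneg_eq_0_iff[OF finV, of "\<lambda>y. f x * g y * h (- x - y)"] nn that by blast
        qed
        hence "good f g h \<epsilon> V V V" using \<epsilon> N cl by (auto simp: good_def)
        thus ?thesis by blast
      next
        case False
        hence Tpos: "T > 0" using T0 by simp
        define \<delta> where "\<delta> = (T / (\<kappa> * N ^ 2)) powr (1 / r)"
        have \<delta>0: "\<delta> > 0" using Tpos \<kappa> N by (simp add: \<delta>_def)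
        have T\<delta>: "T = \<kappa> * \<delta> powr r * N ^ 2" using Tpos \<kappa> N r by (simp add: \<delta>_def powr_powr)
        have \<delta>\<epsilon>: "\<delta> \<le> \<epsilon>"
        proof (rule ccontr)
          assume "\<not> \<delta> \<le> \<epsilon>"
          hence "\<epsilon> powr r < \<delta> powr r" using \<epsilon> r by (intro powr_less_mono2) auto
          hence "\<kappa> * \<epsilon> powr r * N ^ 2 < T" unfolding T\<delta> using \<kappa> N by simp
          thus False using less.prems(4) by (simp add: T_def)
        qed
        define D where "D = T / (N * (\<delta> * (1 - \<rho>)))"
        have D: "D > 0" using Tpos N \<delta>0 \<rho> by (simp add: D_def)
        have DE: "T = D * ((1 - \<rho>) * \<delta> * N)" using N \<delta>0 \<rho> by (simp add: D_def)
        define df where "df x = (\<Sum>y\<in>V. g y * h (- x - y))" for x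
        define dg where "dg y = (\<Sum>x\<in>V. f x * h (- x - y))" for y
        define dh where "dh z = (\<Sum>x\<in>V. f x * g (- x - z))" for z
        have T_eq: "T = (\<Sum>x\<in>V. f x * df x)" "T = (\<Sum>x\<in>V. g x * dg x)" "T = (\<Sum>x\<in>V. h x * dh x)"
          unfolding T_def df_def dg_def dh_def V_def by (rule weighted_triangles_degrees)+
        have nonneg: "df x \<ge> 0" "dg x \<ge> 0" "dh x \<ge> 0" if "x \<in> V" for x
          unfolding df_def dg_def dh_def using that rng cl by (auto intro!: sum_nonneg mult_nonneg_nonneg)
        define A where "A = {x\<in>V. df x \<le> D}"
        define B where "B = {x\<in>V. dg x \<le> D}"
        define C where "C = {x\<in>V. dh x \<le> D}"
        have massA: "(\<Sum>x\<in>V - A. f x) \<le> (1 - \<rho>) * \<delta> * N" unfolding A_def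
          by (rule high_degree_mass[OF finV _ nonneg(1) D]) (use rng T_eq(1) DE in auto)
        have massB: "(\<Sum>x\<in>V - B. g x) \<le> (1 - \<rho>) * \<delta> * N" unfolding B_def
          by (rule high_degree_mass[OF finV _ nonneg(2) D]) (use rng T_eq(2) DE in auto)
        have massC: "(\<Sum>x\<in>V - C. h x) \<le> (1 - \<rho>) * \<delta> * N" unfolding C_def
          by (rule high_degree_mass[OF finV _ nonneg(3) D]) (use rng T_eq(3) DE in auto)
        define f' where "f' x = (if x \<in> A then f x else 0)" for x
        define g' where "g' x = (if x \<in> B then g x else 0)" for x
        define h' where "h' x = (if x \<in> C then h x else 0)" for x
        have rng': "\<forall>x\<in>V. 0 \<le> f' x \<and> f' x \<le> 1 \<and> 0 \<le> g' x \<and> g' x \<le> 1 \<and> 0 \<le> h' x \<and> h' x \<le> 1"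
          using rng by (auto simp: f'_def g'_def h'_def)
        have le': "f' x \<le> f x" "g' x \<le> g x" "h' x \<le> h x" if "x \<in> V" for x
          using rng that by (auto simp: f'_def g'_def h'_def)
        define T' where "T' = weighted_triangles V f' g' h'"
        have half: "T' \<le> T / 2"
        proof (rule ccontr)
          assume "\<not> T' \<le> T / 2"
          hence T': "T' > T / 2" by simp
          obtain d where d: "p ^ d \<le> (1 - \<rho>) / (6 * \<kappa>) * \<delta> powr (- 1 / c)" "12 \<le> (p ^ d) powr (1 + c) * (\<kappa> * \<delta> powr r)"
            using sample[OF \<delta>0] \<delta>\<epsilon> \<epsilon> by auto
          define u where "u = p ^ d"
          have u: "u > 0" using p by (simp add: u_def)
          have cardU: "real (card (supp_on {..<d} :: (nat \<Rightarrow> 'p mod_ring) set)) = u"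
            by (simp add: card_supp_on u_def p_def)
          have tri: "real (card S) \<le> 3 * u powr (1 - c)" if "tricolored d S"
            for S :: "((nat \<Rightarrow> 'p mod_ring) \<times> (nat \<Rightarrow> 'p mod_ring) \<times> (nat \<Rightarrow> 'p mod_ring)) set"
          proof -
            have "u powr (1 - c) = p powr ((1 - c) * real d)"
              using p by (simp add: u_def powr_powr mult.commute flip: powr_realpow)
            thus ?thesis using tricolored_upper_bound[OF that] by (simp add: p_def c_def)
          qed
          have "u ^ 2 * T' * (1 - 3 * D * u / N) \<le> N ^ 2 * (3 * u powr (1 - c))"
          proof -
            have 1: "(\<Sum>y\<in>V. g' y * h' (- x - y)) \<le> D" if "x \<in> V" "f' x > 0" for x
            proof -
              have "(\<Sum>y\<in>V. g' y * h' (- x - y)) \<le> df x"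
                unfolding df_def using le' rng rng' cl that(1) by (intro sum_mono mult_mono) auto
              thus ?thesis using that by (auto simp: f'_def A_def split: if_splits)
            qed
            have 2: "(\<Sum>x\<in>V. f' x * h' (- x - y)) \<le> D" if "y \<in> V" "g' y > 0" for y
            proof -
              have "(\<Sum>x\<in>V. f' x * h' (- x - y)) \<le> dg y"
                unfolding dg_def using le' rng rng' cl that(1) by (intro sum_mono mult_mono) auto
              thus ?thesis using that by (auto simp: g'_def B_def split: if_splits)
            qed
            have 3: "(\<Sum>x\<in>V. f' x * g' (- x - z)) \<le> D" if "z \<in> V" "h' z > 0" for z
            proof -
              have "(\<Sum>x\<in>V. f' x * g' (- x - z)) \<le> dh z"
                unfolding dh_def using le' rng rng' cl that(1) by (intro sum_mono mult_mono) auto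
              thus ?thesis using that by (auto simp: h'_def C_def split: if_splits)
            qed
            have t1: "real (card S) \<le> 3 * real (card (supp_on {..<d} :: (nat \<Rightarrow> 'p mod_ring) set)) powr (1 - c)" if "tricolored d S"
              for S :: "((nat \<Rightarrow> 'p mod_ring) \<times> (nat \<Rightarrow> 'p mod_ring) \<times> (nat \<Rightarrow> 'p mod_ring)) set"
              unfolding cardU by (rule tri[OF that])
            have r1: "0 \<le> f' x \<and> f' x \<le> 1" and r2: "0 \<le> g' x \<and> g' x \<le> 1" and r3: "0 \<le> h' x \<and> h' x \<le> 1"
              if "x \<in> supp_on {..<n}" for x using rng'[unfolded V_def] that by blast+
            show ?thesis
              unfolding T'_def weighted_triangles_def N_def cardU[symmetric] V_def
              by (rule triangle_count_bound[OF t1 r1 r2 r3 1[unfolded V_def] 2[unfolded V_def] 3[unfolded V_def] less_imp_le[OF D]])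
          qed
          moreover have "3 * D * u / N \<le> 1 / 2"
          proof -
            have "u * D \<le> (1 - \<rho>) / (6 * \<kappa>) * \<delta> powr (- 1 / c) * D"
              using d(1) D by (intro mult_right_mono) (auto simp: u_def)
            also have "\<dots> = N / 6 * (\<delta> powr (- 1 / c) * \<delta> powr r / \<delta>)"
              unfolding D_def T\<delta> using \<rho> \<kappa> N \<delta>0 by (simp add: field_simps power2_eq_square)
            also have "\<delta> powr (- 1 / c) * \<delta> powr r / \<delta> = 1"
              using \<delta>0 by (simp add: r_def flip: powr_add)
            finally show ?thesis using N by (simp add: field_simps)
          qed
          hence "u ^ 2 * (T / 2) * (1 / 2) < u ^ 2 * T' * (1 - 3 * D * u / N)"
            using T' u Tpos by (intro mult_less_le_imp_less mult_strict_left_mono) auto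
          ultimately have "u ^ 2 * (T / 2) * (1 / 2) < N ^ 2 * (3 * u powr (1 - c))" by (rule less_le_trans[rotated])
          hence "u ^ 2 * T < N ^ 2 * (12 * u powr (1 - c))" by (simp add: algebra_simps)
          hence "u ^ 2 * (\<kappa> * \<delta> powr r) < 12 * u powr (1 - c)" unfolding T\<delta> using N by (simp add: mult_ac)
          moreover have "u ^ 2 = u powr (1 + c) * u powr (1 - c)"
            using u by (simp flip: powr_add powr_numeral)
          ultimately have "u powr (1 - c) * (u powr (1 + c) * (\<kappa> * \<delta> powr r)) < u powr (1 - c) * 12"
            by (simp add: mult_ac)
          hence "u powr (1 + c) * (\<kappa> * \<delta> powr r) < 12" using u by simp
          thus False using d(2) by (simp add: u_def)
        qed
        have decrease: "nz f' + nz g' + nz h' < nz f + nz g + nz h"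
        proof -
          have "f' \<noteq> f \<or> g' \<noteq> g \<or> h' \<noteq> h" using half Tpos by (auto simp: T_def T'_def)
          have "\<exists>x\<in>V. f' x \<noteq> f x \<or> g' x \<noteq> g x \<or> h' x \<noteq> h x"
          proof (rule ccontr)
            assume *: "\<not> ?thesis"
            have "T' = T" unfolding T_def T'_def weighted_triangles_def
              by (rule sum.cong[OF refl], rule sum.cong[OF refl]) (use * cl in auto)
            thus False using half Tpos by simp
          qed
          then obtain x where x: "x \<in> V" "f' x \<noteq> f x \<or> g' x \<noteq> g x \<or> h' x \<noteq> h x" by blast
          have "nz f' \<le> nz f" "nz g' \<le> nz g" "nz h' \<le> nz h"
            unfolding f'_def g'_def h'_def by (rule nz_le)+
          moreover have "nz f' < nz f \<or> nz g' < nz g \<or> nz h' < nz h"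
            using x nz_less[of x A f] nz_less[of x B g] nz_less[of x C h]
            unfolding f'_def g'_def h'_def by (auto split: if_splits)
          ultimately show ?thesis by linarith
        qed
        have "\<exists>A' B' C'. good f' g' h' (\<rho> * \<delta>) A' B' C'"
        proof (rule less.hyps[OF decrease _ _ rng'])
          show "0 < \<rho> * \<delta>" using \<rho> \<delta>0 by simp
          have "\<rho> * \<delta> \<le> 1 * 1" using \<rho> \<delta>0 \<delta>\<epsilon> \<epsilon> by (intro mult_mono) auto
          thus "\<rho> * \<delta> \<le> 1" by simp
          have "\<kappa> * (\<rho> * \<delta>) powr r * N ^ 2 = T / 2"
            unfolding T\<delta> using \<rho> \<delta>0 \<rho>r by (simp add: powr_mult)
          thus "weighted_triangles V f' g' h' \<le> \<kappa> * (\<rho> * \<delta>) powr r * N ^ 2" using half by (simp add: T'_def)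
        qed
        then obtain A' B' C' where good': "good f' g' h' (\<rho> * \<delta>) A' B' C'" by blast
        have mass: "(\<Sum>x\<in>V - S \<inter> S'. q x) \<le> \<epsilon> * N"
          if "S \<subseteq> V" "(\<Sum>x\<in>V - S. q x) \<le> (1 - \<rho>) * \<delta> * N" "(\<Sum>x\<in>V - S'. if x \<in> S then q x else 0) \<le> \<rho> * \<delta> * N"
          for S S' and q :: "_ \<Rightarrow> real"
        proof -
          have "V - S \<inter> S' = (V - S) \<union> ((V - S') \<inter> S)" using that(1) by auto
          hence "(\<Sum>x\<in>V - S \<inter> S'. q x) = (\<Sum>x\<in>V - S. q x) + (\<Sum>x\<in>(V - S') \<inter> S. q x)"
            using finV by (simp only:) (rule sum.union_disjoint, auto)
          also have "(\<Sum>x\<in>(V - S') \<inter> S. q x) = (\<Sum>x\<in>V - S'. if x \<in> S then q x else 0)"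
            using finV by (intro sum.inter_restrict) auto
          finally have "(\<Sum>x\<in>V - S \<inter> S'. q x) \<le> (1 - \<rho>) * \<delta> * N + \<rho> * \<delta> * N" using that(2,3) by linarith
          also have "\<dots> = \<delta> * N" by (simp add: algebra_simps)
          also have "\<dots> \<le> \<epsilon> * N" using \<delta>\<epsilon> N by simp
          finally show ?thesis .
        qed
        have "good f g h \<epsilon> (A \<inter> A') (B \<inter> B') (C \<inter> C')"
          unfolding good_def
        proof (intro conjI)
          show "A \<inter> A' \<subseteq> V" "B \<inter> B' \<subseteq> V" "C \<inter> C' \<subseteq> V" by (auto simp: A_def B_def C_def)
          show "(\<Sum>x\<in>V - A \<inter> A'. f x) \<le> \<epsilon> * N"
            by (rule mass) (use massA good' in \<open>auto simp: A_def good_def f'_def\<close>)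
          show "(\<Sum>x\<in>V - B \<inter> B'. g x) \<le> \<epsilon> * N"
            by (rule mass) (use massB good' in \<open>auto simp: B_def good_def g'_def\<close>)
          show "(\<Sum>x\<in>V - C \<inter> C'. h x) \<le> \<epsilon> * N"
            by (rule mass) (use massC good' in \<open>auto simp: C_def good_def h'_def\<close>)
          show "\<forall>x\<in>A \<inter> A'. \<forall>y\<in>B \<inter> B'. - x - y \<in> C \<inter> C' \<longrightarrow> f x * g y * h (- x - y) = 0"
          proof (intro ballI impI)
            fix x y assume *: "x \<in> A \<inter> A'" "y \<in> B \<inter> B'" "- x - y \<in> C \<inter> C'"
            have "f' x * g' y * h' (- x - y) = 0" using good' * unfolding good_def by blast
            thus "f x * g y * h (- x - y) = 0" using * by (simp add: f'_def g'_def h'_def)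
          qed
          show "\<forall>k\<in>V. (\<forall>x\<in>V. f (x + k) = f x \<and> g (x + k) = g x \<and> h (x + k) = h x) \<longrightarrow>
            (\<forall>x\<in>V. (x + k \<in> A \<inter> A' \<longleftrightarrow> x \<in> A \<inter> A') \<and> (x + k \<in> B \<inter> B' \<longleftrightarrow> x \<in> B \<inter> B') \<and> (x + k \<in> C \<inter> C' \<longleftrightarrow> x \<in> C \<inter> C'))"
          proof (intro ballI impI)
            fix k x assume k: "k \<in> V" "\<forall>x\<in>V. f (x + k) = f x \<and> g (x + k) = g x \<and> h (x + k) = h x" and x: "x \<in> V"
            have sub: "q (w - k) = q w" if "\<forall>x\<in>V. q (x + k) = q x" "w \<in> V" for q :: "_ \<Rightarrow> real" and w
              using bspec[OF that(1) cl(2)[OF that(2) k(1)]] by simp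
            have qk: "\<forall>x\<in>V. g (x + k) = g x" "\<forall>x\<in>V. h (x + k) = h x" using k(2) by simp_all
            have arg: "- (z + k) - y = (- z - y) - k" "- y - (z + k) = (- y - z) - k" for y z by simp_all
            have inv: "df (z + k) = df z" "dg (z + k) = dg z" "dh (z + k) = dh z" if z: "z \<in> V" for z
            proof -
              have "h (- (z + k) - y) = h (- z - y)" "h (- y - (z + k)) = h (- y - z)" "g (- y - (z + k)) = g (- y - z)" if "y \<in> V" for y
                unfolding arg by (rule sub[OF qk(2) cl(2)[OF cl(3)[OF z z] that]], rule sub[OF qk(2) cl(2)[OF cl(3)[OF that that] z]],
                  rule sub[OF qk(1) cl(2)[OF cl(3)[OF that that] z]])
              thus "df (z + k) = df z" "dg (z + k) = dg z" "dh (z + k) = dh z"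
                unfolding df_def dg_def dh_def by (auto intro!: sum.cong)
            qed
            have invA: "z + k \<in> A \<longleftrightarrow> z \<in> A" "z + k \<in> B \<longleftrightarrow> z \<in> B" "z + k \<in> C \<longleftrightarrow> z \<in> C" if "z \<in> V" for z
              using inv[OF that] that cl(1)[OF that k(1)] by (simp_all add: A_def B_def C_def)
            have "\<forall>x\<in>V. f' (x + k) = f' x \<and> g' (x + k) = g' x \<and> h' (x + k) = h' x"
              using invA k(2) by (simp add: f'_def g'_def h'_def)
            hence "\<forall>x\<in>V. (x + k \<in> A' \<longleftrightarrow> x \<in> A') \<and> (x + k \<in> B' \<longleftrightarrow> x \<in> B') \<and> (x + k \<in> C' \<longleftrightarrow> x \<in> C')"
              using good' k(1) unfolding good_def by blast
            thus "(x + k \<in> A \<inter> A' \<longleftrightarrow> x \<in> A \<inter> A') \<and> (x + k \<in> B \<inter> B' \<longleftrightarrow> x \<in> B \<inter> B') \<and> (x + k \<in> C \<inter> C' \<longleftrightarrow> x \<in> C \<inter> C')"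
              using invA x by blast
          qed
        qed
        thus ?thesis by blast
      qed
    qed
    assume "0 < \<epsilon>" "\<epsilon> \<le> 1" "\<forall>x\<in>supp_on {..<n}. 0 \<le> f x \<and> f x \<le> 1 \<and> 0 \<le> g x \<and> g x \<le> 1 \<and> 0 \<le> h x \<and> h x \<le> 1"
       "weighted_triangles (supp_on {..<n}) f g h \<le> \<kappa> * \<epsilon> powr r * real (card (supp_on {..<n} :: (nat \<Rightarrow> 'p mod_ring) set)) ^ 2"
    from main[unfolded good_def V_def N_def, OF this]
    show "\<exists>A B C. A \<subseteq> supp_on {..<n} \<and> B \<subseteq> supp_on {..<n} \<and> C \<subseteq> supp_on {..<n} \<and>
         (\<Sum>x\<in>supp_on {..<n} - A. f x) \<le> \<epsilon> * real (card (supp_on {..<n} :: (nat \<Rightarrow> 'p mod_ring) set)) \<and>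
         (\<Sum>x\<in>supp_on {..<n} - B. g x) \<le> \<epsilon> * real (card (supp_on {..<n} :: (nat \<Rightarrow> 'p mod_ring) set)) \<and>
         (\<Sum>x\<in>supp_on {..<n} - C. h x) \<le> \<epsilon> * real (card (supp_on {..<n} :: (nat \<Rightarrow> 'p mod_ring) set)) \<and>
         (\<forall>x\<in>A. \<forall>y\<in>B. - x - y \<in> C \<longrightarrow> f x * g y * h (- x - y) = 0) \<and>
         (\<forall>k\<in>supp_on {..<n}. (\<forall>x\<in>supp_on {..<n}. f (x + k) = f x \<and> g (x + k) = g x \<and> h (x + k) = h x) \<longrightarrow>
            (\<forall>x\<in>supp_on {..<n}. (x + k \<in> A \<longleftrightarrow> x \<in> A) \<and> (x + k \<in> B \<longleftrightarrow> x \<in> B) \<and> (x + k \<in> C \<longleftrightarrow> x \<in> C)))" .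
  qed
qed

section \<open>Characters and Fourier coefficients\<close>

definition additive_char :: "'p::prime_card mod_ring \<Rightarrow> complex" where
  "additive_char a = cis (2 * pi * real_of_int (to_int_mod_ring a) / real CARD('p))"

lemma cis_integer_mod:
  fixes a q :: int
  assumes "q > 0"
  shows "cis (2 * pi * real_of_int (a mod q) / real_of_int q) = cis (2 * pi * real_of_int a / real_of_int q)"
proof -
  have "real_of_int a = real_of_int (a mod q) + real_of_int q * real_of_int (a div q)"
    by (metis add.commute mult_div_mod_eq of_int_add of_int_mult)
  hence "2 * pi * real_of_int a / real_of_int q = 2 * pi * real_of_int (a mod q) / real_of_int q + 2 * pi * real_of_int (a div q)"
    using assms by (simp add: field_simps)
  thus ?thesis by (simp add: cis_mult[symmetric])
qed

lemma additive_char_add: "additive_char (a + b) = additive_char a * additive_char (b :: 'p::prime_card mod_ring)"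
proof -
  have "to_int_mod_ring (a + b) = (to_int_mod_ring a + to_int_mod_ring b) mod int CARD('p)"
    by (transfer, simp)
  hence "additive_char (a + b) = cis (2 * pi * real_of_int (to_int_mod_ring a + to_int_mod_ring b) / real CARD('p))"
    using cis_integer_mod[of "int CARD('p)" "to_int_mod_ring a + to_int_mod_ring b"]
      prime_gt_0_nat[OF prime_card[where 'a = 'p]] by (simp add: additive_char_def)
  thus ?thesis by (simp add: additive_char_def cis_mult add_divide_distrib distrib_left)
qed

lemma additive_char_0 [simp]: "additive_char 0 = 1"
  by (simp add: additive_char_def)

lemma norm_additive_char [simp]: "cmod (additive_char a) = 1"
  by (simp add: additive_char_def)

lemma additive_char_1: "additive_char (1 :: 'p::prime_card mod_ring) \<noteq> 1"
proof
  have p: "CARD('p) > 1" using prime_gt_1_nat[OF prime_card[where 'a = 'p]] .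
  have "to_int_mod_ring (1 :: 'p mod_ring) = 1" using p by (transfer, simp)
  moreover assume "additive_char (1 :: 'p mod_ring) = 1"
  ultimately have "cis (2 * pi / real CARD('p)) = 1" by (simp add: additive_char_def)
  hence "cos (2 * pi / real CARD('p)) = 1" by (simp add: complex_eq_iff)
  then obtain k :: int where "2 * pi / real CARD('p) = real_of_int k * 2 * pi" by (auto simp: cos_one_2pi_int)
  hence "1 = real_of_int k * real CARD('p)" using p by (simp add: field_simps)
  hence "1 = k * int CARD('p)" by (metis of_int_1 of_int_eq_iff of_int_mult of_int_of_nat_eq)
  hence "int CARD('p) dvd 1" by (metis dvd_triv_right)
  thus False using p by simp
qed

definition dot :: "nat \<Rightarrow> (nat \<Rightarrow> 'a::comm_ring_1) \<Rightarrow> (nat \<Rightarrow> 'a) \<Rightarrow> 'a" where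
  "dot n r x = (\<Sum>i<n. r i * x i)"

lemma dot_add: "dot n r (x + y) = dot n r x + dot n r y"
  by (simp add: dot_def sum.distrib distrib_left)

lemma dot_commute: "dot n r x = dot n x r"
  unfolding dot_def by (rule sum.cong[OF refl]) (rule mult.commute)

lemma dot_zero [simp]: "dot n r 0 = 0" "dot n 0 x = 0"
  by (simp_all add: dot_def)

definition wave :: "nat \<Rightarrow> (nat \<Rightarrow> 'p::prime_card mod_ring) \<Rightarrow> (nat \<Rightarrow> 'p mod_ring) \<Rightarrow> complex" where
  "wave n r x = additive_char (dot n r x)"

lemma wave_add: "wave n r (x + y) = wave n r x * wave n r y"
  by (simp add: wave_def dot_add additive_char_add)

lemma wave_0 [simp]: "wave n r 0 = 1" "wave n 0 x = 1"
  by (simp_all add: wave_def)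

lemma norm_wave [simp]: "cmod (wave n r x) = 1"
  by (simp add: wave_def)

lemma wave_commute: "wave n r x = wave n x r"
  by (simp add: wave_def dot_commute[of n r])

lemma wave_minus: "wave n r (- x) = cnj (wave n r x)"
proof -
  have "wave n r (- x) * wave n r x = 1" by (simp flip: wave_add)
  moreover have "cnj (wave n r x) * wave n r x = 1"
    by (metis complex_norm_square mult.commute norm_wave of_real_1 power_one)
  ultimately show ?thesis by (metis mult_cancel_right zero_neq_one mult_zero_right)
qed

lemma sum_wave_subgroup:
  fixes K :: "(nat \<Rightarrow> 'p::prime_card mod_ring) set"
  assumes "\<And>x y. x \<in> K \<Longrightarrow> y \<in> K \<Longrightarrow> x + y \<in> K" "\<And>x y. x \<in> K \<Longrightarrow> y \<in> K \<Longrightarrow> x - y \<in> K"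
  shows "(\<Sum>k\<in>K. wave n r k) = (if \<forall>k\<in>K. wave n r k = 1 then of_nat (card K) else 0)"
proof (cases "\<forall>k\<in>K. wave n r k = 1")
  case False
  then obtain t where t: "t \<in> K" "wave n r t \<noteq> 1" by blast
  have "(\<Sum>k\<in>K. wave n r k) = (\<Sum>k\<in>K. wave n r (k + t))"
    by (rule sum.reindex_bij_witness[of _ "\<lambda>k. k + t" "\<lambda>k. k - t"]) (use assms t in auto)
  also have "\<dots> = (\<Sum>k\<in>K. wave n r k) * wave n r t" by (simp add: wave_add sum_distrib_right)
  finally have "(\<Sum>k\<in>K. wave n r k) * (1 - wave n r t) = 0" by (simp add: right_diff_distrib)
  hence "(\<Sum>k\<in>K. wave n r k) = 0" using t(2) by simp
  thus ?thesis by (simp only: if_not_P[OF False])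
qed simp

lemma sum_wave:
  fixes r :: "nat \<Rightarrow> 'p::prime_card mod_ring"
  assumes r: "r \<in> supp_on {..<n}"
  shows "(\<Sum>x\<in>supp_on {..<n}. wave n r x) = (if r = 0 then of_nat (card (supp_on {..<n} :: (nat \<Rightarrow> 'p mod_ring) set)) else 0)"
proof -
  have "(\<forall>k\<in>supp_on {..<n}. wave n r k = 1) \<longleftrightarrow> r = 0"
  proof
    assume *: "\<forall>k\<in>supp_on {..<n}. wave n r k = 1"
    show "r = 0"
    proof (rule ext, rule ccontr)
      fix i assume ri: "r i \<noteq> 0 i"
      hence ri: "r i \<noteq> 0" by simp
      have i: "i < n" using supp_onD[OF r, of i] ri by (cases "i < n") auto
      define t where "t = (\<lambda>j. if j = i then 1 / r i else 0)"
      have "t \<in> supp_on {..<n}" using i by (auto simp: t_def intro!: supp_onI split: if_splits)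
      moreover have "dot n r t = (\<Sum>j<n. if j = i then 1 else 0)"
        unfolding dot_def t_def using ri by (intro sum.cong) auto
      hence "wave n r t \<noteq> 1" using i additive_char_1[where 'p = 'p] by (simp add: wave_def)
      ultimately show False using * by blast
    qed
  qed simp
  thus ?thesis using sum_wave_subgroup[of "supp_on {..<n}" n r] by simp
qed

definition fourier :: "nat \<Rightarrow> ((nat \<Rightarrow> 'p::prime_card mod_ring) \<Rightarrow> real) \<Rightarrow> (nat \<Rightarrow> 'p mod_ring) \<Rightarrow> complex" where
  "fourier n f r = (\<Sum>x\<in>supp_on {..<n}. of_real (f x) * wave n r x)"

lemma fourier_parseval:
  fixes f :: "(nat \<Rightarrow> 'p::prime_card mod_ring) \<Rightarrow> real" and n :: nat
  defines "V \<equiv> supp_on {..<n} :: (nat \<Rightarrow> 'p mod_ring) set"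
  shows "(\<Sum>r\<in>V. cmod (fourier n f r) ^ 2) = real (card V) * (\<Sum>x\<in>V. f x ^ 2)"
proof -
  have finV: "finite V" by (simp add: V_def)
  have "complex_of_real (\<Sum>r\<in>V. cmod (fourier n f r) ^ 2) = (\<Sum>r\<in>V. fourier n f r * cnj (fourier n f r))"
    by (simp only: of_real_sum complex_norm_square)
  also have "\<dots> = (\<Sum>r\<in>V. \<Sum>x\<in>V. \<Sum>y\<in>V. of_real (f x * f y) * wave n r (x - y))"
  proof (rule sum.cong[OF refl])
    fix r
    have "fourier n f r * cnj (fourier n f r) = (\<Sum>x\<in>V. \<Sum>y\<in>V. (of_real (f x) * wave n r x) * (of_real (f y) * wave n r (- y)))"
      unfolding fourier_def V_def by (simp only: cnj_sum complex_cnj_mult complex_cnj_complex_of_real wave_minus[symmetric] sum_product)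
    also have "\<dots> = (\<Sum>x\<in>V. \<Sum>y\<in>V. of_real (f x * f y) * wave n r (x - y))"
      by (rule sum.cong[OF refl], rule sum.cong[OF refl]) (simp add: wave_add[of n r _ "- _", symmetric, simplified] wave_add[symmetric] mult.commute mult.left_commute)
    finally show "fourier n f r * cnj (fourier n f r) = (\<Sum>x\<in>V. \<Sum>y\<in>V. of_real (f x * f y) * wave n r (x - y))" .
  qed
  also have "\<dots> = (\<Sum>x\<in>V. \<Sum>r\<in>V. \<Sum>y\<in>V. of_real (f x * f y) * wave n r (x - y))" by (rule sum.swap)
  also have "\<dots> = (\<Sum>x\<in>V. \<Sum>y\<in>V. \<Sum>r\<in>V. of_real (f x * f y) * wave n r (x - y))"
    by (rule sum.cong[OF refl], rule sum.swap)
  also have "\<dots> = (\<Sum>x\<in>V. \<Sum>y\<in>V. if y = x then of_nat (card V) * of_real (f x ^ 2) else 0)"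
  proof (rule sum.cong[OF refl], rule sum.cong[OF refl])
    fix x y assume xy: "x \<in> V" "y \<in> V"
    have "(\<Sum>r\<in>V. wave n r (x - y)) = (\<Sum>r\<in>V. wave n (x - y) r)" by (rule sum.cong[OF refl], rule wave_commute)
    also have "\<dots> = (if x - y = 0 then of_nat (card V) else 0)"
      unfolding V_def by (rule sum_wave) (use xy in \<open>simp add: V_def\<close>)
    finally have e: "(\<Sum>r\<in>V. wave n r (x - y)) = (if x - y = 0 then of_nat (card V) else 0)" .
    show "(\<Sum>r\<in>V. of_real (f x * f y) * wave n r (x - y)) = (if y = x then of_nat (card V) * of_real (f x ^ 2) else 0)"
      unfolding sum_distrib_left[symmetric] e by (simp add: power2_eq_square)
  qed
  also have "\<dots> = complex_of_real (real (card V) * (\<Sum>x\<in>V. f x ^ 2))"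
    using finV by (simp add: sum_distrib_left)
  finally show ?thesis by (simp only: of_real_eq_iff)
qed

lemma fourier_triangles:
  fixes f g h :: "(nat \<Rightarrow> 'p::prime_card mod_ring) \<Rightarrow> real" and n :: nat
  defines "V \<equiv> supp_on {..<n} :: (nat \<Rightarrow> 'p mod_ring) set"
  shows "(\<Sum>r\<in>V. fourier n f r * fourier n g r * fourier n h r) = of_real (real (card V) * weighted_triangles V f g h)"
proof -
  have finV: "finite V" by (simp add: V_def)
  have "(\<Sum>r\<in>V. fourier n f r * fourier n g r * fourier n h r)
     = (\<Sum>r\<in>V. \<Sum>x\<in>V. \<Sum>y\<in>V. \<Sum>z\<in>V. of_real (f x * g y * h z) * wave n r (x + y + z))"
  proof (rule sum.cong[OF refl])
    fix r
    have "fourier n f r * fourier n g r * fourier n h r = (\<Sum>x\<in>V. \<Sum>y\<in>V. \<Sum>z\<in>V.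
        (of_real (f x) * wave n r x) * (of_real (g y) * wave n r y) * (of_real (h z) * wave n r z))"
    proof -
      have "a * b * c = (\<Sum>x\<in>V. \<Sum>y\<in>V. \<Sum>z\<in>V. (a' x) * (b' y) * (c' z))"
        if "a = (\<Sum>x\<in>V. a' x)" "b = (\<Sum>x\<in>V. b' x)" "c = (\<Sum>x\<in>V. c' x)" for a b c :: complex and a' b' c'
      proof -
        have "a * b * c = (\<Sum>x\<in>V. \<Sum>y\<in>V. a' x * b' y * c)"
          unfolding that(1,2) sum_product by (simp only: sum_distrib_right)
        thus ?thesis unfolding that(3) by (simp only: sum_distrib_left)
      qed
      thus ?thesis unfolding fourier_def V_def[symmetric] by blast
    qed
    also have "\<dots> = (\<Sum>x\<in>V. \<Sum>y\<in>V. \<Sum>z\<in>V. of_real (f x * g y * h z) * wave n r (x + y + z))"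
      by (simp only: wave_add of_real_mult mult_ac)
    finally show "fourier n f r * fourier n g r * fourier n h r = \<dots>" .
  qed
  also have "\<dots> = (\<Sum>x\<in>V. \<Sum>r\<in>V. \<Sum>y\<in>V. \<Sum>z\<in>V. of_real (f x * g y * h z) * wave n r (x + y + z))" by (rule sum.swap)
  also have "\<dots> = (\<Sum>x\<in>V. \<Sum>y\<in>V. \<Sum>r\<in>V. \<Sum>z\<in>V. of_real (f x * g y * h z) * wave n r (x + y + z))"
    by (rule sum.cong[OF refl], rule sum.swap)
  also have "\<dots> = (\<Sum>x\<in>V. \<Sum>y\<in>V. \<Sum>z\<in>V. \<Sum>r\<in>V. of_real (f x * g y * h z) * wave n r (x + y + z))"
    by (rule sum.cong[OF refl], rule sum.cong[OF refl], rule sum.swap)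
  also have "\<dots> = (\<Sum>x\<in>V. \<Sum>y\<in>V. \<Sum>z\<in>V. if z = - x - y then of_nat (card V) * of_real (f x * g y * h (- x - y)) else 0)"
  proof (rule sum.cong[OF refl], rule sum.cong[OF refl], rule sum.cong[OF refl])
    fix x y z assume xyz: "x \<in> V" "y \<in> V" "z \<in> V"
    have "(\<Sum>r\<in>V. wave n r (x + y + z)) = (\<Sum>r\<in>V. wave n (x + y + z) r)" by (rule sum.cong[OF refl], rule wave_commute)
    also have "\<dots> = (if x + y + z = 0 then of_nat (card V) else 0)"
      unfolding V_def by (rule sum_wave) (use xyz in \<open>simp add: V_def\<close>)
    finally have e: "(\<Sum>r\<in>V. wave n r (x + y + z)) = (if x + y + z = 0 then of_nat (card V) else 0)" .
    have i: "x + y + z = 0 \<longleftrightarrow> z = - x - y"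
    proof
      assume "x + y + z = 0"
      hence "z = - (x + y)" by (rule minus_unique[symmetric])
      thus "z = - x - y" by simp
    qed simp
    show "(\<Sum>r\<in>V. of_real (f x * g y * h z) * wave n r (x + y + z))
       = (if z = - x - y then of_nat (card V) * of_real (f x * g y * h (- x - y)) else 0)"
      unfolding sum_distrib_left[symmetric] e i by (cases "z = - x - y") (simp_all only: if_True if_False refl mult_zero_right, rule mult.commute)
  qed
  also have "\<dots> = (\<Sum>x\<in>V. \<Sum>y\<in>V. of_nat (card V) * of_real (f x * g y * h (- x - y)))"
  proof (rule sum.cong[OF refl], rule sum.cong[OF refl])
    fix x y assume "x \<in> V" "y \<in> V"
    hence "- x - y \<in> V" by (simp add: V_def)
    thus "(\<Sum>z\<in>V. if z = - x - y then of_nat (card V) * of_real (f x * g y * h (- x - y)) else (0::complex))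
       = of_nat (card V) * of_real (f x * g y * h (- x - y))"
      using finV by (simp only: sum.delta if_True)
  qed
  also have "\<dots> = of_real (real (card V) * weighted_triangles V f g h)"
    unfolding weighted_triangles_def of_real_mult[of "real (card V)"] of_real_sum of_real_of_nat_eq by (simp only: sum_distrib_left)
  finally show ?thesis .
qed

text \<open>The conditional expectation of \<open>f\<close> on the cosets of \<open>K\<close>, for a subgroup \<open>K\<close>.\<close>

definition coset_average :: "'v::ab_group_add set \<Rightarrow> ('v \<Rightarrow> real) \<Rightarrow> 'v \<Rightarrow> real" where
  "coset_average K f x = (\<Sum>k\<in>K. f (x + k)) / real (card K)"

text \<open>Averaging over \<open>K\<close> projects onto the characters that are trivial on \<open>K\<close>.\<close>

lemma fourier_coset_average:
  fixes f :: "(nat \<Rightarrow> 'p::prime_card mod_ring) \<Rightarrow> real"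
  assumes K: "K \<subseteq> supp_on {..<n}" "0 \<in> K" "\<And>x y. x \<in> K \<Longrightarrow> y \<in> K \<Longrightarrow> x + y \<in> K" "\<And>x y. x \<in> K \<Longrightarrow> y \<in> K \<Longrightarrow> x - y \<in> K"
  shows "fourier n (coset_average K f) r = (if \<forall>k\<in>K. wave n r k = 1 then fourier n f r else 0)"
proof -
  define V where "V = (supp_on {..<n} :: (nat \<Rightarrow> 'p mod_ring) set)"
  have finK: "finite K" using finite_subset[OF K(1)] by simp
  have K0: "card K > 0" using finK K(2) unfolding card_gt_0_iff by blast
  have "of_nat (card K) * fourier n (coset_average K f) r = (\<Sum>x\<in>V. \<Sum>k\<in>K. of_real (f (x + k)) * wave n r x)"
    unfolding fourier_def V_def[symmetric] coset_average_def sum_distrib_left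
    using K0 by (intro sum.cong refl) (simp add: sum_distrib_right)
  also have "\<dots> = (\<Sum>k\<in>K. \<Sum>x\<in>V. of_real (f (x + k)) * wave n r x)" by (rule sum.swap)
  also have "\<dots> = (\<Sum>k\<in>K. cnj (wave n r k) * fourier n f r)"
  proof (rule sum.cong[OF refl])
    fix k assume "k \<in> K"
    hence k: "k \<in> V" using K(1) by (auto simp: V_def)
    have "(\<Sum>x\<in>V. of_real (f (x + k)) * wave n r x) = (\<Sum>x\<in>V. of_real (f x) * wave n r (x - k))"
      by (rule sum.reindex_bij_witness[of _ "\<lambda>x. x - k" "\<lambda>x. x + k"]) (use k in \<open>simp_all add: V_def\<close>)
    also have "\<dots> = (\<Sum>x\<in>V. of_real (f x) * wave n r x * cnj (wave n r k))"
    proof (rule sum.cong[OF refl])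
      fix x
      have "wave n r (x - k) = wave n r x * cnj (wave n r k)"
        unfolding wave_minus[symmetric] wave_add[symmetric] by simp
      thus "of_real (f x) * wave n r (x - k) = of_real (f x) * wave n r x * cnj (wave n r k)" by (simp only: mult.assoc)
    qed
    finally show "(\<Sum>x\<in>V. of_real (f (x + k)) * wave n r x) = cnj (wave n r k) * fourier n f r"
      unfolding fourier_def V_def[symmetric] by (simp only: sum_distrib_right[symmetric]) (rule mult.commute)
  qed
  also have "\<dots> = cnj (\<Sum>k\<in>K. wave n r k) * fourier n f r" by (simp add: sum_distrib_right)
  also have "(\<Sum>k\<in>K. wave n r k) = (if \<forall>k\<in>K. wave n r k = 1 then of_nat (card K) else 0)"
    by (rule sum_wave_subgroup[OF K(3,4)])
  finally have *: "of_nat (card K) * fourier n (coset_average K f) r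
      = cnj (if \<forall>k\<in>K. wave n r k = 1 then of_nat (card K) else 0) * fourier n f r" .
  show ?thesis
  proof (cases "\<forall>k\<in>K. wave n r k = 1")
    case True
    show ?thesis using *[unfolded if_P[OF True]] K0 unfolding if_P[OF True] by simp
  next
    case False
    show ?thesis using *[unfolded if_not_P[OF False]] K0 unfolding if_not_P[OF False] by simp
  qed
qed

section \<open>The quotient by the orthogonal space of the large spectrum\<close>

text \<open>The Fourier coefficients of the averaged functions agree with the original ones on the characters that are trivial on
  \<open>K\<close> and vanish elsewhere. Characters outside \<open>S\<close> have a coefficient of at most \<open>\<delta> N\<close> at \<open>f\<close>, so replacing the
  functions by their averages changes the number of triangles by at most \<open>\<delta> N\<close> times an inner product that
  Cauchy-Schwarz and Parseval control. Only the spectrum of \<open>f\<close> enters, whence the exponent \<open>2\<close>.\<close>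

lemma spectrum_quotient:
  fixes f g h :: "(nat \<Rightarrow> 'p::prime_card mod_ring) \<Rightarrow> real" and n :: nat
  defines "V \<equiv> supp_on {..<n} :: (nat \<Rightarrow> 'p mod_ring) set"
  defines "N \<equiv> real (card V)"
  assumes rng: "\<forall>x\<in>V. 0 \<le> f x \<and> f x \<le> 1 \<and> 0 \<le> g x \<and> g x \<le> 1 \<and> 0 \<le> h x \<and> h x \<le> 1"
    and free: "weighted_triangles V f g h = 0" and \<delta>: "\<delta> > 0"
  defines "S \<equiv> {r\<in>V. cmod (fourier n f r) > \<delta> * N}"
  defines "K \<equiv> {x\<in>V. \<forall>r\<in>S. dot n r x = 0}"
  shows "real (card S) \<le> 1 / \<delta> ^ 2"
    and "weighted_triangles V (coset_average K f) (coset_average K g) (coset_average K h) \<le> \<delta> * N ^ 2"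
proof -
  have finV: "finite V" by (simp add: V_def)
  have V0: "0 \<in> V" by (simp add: V_def)
  have N: "N > 0" unfolding N_def of_nat_0_less_iff card_gt_0_iff using finV V0 by blast
  have energy: "(\<Sum>r\<in>V. cmod (fourier n q r) ^ 2) \<le> N ^ 2" if "\<And>x. x \<in> V \<Longrightarrow> 0 \<le> q x \<and> q x \<le> 1" for q
  proof -
    have "(\<Sum>x\<in>V. q x ^ 2) \<le> (\<Sum>x\<in>V. 1)" using that by (intro sum_mono power_le_one) auto
    hence "N * (\<Sum>x\<in>V. q x ^ 2) \<le> N * N" using N by (intro mult_left_mono) (simp_all add: N_def)
    thus ?thesis using fourier_parseval[of n q] by (simp add: V_def N_def power2_eq_square)
  qed
  have "real (card S) * (\<delta> * N) ^ 2 = (\<Sum>r\<in>S. (\<delta> * N) ^ 2)" by simp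
  also have "\<dots> \<le> (\<Sum>r\<in>S. cmod (fourier n f r) ^ 2)"
    using \<delta> N by (intro sum_mono power_mono) (auto simp: S_def)
  also have "\<dots> \<le> (\<Sum>r\<in>V. cmod (fourier n f r) ^ 2)" using finV by (intro sum_mono2) (auto simp: S_def)
  also have "\<dots> \<le> N ^ 2" using rng by (intro energy) auto
  finally have "(real (card S) * \<delta> ^ 2) * N ^ 2 \<le> 1 * N ^ 2" by (simp add: power_mult_distrib mult.assoc)
  hence "real (card S) * \<delta> ^ 2 \<le> 1" using N by (subst (asm) mult_le_cancel_right_pos) simp_all
  thus "real (card S) \<le> 1 / \<delta> ^ 2" using \<delta> by (simp add: field_simps)
  define P where "P r \<longleftrightarrow> (\<forall>k\<in>K. wave n r k = 1)" for r
  have SP: "P r" if "r \<in> S" for r using that by (auto simp: P_def K_def wave_def)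
  have K: "K \<subseteq> supp_on {..<n}" "0 \<in> K" by (auto simp: K_def V_def)
  have dot_diff: "dot n r (x - y) = dot n r x - dot n r y" for r x y :: "nat \<Rightarrow> 'p mod_ring"
    by (simp add: dot_def sum_subtractf right_diff_distrib)
  have Kcl: "x + y \<in> K" "x - y \<in> K" if "x \<in> K" "y \<in> K" for x y
    using that by (simp_all add: K_def V_def dot_add dot_diff)
  define F where "F r = fourier n f r * fourier n g r * fourier n h r" for r
  have avg: "fourier n (coset_average K q) r = (if P r then fourier n q r else 0)" for q r
    unfolding P_def by (rule fourier_coset_average[OF K Kcl])
  define T where "T = weighted_triangles V (coset_average K f) (coset_average K g) (coset_average K h)"
  have "complex_of_real (N * T) = (\<Sum>r\<in>V. if P r then F r else 0)"
    unfolding N_def T_def V_def fourier_triangles[symmetric] avg F_def by (rule sum.cong[OF refl]) simp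
  also have "\<dots> = (\<Sum>r\<in>V. F r - (if P r then 0 else F r))" by (rule sum.cong[OF refl]) simp
  also have "\<dots> = (\<Sum>r\<in>V. F r) - (\<Sum>r\<in>V. if P r then 0 else F r)" by (rule sum_subtractf)
  also have "(\<Sum>r\<in>V. F r) = 0"
    unfolding F_def using fourier_triangles[of n f g h] free by (simp add: V_def)
  finally have "cmod (complex_of_real (N * T)) = cmod (\<Sum>r\<in>V. if P r then 0 else F r)" by simp
  also have "\<dots> \<le> (\<Sum>r\<in>V. cmod (if P r then 0 else F r))" by (rule norm_sum)
  also have "\<dots> \<le> (\<Sum>r\<in>V. \<delta> * N * ((cmod (fourier n g r) ^ 2 + cmod (fourier n h r) ^ 2) / 2))"
  proof (rule sum_mono)
    fix r assume r: "r \<in> V"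
    show "cmod (if P r then 0 else F r) \<le> \<delta> * N * ((cmod (fourier n g r) ^ 2 + cmod (fourier n h r) ^ 2) / 2)"
    proof (cases "P r")
      case True thus ?thesis using \<delta> N by simp
    next
      case False
      hence "cmod (fourier n f r) \<le> \<delta> * N" using SP r by (force simp: S_def)
      moreover have "cmod (fourier n g r) * cmod (fourier n h r) \<le> (cmod (fourier n g r) ^ 2 + cmod (fourier n h r) ^ 2) / 2"
        using sum_squares_bound[of "cmod (fourier n g r)" "cmod (fourier n h r)"] by simp
      ultimately have "cmod (fourier n f r) * (cmod (fourier n g r) * cmod (fourier n h r))
          \<le> \<delta> * N * ((cmod (fourier n g r) ^ 2 + cmod (fourier n h r) ^ 2) / 2)"
        using \<delta> N by (intro mult_mono) auto
      thus ?thesis using False by (simp add: F_def norm_mult mult.assoc)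
    qed
  qed
  also have "\<dots> = \<delta> * N * (((\<Sum>r\<in>V. cmod (fourier n g r) ^ 2) + (\<Sum>r\<in>V. cmod (fourier n h r) ^ 2)) / 2)"
    by (simp add: sum_distrib_left[symmetric] sum_divide_distrib[symmetric] sum.distrib)
  also have "\<dots> \<le> \<delta> * N * ((N ^ 2 + N ^ 2) / 2)"
    using \<delta> N energy[of g] energy[of h] rng by (intro mult_left_mono divide_right_mono add_mono) auto
  finally have "N * \<bar>T\<bar> \<le> N * (\<delta> * N ^ 2)" using N by (simp add: norm_mult abs_mult mult_ac)
  hence "\<bar>T\<bar> \<le> \<delta> * N ^ 2" using N by (simp only: mult_le_cancel_left_pos)
  thus "weighted_triangles V (coset_average K f) (coset_average K g) (coset_average K h) \<le> \<delta> * N ^ 2"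
    by (simp add: T_def)
qed

lemma sum_coset_average:
  fixes W K :: "'v::ab_group_add set"
  assumes fin: "finite K" "K \<noteq> {}" and W: "\<And>k x. k \<in> K \<Longrightarrow> x + k \<in> W \<longleftrightarrow> x \<in> W"
  shows "(\<Sum>x\<in>W. coset_average K f x) = (\<Sum>x\<in>W. f x)"
proof -
  have "(\<Sum>x\<in>W. coset_average K f x) = (\<Sum>x\<in>W. \<Sum>k\<in>K. f (x + k)) / real (card K)"
    by (simp only: coset_average_def sum_divide_distrib)
  also have "(\<Sum>x\<in>W. \<Sum>k\<in>K. f (x + k)) = (\<Sum>k\<in>K. \<Sum>x\<in>W. f (x + k))" by (rule sum.swap)
  also have "\<dots> = (\<Sum>k\<in>K. \<Sum>x\<in>W. f x)"
  proof (rule sum.cong[OF refl])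
    fix k assume k: "k \<in> K"
    have "x - k \<in> W" if "x \<in> W" for x using W[OF k, of "x - k"] that by simp
    thus "(\<Sum>x\<in>W. f (x + k)) = (\<Sum>x\<in>W. f x)"
      by (intro sum.reindex_bij_witness[of _ "\<lambda>x. x - k" "\<lambda>x. x + k"]) (simp_all add: W[OF k])
  qed
  finally show ?thesis using fin by simp
qed

definition dot_map :: "nat \<Rightarrow> nat \<Rightarrow> (nat \<Rightarrow> nat \<Rightarrow> 'a::comm_ring_1) \<Rightarrow> (nat \<Rightarrow> 'a) \<Rightarrow> nat \<Rightarrow> 'a" where
  "dot_map n m a x = (\<lambda>i. if i < m then dot n (a i) x else 0)"

lemma dot_map_in: "dot_map n m a x \<in> supp_on {..<m}"
  by (rule supp_onI) (simp add: dot_map_def)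

lemma dot_map_add: "dot_map n m a (x + y) = dot_map n m a x + dot_map n m a y"
  by (rule ext) (simp add: dot_map_def dot_add)

text \<open>The linear map is given by the characters of the large spectrum \<open>S\<close> of \<open>X\<close>, padded with zeros to \<open>m\<close>
  coordinates, so that its kernel is \<open>K\<close>. The averaged indicators are \<open>K\<close>-periodic and positive on \<open>X\<close>, \<open>Y\<close>, \<open>Z\<close>, and
  \<open>weighted_removal\<close> yields \<open>K\<close>-periodic sets \<open>A\<close>, \<open>B\<close>, \<open>C\<close> on which they have no triangle. A triangle among the
  images of \<open>X \<inter> A\<close>, \<open>Y \<inter> B\<close>, \<open>Z \<inter> C\<close> lifts to \<open>x + y + z \<in> K\<close>, and moving \<open>z\<close> inside its coset produces a triangle of
  the averages.\<close>

theorem dimension_upper_bound: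
  fixes P :: "'p::prime_card itself"
  defines "r \<equiv> 1 + 1 / removal_const CARD('p)"
  obtains \<kappa> :: real where "\<kappa> > 0" and
    "\<And>n m (X :: (nat \<Rightarrow> 'p mod_ring) set) Y Z \<epsilon>. 0 < \<epsilon> \<Longrightarrow> \<epsilon> \<le> 1 \<Longrightarrow> 1 / (\<kappa> * \<epsilon> powr r) ^ 2 \<le> real m \<Longrightarrow>
       X \<subseteq> supp_on {..<n} \<Longrightarrow> Y \<subseteq> supp_on {..<n} \<Longrightarrow> Z \<subseteq> supp_on {..<n} \<Longrightarrow>
       \<forall>x\<in>X. \<forall>y\<in>Y. \<forall>z\<in>Z. x + y + z \<noteq> 0 \<Longrightarrow>
       \<exists>a X' Y' Z'. X' \<subseteq> supp_on {..<m} \<and> Y' \<subseteq> supp_on {..<m} \<and> Z' \<subseteq> supp_on {..<m} \<and>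
         (\<forall>x\<in>X'. \<forall>y\<in>Y'. \<forall>z\<in>Z'. x + y + z \<noteq> 0) \<and>
         real (card {x\<in>X. dot_map n m a x \<notin> X'}) \<le> \<epsilon> * real CARD('p) ^ n \<and>
         real (card {x\<in>Y. dot_map n m a x \<notin> Y'}) \<le> \<epsilon> * real CARD('p) ^ n \<and>
         real (card {x\<in>Z. dot_map n m a x \<notin> Z'}) \<le> \<epsilon> * real CARD('p) ^ n"
proof -
  obtain \<kappa> where \<kappa>: "\<kappa> > 0" and rem: "\<And>n (f :: (nat \<Rightarrow> 'p mod_ring) \<Rightarrow> real) g h \<epsilon>. 0 < \<epsilon> \<Longrightarrow> \<epsilon> \<le> 1 \<Longrightarrow>
       \<forall>x\<in>supp_on {..<n}. 0 \<le> f x \<and> f x \<le> 1 \<and> 0 \<le> g x \<and> g x \<le> 1 \<and> 0 \<le> h x \<and> h x \<le> 1 \<Longrightarrow>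
       weighted_triangles (supp_on {..<n}) f g h \<le> \<kappa> * \<epsilon> powr (1 + 1 / removal_const CARD('p)) * real (card (supp_on {..<n} :: (nat \<Rightarrow> 'p mod_ring) set)) ^ 2 \<Longrightarrow>
       \<exists>A B C. A \<subseteq> supp_on {..<n} \<and> B \<subseteq> supp_on {..<n} \<and> C \<subseteq> supp_on {..<n} \<and>
         (\<Sum>x\<in>supp_on {..<n} - A. f x) \<le> \<epsilon> * real (card (supp_on {..<n} :: (nat \<Rightarrow> 'p mod_ring) set)) \<and>
         (\<Sum>x\<in>supp_on {..<n} - B. g x) \<le> \<epsilon> * real (card (supp_on {..<n} :: (nat \<Rightarrow> 'p mod_ring) set)) \<and>
         (\<Sum>x\<in>supp_on {..<n} - C. h x) \<le> \<epsilon> * real (card (supp_on {..<n} :: (nat \<Rightarrow> 'p mod_ring) set)) \<and>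
         (\<forall>x\<in>A. \<forall>y\<in>B. - x - y \<in> C \<longrightarrow> f x * g y * h (- x - y) = 0) \<and>
         (\<forall>k\<in>supp_on {..<n}. (\<forall>x\<in>supp_on {..<n}. f (x + k) = f x \<and> g (x + k) = g x \<and> h (x + k) = h x) \<longrightarrow>
            (\<forall>x\<in>supp_on {..<n}. (x + k \<in> A \<longleftrightarrow> x \<in> A) \<and> (x + k \<in> B \<longleftrightarrow> x \<in> B) \<and> (x + k \<in> C \<longleftrightarrow> x \<in> C)))"
    by (rule weighted_removal[where 'p = 'p]) (rule that)
  show ?thesis
  proof (rule that[OF \<kappa>])
    fix n m :: nat and X Y Z :: "(nat \<Rightarrow> 'p mod_ring) set" and \<epsilon> :: real
    assume \<epsilon>: "0 < \<epsilon>" "\<epsilon> \<le> 1" and m: "1 / (\<kappa> * \<epsilon> powr r) ^ 2 \<le> real m"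
      and XYZ: "X \<subseteq> supp_on {..<n}" "Y \<subseteq> supp_on {..<n}" "Z \<subseteq> supp_on {..<n}"
      and free: "\<forall>x\<in>X. \<forall>y\<in>Y. \<forall>z\<in>Z. x + y + z \<noteq> 0"
    define V where "V = (supp_on {..<n} :: (nat \<Rightarrow> 'p mod_ring) set)"
    have finV: "finite V" by (simp add: V_def)
    have cl: "x + y \<in> V" "x - y \<in> V" "- x \<in> V" if "x \<in> V" "y \<in> V" for x y
      using that unfolding V_def by (simp_all only: supp_on_closed)
    have cardV: "real (card V) = real CARD('p) ^ n" by (simp add: V_def card_supp_on)
    define \<delta> where "\<delta> = \<kappa> * \<epsilon> powr r"
    have \<delta>: "\<delta> > 0" using \<kappa> \<epsilon> by (simp add: \<delta>_def)
    define ind where "ind W x = (if x \<in> W then 1 else 0 :: real)" for W and x :: "nat \<Rightarrow> 'p mod_ring"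
    define S where "S = {q\<in>V. cmod (fourier n (ind X) q) > \<delta> * real (card V)}"
    define K where "K = {x\<in>V. \<forall>q\<in>S. dot n q x = 0}"
    have "weighted_triangles V (ind X) (ind Y) (ind Z) = 0"
      unfolding weighted_triangles_def
    proof (intro sum.neutral ballI)
      fix x y assume "x \<in> V" "y \<in> V"
      have "x + y + (- x - y) = 0" by simp
      hence "\<not> (x \<in> X \<and> y \<in> Y \<and> - x - y \<in> Z)" using free by blast
      thus "ind X x * ind Y y * ind Z (- x - y) = 0" unfolding ind_def by (elim de_Morgan_conj[THEN iffD1, THEN disjE]) auto
    qed
    hence cardS: "real (card S) \<le> 1 / \<delta> ^ 2"
      and few: "weighted_triangles V (coset_average K (ind X)) (coset_average K (ind Y)) (coset_average K (ind Z)) \<le> \<delta> * real (card V) ^ 2"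
      unfolding V_def S_def K_def using \<delta> by (intro spectrum_quotient; simp add: ind_def)+
    have finS: "finite S" using finV by (simp add: S_def)
    have finK: "finite K" using finV by (simp add: K_def)
    have K0: "0 \<in> K" by (simp add: K_def V_def)
    have KV: "K \<subseteq> V" by (auto simp: K_def)
    have dot_diff: "dot n q (x - y) = dot n q x - dot n q y" for q x y :: "nat \<Rightarrow> 'p mod_ring"
      by (simp add: dot_def sum_subtractf right_diff_distrib)
    have Kcl: "x + y \<in> K" "x - y \<in> K" if "x \<in> K" "y \<in> K" for x y
      using that cl by (simp_all add: K_def dot_add dot_diff)
    have avg01: "0 \<le> coset_average K (ind W) x \<and> coset_average K (ind W) x \<le> 1" for W x
    proof
      show "0 \<le> coset_average K (ind W) x" unfolding coset_average_def by (intro divide_nonneg_nonneg sum_nonneg) (auto simp: ind_def)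
      have "(\<Sum>k\<in>K. ind W (x + k)) \<le> (\<Sum>k\<in>K. 1)" by (intro sum_mono) (simp add: ind_def)
      thus "coset_average K (ind W) x \<le> 1" using finK K0 unfolding coset_average_def
        by (auto simp: divide_le_eq_1 card_gt_0_iff)
    qed
    have avg_pos: "coset_average K (ind W) x > 0" if "x \<in> W" for W x
    proof -
      have "(\<Sum>k\<in>K. ind W (x + k)) \<ge> ind W (x + 0)"
        by (rule member_le_sum[OF K0 _ finK]) (simp add: ind_def)
      hence "(\<Sum>k\<in>K. ind W (x + k)) > 0" using that by (simp add: ind_def)
      moreover have "card K > 0" unfolding card_gt_0_iff using finK K0 by blast
      ultimately show ?thesis by (simp add: coset_average_def)
    qed
    have avg_inv: "coset_average K q (x + k) = coset_average K q x" if "k \<in> K" for q :: "_ \<Rightarrow> real" and x k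
      unfolding coset_average_def
      by (rule arg_cong[where f = "\<lambda>s. s / _"], rule sum.reindex_bij_witness[of _ "\<lambda>l. l - k" "\<lambda>l. k + l"])
         (use Kcl that in \<open>simp_all add: add.assoc\<close>)
    obtain A B C where ABC: "A \<subseteq> V" "B \<subseteq> V" "C \<subseteq> V"
      and mass: "(\<Sum>x\<in>V - A. coset_average K (ind X) x) \<le> \<epsilon> * real (card V)"
        "(\<Sum>x\<in>V - B. coset_average K (ind Y) x) \<le> \<epsilon> * real (card V)"
        "(\<Sum>x\<in>V - C. coset_average K (ind Z) x) \<le> \<epsilon> * real (card V)"
      and none: "\<forall>x\<in>A. \<forall>y\<in>B. - x - y \<in> C \<longrightarrow> coset_average K (ind X) x * coset_average K (ind Y) y * coset_average K (ind Z) (- x - y) = 0"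
      and inv: "\<forall>k\<in>V. (\<forall>x\<in>V. coset_average K (ind X) (x + k) = coset_average K (ind X) x \<and> coset_average K (ind Y) (x + k) = coset_average K (ind Y) x
            \<and> coset_average K (ind Z) (x + k) = coset_average K (ind Z) x) \<longrightarrow>
            (\<forall>x\<in>V. (x + k \<in> A \<longleftrightarrow> x \<in> A) \<and> (x + k \<in> B \<longleftrightarrow> x \<in> B) \<and> (x + k \<in> C \<longleftrightarrow> x \<in> C))"
    proof -
      have "\<forall>x\<in>supp_on {..<n}. 0 \<le> coset_average K (ind X) x \<and> coset_average K (ind X) x \<le> 1 \<and> 0 \<le> coset_average K (ind Y) x
          \<and> coset_average K (ind Y) x \<le> 1 \<and> 0 \<le> coset_average K (ind Z) x \<and> coset_average K (ind Z) x \<le> 1"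
        using avg01 by blast
      from rem[OF \<epsilon> this few[unfolded V_def \<delta>_def r_def]] show thesis
        using that unfolding V_def by blast
    qed
    have invK: "x + k \<in> A \<longleftrightarrow> x \<in> A" "x + k \<in> B \<longleftrightarrow> x \<in> B" "x + k \<in> C \<longleftrightarrow> x \<in> C" if "k \<in> K" "x \<in> V" for x k
      using inv that KV avg_inv[OF that(1)] by blast+
    have mass': "real (card (W - Q)) \<le> \<epsilon> * real CARD('p) ^ n"
      if Q: "\<And>x k. k \<in> K \<Longrightarrow> x \<in> V \<Longrightarrow> x + k \<in> Q \<longleftrightarrow> x \<in> Q" and m: "(\<Sum>x\<in>V - Q. coset_average K (ind W) x) \<le> \<epsilon> * real (card V)"
        and W: "W \<subseteq> V" for W Q
    proof -
      have "real (card (W - Q)) = (\<Sum>x\<in>W - Q. ind W x)" by (simp add: ind_def)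
      also have "\<dots> \<le> (\<Sum>x\<in>V - Q. ind W x)" using finV W by (intro sum_mono2) (auto simp: ind_def)
      also have "\<dots> = (\<Sum>x\<in>V - Q. coset_average K (ind W) x)"
      proof (rule sum_coset_average[symmetric, OF finK])
        show "K \<noteq> {}" using K0 by blast
        fix k x assume k: "k \<in> K"
        have kV: "k \<in> V" using k KV by blast
        have "x + k \<in> V \<longleftrightarrow> x \<in> V"
        proof
          assume "x + k \<in> V"
          hence "(x + k) - k \<in> V" using kV by (rule cl(2))
          thus "x \<in> V" by simp
        qed (rule cl(1)[OF _ kV])
        moreover have "x \<in> V \<Longrightarrow> x + k \<in> Q \<longleftrightarrow> x \<in> Q" by (rule Q[OF k])
        ultimately show "x + k \<in> V - Q \<longleftrightarrow> x \<in> V - Q" by (simp only: Diff_iff) blast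
      qed
      also have "\<dots> \<le> \<epsilon> * real (card V)" by (rule m)
      finally show ?thesis unfolding cardV .
    qed
    have "real (card S) \<le> real m" using cardS m[folded \<delta>_def] by (rule order_trans)
    hence "card S \<le> m" by (simp only: of_nat_le_iff)
    obtain b where b: "bij_betw b {0..<card S} S" using ex_bij_betw_nat_finite[OF finS] by blast
    define a where "a i = (if i < card S then b i else 0)" for i
    define \<phi> where "\<phi> = dot_map n m a"
    have ker: "k \<in> K" if "k \<in> V" "\<phi> k = 0" for k
    proof -
      have "dot n q k = 0" if "q \<in> S" for q
      proof -
        have "q \<in> b ` {0..<card S}" unfolding bij_betw_imp_surj_on[OF b] by (rule that)
        then obtain i where "i \<in> {0..<card S}" "q = b i" by (rule imageE)
        hence i: "i < card S" "b i = q" by simp_all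
        have "\<phi> k i = 0" using \<open>\<phi> k = 0\<close> by simp
        thus ?thesis using i \<open>card S \<le> m\<close> by (simp add: \<phi>_def dot_map_def a_def)
      qed
      thus ?thesis using that(1) by (simp add: K_def)
    qed
    have fr: "x + y + z \<noteq> 0" if xyz: "x \<in> \<phi> ` (X \<inter> A)" "y \<in> \<phi> ` (Y \<inter> B)" "z \<in> \<phi> ` (Z \<inter> C)" for x y z
    proof
      assume 0: "x + y + z = 0"
      obtain x' y' z' where e: "x = \<phi> x'" "y = \<phi> y'" "z = \<phi> z'" and mem: "x' \<in> X" "x' \<in> A" "y' \<in> Y" "y' \<in> B" "z' \<in> Z" "z' \<in> C"
        using xyz by blast
      have inV: "x' \<in> V" "y' \<in> V" "z' \<in> V" using mem ABC by blast+
      have "\<phi> (x' + y' + z') = 0" using 0 by (simp only: e \<phi>_def dot_map_add)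
      moreover have "x' + y' + z' \<in> V" using inV by (intro cl)
      ultimately have k: "x' + y' + z' \<in> K" by (rule ker[rotated])
      have neg: "0 - (x' + y' + z') \<in> K" using K0 k by (rule Kcl(2))
      have eq: "z' + (0 - (x' + y' + z')) = - x' - y'" by simp
      have "- x' - y' \<in> C" using invK(3)[OF neg inV(3)] mem(6) unfolding eq by blast
      hence "coset_average K (ind X) x' * coset_average K (ind Y) y' * coset_average K (ind Z) (- x' - y') = 0"
        using none mem by blast
      moreover have "coset_average K (ind Z) (- x' - y') = coset_average K (ind Z) z'"
        using avg_inv[OF neg, of "ind Z" z'] unfolding eq .
      ultimately show False using avg_pos[OF mem(1)] avg_pos[OF mem(3)] avg_pos[OF mem(5)] by simp
    qed
    have lift: "real (card {x\<in>W. \<phi> x \<notin> \<phi> ` (W \<inter> Q)}) \<le> \<epsilon> * real CARD('p) ^ n"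
      if "real (card (W - Q)) \<le> \<epsilon> * real CARD('p) ^ n" "W \<subseteq> V" for W Q
    proof -
      have "card {x\<in>W. \<phi> x \<notin> \<phi> ` (W \<inter> Q)} \<le> card (W - Q)"
        using finite_subset[OF that(2) finV] by (intro card_mono) auto
      thus ?thesis using that(1) by linarith
    qed
    have XV: "X \<subseteq> V" "Y \<subseteq> V" "Z \<subseteq> V" using XYZ by (simp_all only: V_def)
    note masses = lift[OF mass'[OF invK(1) mass(1) XV(1)] XV(1)] lift[OF mass'[OF invK(2) mass(2) XV(2)] XV(2)] lift[OF mass'[OF invK(3) mass(3) XV(3)] XV(3)]
    have fr': "\<forall>x\<in>\<phi> ` (X \<inter> A). \<forall>y\<in>\<phi> ` (Y \<inter> B). \<forall>z\<in>\<phi> ` (Z \<inter> C). x + y + z \<noteq> 0" using fr by blast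
    have sub: "\<phi> ` W \<subseteq> supp_on {..<m}" for W unfolding \<phi>_def using dot_map_in by blast
    note final = conjI[OF sub[of "X \<inter> A"] conjI[OF sub[of "Y \<inter> B"] conjI[OF sub[of "Z \<inter> C"] conjI[OF fr' conjI[OF masses(1) conjI[OF masses(2) masses(3)]]]]]]
    show "\<exists>a X' Y' Z'. X' \<subseteq> supp_on {..<m} \<and> Y' \<subseteq> supp_on {..<m} \<and> Z' \<subseteq> supp_on {..<m} \<and>
         (\<forall>x\<in>X'. \<forall>y\<in>Y'. \<forall>z\<in>Z'. x + y + z \<noteq> 0) \<and>
         real (card {x\<in>X. dot_map n m a x \<notin> X'}) \<le> \<epsilon> * real CARD('p) ^ n \<and>
         real (card {x\<in>Y. dot_map n m a x \<notin> Y'}) \<le> \<epsilon> * real CARD('p) ^ n \<and>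
         real (card {x\<in>Z. dot_map n m a x \<notin> Z'}) \<le> \<epsilon> * real CARD('p) ^ n"
      by (rule exI, rule exI, rule exI, rule exI, rule final[unfolded \<phi>_def])
  qed
qed

section \<open>Coordinate vectors\<close>

definition fun_of_vec :: "nat \<Rightarrow> 'a::zero Matrix.vec \<Rightarrow> nat \<Rightarrow> 'a" where
  "fun_of_vec n v = (\<lambda>i. if i < n then vec_index v i else 0)"

lemma fun_of_vec_in: "fun_of_vec n v \<in> supp_on {..<n}"
  by (rule supp_onI) (simp add: fun_of_vec_def)

lemma fun_of_vec_add:
  fixes v w :: "'a::ab_group_add Matrix.vec"
  assumes "v \<in> carrier_vec n" "w \<in> carrier_vec n"
  shows "fun_of_vec n (v + w) = fun_of_vec n v + fun_of_vec n w"
proof (rule ext)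
  fix i
  show "fun_of_vec n (v + w) i = (fun_of_vec n v + fun_of_vec n w) i"
  proof (cases "i < n")
    case True
    hence "vec_index (v + w) i = vec_index v i + vec_index w i"
      by (intro index_add_vec(1)) (simp only: carrier_vecD[OF assms(2)])
    thus ?thesis using True by (simp only: fun_of_vec_def plus_fun_apply if_True)
  next
    case False
    thus ?thesis by (simp only: fun_of_vec_def plus_fun_apply if_False add_0)
  qed
qed

lemma vec_fun_of_vec:
  assumes "v \<in> carrier_vec n" shows "Matrix.vec n (fun_of_vec n v) = v"
proof (rule eq_vecI)
  show "dim_vec (Matrix.vec n (fun_of_vec n v)) = dim_vec v" by (simp only: dim_vec carrier_vecD[OF assms])
  fix i assume "i < dim_vec v"
  hence "i < n" by (simp only: carrier_vecD[OF assms])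
  thus "vec_index (Matrix.vec n (fun_of_vec n v)) i = vec_index v i" by (simp only: index_vec fun_of_vec_def if_True)
qed

lemma fun_of_vec_inj:
  assumes "v \<in> carrier_vec n" "w \<in> carrier_vec n" "fun_of_vec n v = fun_of_vec n w" shows "v = w"
proof -
  have "v = Matrix.vec n (fun_of_vec n v)" by (rule vec_fun_of_vec[OF assms(1), symmetric])
  also have "\<dots> = Matrix.vec n (fun_of_vec n w)" by (simp only: assms(3))
  also have "\<dots> = w" by (rule vec_fun_of_vec[OF assms(2)])
  finally show ?thesis .
qed

lemma vec_add:
  fixes x y :: "nat \<Rightarrow> 'a::ab_group_add"
  shows "Matrix.vec n (x + y) = Matrix.vec n x + Matrix.vec n y"
proof (rule eq_vecI)
  show "dim_vec (Matrix.vec n (x + y)) = dim_vec (Matrix.vec n x + Matrix.vec n y)"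
    by (simp only: dim_vec index_add_vec(2))
  fix i assume "i < dim_vec (Matrix.vec n x + Matrix.vec n y)"
  hence i: "i < n" by (simp only: dim_vec index_add_vec(2))
  hence "vec_index (Matrix.vec n x + Matrix.vec n y) i = vec_index (Matrix.vec n x) i + vec_index (Matrix.vec n y) i"
    by (intro index_add_vec(1)) (simp only: dim_vec)
  thus "vec_index (Matrix.vec n (x + y)) i = vec_index (Matrix.vec n x + Matrix.vec n y) i"
    using i by (simp only: index_vec plus_fun_apply)
qed

lemma vec_eq_zero_iff: "x \<in> supp_on {..<n} \<Longrightarrow> Matrix.vec n x = 0\<^sub>v n \<longleftrightarrow> x = (0 :: nat \<Rightarrow> 'a::ab_group_add)"
proof
  assume x: "x \<in> supp_on {..<n}" and 0: "Matrix.vec n x = 0\<^sub>v n"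
  show "x = 0"
  proof
    fix i show "x i = 0 i"
    proof (cases "i < n")
      case True
      hence "x i = vec_index (Matrix.vec n x) i" by simp
      also have "\<dots> = 0" using True unfolding 0 by simp
      finally show ?thesis by simp
    next
      case False thus ?thesis using supp_onD[OF x, of i] by simp
    qed
  qed
next
  assume "x = 0" thus "Matrix.vec n x = 0\<^sub>v n" by (intro eq_vecI) simp_all
qed

theorem removal_dim_ok_upper:
  fixes P :: "'p::prime_card itself"
  obtains \<kappa> :: real where "\<kappa> > 0" and
    "\<And>m \<epsilon>. 0 < \<epsilon> \<Longrightarrow> \<epsilon> \<le> 1 \<Longrightarrow> 1 / (\<kappa> * \<epsilon> powr (1 + 1 / removal_const CARD('p))) ^ 2 \<le> real m \<Longrightarrow> removal_dim_ok P \<epsilon> m"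
proof -
  obtain \<kappa> where \<kappa>: "\<kappa> > 0" and bound:
    "\<And>n m (X :: (nat \<Rightarrow> 'p mod_ring) set) Y Z \<epsilon>. 0 < \<epsilon> \<Longrightarrow> \<epsilon> \<le> 1 \<Longrightarrow> 1 / (\<kappa> * \<epsilon> powr (1 + 1 / removal_const CARD('p))) ^ 2 \<le> real m \<Longrightarrow>
       X \<subseteq> supp_on {..<n} \<Longrightarrow> Y \<subseteq> supp_on {..<n} \<Longrightarrow> Z \<subseteq> supp_on {..<n} \<Longrightarrow>
       \<forall>x\<in>X. \<forall>y\<in>Y. \<forall>z\<in>Z. x + y + z \<noteq> 0 \<Longrightarrow>
       \<exists>a X' Y' Z'. X' \<subseteq> supp_on {..<m} \<and> Y' \<subseteq> supp_on {..<m} \<and> Z' \<subseteq> supp_on {..<m} \<and>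
         (\<forall>x\<in>X'. \<forall>y\<in>Y'. \<forall>z\<in>Z'. x + y + z \<noteq> 0) \<and>
         real (card {x\<in>X. dot_map n m a x \<notin> X'}) \<le> \<epsilon> * real CARD('p) ^ n \<and>
         real (card {x\<in>Y. dot_map n m a x \<notin> Y'}) \<le> \<epsilon> * real CARD('p) ^ n \<and>
         real (card {x\<in>Z. dot_map n m a x \<notin> Z'}) \<le> \<epsilon> * real CARD('p) ^ n"
    by (rule dimension_upper_bound[where 'p = 'p]) (rule that)
  show ?thesis
  proof (rule that[OF \<kappa>])
    fix m \<epsilon> assume \<epsilon>: "0 < \<epsilon>" "\<epsilon> \<le> 1" and m: "1 / (\<kappa> * \<epsilon> powr (1 + 1 / removal_const CARD('p))) ^ 2 \<le> real m"
    show "removal_dim_ok P \<epsilon> m"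
      unfolding removal_dim_ok_def
    proof (intro allI impI)
      fix n and X Y Z :: "'p mod_ring Matrix.vec set"
      assume XYZ: "X \<subseteq> carrier_vec n" "Y \<subseteq> carrier_vec n" "Z \<subseteq> carrier_vec n" and free: "triangle_free n X Y Z"
      define F where "F = (fun_of_vec n :: 'p mod_ring Matrix.vec \<Rightarrow> _)"
      have in': "F ` W \<subseteq> supp_on {..<n}" for W unfolding F_def using fun_of_vec_in by blast
      have "\<forall>x\<in>F ` X. \<forall>y\<in>F ` Y. \<forall>z\<in>F ` Z. x + y + z \<noteq> 0"
      proof (intro ballI)
        fix x y z assume "x \<in> F ` X" "y \<in> F ` Y" "z \<in> F ` Z"
        then obtain x' y' z' where e: "x = F x'" "y = F y'" "z = F z'" and mem: "x' \<in> X" "y' \<in> Y" "z' \<in> Z" by blast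
        have c: "x' \<in> carrier_vec n" "y' \<in> carrier_vec n" "z' \<in> carrier_vec n" using mem XYZ by blast+
        have "x' + y' + z' \<noteq> 0\<^sub>v n" using free mem unfolding triangle_free_def by blast
        moreover have "Matrix.vec n (x + y + z) = x' + y' + z'"
          unfolding e F_def using c by (simp add: vec_add vec_fun_of_vec)
        ultimately show "x + y + z \<noteq> 0"
          using vec_eq_zero_iff[OF supp_on_closed(1), of n] by (metis (no_types))
      qed
      from bound[OF \<epsilon> m in' in' in' this]
      obtain a X' Y' Z' where sub: "X' \<subseteq> supp_on {..<m}" "Y' \<subseteq> supp_on {..<m}" "Z' \<subseteq> supp_on {..<m}"
        and free': "\<forall>x\<in>X'. \<forall>y\<in>Y'. \<forall>z\<in>Z'. x + y + z \<noteq> 0"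
        and small: "real (card {x\<in>F ` X. dot_map n m a x \<notin> X'}) \<le> \<epsilon> * real CARD('p) ^ n"
         "real (card {x\<in>F ` Y. dot_map n m a x \<notin> Y'}) \<le> \<epsilon> * real CARD('p) ^ n"
         "real (card {x\<in>F ` Z. dot_map n m a x \<notin> Z'}) \<le> \<epsilon> * real CARD('p) ^ n" by blast
      define \<phi> where "\<phi> v = Matrix.vec m (dot_map n m a (F v))" for v
      have lin: "linear_vec_map n m \<phi>"
        unfolding linear_vec_map_iff
      proof (intro conjI ballI allI)
        fix v w :: "'p mod_ring Matrix.vec" and s assume v: "v \<in> carrier_vec n"
        show "\<phi> v \<in> carrier_vec m" by (simp add: \<phi>_def)
        show "\<phi> (v + w) = \<phi> v + \<phi> w" if "w \<in> carrier_vec n"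
          unfolding \<phi>_def F_def fun_of_vec_add[OF v that] dot_map_add vec_add ..
        show "\<phi> (s \<cdot>\<^sub>v v) = s \<cdot>\<^sub>v \<phi> v"
        proof (rule eq_vecI)
          fix i assume "i < dim_vec (s \<cdot>\<^sub>v \<phi> v)"
          hence i: "i < m" by (simp add: \<phi>_def)
          have "dot n (a i) (F (s \<cdot>\<^sub>v v)) = s * dot n (a i) (F v)"
            unfolding dot_def sum_distrib_left F_def fun_of_vec_def
            by (rule sum.cong[OF refl]) (use v in simp)
          thus "vec_index (\<phi> (s \<cdot>\<^sub>v v)) i = vec_index (s \<cdot>\<^sub>v \<phi> v) i" using i by (simp add: \<phi>_def dot_map_def)
        qed (simp add: \<phi>_def)
      qed
      have almost: "almost_maps_into \<epsilon> n \<phi> W (Matrix.vec m ` W')"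
        if "W \<subseteq> carrier_vec n" "real (card {x\<in>F ` W. dot_map n m a x \<notin> W'}) \<le> \<epsilon> * real CARD('p) ^ n" for W W'
      proof -
        have fin: "finite {x\<in>F ` W. dot_map n m a x \<notin> W'}" by (rule finite_subset[of _ "supp_on {..<n}"]) (use in' in auto)
        have "card {x\<in>W. \<phi> x \<notin> Matrix.vec m ` W'} \<le> card {x\<in>F ` W. dot_map n m a x \<notin> W'}"
          by (rule card_inj_on_le[of F, OF _ _ fin])
             (use that(1) in \<open>auto simp: inj_on_def F_def \<phi>_def intro!: fun_of_vec_inj\<close>)
        thus ?thesis using that(2) unfolding almost_maps_into_def by linarith
      qed
      have "triangle_free m (Matrix.vec m ` X') (Matrix.vec m ` Y') (Matrix.vec m ` Z')"
        unfolding triangle_free_def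
      proof
        assume "\<exists>x\<in>Matrix.vec m ` X'. \<exists>y\<in>Matrix.vec m ` Y'. \<exists>z\<in>Matrix.vec m ` Z'. x + y + z = 0\<^sub>v m"
        then obtain x y z where xyz: "x \<in> X'" "y \<in> Y'" "z \<in> Z'" "Matrix.vec m x + Matrix.vec m y + Matrix.vec m z = 0\<^sub>v m" by blast
        hence "Matrix.vec m (x + y + z) = 0\<^sub>v m" by (simp only: vec_add)
        moreover have "x + y + z \<in> supp_on {..<m}" using xyz sub by (intro supp_on_closed) auto
        ultimately have "x + y + z = 0" by (simp only: vec_eq_zero_iff)
        thus False using free' xyz by blast
      qed
      thus "\<exists>X' Y' Z' \<phi>. X' \<subseteq> carrier_vec m \<and> Y' \<subseteq> carrier_vec m \<and> Z' \<subseteq> carrier_vec m \<and>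
           triangle_free m X' Y' Z' \<and> linear_vec_map n m \<phi> \<and>
           almost_maps_into \<epsilon> n \<phi> X X' \<and> almost_maps_into \<epsilon> n \<phi> Y Y' \<and> almost_maps_into \<epsilon> n \<phi> Z Z'"
        using lin almost[OF XYZ(1) small(1)] almost[OF XYZ(2) small(2)] almost[OF XYZ(3) small(3)]
        by (intro exI[of _ "Matrix.vec m ` X'"] exI[of _ "Matrix.vec m ` Y'"] exI[of _ "Matrix.vec m ` Z'"] exI[of _ \<phi>]) auto
    qed
  qed
qed

section \<open>Tricolored sets force large dimension\<close>

text \<open>The pair of \<open>x \<in> F_p^k\<close> and \<open>v\<close> as one vector: \<open>v\<close> is appended at position \<open>k\<close>.\<close>

definition juxtapose :: "nat \<Rightarrow> (nat \<Rightarrow> 'a) \<Rightarrow> (nat \<Rightarrow> 'a) \<Rightarrow> nat \<Rightarrow> 'a" where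
  "juxtapose k x v = (\<lambda>j. if j < k then x j else v (j - k))"

lemma juxtapose_add: "juxtapose k (x + y) (v + w) = juxtapose k x v + juxtapose k y (w :: nat \<Rightarrow> 'a::ab_group_add)"
proof (rule ext)
  fix j show "juxtapose k (x + y) (v + w) j = (juxtapose k x v + juxtapose k y w) j"
    by (cases "j < k") (simp_all only: juxtapose_def plus_fun_apply if_True if_False)
qed

lemma juxtapose_in:
  assumes "v \<in> supp_on {..<l}" shows "juxtapose k x v \<in> supp_on {..<k + l}"
proof (rule supp_onI)
  fix j assume "j \<notin> {..<k + l}"
  hence "\<not> j < k" "j - k \<notin> {..<l}" by auto
  thus "juxtapose k x v j = 0" using supp_onD[OF assms] by (simp only: juxtapose_def if_False)
qed

lemma juxtapose_eq_zero:
  fixes x v :: "nat \<Rightarrow> 'a::ab_group_add"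
  assumes "x \<in> supp_on {..<k}" "juxtapose k x v = 0" shows "x = 0" "v = 0"
proof -
  have z: "juxtapose k x v j = 0" for j by (simp only: assms(2) zero_fun_apply)
  show "x = 0"
  proof (rule ext)
    fix j show "x j = 0 j"
    proof (cases "j < k")
      case True thus ?thesis using z[of j] by (simp only: juxtapose_def if_True zero_fun_apply)
    next
      case False thus ?thesis using supp_onD[OF assms(1), of j] by (simp only: lessThan_iff zero_fun_apply simp_thms)
    qed
  qed
  show "v = 0"
  proof (rule ext)
    fix j show "v j = 0 j" using z[of "k + j"] by (simp add: juxtapose_def)
  qed
qed

lemma sum_card_le_card_disjoint_images:
  assumes "finite I" "\<And>i. i \<in> I \<Longrightarrow> finite (R i)" "finite W"
    and "\<And>i v. i \<in> I \<Longrightarrow> v \<in> R i \<Longrightarrow> g i v \<in> W"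
    and "\<And>i v i' v'. i \<in> I \<Longrightarrow> v \<in> R i \<Longrightarrow> i' \<in> I \<Longrightarrow> v' \<in> R i' \<Longrightarrow> g i v = g i' v' \<Longrightarrow> i = i' \<and> v = v'"
  shows "(\<Sum>i\<in>I. card (R i)) \<le> card W"
proof -
  have "(\<Sum>i\<in>I. card (R i)) = card (SIGMA i:I. R i)" using assms(1,2) by simp
  also have "\<dots> \<le> card W"
    by (rule card_inj_on_le[of "\<lambda>(i, v). g i v"]) (use assms(3-5) in \<open>auto simp: inj_on_def\<close>)
  finally show ?thesis .
qed

text \<open>Count the pairs \<open>(a, b)\<close>: each condition alone holds for at most \<open>card A * card R\<close> of them.\<close>

lemma covering_pairs:
  fixes A :: "'v::ab_group_add set"
  assumes fin: "finite A" and add: "\<And>a b. a \<in> A \<Longrightarrow> b \<in> A \<Longrightarrow> a + b \<in> A"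
    and sub: "R1 \<subseteq> A" "R2 \<subseteq> A" "R3 \<subseteq> A"
    and cover: "\<And>a b. a \<in> A \<Longrightarrow> b \<in> A \<Longrightarrow> a \<in> R1 \<or> b \<in> R2 \<or> a + b \<in> R3"
  shows "card A \<le> card R1 + card R2 + card R3"
proof (cases "A = {}")
  case False
  have fR: "finite R1" "finite R2" "finite R3" using sub fin finite_subset by blast+
  define T where "T = {(a, b). a \<in> A \<and> b \<in> A \<and> a + b \<in> R3}"
  have finT: "finite T" by (rule finite_subset[of _ "A \<times> A"]) (auto simp: T_def fin)
  have "card T \<le> card (A \<times> R3)"
    by (rule card_inj_on_le[of "\<lambda>(a, b). (a, a + b)"]) (auto simp: T_def inj_on_def fin fR)
  hence T: "card T \<le> card A * card R3" by (simp add: card_cartesian_product)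
  have "A \<times> A \<subseteq> R1 \<times> A \<union> A \<times> R2 \<union> T" using cover by (auto simp: T_def)
  hence "card (A \<times> A) \<le> card (R1 \<times> A \<union> A \<times> R2 \<union> T)"
    using fin fR finT by (intro card_mono) auto
  also have "\<dots> \<le> card (R1 \<times> A) + card (A \<times> R2) + card T"
    using card_Un_le[of "R1 \<times> A \<union> A \<times> R2" T] card_Un_le[of "R1 \<times> A" "A \<times> R2"] by linarith
  finally have "card A * card A \<le> card R1 * card A + card A * card R2 + card A * card R3"
    using T unfolding card_cartesian_product by linarith
  also have "\<dots> = card A * (card R1 + card R2 + card R3)" by (simp only: distrib_left mult.commute[of "card R1"])
  finally have "card A * card A \<le> card A * (card R1 + card R2 + card R3)" .
  thus ?thesis using False fin by (simp add: card_gt_0_iff)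
qed simp

text \<open>Enumerate \<open>S\<close> as \<open>(x i, y i, z i)\<close>, \<open>i < N\<close>, and consider in \<open>F_p^k \<times> F_p^N\<close> the sets of all \<open>(x i, v)\<close> with \<open>v i = 0\<close>,
  of all \<open>(y i, v)\<close> with \<open>v i = 0\<close> and of all \<open>(z i, v)\<close> with \<open>v i \<noteq> 0\<close>. A triangle would have the same \<open>i\<close> in all three
  places and hence \<open>v i = 0\<close> in the third. Let \<open>\<phi>\<close> be the given map and let \<open>I\<close> be the set of those \<open>i\<close> for which the
  kernel of \<open>\<phi>\<close> on \<open>{0} \<times> F_p^N\<close> has an element \<open>v0\<close> with \<open>v0 i \<noteq> 0\<close>; the other coordinates number at most \<open>m\<close>, since \<open>\<phi>\<close> is
  injective on the vectors supported there. For \<open>i \<in> I\<close> and \<open>a\<close>, \<open>b\<close> with \<open>a i = b i = 0\<close>, the triple \<open>(x i, a)\<close>,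
  \<open>(y i, b)\<close>, \<open>(z i, v0 - a - b)\<close> has image sum zero, so one of the three must be lost. By \<open>covering_pairs\<close> this loses \<open>p^(N-1)\<close> elements for
  each \<open>i \<in> I\<close>, out of an allowance of \<open>3 \<epsilon> p^(k+N)\<close>.\<close>

theorem removal_dim_lower:
  fixes S :: "((nat \<Rightarrow> 'p::prime_card mod_ring) \<times> (nat \<Rightarrow> 'p mod_ring) \<times> (nat \<Rightarrow> 'p mod_ring)) set"
  assumes S: "tricolored k S" and ok: "removal_dim_ok TYPE('p) \<epsilon> m"
  shows "real (card S) - real m \<le> 3 * \<epsilon> * real CARD('p) ^ (k + 1)"
proof (cases "card S = 0")
  case True
  have "triangle_free 0 {} {} ({} :: 'p mod_ring Matrix.vec set)" by (simp add: triangle_free_def)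
  from ok[unfolded removal_dim_ok_def, rule_format, OF empty_subsetI empty_subsetI empty_subsetI this]
  obtain X' \<phi> where "almost_maps_into \<epsilon> 0 \<phi> ({} :: 'p mod_ring Matrix.vec set) X'" by blast
  hence "0 \<le> \<epsilon>" by (simp add: almost_maps_into_def)
  hence "0 \<le> 3 * \<epsilon> * real CARD('p) ^ (k + 1)" by simp
  thus ?thesis using True by linarith
next
  case False
  define N where "N = card S"
  have finS: "finite S" using finite_tricolored[OF S] .
  have N: "N > 0" using False by (simp add: N_def)
  define n where "n = k + N"
  obtain b where b: "bij_betw b {0..<N} S" using ex_bij_betw_nat_finite[OF finS] unfolding N_def by blast
  define x y z where "x i = fst (b i)" and "y i = fst (snd (b i))" and "z i = snd (snd (b i))" for i
  have bS: "b i \<in> S" if "i < N" for i using bij_betwE[OF b] that by simp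
  have mem: "x i \<in> supp_on {..<k}" "y i \<in> supp_on {..<k}" "z i \<in> supp_on {..<k}" "x i + y i + z i = 0" if "i < N" for i
    using conjunct1[OF S[unfolded tricolored_def], THEN bspec, OF bS[OF that]]
    unfolding x_def y_def z_def case_prod_unfold by blast+
  have diag: "i = j \<and> j = l" if "i < N" "j < N" "l < N" "x i + y j + z l = 0" for i j l
  proof -
    have "b i = b j \<and> b j = b l"
      using conjunct2[OF S[unfolded tricolored_def], THEN bspec, OF bS[OF that(1)], THEN bspec, OF bS[OF that(2)], THEN bspec, OF bS[OF that(3)]] that(4)
      unfolding x_def y_def z_def by blast
    thus ?thesis using bij_betw_imp_inj_on[OF b] that(1-3) unfolding inj_on_def by simp
  qed
  define V where "V = (supp_on {..<N} :: (nat \<Rightarrow> 'p mod_ring) set)"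
  have cl: "v + w \<in> V" "v - w \<in> V" "- v \<in> V" if "v \<in> V" "w \<in> V" for v w
    using that unfolding V_def by (simp_all only: supp_on_closed)
  define E where "E a v = Matrix.vec n (juxtapose k a v)" for a v :: "nat \<Rightarrow> 'p mod_ring"
  have E_in: "E a v \<in> carrier_vec n" for a v unfolding E_def by (rule vec_carrier)
  have E_add: "E (a + a') (v + v') = E a v + E a' v'" for a a' v v' unfolding E_def juxtapose_add vec_add ..
  have E_zero: "a = 0 \<and> v = 0" if "E a v = 0\<^sub>v n" "a \<in> supp_on {..<k}" "v \<in> V" for a v
  proof -
    have "juxtapose k a v \<in> supp_on {..<n}" unfolding n_def by (rule juxtapose_in) (use that(3) in \<open>simp only: V_def\<close>)
    hence "juxtapose k a v = 0" using that(1) unfolding E_def by (simp only: vec_eq_zero_iff)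
    thus ?thesis using juxtapose_eq_zero[OF that(2)] by blast
  qed
  have E_inj: "a = a' \<and> v = v'" if "E a v = E a' v'" "a \<in> supp_on {..<k}" "a' \<in> supp_on {..<k}" "v \<in> V" "v' \<in> V" for a v a' v'
  proof -
    have "E a' v' + E (a - a') (v - v') = E (a' + (a - a')) (v' + (v - v'))" by (rule E_add[symmetric])
    also have "\<dots> = E a v" by simp
    finally have "E a' v' + E (a - a') (v - v') = E a' v'" using that(1) by simp
    hence "E (a - a') (v - v') = 0\<^sub>v n" using E_in
      by (metis add.left_cancel fun_of_vec_add fun_of_vec_inj right_zero_vec zero_carrier_vec)
    hence "a - a' = 0 \<and> v - v' = 0" using that(2-5) cl by (intro E_zero supp_on_closed(3))
    thus ?thesis by simp
  qed
  define X where "X = {E (x i) v | i v. i < N \<and> v \<in> V \<and> v i = 0}"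
  define Y where "Y = {E (y i) v | i v. i < N \<and> v \<in> V \<and> v i = 0}"
  define Z where "Z = {E (z i) v | i v. i < N \<and> v \<in> V \<and> v i \<noteq> 0}"
  have sub: "X \<subseteq> carrier_vec n" "Y \<subseteq> carrier_vec n" "Z \<subseteq> carrier_vec n" unfolding X_def Y_def Z_def using E_in by blast+
  have free: "triangle_free n X Y Z"
    unfolding triangle_free_def
  proof
    assume "\<exists>p\<in>X. \<exists>q\<in>Y. \<exists>r\<in>Z. p + q + r = 0\<^sub>v n"
    then obtain i j l u v w where ijl: "i < N" "j < N" "l < N" "u \<in> V" "v \<in> V" "w \<in> V" "u i = 0" "v j = 0" "w l \<noteq> 0"
      and 0: "E (x i) u + E (y j) v + E (z l) w = 0\<^sub>v n" unfolding X_def Y_def Z_def by blast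
    have "E (x i + y j + z l) (u + v + w) = 0\<^sub>v n" unfolding E_add by (rule 0)
    moreover have "x i + y j + z l \<in> supp_on {..<k}" by (intro supp_on_closed(2) mem ijl)
    moreover have "u + v + w \<in> V" by (intro cl(1) ijl)
    ultimately have "x i + y j + z l = 0 \<and> u + v + w = 0" by (rule E_zero)
    moreover from this have "i = j \<and> j = l" using diag ijl by blast
    ultimately have "u l + v l + w l = 0" "u l = 0" "v l = 0" using ijl by (metis plus_fun_apply zero_fun_apply)+
    thus False using ijl by simp
  qed
  from ok[unfolded removal_dim_ok_def, rule_format, OF sub free]
  obtain X' Y' Z' \<phi> where X': "X' \<subseteq> carrier_vec m" "Y' \<subseteq> carrier_vec m" "Z' \<subseteq> carrier_vec m"
    and free': "triangle_free m X' Y' Z'" and lin: "linear_vec_map n m \<phi>"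
    and almost: "almost_maps_into \<epsilon> n \<phi> X X'" "almost_maps_into \<epsilon> n \<phi> Y Y'" "almost_maps_into \<epsilon> n \<phi> Z Z'" by blast
  have \<phi>in: "\<phi> v \<in> carrier_vec m" if "v \<in> carrier_vec n" for v using lin that unfolding linear_vec_map_iff by blast
  have \<phi>add: "\<phi> (v + w) = \<phi> v + \<phi> w" if "v \<in> carrier_vec n" "w \<in> carrier_vec n" for v w
    using lin that unfolding linear_vec_map_iff by blast
  define \<Psi> where "\<Psi> v = fun_of_vec m (\<phi> (E 0 v))" for v
  have \<Psi>add: "\<Psi> (v + w) = \<Psi> v + \<Psi> w" for v w
  proof -
    have "E 0 (v + w) = E 0 v + E 0 w" using E_add[of 0 0 v w] by simp
    thus ?thesis unfolding \<Psi>_def by (simp only: \<phi>add[OF E_in E_in] fun_of_vec_add[OF \<phi>in[OF E_in] \<phi>in[OF E_in]])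
  qed
  have \<Psi>0: "\<phi> (E 0 v) = 0\<^sub>v m" if "\<Psi> v = 0" for v
    using vec_fun_of_vec[OF \<phi>in[OF E_in[of 0 v]]] that vec_eq_zero_iff[OF supp_on_closed(1), of m]
    unfolding \<Psi>_def by (metis (no_types))
  define J where "J = {i. i < N \<and> (\<forall>v\<in>V. \<Psi> v = 0 \<longrightarrow> v i = 0)}"
  have JN: "J \<subseteq> {..<N}" by (auto simp: J_def)
  have finJ: "finite J" using finite_subset[OF JN] by simp
  have "card (supp_on J :: (nat \<Rightarrow> 'p mod_ring) set) \<le> card (supp_on {..<m} :: (nat \<Rightarrow> 'p mod_ring) set)"
  proof (rule card_inj_on_le[of \<Psi>])
    show "\<Psi> ` supp_on J \<subseteq> supp_on {..<m}" unfolding \<Psi>_def using fun_of_vec_in by blast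
    show "inj_on \<Psi> (supp_on J)"
    proof (rule inj_onI)
      fix v w assume vw: "v \<in> supp_on J" "w \<in> supp_on J" "\<Psi> v = \<Psi> w"
      have d: "v - w \<in> supp_on J" using vw by (intro supp_on_closed(3))
      hence dV: "v - w \<in> V" using JN unfolding V_def supp_on_def by blast
      have "\<Psi> (v - w) + \<Psi> w = \<Psi> v" unfolding \<Psi>add[symmetric] by simp
      hence "\<Psi> (v - w) = 0" using vw(3) by simp
      hence "(v - w) i = 0" for i using d dV unfolding J_def supp_on_def by blast
      hence "v i = w i" for i by (metis eq_iff_diff_eq_0 minus_apply)
      thus "v = w" by (rule ext)
    qed
  qed simp
  hence "CARD('p) ^ card J \<le> CARD('p) ^ m" by (simp add: card_supp_on finJ)
  hence cardJ: "card J \<le> m" using prime_gt_1_nat[OF prime_card[where 'a = 'p]] by (simp only: power_increasing_iff)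
  define I where "I = {..<N} - J"
  have finI: "finite I" by (simp add: I_def)
  have "\<forall>i\<in>I. \<exists>v. v \<in> V \<and> \<Psi> v = 0 \<and> v i \<noteq> 0" by (auto simp: I_def J_def)
  then obtain v0 where v0: "\<And>i. i \<in> I \<Longrightarrow> v0 i \<in> V \<and> \<Psi> (v0 i) = 0 \<and> v0 i i \<noteq> 0" by metis
  have IN: "i < N" if "i \<in> I" for i using that by (simp add: I_def)
  define A where "A i = (supp_on ({..<N} - {i}) :: (nat \<Rightarrow> 'p mod_ring) set)" for i
  have finA: "finite (A i)" for i by (simp add: A_def)
  have AV: "a \<in> V \<and> a i = 0" if "a \<in> A i" for a i using that unfolding A_def V_def supp_on_def by blast
  define RX where "RX i = {a \<in> A i. \<phi> (E (x i) a) \<notin> X'}" for i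
  define RY where "RY i = {a \<in> A i. \<phi> (E (y i) a) \<notin> Y'}" for i
  define RZ where "RZ i = {a \<in> A i. \<phi> (E (z i) (v0 i - a)) \<notin> Z'}" for i
  have fiber: "CARD('p) ^ (N - 1) \<le> card (RX i) + card (RY i) + card (RZ i)" if i: "i \<in> I" for i
  proof -
    have "card (A i) \<le> card (RX i) + card (RY i) + card (RZ i)"
    proof (rule covering_pairs[OF finA])
      show "RX i \<subseteq> A i" "RY i \<subseteq> A i" "RZ i \<subseteq> A i" unfolding RX_def RY_def RZ_def by blast+
      show "a + c \<in> A i" if "a \<in> A i" "c \<in> A i" for a c using that unfolding A_def by (rule supp_on_closed(2))
      show "a \<in> RX i \<or> c \<in> RY i \<or> a + c \<in> RZ i" if ac: "a \<in> A i" "c \<in> A i" for a c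
      proof (rule ccontr)
        assume neg: "\<not> (a \<in> RX i \<or> c \<in> RY i \<or> a + c \<in> RZ i)"
        have acA: "a + c \<in> A i" using ac unfolding A_def by (rule supp_on_closed(2))
        have m1: "\<phi> (E (x i) a) \<in> X'" using neg ac(1) unfolding RX_def by blast
        have m2: "\<phi> (E (y i) c) \<in> Y'" using neg ac(2) unfolding RY_def by blast
        have m3: "\<phi> (E (z i) (v0 i - (a + c))) \<in> Z'" using neg acA unfolding RZ_def by blast
        note m' = m1 m2 m3
        have "\<phi> (E (x i) a) + \<phi> (E (y i) c) + \<phi> (E (z i) (v0 i - (a + c))) = \<phi> (E (x i) a + E (y i) c + E (z i) (v0 i - (a + c)))"
          unfolding \<phi>add[OF add_carrier_vec[OF E_in E_in] E_in] \<phi>add[OF E_in E_in] by (rule refl)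
        also have "E (x i) a + E (y i) c + E (z i) (v0 i - (a + c)) = E (x i + y i + z i) (a + c + (v0 i - (a + c)))"
          unfolding E_add by (rule refl)
        also have "x i + y i + z i = 0" by (rule mem(4)[OF IN[OF i]])
        also have "a + c + (v0 i - (a + c)) = v0 i" by (simp only: add_diff_eq add_diff_cancel_left')
        also have "\<phi> (E 0 (v0 i)) = 0\<^sub>v m" using v0[OF i] by (intro \<Psi>0) blast
        finally have "\<phi> (E (x i) a) + \<phi> (E (y i) c) + \<phi> (E (z i) (v0 i - (a + c))) = 0\<^sub>v m" .
        thus False using free'[unfolded triangle_free_def] m1 m2 m3 by blast
      qed
    qed
    moreover have "card ({..<N} - {i}) = N - 1" using IN[OF i] by simp
    hence "card (A i) = CARD('p) ^ (N - 1)" unfolding A_def card_supp_on[OF finite_Diff[OF finite_lessThan]] by (simp only:)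
    ultimately show ?thesis by (simp only:)
  qed
  have xinj: "i = j" if "x i = x j" "i < N" "j < N" for i j
  proof -
    have "x j + y i + z i = 0" unfolding that(1)[symmetric] by (rule mem(4)[OF that(2)])
    from diag[OF that(3) that(2) that(2) this] show ?thesis by (elim conjE) (simp only:)
  qed
  have yinj: "i = j" if "y i = y j" "i < N" "j < N" for i j
  proof -
    have "x i + y j + z i = 0" unfolding that(1)[symmetric] by (rule mem(4)[OF that(2)])
    from diag[OF that(2) that(3) that(2) this] show ?thesis by (elim conjE) (simp only:)
  qed
  have zinj: "i = j" if "z i = z j" "i < N" "j < N" for i j
  proof -
    have "x i + y i + z j = 0" unfolding that(1)[symmetric] by (rule mem(4)[OF that(2)])
    from diag[OF that(2) that(2) that(3) this] show ?thesis by (elim conjE) (simp only:)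
  qed
  have finX: "finite W" if "W \<subseteq> carrier_vec n" for W :: "'p mod_ring Matrix.vec set"
  proof (rule inj_on_finite[of "fun_of_vec n" _ "supp_on {..<n}"])
    show "inj_on (fun_of_vec n) W" using that by (intro inj_onI fun_of_vec_inj) blast+
    show "fun_of_vec n ` W \<subseteq> supp_on {..<n}" using fun_of_vec_in by blast
  qed simp
  have sX: "(\<Sum>i\<in>I. card (RX i)) \<le> card {w\<in>X. \<phi> w \<notin> X'}"
  proof (rule sum_card_le_card_disjoint_images[OF finI, where g = "\<lambda>i. E (x i)"])
    show "finite (RX i)" for i unfolding RX_def using finA by simp
    show "finite {w\<in>X. \<phi> w \<notin> X'}" using finX[OF sub(1)] by simp
    show "E (x i) v \<in> {w\<in>X. \<phi> w \<notin> X'}" if "i \<in> I" "v \<in> RX i" for i v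
      using that IN[OF that(1)] AV unfolding RX_def X_def by blast
    show "i = i' \<and> v = v'" if "i \<in> I" "v \<in> RX i" "i' \<in> I" "v' \<in> RX i'" "E (x i) v = E (x i') v'" for i v i' v'
    proof -
      have "x i = x i' \<and> v = v'" using that mem(1)[OF IN] AV unfolding RX_def by (intro E_inj) blast+
      thus ?thesis using xinj IN that by blast
    qed
  qed
  have sY: "(\<Sum>i\<in>I. card (RY i)) \<le> card {w\<in>Y. \<phi> w \<notin> Y'}"
  proof (rule sum_card_le_card_disjoint_images[OF finI, where g = "\<lambda>i. E (y i)"])
    show "finite (RY i)" for i unfolding RY_def using finA by simp
    show "finite {w\<in>Y. \<phi> w \<notin> Y'}" using finX[OF sub(2)] by simp
    show "E (y i) v \<in> {w\<in>Y. \<phi> w \<notin> Y'}" if "i \<in> I" "v \<in> RY i" for i v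
      using that IN[OF that(1)] AV unfolding RY_def Y_def by blast
    show "i = i' \<and> v = v'" if "i \<in> I" "v \<in> RY i" "i' \<in> I" "v' \<in> RY i'" "E (y i) v = E (y i') v'" for i v i' v'
    proof -
      have "y i = y i' \<and> v = v'" using that mem(2)[OF IN] AV unfolding RY_def by (intro E_inj) blast+
      thus ?thesis using yinj IN that by blast
    qed
  qed
  have v0A: "v0 i - a \<in> V" "(v0 i - a) i \<noteq> 0" if "i \<in> I" "a \<in> A i" for i a
    using v0[OF that(1)] AV[OF that(2)] cl(2) by simp_all
  have sZ: "(\<Sum>i\<in>I. card (RZ i)) \<le> card {w\<in>Z. \<phi> w \<notin> Z'}"
  proof (rule sum_card_le_card_disjoint_images[OF finI, where g = "\<lambda>i a. E (z i) (v0 i - a)"])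
    show "finite (RZ i)" for i unfolding RZ_def using finA by simp
    show "finite {w\<in>Z. \<phi> w \<notin> Z'}" using finX[OF sub(3)] by simp
    show "E (z i) (v0 i - a) \<in> {w\<in>Z. \<phi> w \<notin> Z'}" if "i \<in> I" "a \<in> RZ i" for i a
      using that IN[OF that(1)] v0A[OF that(1)] unfolding RZ_def Z_def by blast
    show "i = i' \<and> v = v'" if "i \<in> I" "v \<in> RZ i" "i' \<in> I" "v' \<in> RZ i'" "E (z i) (v0 i - v) = E (z i') (v0 i' - v')" for i v i' v'
    proof -
      have e: "z i = z i' \<and> v0 i - v = v0 i' - v'" using that mem(3)[OF IN] v0A unfolding RZ_def by (intro E_inj) blast+
      hence "i = i'" using zinj IN that by blast
      thus ?thesis using e by simp
    qed
  qed
  have "card I * CARD('p) ^ (N - 1) = (\<Sum>i\<in>I. CARD('p) ^ (N - 1))" by simp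
  also have "\<dots> \<le> (\<Sum>i\<in>I. card (RX i) + card (RY i) + card (RZ i))" by (rule sum_mono[OF fiber])
  also have "\<dots> \<le> card {w\<in>X. \<phi> w \<notin> X'} + card {w\<in>Y. \<phi> w \<notin> Y'} + card {w\<in>Z. \<phi> w \<notin> Z'}"
    unfolding sum.distrib using sX sY sZ by linarith
  finally have "real (card I * CARD('p) ^ (N - 1)) \<le> real (card {w\<in>X. \<phi> w \<notin> X'} + card {w\<in>Y. \<phi> w \<notin> Y'} + card {w\<in>Z. \<phi> w \<notin> Z'})"
    by (simp only: of_nat_le_iff)
  also have "\<dots> \<le> 3 * (\<epsilon> * real CARD('p) ^ n)" using almost unfolding almost_maps_into_def of_nat_add by linarith
  also have "real CARD('p) ^ n = real CARD('p) ^ (k + 1) * real CARD('p) ^ (N - 1)"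
    unfolding power_add[symmetric] n_def using N by simp
  finally have "real (card I) * real CARD('p) ^ (N - 1) \<le> (3 * \<epsilon> * real CARD('p) ^ (k + 1)) * real CARD('p) ^ (N - 1)"
    by (simp only: of_nat_mult of_nat_power mult.assoc)
  moreover have "real CARD('p) ^ (N - 1) > 0" using prime_gt_0_nat[OF prime_card[where 'a = 'p]] by simp
  ultimately have "real (card I) \<le> 3 * \<epsilon> * real CARD('p) ^ (k + 1)" by (simp only: mult_le_cancel_right_pos)
  moreover have "card I = N - card J" unfolding I_def using card_Diff_subset[OF finJ JN] by simp
  hence "real N - real m \<le> real (card I)" using cardJ by linarith
  ultimately show ?thesis unfolding N_def by linarith
qed

section \<open>Types of near-maximal entropy\<close>

lemma ln_fact_lower: "n > 0 \<Longrightarrow> real n * ln (real n) - real n \<le> ln (fact n)"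
proof (induction n)
  case (Suc n)
  show ?case
  proof (cases "n = 0")
    case False
    have "ln (real (Suc n)) = ln (real n) + ln (1 + 1 / real n)"
    proof -
      have "real (Suc n) = real n * (1 + 1 / real n)" using False by (simp add: field_simps)
      moreover have "ln (real n * (1 + 1 / real n)) = ln (real n) + ln (1 + 1 / real n)"
        using False by (intro ln_mult_pos) (auto intro: add_pos_nonneg)
      ultimately show ?thesis by (simp only:)
    qed
    also have "ln (1 + 1 / real n) \<le> 1 / real n" using False by (intro ln_add_one_self_le_self) auto
    finally have "real n * ln (real (Suc n)) \<le> real n * ln (real n) + 1" using False by (simp add: field_simps)
    moreover have "ln (fact (Suc n) :: real) = ln (real (Suc n)) + ln (fact n)" by (simp add: ln_mult)
    ultimately show ?thesis using Suc.IH False by (simp add: algebra_simps)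
  qed simp
qed simp

lemma ln_fact_upper: "n > 0 \<Longrightarrow> ln (fact n) \<le> 1 + ln (real n) + real n * ln (real n) - real n"
proof (induction n)
  case (Suc n)
  show ?case
  proof (cases "n = 0")
    case False
    have "ln (real n / real (Suc n)) \<le> real n / real (Suc n) - 1" using False by (intro ln_le_minus_one) auto
    also have "\<dots> = - 1 / real (Suc n)" by (simp add: field_simps)
    also have "ln (real n / real (Suc n)) = ln (real n) - ln (real (Suc n))" using False by (simp add: ln_div)
    finally have "real (Suc n) * (ln (real n) - ln (real (Suc n))) \<le> real (Suc n) * (- 1 / real (Suc n))"
      by (intro mult_left_mono) auto
    hence "real (Suc n) * ln (real n) + 1 \<le> real (Suc n) * ln (real (Suc n))" by (simp add: right_diff_distrib)
    moreover have "ln (fact (Suc n) :: real) = ln (real (Suc n)) + ln (fact n)" by (simp add: ln_mult)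
    ultimately show ?thesis using Suc.IH False by (simp add: algebra_simps)
  qed simp
qed simp

text \<open>The multinomial coefficient is the exponential of the entropy of the frequencies, up to a factor polynomial in the size.\<close>

lemma ln_card_permutations_lower:
  assumes A: "A \<noteq> {#}" "set_mset A \<subseteq> {..m}"
  shows "(\<Sum>i\<le>m. real (count A i) * ln (real (size A) / real (count A i))) - (real m + 1) * (1 + ln (real (size A)))
     \<le> ln (real (card (permutations_of_multiset A)))"
proof -
  define s where "s = size A"
  have s: "s > 0" using A by (simp add: s_def nonempty_has_size)
  have cpos: "count A i > 0" if "i \<in> set_mset A" for i using that by simp
  have cs: "count A i \<le> s" for i unfolding s_def by (rule count_le_size)
  have pos: "(\<Prod>x\<in>set_mset A. fact (count A x) :: real) > 0" by (intro prod_pos) auto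
  have "real (card (permutations_of_multiset A) * (\<Prod>x\<in>set_mset A. fact (count A x))) = real (fact s)"
    unfolding s_def by (simp only: card_permutations_of_multiset_aux)
  hence prod: "real (card (permutations_of_multiset A)) * (\<Prod>x\<in>set_mset A. fact (count A x)) = fact s" by simp
  have card0: "real (card (permutations_of_multiset A)) > 0"
    using prod pos by (metis fact_gt_zero zero_less_mult_pos2)
  have "ln (fact s) = ln (real (card (permutations_of_multiset A))) + ln (\<Prod>x\<in>set_mset A. fact (count A x))"
    unfolding prod[symmetric] using card0 pos by (intro ln_mult_pos)
  also have "ln (\<Prod>x\<in>set_mset A. fact (count A x) :: real) = (\<Sum>x\<in>set_mset A. ln (fact (count A x)))"
    by (rule ln_prod) auto
  finally have eq: "ln (real (card (permutations_of_multiset A))) = ln (fact s) - (\<Sum>x\<in>set_mset A. ln (fact (count A x)))" by simp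
  have "(\<Sum>x\<in>set_mset A. ln (fact (count A x)))
      \<le> (\<Sum>x\<in>set_mset A. (1 + ln (real s)) + (real (count A x) * ln (real (count A x)) - real (count A x)))"
  proof (rule sum_mono)
    fix x assume x: "x \<in> set_mset A"
    have "ln (real (count A x)) \<le> ln (real s)" using cpos[OF x] cs[of x] s by simp
    thus "ln (fact (count A x)) \<le> (1 + ln (real s)) + (real (count A x) * ln (real (count A x)) - real (count A x))"
      using ln_fact_upper[OF cpos[OF x]] by linarith
  qed
  also have "\<dots> = real (card (set_mset A)) * (1 + ln (real s)) + (\<Sum>x\<in>set_mset A. real (count A x) * ln (real (count A x))) - real s"
    by (simp add: sum.distrib sum_subtractf s_def size_multiset_overloaded_eq)
  also have "real (card (set_mset A)) * (1 + ln (real s)) \<le> (real m + 1) * (1 + ln (real s))"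
  proof (rule mult_right_mono)
    have "card (set_mset A) \<le> card {..m}" using A(2) by (intro card_mono) auto
    thus "real (card (set_mset A)) \<le> real m + 1" by simp
  qed (use s in simp)
  finally have "ln (fact s) - (\<Sum>x\<in>set_mset A. ln (fact (count A x)))
     \<ge> real s * ln (real s) - (\<Sum>x\<in>set_mset A. real (count A x) * ln (real (count A x))) - (real m + 1) * (1 + ln (real s))"
    using ln_fact_lower[OF s] by linarith
  moreover have "(\<Sum>i\<le>m. real (count A i) * ln (real s / real (count A i)))
     = real s * ln (real s) - (\<Sum>x\<in>set_mset A. real (count A x) * ln (real (count A x)))"
  proof -
    have "(\<Sum>i\<le>m. real (count A i) * ln (real s / real (count A i))) = (\<Sum>i\<in>set_mset A. real (count A i) * ln (real s / real (count A i)))"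
      using A(2) by (intro sum.mono_neutral_right) (auto simp: not_in_iff)
    also have "\<dots> = (\<Sum>i\<in>set_mset A. real (count A i) * ln (real s) - real (count A i) * ln (real (count A i)))"
      using s cpos by (intro sum.cong) (auto simp: ln_div right_diff_distrib)
    also have "\<dots> = (\<Sum>i\<in>set_mset A. real (count A i)) * ln (real s) - (\<Sum>i\<in>set_mset A. real (count A i) * ln (real (count A i)))"
      by (simp add: sum_subtractf sum_distrib_right)
    also have "(\<Sum>i\<in>set_mset A. real (count A i)) = real s" by (simp add: s_def size_multiset_overloaded_eq)
    finally show ?thesis .
  qed
  ultimately show ?thesis unfolding eq s_def[symmetric] by linarith
qed

text \<open>Each triple is used together with its cyclic shifts, so that the three coordinates obtain equal frequencies.\<close>

definition rotations :: "nat \<Rightarrow> nat \<times> nat \<times> nat \<Rightarrow> (nat \<times> nat \<times> nat) list" where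
  "rotations k = (\<lambda>(a, b, c). replicate k (a, b, c) @ replicate k (b, c, a) @ replicate k (c, a, b))"

lemma mset_rotations:
  "mset (map fst (rotations k \<tau>)) = mset (map (\<lambda>t. fst (snd t)) (rotations k \<tau>))"
  "mset (map fst (rotations k \<tau>)) = mset (map (\<lambda>t. snd (snd t)) (rotations k \<tau>))"
  by (auto simp: rotations_def case_prod_unfold ac_simps)

lemma count_rotations: "count (mset (map fst (rotations k \<tau>))) i = k * hits i \<tau>"
  by (auto simp: rotations_def hits_def case_prod_unfold)

lemma set_rotations: "\<tau> \<in> triples m \<Longrightarrow> set (rotations k \<tau>) \<subseteq> triples m"
  by (auto simp: rotations_def triples_def)

lemma nat_floor_ratio_tendsto:
  fixes x :: real
  assumes "x \<ge> 0"
  shows "(\<lambda>N. real (nat \<lfloor>real N * x\<rfloor>) / real N) \<longlonglongrightarrow> x"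
proof (rule tendsto_sandwich)
  have "(\<lambda>N. x - 1 / real N) \<longlonglongrightarrow> x - 0" by (intro tendsto_diff tendsto_const lim_1_over_n)
  thus "(\<lambda>N. x - 1 / real N) \<longlonglongrightarrow> x" by simp
  show "\<forall>\<^sub>F N in sequentially. x - 1 / real N \<le> real (nat \<lfloor>real N * x\<rfloor>) / real N"
  proof (rule eventually_mono[OF eventually_gt_at_top[of 0]])
    fix N :: nat assume "N > 0"
    moreover have "real N * x - 1 \<le> real (nat \<lfloor>real N * x\<rfloor>)" by linarith
    ultimately have "(real N * x - 1) / real N \<le> real (nat \<lfloor>real N * x\<rfloor>) / real N" by (intro divide_right_mono) auto
    thus "x - 1 / real N \<le> real (nat \<lfloor>real N * x\<rfloor>) / real N" using \<open>N > 0\<close> by (simp add: diff_divide_distrib)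
  qed
  show "\<forall>\<^sub>F N in sequentially. real (nat \<lfloor>real N * x\<rfloor>) / real N \<le> x"
  proof (rule eventually_mono[OF eventually_gt_at_top[of 0]])
    fix N :: nat assume "N > 0"
    moreover have "real (nat \<lfloor>real N * x\<rfloor>) \<le> real N * x" using assms by simp
    ultimately show "real (nat \<lfloor>real N * x\<rfloor>) / real N \<le> x" by (simp add: field_simps)
  qed
qed simp

text \<open>Let \<open>\<psi>\<close> be the geometric distribution of mean \<open>(p-1)/3\<close> and \<open>\<pi>\<close> a coupling from \<open>decreasing_mean_third_coupling\<close>. Take each triple
  about \<open>N \<pi>\<close> times, with its rotations. The frequencies in the resulting multiset \<open>A\<close>
  tend to \<open>\<psi>\<close>, so the number of rearrangements grows at the rate given by the entropy of \<open>\<psi>\<close>. As \<open>ln \<psi>\<close> is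
  affine and the mean is prescribed, this entropy is the logarithm of \<^const>\<open>growth_fun\<close> at the ratio
  \<open>t\<close>, which is at least that of the infimum defining the constant.\<close>

theorem coupled_type:
  fixes P :: "'p::prime_card itself" and K :: nat and \<eta> :: real
  defines "p \<equiv> CARD('p)"
  assumes \<eta>: "\<eta> > 0"
  obtains A :: "nat multiset" and L where "set L \<subseteq> triples (p - 1)" "mset (map fst L) = A"
    "mset (map (\<lambda>t. fst (snd t)) L) = A" "mset (map (\<lambda>t. snd (snd t)) L) = A" "size A \<ge> K" "size A > 0" "set_mset A \<subseteq> {..p - 1}"
    "real (card (permutations_of_multiset A)) \<ge> real p powr ((1 - removal_const p - \<eta>) * real (size A))"
proof -
  have p2: "p \<ge> 2" using prime_ge_2_nat[OF prime_card[where 'a = 'p]] by (simp add: p_def)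
  define m where "m = p - 1"
  have m: "m \<ge> 1" "p = Suc m" using p2 by (auto simp: m_def)
  obtain t :: real where t: "0 < t" "t < 1" and mean0: "(\<Sum>i\<le>m. t ^ i * (real m - 3 * real i)) = 0"
    by (rule geometric_mean_third[OF m(1)])
  define s where "s = (\<Sum>i\<le>m. t ^ i)"
  have s: "s > 0" unfolding s_def using t by (intro sum_pos) auto
  define \<psi> where "\<psi> i = t ^ i / s" for i
  have \<psi>pos: "\<psi> i > 0" for i using t s by (simp add: \<psi>_def)
  have \<psi>dec: "\<psi> (Suc i) \<le> \<psi> i" for i
    unfolding \<psi>_def using t s by (intro divide_right_mono power_decreasing) auto
  have mean: "(\<Sum>i\<le>m. \<psi> i * (real m - 3 * real i)) = 0"
    using mean0 by (simp add: \<psi>_def sum_divide_distrib[symmetric])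
  have total: "(\<Sum>i\<le>m. \<psi> i) = 1" using s by (simp add: \<psi>_def sum_divide_distrib[symmetric] s_def)
  obtain h :: "'p mod_ring \<Rightarrow> nat" where "bij_betw h UNIV {0..<card (UNIV :: 'p mod_ring set)}"
    using ex_bij_betw_finite_nat[of "UNIV :: 'p mod_ring set"] by auto
  moreover have "{0..<card (UNIV :: 'p mod_ring set)} = {..m}" using m by (auto simp: p_def)
  ultimately have h: "bij_betw h UNIV {..m}" by simp
  obtain \<pi> where \<pi>: "\<And>\<tau>. \<tau> \<in> triples m \<Longrightarrow> 0 \<le> \<pi> \<tau>"
    and marg: "\<And>i. i \<le> m \<Longrightarrow> (\<Sum>\<tau>\<in>triples m. \<pi> \<tau> * real (hits i \<tau>)) = 3 * \<psi> i"
    by (rule decreasing_mean_third_coupling[OF h less_imp_le[OF \<psi>pos] \<psi>dec mean total]) blast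
  obtain ts where ts: "set ts = triples m" "distinct ts" using finite_distinct_list[OF finite_triples] by blast
  define k where "k N \<tau> = nat \<lfloor>real N * \<pi> \<tau>\<rfloor>" for N and \<tau> :: "nat \<times> nat \<times> nat"
  define L where "L N = concat (map (\<lambda>\<tau>. rotations (k N \<tau>) \<tau>) ts)" for N
  define A where "A N = mset (map fst (L N))" for N
  have mset_L: "mset (map f (concat (map g xs))) = (\<Sum>\<tau>\<leftarrow>xs. mset (map f (g \<tau>)))" for f :: "nat \<times> nat \<times> nat \<Rightarrow> nat" and g and xs :: "(nat \<times> nat \<times> nat) list"
    by (induction xs) auto
  have L: "set (L N) \<subseteq> triples m" "mset (map (\<lambda>t. fst (snd t)) (L N)) = A N" "mset (map (\<lambda>t. snd (snd t)) (L N)) = A N" for N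
  proof -
    show "set (L N) \<subseteq> triples m" using set_rotations[of _ m] ts(1) unfolding L_def by fastforce
    show "mset (map (\<lambda>t. fst (snd t)) (L N)) = A N" "mset (map (\<lambda>t. snd (snd t)) (L N)) = A N"
      unfolding L_def A_def mset_L mset_rotations[symmetric] by (rule refl)+
  qed
  have count_A: "count (A N) i = (\<Sum>\<tau>\<in>triples m. k N \<tau> * hits i \<tau>)" for N i
  proof -
    have "count (\<Sum>\<tau>\<leftarrow>xs. mset (map fst (rotations (k N \<tau>) \<tau>))) i = (\<Sum>\<tau>\<leftarrow>xs. k N \<tau> * hits i \<tau>)" for xs
      by (induction xs) (auto simp: count_rotations simp del: mset_map)
    thus ?thesis unfolding A_def L_def mset_L using sum_list_distinct_conv_sum_set[OF ts(2)] ts(1) by simp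
  qed
  have setA: "set_mset (A N) \<subseteq> {..m}" for N
    using L(1)[of N] by (auto simp: A_def triples_def)
  have size_A: "size (A N) = (\<Sum>i\<le>m. count (A N) i)" for N
    unfolding size_multiset_overloaded_eq using setA[of N]
    by (intro sum.mono_neutral_left) (auto simp: not_in_iff)
  have lim_count: "(\<lambda>N. real (count (A N) i) / real N) \<longlonglongrightarrow> 3 * \<psi> i" if "i \<le> m" for i
  proof -
    have "(\<lambda>N. \<Sum>\<tau>\<in>triples m. real (k N \<tau>) / real N * real (hits i \<tau>)) \<longlonglongrightarrow> (\<Sum>\<tau>\<in>triples m. \<pi> \<tau> * real (hits i \<tau>))"
      unfolding k_def by (intro tendsto_sum tendsto_mult tendsto_const nat_floor_ratio_tendsto \<pi>)
    thus ?thesis unfolding marg[OF that] by (simp add: count_A sum_divide_distrib)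
  qed
  have lim_size: "(\<lambda>N. real (size (A N)) / real N) \<longlonglongrightarrow> 3"
  proof -
    have "(\<lambda>N. \<Sum>i\<le>m. real (count (A N) i) / real N) \<longlonglongrightarrow> (\<Sum>i\<le>m. 3 * \<psi> i)"
      by (intro tendsto_sum lim_count) auto
    thus ?thesis by (simp add: size_A sum_divide_distrib sum_distrib_left[symmetric] total)
  qed
  define e where "e N = (\<Sum>i\<le>m. real (count (A N) i) / real N * ln ((real (size (A N)) / real N) / (real (count (A N) i) / real N)))" for N
  have lim_e: "e \<longlonglongrightarrow> (\<Sum>i\<le>m. 3 * \<psi> i * ln (3 / (3 * \<psi> i)))"
    unfolding e_def
  proof (intro tendsto_sum tendsto_mult tendsto_ln tendsto_divide lim_size)
    fix i assume i: "i \<in> {..m}"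
    show "(\<lambda>N. real (count (A N) i) / real N) \<longlonglongrightarrow> 3 * \<psi> i" "(\<lambda>N. real (count (A N) i) / real N) \<longlonglongrightarrow> 3 * \<psi> i"
      using i by (auto intro: lim_count)
    show "3 * \<psi> i \<noteq> 0" "3 / (3 * \<psi> i) \<noteq> 0" using \<psi>pos[of i] by auto
  qed
  define H where "H = ln (growth_fun p t)"
  have entropy: "(\<Sum>i\<le>m. 3 * \<psi> i * ln (3 / (3 * \<psi> i))) = 3 * H"
  proof -
    have mean': "(\<Sum>i\<le>m. \<psi> i * real i) = real m / 3"
    proof -
      have "(\<Sum>i\<le>m. \<psi> i * (real m - 3 * real i)) = real m * (\<Sum>i\<le>m. \<psi> i) - 3 * (\<Sum>i\<le>m. \<psi> i * real i)"
        by (simp add: right_diff_distrib sum_subtractf sum_distrib_left mult_ac)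
      thus ?thesis using mean total by simp
    qed
    have ln\<psi>: "ln (3 / (3 * \<psi> i)) = ln s - real i * ln t" for i
      using t s by (simp add: \<psi>_def ln_div ln_realpow)
    have "(\<Sum>i\<le>m. 3 * \<psi> i * ln (3 / (3 * \<psi> i))) = (\<Sum>i\<le>m. 3 * ln s * \<psi> i - 3 * ln t * (\<psi> i * real i))"
      unfolding ln\<psi> by (simp add: algebra_simps)
    also have "\<dots> = 3 * ln s * (\<Sum>i\<le>m. \<psi> i) - 3 * ln t * (\<Sum>i\<le>m. \<psi> i * real i)"
      by (simp only: sum_subtractf sum_distrib_left)
    also have "\<dots> = 3 * (ln s - real m / 3 * ln t)" unfolding total mean' by (simp add: algebra_simps)
    also have "ln s - real m / 3 * ln t = H"
    proof -
      have "{..<p} = {..m}" using m by auto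
      hence "growth_fun p t = t powr (- (real m / 3)) * s" using m by (simp add: growth_fun_def s_def)
      thus ?thesis using t s by (simp add: H_def ln_mult ln_powr)
    qed
    finally show ?thesis .
  qed
  have ev_pos: "\<forall>\<^sub>F N in sequentially. real (size (A N)) / real N > 2"
    by (rule order_tendstoD(1)[OF lim_size]) simp
  have lim_infty: "filterlim (\<lambda>N. real (size (A N))) at_top sequentially"
  proof (rule filterlim_at_top_mono[OF filterlim_real_sequentially])
    show "\<forall>\<^sub>F N in sequentially. real N \<le> real (size (A N))"
      using ev_pos eventually_gt_at_top[of 0]
    proof eventually_elim
      case (elim N)
      hence "2 * real N < real (size (A N))" by (simp add: field_simps)
      thus ?case by simp
    qed
  qed
  have "((\<lambda>x. (real m + 1) * (1 + ln x) / x) \<longlongrightarrow> 0) at_top"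
  proof -
    have "((\<lambda>x::real. (real m + 1) * (inverse x + ln x / x)) \<longlongrightarrow> (real m + 1) * (0 + 0)) at_top"
      by (intro tendsto_intros tendsto_inverse_0_at_top filterlim_ident ln_x_over_x_tendsto_0)
    thus ?thesis by (simp add: field_simps add_divide_distrib)
  qed
  hence lim_err: "(\<lambda>N. (real m + 1) * (1 + ln (real (size (A N)))) / real (size (A N))) \<longlonglongrightarrow> 0"
    using lim_infty by (rule filterlim_compose)
  define rate where "rate N = e N / (real (size (A N)) / real N) - (real m + 1) * (1 + ln (real (size (A N)))) / real (size (A N))" for N
  have "rate \<longlonglongrightarrow> 3 * H / 3 - 0"
    unfolding rate_def using lim_e unfolding entropy by (intro tendsto_diff tendsto_divide lim_size lim_err) auto
  moreover have "H - \<eta> * ln (real p) < 3 * H / 3 - 0" using \<eta> p2 by simp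
  ultimately have ev_rate: "\<forall>\<^sub>F N in sequentially. H - \<eta> * ln (real p) < rate N"
    by (rule order_tendstoD(1))
  have ev_K: "\<forall>\<^sub>F N in sequentially. real K + 1 \<le> real (size (A N))"
    using lim_infty unfolding filterlim_at_top by blast
  have "\<forall>\<^sub>F N in sequentially. H - \<eta> * ln (real p) < rate N \<and> real K + 1 \<le> real (size (A N)) \<and> N > 0"
    using ev_rate ev_K eventually_gt_at_top[of 0] by eventually_elim blast
  then obtain N where N: "H - \<eta> * ln (real p) < rate N" "real K + 1 \<le> real (size (A N))" "N > 0"
    using eventually_happens[of _ sequentially] by auto
  define n where "n = real (size (A N))"
  have n: "n > 0" using N(2) by (simp add: n_def)
  have neA: "A N \<noteq> {#}" using n by (auto simp: n_def)
  have "e N / (n / real N) = (\<Sum>i\<le>m. real (count (A N) i) * ln (n / real (count (A N) i))) / n"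
  proof -
    have "e N = (\<Sum>i\<le>m. real (count (A N) i) * ln (n / real (count (A N) i))) / real N"
      using N(3) by (simp add: e_def n_def[symmetric] sum_divide_distrib)
    thus ?thesis using N(3) n by simp
  qed
  hence "rate N * n = (\<Sum>i\<le>m. real (count (A N) i) * ln (n / real (count (A N) i))) - (real m + 1) * (1 + ln n)"
    using n by (simp add: rate_def n_def[symmetric] left_diff_distrib)
  also have "\<dots> \<le> ln (real (card (permutations_of_multiset (A N))))"
    unfolding n_def by (rule ln_card_permutations_lower[OF neA setA])
  finally have low: "rate N * n \<le> ln (real (card (permutations_of_multiset (A N))))" .
  have cpos: "real (card (permutations_of_multiset (A N))) > 0"
    by (simp add: card_gt_0_iff permutations_of_multiset_nonempty)
  have "(1 - removal_const p) * ln (real p) \<le> H"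
  proof -
    have "real p powr (1 - removal_const p) = (INF t\<in>{0<..<1}. growth_fun p t)" by (rule powr_removal_const[OF p2])
    also have "\<dots> \<le> growth_fun p t"
      using t growth_fun_lower[OF p2] by (intro cINF_lower bdd_belowI2) auto
    finally have "ln (real p powr (1 - removal_const p)) \<le> H" unfolding H_def
      using p2 by (intro ln_mono) auto
    thus ?thesis using p2 by (simp add: ln_powr)
  qed
  hence "(1 - removal_const p - \<eta>) * ln (real p) \<le> rate N" using N(1) by (simp add: left_diff_distrib)
  hence "(1 - removal_const p - \<eta>) * ln (real p) * n \<le> rate N * n" using n by (intro mult_right_mono) auto
  hence "(1 - removal_const p - \<eta>) * n * ln (real p) \<le> ln (real (card (permutations_of_multiset (A N))))" using low by (simp add: mult_ac)
  hence "exp ((1 - removal_const p - \<eta>) * n * ln (real p)) \<le> real (card (permutations_of_multiset (A N)))"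
    using cpos by (simp add: ln_ge_iff)
  hence card: "real p powr ((1 - removal_const p - \<eta>) * n) \<le> real (card (permutations_of_multiset (A N)))"
    using p2 by (simp add: powr_def)
  show thesis
  proof (rule that[of "L N" "A N"])
    show "size (A N) \<ge> K" "size (A N) > 0" using N(2) by linarith+
    show "mset (map fst (L N)) = A N" by (simp only: A_def)
  qed (use L[of N] setA[of N] card in \<open>simp_all only: m_def n_def\<close>)
qed

section \<open>Hash functions and triangles of words\<close>

text \<open>Some coordinate of the difference \<open>d\<close> is prime to \<open>p\<close>, hence invertible modulo \<open>Q\<close>; all other coefficients determine that one.\<close>

lemma hash_collisions:
  fixes d :: "nat \<Rightarrow> int" and p e n \<kappa> i0 :: nat
  defines "Q \<equiv> p ^ e"
  assumes p: "prime p" and i0: "i0 < n" "d i0 \<noteq> 0" "\<bar>d i0\<bar> < int p"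
  shows "card {\<alpha>\<in>PiE ({..<n} \<times> {..<\<kappa>}) (\<lambda>_. {0..<int Q}). \<forall>r<\<kappa>. int Q dvd (\<Sum>i<n. \<alpha> (i, r) * d i)} * Q ^ \<kappa> \<le> Q ^ (n * \<kappa>)"
proof -
  define W where "W = {\<alpha>\<in>PiE ({..<n} \<times> {..<\<kappa>}) (\<lambda>_. {0..<int Q}). \<forall>r<\<kappa>. int Q dvd (\<Sum>i<n. \<alpha> (i, r) * d i)}"
  define J where "J = ({..<n} - {i0}) \<times> {..<\<kappa>}"
  have "coprime (d i0) (int p)"
  proof -
    have "\<not> int p dvd d i0" using i0 zdvd_imp_le[of "int p" "\<bar>d i0\<bar>"] by auto
    thus ?thesis using p prime_imp_coprime[of "int p" "d i0"] by (simp add: coprime_commute)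
  qed
  hence cop: "coprime (int Q) (d i0)" by (simp add: Q_def coprime_commute)
  have "card W \<le> card (PiE J (\<lambda>_. {0..<int Q}))"
  proof (rule card_inj_on_le[of "\<lambda>\<alpha>. restrict \<alpha> J"])
    show "finite (PiE J (\<lambda>_. {0..<int Q}))" by (intro finite_PiE) (auto simp: J_def)
    show "(\<lambda>\<alpha>. restrict \<alpha> J) ` W \<subseteq> PiE J (\<lambda>_. {0..<int Q})"
    proof (rule image_subsetI)
      fix \<alpha> assume "\<alpha> \<in> W"
      hence "\<alpha> \<in> PiE ({..<n} \<times> {..<\<kappa>}) (\<lambda>_. {0..<int Q})" by (simp only: W_def mem_Collect_eq)
      hence "\<alpha> ir \<in> {0..<int Q}" if "ir \<in> J" for ir using that unfolding J_def by (elim PiE_mem) blast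
      thus "restrict \<alpha> J \<in> PiE J (\<lambda>_. {0..<int Q})" unfolding restrict_PiE_iff by blast
    qed
    show "inj_on (\<lambda>\<alpha>. restrict \<alpha> J) W"
    proof (rule inj_onI)
      fix \<alpha> \<beta> assume ab: "\<alpha> \<in> W" "\<beta> \<in> W" "restrict \<alpha> J = restrict \<beta> J"
      have off: "\<alpha> (i, r) = \<beta> (i, r)" if "i < n" "i \<noteq> i0" "r < \<kappa>" for i r
        using fun_cong[OF ab(3), of "(i, r)"] that by (simp add: J_def)
      have at: "\<alpha> (i0, r) = \<beta> (i0, r)" if r: "r < \<kappa>" for r
      proof -
        have "int Q dvd (\<Sum>i<n. \<alpha> (i, r) * d i) - (\<Sum>i<n. \<beta> (i, r) * d i)"
          using ab(1,2) r by (intro dvd_diff) (simp_all add: W_def)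
        also have "(\<Sum>i<n. \<alpha> (i, r) * d i) - (\<Sum>i<n. \<beta> (i, r) * d i) = (\<Sum>i<n. if i = i0 then (\<alpha> (i0, r) - \<beta> (i0, r)) * d i0 else 0)"
          unfolding sum_subtractf[symmetric] using off r by (intro sum.cong) (auto simp: left_diff_distrib)
        also have "\<dots> = (\<alpha> (i0, r) - \<beta> (i0, r)) * d i0" using i0(1) by simp
        finally have Qdvd: "int Q dvd \<alpha> (i0, r) - \<beta> (i0, r)" using cop by (simp add: coprime_dvd_mult_left_iff)
        have mem: "(i0, r) \<in> {..<n} \<times> {..<\<kappa>}" using i0(1) r by simp
        have pi: "\<alpha> \<in> PiE ({..<n} \<times> {..<\<kappa>}) (\<lambda>_. {0..<int Q})" "\<beta> \<in> PiE ({..<n} \<times> {..<\<kappa>}) (\<lambda>_. {0..<int Q})"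
          using ab(1,2) by (simp_all only: W_def mem_Collect_eq)
        have "\<alpha> (i0, r) \<in> {0..<int Q}" "\<beta> (i0, r) \<in> {0..<int Q}" by (rule PiE_mem[OF pi(1) mem], rule PiE_mem[OF pi(2) mem])
        hence lt: "\<bar>\<alpha> (i0, r) - \<beta> (i0, r)\<bar> < int Q" by (simp only: atLeastLessThan_iff) linarith
        show ?thesis
        proof (rule ccontr)
          assume "\<alpha> (i0, r) \<noteq> \<beta> (i0, r)"
          hence "0 < \<bar>\<alpha> (i0, r) - \<beta> (i0, r)\<bar>" by simp
          moreover have "int Q dvd \<bar>\<alpha> (i0, r) - \<beta> (i0, r)\<bar>" using Qdvd by (simp only: dvd_abs_iff)
          ultimately have "int Q \<le> \<bar>\<alpha> (i0, r) - \<beta> (i0, r)\<bar>" by (intro zdvd_imp_le)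
          thus False using lt by linarith
        qed
      qed
      show "\<alpha> = \<beta>"
      proof (rule extensionalityI[of _ "{..<n} \<times> {..<\<kappa>}"])
        show "\<alpha> \<in> extensional ({..<n} \<times> {..<\<kappa>})" "\<beta> \<in> extensional ({..<n} \<times> {..<\<kappa>})" 
          using ab(1,2) by (simp_all add: W_def PiE_def)
        show "\<alpha> ir = \<beta> ir" if mem': "ir \<in> {..<n} \<times> {..<\<kappa>}" for ir
        proof -
          obtain i r where ir: "ir = (i, r)" "i < n" "r < \<kappa>" using mem' by blast
          show ?thesis unfolding ir(1) using off[OF ir(2) _ ir(3)] at[OF ir(3)] by (cases "i = i0") (simp_all only: simp_thms)
        qed
      qed
    qed
  qed
  also have "card (PiE J (\<lambda>_. {0..<int Q})) = Q ^ ((n - 1) * \<kappa>)"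
    using i0(1) by (simp add: card_PiE J_def card_cartesian_product)
  finally have "card W * Q ^ \<kappa> \<le> Q ^ ((n - 1) * \<kappa>) * Q ^ \<kappa>" by (rule mult_le_mono1)
  also have "\<dots> = Q ^ (n * \<kappa>)" using i0(1) by (cases n) (auto simp: power_add[symmetric] add.commute)
  finally show ?thesis by (simp add: W_def)
qed

text \<open>Triples of rearrangements of the same multiset, viewed as the edges of a 3-partite hypergraph on words.\<close>

definition triangle_system :: "nat \<Rightarrow> nat multiset \<Rightarrow> (nat list \<times> nat list \<times> nat list) set" where
  "triangle_system m A = {(x, y, z). mset x = A \<and> mset y = A \<and> mset z = A \<and> (\<forall>i<size A. x ! i + y ! i + z ! i = m)}"

lemma finite_triangle_system: "finite (triangle_system m A)"
  by (rule finite_subset[OF _ finite_cartesian_product[OF finite_permutations_of_multiset[of A]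
        finite_cartesian_product[OF finite_permutations_of_multiset[of A] finite_permutations_of_multiset[of A]]]])
     (auto simp: triangle_system_def permutations_of_multiset_def)

text \<open>Permuting positions acts on the triples, and transitively on the rearrangements of \<open>A\<close>.\<close>

lemma triangle_system_degree_mono:
  assumes x: "mset x = A" "mset x' = A"
  shows "card {e\<in>triangle_system m A. fst e = x} \<le> card {e\<in>triangle_system m A. fst e = x'}"
proof -
  have "mset x' = mset x" using x by simp
  then obtain f where f: "f permutes {..<length x}" "permute_list f x = x'"
    by (rule mset_eq_permutation)
  have n: "length x = size A" unfolding x(1)[symmetric] by (rule size_mset[symmetric])
  have len: "length y = size A" if "mset y = A" for y unfolding that[symmetric] by (rule size_mset[symmetric])
  define g :: "nat list \<times> nat list \<times> nat list \<Rightarrow> nat list \<times> nat list \<times> nat list"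
    where "g = (\<lambda>(x, y, z). (permute_list f x, permute_list f y, permute_list f z))"
  have bound: "f i < size A" if "i < size A" for i
    using permutes_in_image[OF f(1), of i] that unfolding n by simp
  have nth: "permute_list f y ! i = y ! f i" if "mset y = A" "i < size A" for y i
    using f(1) that(2) unfolding n len[OF that(1), symmetric] by (rule permute_list_nth)
  have mset: "mset (permute_list f y) = A" if "mset y = A" for y
  proof -
    have "f permutes {..<length y}" using f(1) unfolding n len[OF that] .
    thus ?thesis using that by simp
  qed
  have inj: "y = y'" if "mset y = A" "mset y' = A" "permute_list f y = permute_list f y'" for y y'
  proof (rule nth_equalityI)
    show "length y = length y'" using len that by simp
    fix i assume i: "i < length y"
    hence "i \<in> f ` {..<length x}" using permutes_image[OF f(1)] n len[OF that(1)] by auto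
    then obtain j where j: "j < size A" "i = f j" using n by auto
    show "y ! i = y' ! i" using nth[OF that(1) j(1)] nth[OF that(2) j(1)] that(3) j(2) by simp
  qed
  show ?thesis
  proof (rule card_inj_on_le[of g])
    show "inj_on g {e\<in>triangle_system m A. fst e = x}"
      by (auto simp: inj_on_def g_def triangle_system_def intro: inj)
    show "g ` {e\<in>triangle_system m A. fst e = x} \<subseteq> {e\<in>triangle_system m A. fst e = x'}"
    proof (rule image_subsetI)
      fix e assume "e \<in> {e\<in>triangle_system m A. fst e = x}"
      then obtain y z where e: "e = (x, y, z)" and yz: "mset y = A" "mset z = A" "\<And>i. i < size A \<Longrightarrow> x ! i + y ! i + z ! i = m"
        by (cases e) (auto simp: triangle_system_def)
      have "permute_list f x ! i + permute_list f y ! i + permute_list f z ! i = m" if "i < size A" for i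
        unfolding nth[OF x(1) that] nth[OF yz(1) that] nth[OF yz(2) that] by (rule yz(3)[OF bound[OF that]])
      thus "g e \<in> {e\<in>triangle_system m A. fst e = x'}"
        using mset[OF x(1)] mset[OF yz(1)] mset[OF yz(2)] f(2) by (simp add: e g_def triangle_system_def)
    qed
    show "finite {e\<in>triangle_system m A. fst e = x'}" using finite_triangle_system by simp
  qed
qed

lemma triangle_system_regular:
  assumes "triangle_system m A \<noteq> {}"
  obtains D where "D \<ge> 1" "card (triangle_system m A) = card (permutations_of_multiset A) * D"
    "\<And>e. e \<in> triangle_system m A \<Longrightarrow> card {e'\<in>triangle_system m A. fst e' = fst e} = D"
    "\<And>e. e \<in> triangle_system m A \<Longrightarrow> card {e'\<in>triangle_system m A. fst (snd e') = fst (snd e)} = D"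
    "\<And>e. e \<in> triangle_system m A \<Longrightarrow> card {e'\<in>triangle_system m A. snd (snd e') = snd (snd e)} = D"
proof -
  define E where "E = triangle_system m A"
  have finE: "finite E" by (simp add: E_def finite_triangle_system)
  obtain e0 where e0: "e0 \<in> E" using assms by (auto simp: E_def)
  define D where "D = card {e\<in>E. fst e = fst e0}"
  have e0A: "mset (fst e0) = A" using e0 by (auto simp: E_def triangle_system_def)
  have deg: "card {e\<in>E. fst e = x} = D" if "mset x = A" for x
    unfolding D_def E_def using triangle_system_degree_mono[OF that e0A] triangle_system_degree_mono[OF e0A that] by (rule antisym)
  have swap1: "card {e\<in>E. fst (snd e) = x} = card {e\<in>E. fst e = x}" for x
    by (rule bij_betw_same_card[of "\<lambda>(x, y, z). (y, x, z)"], rule bij_betwI[where g = "\<lambda>(x, y, z). (y, x, z)"])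
       (auto simp: E_def triangle_system_def add_ac)
  have swap2: "card {e\<in>E. snd (snd e) = x} = card {e\<in>E. fst e = x}" for x
    by (rule bij_betw_same_card[of "\<lambda>(x, y, z). (z, y, x)"], rule bij_betwI[where g = "\<lambda>(x, y, z). (z, y, x)"])
       (auto simp: E_def triangle_system_def add_ac)
  have "card E = (\<Sum>x\<in>permutations_of_multiset A. card {e\<in>E. fst e = x})"
  proof -
    have "card E = (\<Sum>e\<in>E. 1)" by simp
    also have "\<dots> = (\<Sum>x\<in>permutations_of_multiset A. \<Sum>e\<in>{e\<in>E. fst e = x}. 1)"
      by (rule sum.group[symmetric, OF finE finite_permutations_of_multiset]) (auto simp: E_def triangle_system_def permutations_of_multiset_def)
    finally show ?thesis by simp
  qed
  also have "\<dots> = card (permutations_of_multiset A) * D"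
    using deg by (simp add: permutations_of_multiset_def)
  finally have cardE: "card E = card (permutations_of_multiset A) * D" .
  have "D \<noteq> 0" 
  proof -
    have "e0 \<in> {e\<in>E. fst e = fst e0}" using e0 by simp
    hence "{e\<in>E. fst e = fst e0} \<noteq> {}" by (intro notI) (simp only: empty_iff)
    moreover have "finite {e\<in>E. fst e = fst e0}" by (rule finite_subset[OF Collect_restrict finE])
    ultimately have "card {e\<in>E. fst e = fst e0} > 0" unfolding card_gt_0_iff ..
    thus ?thesis unfolding D_def by (simp only: neq0_conv)
  qed
  show thesis
  proof (rule that[of D, folded E_def])
    show "D \<ge> 1" using \<open>D \<noteq> 0\<close> by simp
    show "card {e'\<in>E. fst e' = fst e} = D" if "e \<in> E" for e
      using that by (intro deg) (auto simp: E_def triangle_system_def)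
    show "card {e'\<in>E. fst (snd e') = fst (snd e)} = D" if "e \<in> E" for e
      unfolding swap1 using that by (intro deg) (auto simp: E_def triangle_system_def)
    show "card {e'\<in>E. snd (snd e') = snd (snd e)} = D" if "e \<in> E" for e
      unfolding swap2 using that by (intro deg) (auto simp: E_def triangle_system_def)
  qed (rule cardE)
qed

text \<open>Behrend's construction: a most popular sphere in the grid. A sphere contains no midpoint of two of its points.\<close>

lemma sphere_without_progressions:
  assumes q: "q \<ge> 1" and \<kappa>: "\<kappa> \<ge> 1"
  obtains B :: "(nat \<Rightarrow> int) set" where "B \<subseteq> PiE {..<\<kappa>} (\<lambda>_. {0..<int q})" "q ^ \<kappa> \<le> \<kappa> * q ^ 2 * card B"
    "\<And>b1 b2 b3. b1 \<in> B \<Longrightarrow> b2 \<in> B \<Longrightarrow> b3 \<in> B \<Longrightarrow> \<forall>r<\<kappa>. b1 r + b2 r = 2 * b3 r \<Longrightarrow> b1 = b2 \<and> b2 = b3"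
proof -
  define G where "G = PiE {..<\<kappa>} (\<lambda>_. {0..<int q})"
  define nm where "nm b = nat (\<Sum>r<\<kappa>. b r ^ 2)" for b :: "nat \<Rightarrow> int"
  have finG: "finite G" unfolding G_def by (intro finite_PiE) auto
  have cardG: "card G = q ^ \<kappa>" by (simp add: G_def card_PiE)
  have nm: "nm ` G \<subseteq> {..<\<kappa> * q ^ 2}"
  proof
    fix v assume "v \<in> nm ` G"
    then obtain b where b: "b \<in> G" "v = nm b" by blast
    have "(\<Sum>r<\<kappa>. b r ^ 2) < (\<Sum>r<\<kappa>. int q ^ 2)"
    proof (rule sum_strict_mono)
      fix r assume "r \<in> {..<\<kappa>}"
      hence "0 \<le> b r" "b r < int q" using b(1) by (auto simp: G_def PiE_def Pi_def)
      thus "b r ^ 2 < int q ^ 2" by (intro power_strict_mono) auto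
    next
      have "0 \<in> {..<\<kappa>}" using \<kappa> by simp
      thus "{..<\<kappa>} \<noteq> {}" by blast
    qed simp
    also have "\<dots> = int (\<kappa> * q ^ 2)" by simp
    finally show "v \<in> {..<\<kappa> * q ^ 2}" 
      unfolding b(2) nm_def lessThan_iff by (subst nat_less_iff) (rule sum_nonneg, rule zero_le_power2)
  qed
  have "G \<noteq> {}" using cardG q by auto
  have "\<exists>v\<in>nm ` G. q ^ \<kappa> \<le> \<kappa> * q ^ 2 * card {b\<in>G. nm b = v}"
  proof (rule ccontr)
    assume neg: "\<not> ?thesis"
    have "card G = (\<Sum>v\<in>nm ` G. card {b\<in>G. nm b = v})"
      using sum.image_gen[OF finG, of "\<lambda>_. 1::nat" nm] by (simp only: card_eq_sum)
    hence "\<kappa> * q ^ 2 * card G = (\<Sum>v\<in>nm ` G. \<kappa> * q ^ 2 * card {b\<in>G. nm b = v})" by (simp only: sum_distrib_left)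
    also have "\<dots> < (\<Sum>v\<in>nm ` G. q ^ \<kappa>)"
    proof (rule sum_strict_mono)
      show "finite (nm ` G)" "nm ` G \<noteq> {}" using finG \<open>G \<noteq> {}\<close> by simp_all
      fix v assume "v \<in> nm ` G"
      thus "\<kappa> * q ^ 2 * card {b\<in>G. nm b = v} < q ^ \<kappa>" using neg by (meson not_le)
    qed
    also have "\<dots> = card (nm ` G) * q ^ \<kappa>" by simp
    also have "\<dots> \<le> \<kappa> * q ^ 2 * q ^ \<kappa>" 
    proof (rule mult_le_mono1)
      show "card (nm ` G) \<le> \<kappa> * q ^ 2" using card_mono[OF finite_lessThan nm] unfolding card_lessThan .
    qed
    finally show False unfolding cardG by (simp only: less_irrefl)
  qed
  then obtain v where v: "q ^ \<kappa> \<le> \<kappa> * q ^ 2 * card {b\<in>G. nm b = v}" by blast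
  define B where "B = {b\<in>G. nm b = v}"
  show thesis
  proof (rule that[of B])
    show "B \<subseteq> PiE {..<\<kappa>} (\<lambda>_. {0..<int q})" by (auto simp: B_def G_def)
    show "q ^ \<kappa> \<le> \<kappa> * q ^ 2 * card B" using v by (simp add: B_def)
    fix b1 b2 b3 assume b: "b1 \<in> B" "b2 \<in> B" "b3 \<in> B" and mid: "\<forall>r<\<kappa>. b1 r + b2 r = 2 * b3 r"
    have eq: "(\<Sum>r<\<kappa>. b r ^ 2) = int v" if "b \<in> B" for b
    proof -
      have "nm b = v" using that by (simp only: B_def mem_Collect_eq)
      moreover have "0 \<le> (\<Sum>r<\<kappa>. b r ^ 2)" by (rule sum_nonneg) (rule zero_le_power2)
      ultimately show ?thesis unfolding nm_def by linarith
    qed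
    have "(\<Sum>r<\<kappa>. (b1 r - b2 r) ^ 2) = (\<Sum>r<\<kappa>. 2 * b1 r ^ 2 + 2 * b2 r ^ 2 - 4 * b3 r ^ 2)"
    proof (rule sum.cong[OF refl])
      fix r assume "r \<in> {..<\<kappa>}"
      hence "b1 r + b2 r = 2 * b3 r" using mid by simp
      hence "(b1 r + b2 r) ^ 2 = 4 * b3 r ^ 2" by (simp add: power_mult_distrib)
      moreover have "(b1 r - b2 r) ^ 2 = 2 * b1 r ^ 2 + 2 * b2 r ^ 2 - (b1 r + b2 r) ^ 2"
        by (simp add: power2_sum power2_diff)
      ultimately show "(b1 r - b2 r) ^ 2 = 2 * b1 r ^ 2 + 2 * b2 r ^ 2 - 4 * b3 r ^ 2" by simp
    qed
    also have "\<dots> = 2 * (\<Sum>r<\<kappa>. b1 r ^ 2) + 2 * (\<Sum>r<\<kappa>. b2 r ^ 2) - 4 * (\<Sum>r<\<kappa>. b3 r ^ 2)"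
      unfolding sum_subtractf sum.distrib sum_distrib_left[symmetric] ..
    also have "\<dots> = 0" unfolding eq[OF b(1)] eq[OF b(2)] eq[OF b(3)] by simp
    finally have "(\<Sum>r<\<kappa>. (b1 r - b2 r) ^ 2) = 0" .
    hence "\<forall>r\<in>{..<\<kappa>}. (b1 r - b2 r) ^ 2 = 0" by (subst (asm) sum_nonneg_eq_0_iff) auto
    hence e12: "b1 r = b2 r" if "r < \<kappa>" for r using that by simp
    have e23: "b2 r = b3 r" if "r < \<kappa>" for r using e12[OF that] mid that by force
    have mem: "b \<in> extensional {..<\<kappa>}" if "b \<in> B" for b using that by (simp add: B_def G_def PiE_def)
    have "b1 = b2" by (rule extensionalityI[OF mem[OF b(1)] mem[OF b(2)]]) (use e12 in simp)
    moreover have "b2 = b3" by (rule extensionalityI[OF mem[OF b(2)] mem[OF b(3)]]) (use e23 in simp)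
    ultimately show "b1 = b2 \<and> b2 = b3" ..
  qed
qed

text \<open>The deletion method. The expected number of selected elements is at least \<open>card E * a / card \<Omega>\<close>, and the
  expected number of selected conflicting pairs is at most half of it.\<close>

lemma isolated_selection:
  fixes S :: "'w \<Rightarrow> 'e set" and E :: "'e set" and sh :: "'e \<Rightarrow> 'e \<Rightarrow> bool" and a c :: nat
  assumes fin: "finite \<Omega>" "finite E" and S: "\<And>\<omega>. \<omega> \<in> \<Omega> \<Longrightarrow> S \<omega> \<subseteq> E"
    and one: "\<And>e. e \<in> E \<Longrightarrow> a \<le> card {\<omega>\<in>\<Omega>. e \<in> S \<omega>}"
    and two: "\<And>e e'. e \<in> E \<Longrightarrow> e' \<in> E \<Longrightarrow> e \<noteq> e' \<Longrightarrow> sh e e' \<Longrightarrow> card {\<omega>\<in>\<Omega>. e \<in> S \<omega> \<and> e' \<in> S \<omega>} \<le> c"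
    and deg: "\<And>e. e \<in> E \<Longrightarrow> card {e'\<in>E. e' \<noteq> e \<and> sh e e'} \<le> k"
    and half: "2 * k * c \<le> a"
    and ne: "\<Omega> \<noteq> {}"
  obtains \<omega> where "\<omega> \<in> \<Omega>" "card E * a \<le> 2 * card \<Omega> * card {e\<in>S \<omega>. \<forall>e'\<in>S \<omega>. e' \<noteq> e \<longrightarrow> \<not> sh e e'}"
proof -
  define I where "I \<omega> = {e\<in>S \<omega>. \<forall>e'\<in>S \<omega>. e' \<noteq> e \<longrightarrow> \<not> sh e e'}" for \<omega>
  define T where "T = {(e, e'). e \<in> E \<and> e' \<in> E \<and> e' \<noteq> e \<and> sh e e'}"
  have finT: "finite T" by (rule finite_subset[of _ "E \<times> E"]) (auto simp: T_def fin)
  have finS: "finite (S \<omega>)" if "\<omega> \<in> \<Omega>" for \<omega> using finite_subset[OF S[OF that] fin(2)] .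
  have "card (S \<omega>) \<le> card (I \<omega>) + card {t\<in>T. fst t \<in> S \<omega> \<and> snd t \<in> S \<omega>}" if w: "\<omega> \<in> \<Omega>" for \<omega>
  proof -
    have "card (S \<omega> - I \<omega>) \<le> card (fst ` {t\<in>T. fst t \<in> S \<omega> \<and> snd t \<in> S \<omega>})"
    proof (rule card_mono)
      show "finite (fst ` {t\<in>T. fst t \<in> S \<omega> \<and> snd t \<in> S \<omega>})" using finT by simp
      show "S \<omega> - I \<omega> \<subseteq> fst ` {t\<in>T. fst t \<in> S \<omega> \<and> snd t \<in> S \<omega>}"
      proof
        fix e assume e: "e \<in> S \<omega> - I \<omega>"
        then obtain e' where e': "e' \<in> S \<omega>" "e' \<noteq> e" "sh e e'" by (auto simp: I_def)
        hence "(e, e') \<in> {t\<in>T. fst t \<in> S \<omega> \<and> snd t \<in> S \<omega>}" using e S[OF w] by (auto simp: T_def)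
        thus "e \<in> fst ` {t\<in>T. fst t \<in> S \<omega> \<and> snd t \<in> S \<omega>}" by force
      qed
    qed
    also have "\<dots> \<le> card {t\<in>T. fst t \<in> S \<omega> \<and> snd t \<in> S \<omega>}" by (rule card_image_le) (use finT in simp)
    finally have "card (S \<omega> - I \<omega>) \<le> card {t\<in>T. fst t \<in> S \<omega> \<and> snd t \<in> S \<omega>}" .
    moreover have "I \<omega> \<subseteq> S \<omega>" by (auto simp: I_def)
    hence "card (S \<omega> - I \<omega>) = card (S \<omega>) - card (I \<omega>)" "card (I \<omega>) \<le> card (S \<omega>)"
      using finS[OF w] finite_subset by (auto intro: card_Diff_subset card_mono)
    ultimately show ?thesis by linarith
  qed
  hence "(\<Sum>\<omega>\<in>\<Omega>. card (S \<omega>)) \<le> (\<Sum>\<omega>\<in>\<Omega>. card (I \<omega>) + card {t\<in>T. fst t \<in> S \<omega> \<and> snd t \<in> S \<omega>})" by (rule sum_mono)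
  moreover have "card E * a \<le> (\<Sum>\<omega>\<in>\<Omega>. card (S \<omega>))"
  proof -
    have "card E * a = (\<Sum>e\<in>E. a)" by simp
    also have "\<dots> \<le> (\<Sum>e\<in>E. card {\<omega>\<in>\<Omega>. e \<in> S \<omega>})" by (rule sum_mono[OF one])
    also have "\<dots> = (\<Sum>\<omega>\<in>\<Omega>. card {e\<in>E. e \<in> S \<omega>})" by (rule sum_multicount_gen) (use fin in auto)
    also have "\<dots> = (\<Sum>\<omega>\<in>\<Omega>. card (S \<omega>))"
    proof (rule sum.cong[OF refl])
      fix \<omega> assume "\<omega> \<in> \<Omega>"
      hence "{e\<in>E. e \<in> S \<omega>} = S \<omega>" using S by blast
      thus "card {e\<in>E. e \<in> S \<omega>} = card (S \<omega>)" by simp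
    qed
    finally show ?thesis .
  qed
  moreover have "(\<Sum>\<omega>\<in>\<Omega>. card {t\<in>T. fst t \<in> S \<omega> \<and> snd t \<in> S \<omega>}) \<le> card E * (k * c)"
  proof -
    have "(\<Sum>\<omega>\<in>\<Omega>. card {t\<in>T. fst t \<in> S \<omega> \<and> snd t \<in> S \<omega>}) = (\<Sum>t\<in>T. card {\<omega>\<in>\<Omega>. fst t \<in> S \<omega> \<and> snd t \<in> S \<omega>})"
      by (rule sum_multicount_gen[symmetric]) (use fin finT in auto)
    also have "\<dots> \<le> (\<Sum>t\<in>T. c)" by (rule sum_mono) (auto simp: T_def intro!: two)
    also have "\<dots> = card T * c" by simp
    also have "\<dots> \<le> card E * k * c"
    proof (rule mult_le_mono1)
      have "T = (SIGMA e:E. {e'\<in>E. e' \<noteq> e \<and> sh e e'})" by (auto simp: T_def)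
      hence "card T = (\<Sum>e\<in>E. card {e'\<in>E. e' \<noteq> e \<and> sh e e'})" using fin by simp
      also have "\<dots> \<le> (\<Sum>e\<in>E. k)" by (intro sum_mono deg)
      finally show "card T \<le> card E * k" by simp
    qed
    finally show ?thesis by (simp add: mult.assoc)
  qed
  ultimately have main: "card E * a \<le> (\<Sum>\<omega>\<in>\<Omega>. card (I \<omega>)) + card E * (k * c)" by (simp only: sum.distrib)
  have "card E * (2 * (k * c)) \<le> card E * a" using half by (intro mult_le_mono2) simp
  hence "card E * a \<le> 2 * (\<Sum>\<omega>\<in>\<Omega>. card (I \<omega>))" using main unfolding mult.left_commute[of _ 2] by linarith
  moreover have "\<exists>\<omega>\<in>\<Omega>. (\<Sum>\<omega>\<in>\<Omega>. card (I \<omega>)) \<le> card \<Omega> * card (I \<omega>)"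
  proof -
    have "Max ((\<lambda>\<omega>. card (I \<omega>)) ` \<Omega>) \<in> (\<lambda>\<omega>. card (I \<omega>)) ` \<Omega>" using fin ne by (intro Max_in) auto
    then obtain \<omega> where w: "\<omega> \<in> \<Omega>" "Max ((\<lambda>\<omega>. card (I \<omega>)) ` \<Omega>) = card (I \<omega>)" by blast
    have "(\<Sum>\<omega>\<in>\<Omega>. card (I \<omega>)) \<le> (\<Sum>\<omega>'\<in>\<Omega>. card (I \<omega>))"
      unfolding w(2)[symmetric] using fin by (intro sum_mono Max_ge) auto
    thus ?thesis using w(1) by auto
  qed
  ultimately obtain \<omega> where w: "\<omega> \<in> \<Omega>" "card E * a \<le> 2 * (card \<Omega> * card (I \<omega>))" by (meson le_trans mult_le_mono2)
  show thesis by (rule that[OF w(1)]) (use w(2) in \<open>simp add: I_def mult.assoc\<close>)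
qed

section \<open>Selecting triangles by a hash function\<close>

definition hash :: "(nat \<times> nat \<Rightarrow> int) \<Rightarrow> nat list \<Rightarrow> nat \<Rightarrow> int" where
  "hash \<alpha> x r = (\<Sum>i<length x. \<alpha> (i, r) * int (x ! i))"

text \<open>A linear part shared by all three coordinates of a triple, and independent shifts for the first and the second coordinate.
  The value of the third coordinate is then determined by the constant sum.\<close>

definition hash_params :: "nat \<Rightarrow> nat \<Rightarrow> nat \<Rightarrow> ((nat \<times> nat \<Rightarrow> int) \<times> (nat \<Rightarrow> int) \<times> (nat \<Rightarrow> int)) set" where
  "hash_params n \<kappa> Q = PiE ({..<n} \<times> {..<\<kappa>}) (\<lambda>_. {0..<int Q})
     \<times> PiE {..<\<kappa>} (\<lambda>_. {0..<int Q}) \<times> PiE {..<\<kappa>} (\<lambda>_. {0..<int Q})"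

definition hashes_to :: "nat \<Rightarrow> nat \<Rightarrow> (nat \<times> nat \<Rightarrow> int) \<Rightarrow> (nat \<Rightarrow> int) \<Rightarrow> nat list \<Rightarrow> (nat \<Rightarrow> int) \<Rightarrow> bool" where
  "hashes_to Q \<kappa> \<alpha> \<beta> x b \<longleftrightarrow> (\<forall>r<\<kappa>. int Q dvd hash \<alpha> x r + \<beta> r - b r)"

definition offset :: "nat \<Rightarrow> nat \<Rightarrow> (nat \<times> nat \<Rightarrow> int) \<Rightarrow> nat list \<Rightarrow> (nat \<Rightarrow> int) \<Rightarrow> nat \<Rightarrow> int" where
  "offset Q \<kappa> \<alpha> x b = restrict (\<lambda>r. (b r - hash \<alpha> x r) mod int Q) {..<\<kappa>}"

lemma hashes_to_offset: "hashes_to Q \<kappa> \<alpha> (offset Q \<kappa> \<alpha> x b) x b"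
  unfolding hashes_to_def
proof (intro allI impI)
  fix r assume r: "r < \<kappa>"
  have "int Q dvd - ((b r - hash \<alpha> x r) - (b r - hash \<alpha> x r) mod int Q)"
    unfolding dvd_minus_iff by (rule dvd_minus_mod)
  also have "- ((b r - hash \<alpha> x r) - (b r - hash \<alpha> x r) mod int Q) = hash \<alpha> x r + offset Q \<kappa> \<alpha> x b r - b r"
    using r by (simp add: offset_def)
  finally show "int Q dvd hash \<alpha> x r + offset Q \<kappa> \<alpha> x b r - b r" .
qed

lemma hashes_to_imp_offset:
  assumes "hashes_to Q \<kappa> \<alpha> \<beta> x b" and \<beta>: "\<beta> \<in> PiE {..<\<kappa>} (\<lambda>_. {0..<int Q})"
  shows "\<beta> = offset Q \<kappa> \<alpha> x b"
proof (rule extensionalityI[of _ "{..<\<kappa>}"])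
  show "\<beta> \<in> extensional {..<\<kappa>}" using \<beta> by (simp add: PiE_def)
  show "offset Q \<kappa> \<alpha> x b \<in> extensional {..<\<kappa>}" by (simp add: offset_def)
  fix r assume r: "r \<in> {..<\<kappa>}"
  have "int Q dvd hash \<alpha> x r + \<beta> r - b r" using assms(1) r by (simp add: hashes_to_def)
  also have "hash \<alpha> x r + \<beta> r - b r = \<beta> r - (b r - hash \<alpha> x r)" by simp
  finally have "\<beta> r mod int Q = (b r - hash \<alpha> x r) mod int Q" by (simp only: mod_eq_dvd_iff)
  moreover have "\<beta> r \<in> {0..<int Q}" by (rule PiE_mem[OF \<beta> r])
  ultimately show "\<beta> r = offset Q \<kappa> \<alpha> x b r" using r by (simp add: offset_def)
qed

text \<open>The entries are below \<open>Q / 2\<close>, so the congruence cannot wrap around. The factor \<open>2\<close> stems from a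
  shared third coordinate: the hash values of the first two coordinates add up to twice the bucket.\<close>

lemma eq_if_dvd_double:
  assumes "b \<in> PiE {..<\<kappa>} (\<lambda>_. {0..<int q})" "b' \<in> PiE {..<\<kappa>} (\<lambda>_. {0..<int q})" "2 * q \<le> Q"
    and dvd: "\<And>r. r < \<kappa> \<Longrightarrow> int Q dvd 2 * (b r - b' r)"
  shows "b = b'"
proof (rule extensionalityI[of _ "{..<\<kappa>}"])
  show "b \<in> extensional {..<\<kappa>}" "b' \<in> extensional {..<\<kappa>}" using assms(1,2) by (simp_all add: PiE_def)
  fix r assume r: "r \<in> {..<\<kappa>}"
  have "0 \<le> b r" "b r < int q" "0 \<le> b' r" "b' r < int q"
    using PiE_mem[OF assms(1) r] PiE_mem[OF assms(2) r] by simp_all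
  hence "\<bar>b r - b' r\<bar> < int q" by linarith
  hence "\<bar>2 * (b r - b' r)\<bar> < int (2 * q)" by (simp only: abs_mult) simp
  also have "int (2 * q) \<le> int Q" using assms(3) by (simp only: of_nat_le_iff)
  finally have "\<bar>2 * (b r - b' r)\<bar> < int Q" .
  moreover have "int Q dvd 2 * (b r - b' r)" using dvd r by simp
  ultimately have "2 * (b r - b' r) = 0" using dvd_imp_le_int[of "2 * (b r - b' r)" "int Q"] by linarith
  thus "b r = b' r" by simp
qed

text \<open>Linear part and bucket may be prescribed, and they determine the shifts.\<close>

lemma card_selecting_params_ge:
  assumes B: "B \<subseteq> PiE {..<\<kappa>} (\<lambda>_. {0..<int q})" and q: "2 * q \<le> Q" "Q \<ge> 1"
  shows "card B * Q ^ (n * \<kappa>) \<le> card {\<omega>\<in>hash_params n \<kappa> Q. \<exists>b\<in>B.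
    hashes_to Q \<kappa> (fst \<omega>) (fst (snd \<omega>)) x b \<and> hashes_to Q \<kappa> (fst \<omega>) (snd (snd \<omega>)) y b}"
proof -
  define A where "A = PiE ({..<n} \<times> {..<\<kappa>}) (\<lambda>_. {0..<int Q})"
  define g where "g = (\<lambda>(b, \<alpha>). (\<alpha>, offset Q \<kappa> \<alpha> x b, offset Q \<kappa> \<alpha> y b))"
  have "card (B \<times> A) \<le> card {\<omega>\<in>hash_params n \<kappa> Q. \<exists>b\<in>B.
    hashes_to Q \<kappa> (fst \<omega>) (fst (snd \<omega>)) x b \<and> hashes_to Q \<kappa> (fst \<omega>) (snd (snd \<omega>)) y b}"
  proof (rule card_inj_on_le[of g])
    have off: "offset Q \<kappa> \<alpha> x b \<in> PiE {..<\<kappa>} (\<lambda>_. {0..<int Q})" for \<alpha> x b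
      unfolding offset_def restrict_PiE_iff 
      by (intro ballI) (simp only: atLeastLessThan_iff, use q(2) in simp)
    show "g ` (B \<times> A) \<subseteq> {\<omega>\<in>hash_params n \<kappa> Q. \<exists>b\<in>B.
      hashes_to Q \<kappa> (fst \<omega>) (fst (snd \<omega>)) x b \<and> hashes_to Q \<kappa> (fst \<omega>) (snd (snd \<omega>)) y b}"
    proof (rule image_subsetI)
      fix s assume "s \<in> B \<times> A"
      then obtain b \<alpha> where s: "s = (b, \<alpha>)" "b \<in> B" "\<alpha> \<in> A" by blast
      show "g s \<in> {\<omega>\<in>hash_params n \<kappa> Q. \<exists>b\<in>B.
        hashes_to Q \<kappa> (fst \<omega>) (fst (snd \<omega>)) x b \<and> hashes_to Q \<kappa> (fst \<omega>) (snd (snd \<omega>)) y b}"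
        unfolding s(1) g_def prod.case mem_Collect_eq fst_conv snd_conv hash_params_def
        by (intro conjI SigmaI off bexI[OF _ s(2)] hashes_to_offset s(3)[unfolded A_def])
    qed
    show "inj_on g (B \<times> A)"
    proof (rule inj_onI)
      fix s s' assume ss: "s \<in> B \<times> A" "s' \<in> B \<times> A" "g s = g s'"
      obtain b \<alpha> where s1: "b \<in> B" "s = (b, \<alpha>)" using ss(1) by (rule SigmaE)
      obtain b' \<alpha>' where s2: "b' \<in> B" "s' = (b', \<alpha>')" using ss(2) by (rule SigmaE)
      note s = s1(2) s2(2) s1(1) s2(1)
      have eq: "\<alpha> = \<alpha>'" "offset Q \<kappa> \<alpha> x b = offset Q \<kappa> \<alpha>' x b'"
        using ss(3) unfolding g_def s(1,2) prod.case prod.inject by blast+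
      have "b = b'"
      proof (rule eq_if_dvd_double)
        show "b \<in> PiE {..<\<kappa>} (\<lambda>_. {0..<int q})" "b' \<in> PiE {..<\<kappa>} (\<lambda>_. {0..<int q})" using B s(3,4) by blast+
        show "2 * q \<le> Q" by (rule q(1))
        fix r assume r: "r < \<kappa>"
        have eq': "offset Q \<kappa> \<alpha> x b = offset Q \<kappa> \<alpha> x b'" using eq(2) unfolding eq(1)[symmetric] .
        note h = hashes_to_offset[unfolded hashes_to_def, rule_format, OF r]
        have h1: "int Q dvd hash \<alpha> x r + offset Q \<kappa> \<alpha> x b r - b r" by (rule h)
        have h2: "int Q dvd hash \<alpha> x r + offset Q \<kappa> \<alpha> x b r - b' r" unfolding eq' by (rule h)
        have "int Q dvd (hash \<alpha> x r + offset Q \<kappa> \<alpha> x b r - b' r) - (hash \<alpha> x r + offset Q \<kappa> \<alpha> x b r - b r)"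
          by (rule dvd_diff[OF h2 h1])
        also have "\<dots> = b r - b' r" by linarith
        finally have "int Q dvd b r - b' r" .
        thus "int Q dvd 2 * (b r - b' r)" by (rule dvd_mult)
      qed
      thus "s = s'" by (simp add: s(1,2) eq(1))
    qed
    show "finite {\<omega>\<in>hash_params n \<kappa> Q. \<exists>b\<in>B.
      hashes_to Q \<kappa> (fst \<omega>) (fst (snd \<omega>)) x b \<and> hashes_to Q \<kappa> (fst \<omega>) (snd (snd \<omega>)) y b}"
      by (rule finite_subset[OF Collect_restrict]) (simp add: hash_params_def finite_PiE)
  qed
  moreover have "card (B \<times> A) = card B * Q ^ (n * \<kappa>)"
    by (simp add: card_cartesian_product A_def card_PiE)
  ultimately show ?thesis by simp
qed

lemma card_selecting_params_le:
  assumes B: "finite B" and W: "finite W"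
    and imp: "\<And>\<omega> b. \<omega> \<in> hash_params n \<kappa> Q \<Longrightarrow> b \<in> B \<Longrightarrow> hashes_to Q \<kappa> (fst \<omega>) (fst (snd \<omega>)) x b \<Longrightarrow>
      hashes_to Q \<kappa> (fst \<omega>) (snd (snd \<omega>)) y b \<Longrightarrow> P \<omega> \<Longrightarrow> fst \<omega> \<in> W"
  shows "card {\<omega>\<in>hash_params n \<kappa> Q. (\<exists>b\<in>B. hashes_to Q \<kappa> (fst \<omega>) (fst (snd \<omega>)) x b \<and>
    hashes_to Q \<kappa> (fst \<omega>) (snd (snd \<omega>)) y b) \<and> P \<omega>} \<le> card B * card W"
proof -
  define g where "g = (\<lambda>(b, \<alpha>). (\<alpha>, offset Q \<kappa> \<alpha> x b, offset Q \<kappa> \<alpha> y b))"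
  have "{\<omega>\<in>hash_params n \<kappa> Q. (\<exists>b\<in>B. hashes_to Q \<kappa> (fst \<omega>) (fst (snd \<omega>)) x b \<and>
    hashes_to Q \<kappa> (fst \<omega>) (snd (snd \<omega>)) y b) \<and> P \<omega>} \<subseteq> g ` (B \<times> W)"
  proof
    fix \<omega> assume "\<omega> \<in> {\<omega>\<in>hash_params n \<kappa> Q. (\<exists>b\<in>B. hashes_to Q \<kappa> (fst \<omega>) (fst (snd \<omega>)) x b \<and>
      hashes_to Q \<kappa> (fst \<omega>) (snd (snd \<omega>)) y b) \<and> P \<omega>}"
    then obtain b where b: "\<omega> \<in> hash_params n \<kappa> Q" "b \<in> B" "hashes_to Q \<kappa> (fst \<omega>) (fst (snd \<omega>)) x b"
      "hashes_to Q \<kappa> (fst \<omega>) (snd (snd \<omega>)) y b" "P \<omega>" by blast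
    have "fst (snd \<omega>) = offset Q \<kappa> (fst \<omega>) x b" "snd (snd \<omega>) = offset Q \<kappa> (fst \<omega>) y b"
      using b(1) unfolding hash_params_def mem_Times_iff
      by (blast intro: hashes_to_imp_offset[OF b(3)] hashes_to_imp_offset[OF b(4)])+
    hence "\<omega> = g (b, fst \<omega>)" by (simp add: g_def prod_eq_iff)
    moreover have "(b, fst \<omega>) \<in> B \<times> W" using b(2) imp[OF b] by simp
    ultimately show "\<omega> \<in> g ` (B \<times> W)" by (rule image_eqI)
  qed
  hence "card {\<omega>\<in>hash_params n \<kappa> Q. (\<exists>b\<in>B. hashes_to Q \<kappa> (fst \<omega>) (fst (snd \<omega>)) x b \<and>
    hashes_to Q \<kappa> (fst \<omega>) (snd (snd \<omega>)) y b) \<and> P \<omega>} \<le> card (g ` (B \<times> W))"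
    using B W by (intro card_mono) auto
  also have "\<dots> \<le> card (B \<times> W)" using B W by (intro card_image_le) auto
  finally show ?thesis by (simp only: card_cartesian_product)
qed

text \<open>Two distinct words that fall into the same bucket under the same shift restrict the linear part by one collision
  for each of the \<open>\<kappa>\<close> hash values.\<close>

lemma hash_collisions_list:
  fixes x x' :: "nat list" and p e \<kappa> :: nat
  defines "Q \<equiv> p ^ e" and "n \<equiv> length x"
  assumes p: "prime p" and x: "x \<noteq> x'" "length x' = length x" "set x \<subseteq> {..<p}" "set x' \<subseteq> {..<p}"
  obtains W where "finite W" "card W \<le> Q ^ ((n - 1) * \<kappa>)"
    "\<And>\<alpha> \<beta> b. \<alpha> \<in> PiE ({..<n} \<times> {..<\<kappa>}) (\<lambda>_. {0..<int Q}) \<Longrightarrow> hashes_to Q \<kappa> \<alpha> \<beta> x b \<Longrightarrow> hashes_to Q \<kappa> \<alpha> \<beta> x' b \<Longrightarrow> \<alpha> \<in> W"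
proof -
  have "\<exists>i0<n. x ! i0 \<noteq> x' ! i0"
  proof (rule ccontr)
    assume "\<not> ?thesis"
    hence "x = x'" by (intro nth_equalityI) (simp_all add: x(2) n_def)
    thus False using x(1) by contradiction
  qed
  then obtain i0 where i0: "i0 < n" "x ! i0 \<noteq> x' ! i0" by blast
  define d where "d i = int (x ! i) - int (x' ! i)" for i
  have "x ! i0 \<in> set x" "x' ! i0 \<in> set x'" using i0(1) x(2) by (simp_all add: n_def)
  hence lt: "x ! i0 < p" "x' ! i0 < p" using x(3,4) by blast+
  have d: "d i0 \<noteq> 0" using i0(2) by (simp add: d_def)
  have d': "\<bar>d i0\<bar> < int p" using lt unfolding d_def by linarith
  define W where "W = {\<alpha>\<in>PiE ({..<n} \<times> {..<\<kappa>}) (\<lambda>_. {0..<int Q}). \<forall>r<\<kappa>. int Q dvd (\<Sum>i<n. \<alpha> (i, r) * d i)}"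
  have "card W * Q ^ \<kappa> \<le> Q ^ (n * \<kappa>)"
    unfolding W_def Q_def by (rule hash_collisions[where d = d and ?i0.0 = i0, OF p i0(1) d d'])
  also have "\<dots> = Q ^ ((n - 1) * \<kappa>) * Q ^ \<kappa>"
    using i0(1) by (cases n) (auto simp: power_add[symmetric] add.commute)
  finally have card: "card W \<le> Q ^ ((n - 1) * \<kappa>)" 
  proof (rule mult_le_cancel2[THEN iffD1, THEN mp])
    show "0 < Q ^ \<kappa>" using prime_gt_0_nat[OF p] by (simp add: Q_def)
  qed
  show thesis
  proof (rule that[OF _ card])
    show "finite W" unfolding W_def by (rule finite_subset[OF Collect_restrict]) (simp add: finite_PiE)
    fix \<alpha> \<beta> b assume a: "\<alpha> \<in> PiE ({..<n} \<times> {..<\<kappa>}) (\<lambda>_. {0..<int Q})" and h: "hashes_to Q \<kappa> \<alpha> \<beta> x b" "hashes_to Q \<kappa> \<alpha> \<beta> x' b"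
    have "int Q dvd (\<Sum>i<n. \<alpha> (i, r) * d i)" if r: "r < \<kappa>" for r
    proof -
      have "int Q dvd (hash \<alpha> x r + \<beta> r - b r) - (hash \<alpha> x' r + \<beta> r - b r)"
        by (rule dvd_diff[OF h(1)[unfolded hashes_to_def, rule_format, OF r] h(2)[unfolded hashes_to_def, rule_format, OF r]])
      also have "(hash \<alpha> x r + \<beta> r - b r) - (hash \<alpha> x' r + \<beta> r - b r) = hash \<alpha> x r - hash \<alpha> x' r" by simp
      also have "\<dots> = (\<Sum>i<n. \<alpha> (i, r) * d i)"
        by (simp only: hash_def x(2) n_def d_def right_diff_distrib sum_subtractf)
      finally show ?thesis .
    qed
    thus "\<alpha> \<in> W" unfolding W_def using a by simp
  qed
qed

lemma triangle_system_length:
  assumes "(x, y, z) \<in> triangle_system m A"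
  shows "length x = size A" "length y = size A" "length z = size A"
proof -
  have "mset x = A" "mset y = A" "mset z = A" using assms by (simp_all add: triangle_system_def)
  thus "length x = size A" "length y = size A" "length z = size A" by (simp_all only: size_mset[symmetric])
qed

lemma triangle_system_hash:
  assumes "(x, y, z) \<in> triangle_system m A"
  shows "hash \<alpha> x r + hash \<alpha> y r + hash \<alpha> z r = int m * (\<Sum>i<size A. \<alpha> (i, r))"
proof -
  note len = triangle_system_length[OF assms]
  have "hash \<alpha> x r + hash \<alpha> y r + hash \<alpha> z r = (\<Sum>i<size A. \<alpha> (i, r) * int (x ! i + y ! i + z ! i))"
    unfolding hash_def len by (simp only: sum.distrib[symmetric] of_nat_add distrib_left)
  also have "\<dots> = (\<Sum>i<size A. \<alpha> (i, r) * int m)"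
  proof (rule sum.cong[OF refl])
    fix i assume "i \<in> {..<size A}"
    hence "x ! i + y ! i + z ! i = m" using assms by (simp add: triangle_system_def)
    thus "\<alpha> (i, r) * int (x ! i + y ! i + z ! i) = \<alpha> (i, r) * int m" by (simp only:)
  qed
  finally show ?thesis by (simp only: sum_distrib_left mult.commute)
qed

definition adjacent :: "'a \<times> 'a \<times> 'a \<Rightarrow> 'a \<times> 'a \<times> 'a \<Rightarrow> bool" where
  "adjacent e e' \<longleftrightarrow> fst e = fst e' \<or> fst (snd e) = fst (snd e') \<or> snd (snd e) = snd (snd e')"

lemma triangle_system_third:
  assumes "(x, y, z) \<in> triangle_system m A" "(x', y', z') \<in> triangle_system m A"
    and "x = x' \<and> y = y' \<or> x = x' \<and> z = z' \<or> y = y' \<and> z = z'"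
  shows "x = x' \<and> y = y' \<and> z = z'"
proof -
  note len = triangle_system_length[OF assms(1)] triangle_system_length[OF assms(2)]
  have s: "x ! i + y ! i + z ! i = x' ! i + y' ! i + z' ! i" if "i < size A" for i
    using assms(1,2) that by (simp add: triangle_system_def)
  show ?thesis using assms(3)
  proof (elim disjE conjE)
    assume e: "x = x'" "y = y'"
    have "z = z'"
    proof (rule nth_equalityI)
      show "length z = length z'" using len by simp
      show "z ! i = z' ! i" if "i < length z" for i using s[of i] that len unfolding e by simp
    qed
    thus ?thesis using e by simp
  next
    assume e: "x = x'" "z = z'"
    have "y = y'"
    proof (rule nth_equalityI)
      show "length y = length y'" using len by simp
      show "y ! i = y' ! i" if "i < length y" for i using s[of i] that len unfolding e by simp
    qed
    thus ?thesis using e by simp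
  next
    assume e: "y = y'" "z = z'"
    have "x = x'"
    proof (rule nth_equalityI)
      show "length x = length x'" using len by simp
      show "x ! i = x' ! i" if "i < length x" for i using s[of i] that len unfolding e by simp
    qed
    thus ?thesis using e by simp
  qed
qed

lemma adjacent_same_bucket:
  assumes e: "(x, y, z) \<in> triangle_system m A" "(x', y', z') \<in> triangle_system m A" and sh: "adjacent (x, y, z) (x', y', z')"
    and h: "hashes_to Q \<kappa> \<alpha> \<beta> x b" "hashes_to Q \<kappa> \<alpha> \<beta>' y b" "hashes_to Q \<kappa> \<alpha> \<beta> x' b'" "hashes_to Q \<kappa> \<alpha> \<beta>' y' b'"
    and b: "b \<in> PiE {..<\<kappa>} (\<lambda>_. {0..<int q})" "b' \<in> PiE {..<\<kappa>} (\<lambda>_. {0..<int q})" and q: "2 * q \<le> Q"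
  shows "b = b'"
proof (rule eq_if_dvd_double[OF b q])
  fix r assume r: "r < \<kappa>"
  note h = h[unfolded hashes_to_def, rule_format, OF r]
  from sh consider "x = x'" | "y = y'" | "z = z'" by (auto simp: adjacent_def)
  thus "int Q dvd 2 * (b r - b' r)"
  proof cases
    case 1
    have "int Q dvd (hash \<alpha> x r + \<beta> r - b' r) - (hash \<alpha> x r + \<beta> r - b r)" using h(3)[folded 1] h(1) by (rule dvd_diff)
    also have "\<dots> = b r - b' r" by simp
    finally show ?thesis by (rule dvd_mult)
  next
    case 2
    have "int Q dvd (hash \<alpha> y r + \<beta>' r - b' r) - (hash \<alpha> y r + \<beta>' r - b r)" using h(4)[folded 2] h(2) by (rule dvd_diff)
    also have "\<dots> = b r - b' r" by simp
    finally show ?thesis by (rule dvd_mult)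
  next
    case 3
    have "int Q dvd ((hash \<alpha> x' r + \<beta> r - b' r) + (hash \<alpha> y' r + \<beta>' r - b' r)) - ((hash \<alpha> x r + \<beta> r - b r) + (hash \<alpha> y r + \<beta>' r - b r))"
      by (intro dvd_diff dvd_add h)
    also have "\<dots> = 2 * (b r - b' r)"
      using triangle_system_hash[OF e(1), of \<alpha> r] triangle_system_hash[OF e(2), of \<alpha> r] unfolding 3 mult_2 by linarith
    finally show ?thesis .
  qed
qed

text \<open>Two adjacent triples that are both selected lie in the same bucket. They differ in the first or in the second coordinate, since two
  coordinates determine the third, and there the linear part has a collision.\<close>

lemma card_both_selected:
  fixes p e \<kappa> m :: nat and A :: "nat multiset"
  defines "Q \<equiv> p ^ e" and "n \<equiv> size A"
  defines "sel \<equiv> \<lambda>\<omega> B t. \<exists>b\<in>B. hashes_to Q \<kappa> (fst \<omega>) (fst (snd \<omega>)) (fst t) b \<and> hashes_to Q \<kappa> (fst \<omega>) (snd (snd \<omega>)) (fst (snd t)) b"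
  assumes p: "prime p" and A: "set_mset A \<subseteq> {..<p}" and B: "B \<subseteq> PiE {..<\<kappa>} (\<lambda>_. {0..<int q})" and q: "2 * q \<le> Q"
    and t: "t \<in> triangle_system m A" "t' \<in> triangle_system m A" "t \<noteq> t'" "adjacent t t'"
  shows "card {\<omega>\<in>hash_params n \<kappa> Q. sel \<omega> B t \<and> sel \<omega> B t'} \<le> card B * Q ^ ((n - 1) * \<kappa>)"
proof -
  obtain x y z where xyz: "t = (x, y, z)" by (cases t) blast
  obtain x' y' z' where xyz': "t' = (x', y', z')" by (cases t') blast
  note tt = t(1)[unfolded xyz] t(2)[unfolded xyz'] t(4)[unfolded xyz xyz']
  have ms: "mset x = A" "mset y = A" "mset x' = A" "mset y' = A"
    using tt(1,2) by (simp_all add: triangle_system_def)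
  have len: "length u = n" if "mset u = A" for u unfolding n_def that[symmetric] by simp
  have set: "set u \<subseteq> {..<p}" if "mset u = A" for u using A unfolding that[symmetric] by simp
  have ne: "x \<noteq> x' \<or> y \<noteq> y'" using triangle_system_third[OF tt(1,2)] t(3) unfolding xyz xyz' by blast
  have finB: "finite B" by (rule finite_subset[OF B]) (simp add: finite_PiE)
  have same: "b = b'" if "b \<in> B" "b' \<in> B" "hashes_to Q \<kappa> \<alpha> \<beta> x b" "hashes_to Q \<kappa> \<alpha> \<beta>' y b" "hashes_to Q \<kappa> \<alpha> \<beta> x' b'" "hashes_to Q \<kappa> \<alpha> \<beta>' y' b'" for b b' \<alpha> \<beta> \<beta>'
    by (rule adjacent_same_bucket[OF tt that(3,4,5,6) subsetD[OF B that(1)] subsetD[OF B that(2)] q])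
  obtain W where W: "finite W" "card W \<le> Q ^ ((n - 1) * \<kappa>)"
    "\<And>\<alpha> \<beta> \<beta>' b. \<alpha> \<in> PiE ({..<n} \<times> {..<\<kappa>}) (\<lambda>_. {0..<int Q}) \<Longrightarrow> hashes_to Q \<kappa> \<alpha> \<beta> x b \<Longrightarrow> hashes_to Q \<kappa> \<alpha> \<beta>' y b
      \<Longrightarrow> hashes_to Q \<kappa> \<alpha> \<beta> x' b \<Longrightarrow> hashes_to Q \<kappa> \<alpha> \<beta>' y' b \<Longrightarrow> \<alpha> \<in> W"
  proof (cases "x = x'")
    case False
    have l: "length x' = length x" using len[OF ms(1)] len[OF ms(3)] by simp
    obtain W where W: "finite W" "card W \<le> Q ^ ((n - 1) * \<kappa>)"
      "\<And>\<alpha> \<beta> b. \<alpha> \<in> PiE ({..<n} \<times> {..<\<kappa>}) (\<lambda>_. {0..<int Q}) \<Longrightarrow> hashes_to Q \<kappa> \<alpha> \<beta> x b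
        \<Longrightarrow> hashes_to Q \<kappa> \<alpha> \<beta> x' b \<Longrightarrow> \<alpha> \<in> W"
      by (rule hash_collisions_list[OF p False l set[OF ms(1)] set[OF ms(3)], of e \<kappa>, folded Q_def, unfolded len[OF ms(1)]]) (rule that)
    show thesis by (rule that[OF W(1,2)]) (rule W(3))
  next
    case True
    hence y: "y \<noteq> y'" using ne by blast
    have l: "length y' = length y" using len[OF ms(2)] len[OF ms(4)] by simp
    obtain W where W: "finite W" "card W \<le> Q ^ ((n - 1) * \<kappa>)"
      "\<And>\<alpha> \<beta> b. \<alpha> \<in> PiE ({..<n} \<times> {..<\<kappa>}) (\<lambda>_. {0..<int Q}) \<Longrightarrow> hashes_to Q \<kappa> \<alpha> \<beta> y b
        \<Longrightarrow> hashes_to Q \<kappa> \<alpha> \<beta> y' b \<Longrightarrow> \<alpha> \<in> W"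
      by (rule hash_collisions_list[OF p y l set[OF ms(2)] set[OF ms(4)], of e \<kappa>, folded Q_def, unfolded len[OF ms(2)]]) (rule that)
    show thesis by (rule that[OF W(1,2)]) (rule W(3))
  qed
  have "card {\<omega>\<in>hash_params n \<kappa> Q. sel \<omega> B t \<and> sel \<omega> B t'} \<le> card B * card W"
    unfolding sel_def xyz fst_conv snd_conv
  proof (rule card_selecting_params_le[OF finB W(1)])
    fix \<omega> b assume w: "\<omega> \<in> hash_params n \<kappa> Q" "b \<in> B" "hashes_to Q \<kappa> (fst \<omega>) (fst (snd \<omega>)) x b"
      "hashes_to Q \<kappa> (fst \<omega>) (snd (snd \<omega>)) y b"
      "\<exists>b\<in>B. hashes_to Q \<kappa> (fst \<omega>) (fst (snd \<omega>)) (fst t') b \<and> hashes_to Q \<kappa> (fst \<omega>) (snd (snd \<omega>)) (fst (snd t')) b"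
    then obtain b' where b': "b' \<in> B" "hashes_to Q \<kappa> (fst \<omega>) (fst (snd \<omega>)) x' b'" "hashes_to Q \<kappa> (fst \<omega>) (snd (snd \<omega>)) y' b'"
      unfolding xyz' fst_conv snd_conv by blast
    have "b = b'" by (rule same[OF w(2) b'(1) w(3,4) b'(2,3)])
    moreover have "fst \<omega> \<in> PiE ({..<n} \<times> {..<\<kappa>}) (\<lambda>_. {0..<int Q})" using w(1) unfolding hash_params_def mem_Times_iff by blast
    ultimately show "fst \<omega> \<in> W" using W(3) w(3,4) b'(2,3) by blast
  qed
  also have "\<dots> \<le> card B * Q ^ ((n - 1) * \<kappa>)" by (rule mult_le_mono2[OF W(2)])
  finally show ?thesis .
qed

text \<open>Select the triples whose first and second words are hashed to the same element of a progression-free set \<open>B\<close>, and keep the isolated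
  ones. Suppose that \<open>t1\<close>, \<open>t2\<close>, \<open>t3\<close> are kept and that the first, second and third word of them form a triple of the system. Its
  hash values satisfy \<open>b1 + b2 = 2 b3\<close> modulo \<open>Q\<close>, hence as integers, so the three buckets agree. The triple is therefore selected, and
  being adjacent to the isolated \<open>t1\<close>, \<open>t2\<close>, \<open>t3\<close> it coincides with all of them.

  The modulus \<open>Q\<close> is the least power of \<open>p\<close> for which \<open>Q ^ \<kappa>\<close> reaches \<open>6\<close> times the degree \<open>D\<close>: a triple has at most \<open>3 D\<close>
  neighbours, each selected along with it with probability at most \<open>Q^(-\<kappa>)\<close>, relative to the lower bound for its own selection. On average about \<open>card B / Q^\<kappa>\<close> triples
  are kept for every word, up to factors depending only on \<open>p\<close> and \<open>\<kappa>\<close>.\<close>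

theorem isolated_triangles:
  fixes p \<kappa> m :: nat and A :: "nat multiset"
  assumes p: "prime p" and \<kappa>: "\<kappa> \<ge> 1" and A: "set_mset A \<subseteq> {..<p}" "size A > 0" and ne: "triangle_system m A \<noteq> {}"
  obtains I Q where "I \<subseteq> triangle_system m A"
    "\<And>t1 t2 t3. t1 \<in> I \<Longrightarrow> t2 \<in> I \<Longrightarrow> t3 \<in> I \<Longrightarrow> (fst t1, fst (snd t2), snd (snd t3)) \<in> triangle_system m A \<Longrightarrow> t1 = t2 \<and> t2 = t3"
    "card (permutations_of_multiset A) \<le> 12 * (3 * p) ^ \<kappa> * \<kappa> * Q ^ 2 * card I"
    "Q ^ \<kappa> \<le> 6 * p ^ \<kappa> * p ^ size A" "Q \<ge> 1"
proof -
  define n where "n = size A"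
  define E where "E = triangle_system m A"
  have p2: "p \<ge> 2" by (rule prime_ge_2_nat[OF p])
  have finE: "finite E" unfolding E_def by (rule finite_triangle_system)
  obtain D where D: "D \<ge> 1" "card E = card (permutations_of_multiset A) * D"
    "\<And>e. e \<in> E \<Longrightarrow> card {e'\<in>E. fst e' = fst e} = D"
    "\<And>e. e \<in> E \<Longrightarrow> card {e'\<in>E. fst (snd e') = fst (snd e)} = D"
    "\<And>e. e \<in> E \<Longrightarrow> card {e'\<in>E. snd (snd e') = snd (snd e)} = D"
    using triangle_system_regular[OF ne] unfolding E_def by blast
  have Dle: "D \<le> p ^ n"
  proof -
    obtain t where t: "t \<in> E" using ne unfolding E_def by blast
    have "card {e'\<in>E. fst e' = fst t} \<le> card {xs. set xs \<subseteq> {..<p} \<and> length xs = n}"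
    proof (rule card_inj_on_le[of "\<lambda>e. fst (snd e)"])
      show "inj_on (\<lambda>e. fst (snd e)) {e'\<in>E. fst e' = fst t}"
      proof (rule inj_onI)
        fix u v assume uv: "u \<in> {e'\<in>E. fst e' = fst t}" "v \<in> {e'\<in>E. fst e' = fst t}" "fst (snd u) = fst (snd v)"
        obtain x y z x' y' z' where xyz: "u = (x, y, z)" "v = (x', y', z')" by (cases u, cases v) blast
        have "x = x' \<and> y = y' \<and> z = z'"
          using uv triangle_system_third[of x y z m A x' y' z'] unfolding xyz E_def by auto
        thus "u = v" by (simp add: xyz)
      qed
      show "(\<lambda>e. fst (snd e)) ` {e'\<in>E. fst e' = fst t} \<subseteq> {xs. set xs \<subseteq> {..<p} \<and> length xs = n}"
      proof (rule image_subsetI)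
        fix u assume u: "u \<in> {e'\<in>E. fst e' = fst t}"
        obtain x y z where xyz: "u = (x, y, z)" by (cases u) blast
        have "mset y = A" using u by (simp add: xyz E_def triangle_system_def)
        hence "set y \<subseteq> {..<p}" "length y = n" using A(1) unfolding n_def by auto
        thus "fst (snd u) \<in> {xs. set xs \<subseteq> {..<p} \<and> length xs = n}" by (simp add: xyz)
      qed
      show "finite {xs. set xs \<subseteq> {..<p} \<and> length xs = n}" by (rule finite_lists_length_eq) simp
    qed
    thus ?thesis unfolding D(3)[OF t] by (simp add: card_lists_length_eq)
  qed

  define e where "e = (LEAST e. 6 * D \<le> (p ^ e) ^ \<kappa>)"
  define Q where "Q = p ^ e"
  have "6 * D \<le> (p ^ (6 * D)) ^ \<kappa>"
  proof -
    have "6 * D \<le> p ^ (6 * D)" using power_gt_expt[of p "6 * D"] p2 by simp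
    also have "\<dots> \<le> (p ^ (6 * D)) ^ \<kappa>" using \<kappa> p2 by (intro self_le_power) auto
    finally show ?thesis .
  qed
  hence large: "6 * D \<le> Q ^ \<kappa>" unfolding Q_def e_def by (rule LeastI)
  have "e \<noteq> 0"
  proof
    assume "e = 0" thus False using large D(1) by (simp add: Q_def)
  qed
  then obtain e' where e': "e = Suc e'" by (cases e) auto
  have "(p ^ e') ^ \<kappa> < 6 * D" using not_less_Least[of e' "\<lambda>e. 6 * D \<le> (p ^ e) ^ \<kappa>"] e' unfolding e_def[symmetric] by simp
  hence Qle: "Q ^ \<kappa> \<le> p ^ \<kappa> * (6 * D)" by (simp add: Q_def e' power_mult_distrib)
  have "p ^ 1 \<le> p ^ e" using p2 e' by (intro power_increasing) auto
  hence Q2: "Q \<ge> 2" using p2 by (simp add: Q_def)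
  define q where "q = Q div 2"
  have q: "q \<ge> 1" "2 * q \<le> Q" "Q \<le> 3 * q" using Q2 by (auto simp: q_def)
  obtain B :: "(nat \<Rightarrow> int) set" where B: "B \<subseteq> PiE {..<\<kappa>} (\<lambda>_. {0..<int q})" "q ^ \<kappa> \<le> \<kappa> * q ^ 2 * card B"
    "\<And>b1 b2 b3. b1 \<in> B \<Longrightarrow> b2 \<in> B \<Longrightarrow> b3 \<in> B \<Longrightarrow> \<forall>r<\<kappa>. b1 r + b2 r = 2 * b3 r \<Longrightarrow> b1 = b2 \<and> b2 = b3"
    by (rule sphere_without_progressions[OF q(1) \<kappa>]) (rule that)

  define sel where "sel = (\<lambda>\<omega> B (t :: nat list \<times> nat list \<times> nat list). \<exists>b\<in>B. hashes_to Q \<kappa> (fst \<omega>) (fst (snd \<omega>)) (fst t) b \<and> hashes_to Q \<kappa> (fst \<omega>) (snd (snd \<omega>)) (fst (snd t)) b)"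
  define S where "S \<omega> = {t\<in>E. sel \<omega> B t}" for \<omega>
  define \<Omega> where "\<Omega> = hash_params n \<kappa> Q"
  have fin\<Omega>: "finite \<Omega>" by (simp add: \<Omega>_def hash_params_def finite_PiE)
  have card\<Omega>: "card \<Omega> = Q ^ (n * \<kappa>) * (Q ^ \<kappa> * Q ^ \<kappa>)"
    by (simp add: \<Omega>_def hash_params_def card_cartesian_product card_PiE)
  hence "card \<Omega> \<noteq> 0" using Q2 by simp
  hence ne\<Omega>: "\<Omega> \<noteq> {}" by auto
  obtain \<omega> where w: "\<omega> \<in> \<Omega>" "card E * (card B * Q ^ (n * \<kappa>)) \<le> 2 * card \<Omega> * card {t\<in>S \<omega>. \<forall>t'\<in>S \<omega>. t' \<noteq> t \<longrightarrow> \<not> adjacent t t'}"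
  proof (rule isolated_selection[OF fin\<Omega> finE, of S "card B * Q ^ (n * \<kappa>)" adjacent "card B * Q ^ ((n - 1) * \<kappa>)" "3 * D"])
    show "S \<omega> \<subseteq> E" for \<omega> by (auto simp: S_def)
    show "card B * Q ^ (n * \<kappa>) \<le> card {\<omega>\<in>\<Omega>. t \<in> S \<omega>}" if t: "t \<in> E" for t
    proof -
      have "{\<omega>\<in>\<Omega>. t \<in> S \<omega>} = {\<omega>\<in>hash_params n \<kappa> Q. sel \<omega> B t}" using t by (simp add: S_def \<Omega>_def)
      moreover have "card B * Q ^ (n * \<kappa>) \<le> card {\<omega>\<in>hash_params n \<kappa> Q. sel \<omega> B t}"
        unfolding sel_def by (rule card_selecting_params_ge[OF B(1) q(2)]) (use Q2 in simp)
      ultimately show ?thesis by (simp only:)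
    qed
    show "card {\<omega>\<in>\<Omega>. t \<in> S \<omega> \<and> t' \<in> S \<omega>} \<le> card B * Q ^ ((n - 1) * \<kappa>)" if t: "t \<in> E" "t' \<in> E" "t \<noteq> t'" "adjacent t t'" for t t'
    proof -
      have "{\<omega>\<in>\<Omega>. t \<in> S \<omega> \<and> t' \<in> S \<omega>} = {\<omega>\<in>hash_params n \<kappa> Q. sel \<omega> B t \<and> sel \<omega> B t'}" using t by (simp add: S_def \<Omega>_def)
      moreover have "card {\<omega>\<in>hash_params n \<kappa> Q. sel \<omega> B t \<and> sel \<omega> B t'} \<le> card B * Q ^ ((n - 1) * \<kappa>)"
        unfolding sel_def Q_def n_def
        by (rule card_both_selected[OF p A(1) B(1) q(2)[unfolded Q_def] t(1,2)[unfolded E_def] t(3,4)])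
      ultimately show ?thesis by (simp only:)
    qed
    show "card {t'\<in>E. t' \<noteq> t \<and> adjacent t t'} \<le> 3 * D" if t: "t \<in> E" for t
    proof -
      have "card {t'\<in>E. t' \<noteq> t \<and> adjacent t t'}
        \<le> card ({e'\<in>E. fst e' = fst t} \<union> ({e'\<in>E. fst (snd e') = fst (snd t)} \<union> {e'\<in>E. snd (snd e') = snd (snd t)}))"
        by (rule card_mono) (use finE in \<open>auto simp: adjacent_def\<close>)
      also have "\<dots> \<le> D + card ({e'\<in>E. fst (snd e') = fst (snd t)} \<union> {e'\<in>E. snd (snd e') = snd (snd t)})"
        using card_Un_le[of "{e'\<in>E. fst e' = fst t}"] unfolding D(3)[OF t] by blast
      also have "\<dots> \<le> D + (D + D)"
        using card_Un_le[of "{e'\<in>E. fst (snd e') = fst (snd t)}" "{e'\<in>E. snd (snd e') = snd (snd t)}"] unfolding D(4,5)[OF t] by simp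
      finally show ?thesis by simp
    qed
    show "2 * (3 * D) * (card B * Q ^ ((n - 1) * \<kappa>)) \<le> card B * Q ^ (n * \<kappa>)"
    proof -
      have "2 * (3 * D) * (card B * Q ^ ((n - 1) * \<kappa>)) = (6 * D) * (card B * Q ^ ((n - 1) * \<kappa>))" by simp
      also have "\<dots> \<le> Q ^ \<kappa> * (card B * Q ^ ((n - 1) * \<kappa>))" by (rule mult_le_mono1[OF large])
      also have "\<dots> = card B * (Q ^ \<kappa> * Q ^ ((n - 1) * \<kappa>))" by (rule mult.left_commute)
      also have "Q ^ \<kappa> * Q ^ ((n - 1) * \<kappa>) = Q ^ (n * \<kappa>)" using A(2) unfolding n_def[symmetric] by (cases n) (simp_all add: power_add)
      finally show ?thesis .
    qed
    show "\<Omega> \<noteq> {}" by (rule ne\<Omega>)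
  qed (rule that)
  define I where "I = {t\<in>S \<omega>. \<forall>t'\<in>S \<omega>. t' \<noteq> t \<longrightarrow> \<not> adjacent t t'}"
  have iso: "t' = t" if "t \<in> I" "t' \<in> S \<omega>" "adjacent t t'" for t t' using that unfolding I_def by blast
  show thesis
  proof (rule that[of I Q])
    show "I \<subseteq> triangle_system m A" by (auto simp: I_def S_def E_def)
    show "Q \<ge> 1" using Q2 by simp
    have "Q ^ \<kappa> \<le> p ^ \<kappa> * (6 * p ^ n)" by (rule order.trans[OF Qle mult_le_mono2[OF mult_le_mono2[OF Dle]]])
    thus "Q ^ \<kappa> \<le> 6 * p ^ \<kappa> * p ^ size A" unfolding n_def by (simp only: mult.assoc mult.left_commute)
    show "card (permutations_of_multiset A) \<le> 12 * (3 * p) ^ \<kappa> * \<kappa> * Q ^ 2 * card I"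
    proof -
      define X where "X = card (permutations_of_multiset A)"
      have "Q ^ (n * \<kappa>) * (X * D * card B) = card E * (card B * Q ^ (n * \<kappa>))" unfolding D(2) X_def by simp
      also have "\<dots> \<le> 2 * card \<Omega> * card I" unfolding I_def by (rule w(2))
      also have "\<dots> = Q ^ (n * \<kappa>) * (2 * (Q ^ \<kappa> * Q ^ \<kappa>) * card I)" unfolding card\<Omega> by simp
      finally have sel: "X * D * card B \<le> 2 * (Q ^ \<kappa> * Q ^ \<kappa>) * card I" using Q2 by simp
      have "Q ^ \<kappa> \<le> (3 * q) ^ \<kappa>" by (rule power_mono[OF q(3)]) simp
      also have "\<dots> = 3 ^ \<kappa> * q ^ \<kappa>" by (rule power_mult_distrib)
      also have "\<dots> \<le> 3 ^ \<kappa> * (\<kappa> * q ^ 2 * card B)" by (rule mult_le_mono2[OF B(2)])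
      also have "\<dots> \<le> 3 ^ \<kappa> * (\<kappa> * Q ^ 2 * card B)" using q(2) by (intro mult_le_mono power_mono) auto
      finally have dens: "Q ^ \<kappa> \<le> 3 ^ \<kappa> * (\<kappa> * Q ^ 2 * card B)" .
      have "(D * Q ^ \<kappa>) * X = X * D * Q ^ \<kappa>" by simp
      also have "\<dots> \<le> X * D * (3 ^ \<kappa> * (\<kappa> * Q ^ 2 * card B))" by (rule mult_le_mono2[OF dens])
      also have "\<dots> = 3 ^ \<kappa> * (\<kappa> * Q ^ 2) * (X * D * card B)" by simp
      also have "\<dots> \<le> 3 ^ \<kappa> * (\<kappa> * Q ^ 2) * (2 * (Q ^ \<kappa> * Q ^ \<kappa>) * card I)" by (rule mult_le_mono2[OF sel])
      also have "\<dots> = (3 ^ \<kappa> * (\<kappa> * Q ^ 2) * 2 * Q ^ \<kappa> * card I) * Q ^ \<kappa>" by simp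
      also have "\<dots> \<le> (3 ^ \<kappa> * (\<kappa> * Q ^ 2) * 2 * Q ^ \<kappa> * card I) * (p ^ \<kappa> * (6 * D))" by (rule mult_le_mono2[OF Qle])
      also have "\<dots> = (D * Q ^ \<kappa>) * (12 * (3 ^ \<kappa> * p ^ \<kappa>) * \<kappa> * Q ^ 2 * card I)" by simp
      finally have "X \<le> 12 * (3 ^ \<kappa> * p ^ \<kappa>) * \<kappa> * Q ^ 2 * card I" using D(1) Q2 by simp
      thus ?thesis unfolding X_def power_mult_distrib .
    qed
    fix t1 t2 t3 assume t: "t1 \<in> I" "t2 \<in> I" "t3 \<in> I" "(fst t1, fst (snd t2), snd (snd t3)) \<in> triangle_system m A"
    obtain x1 y1 z1 where t1: "t1 = (x1, y1, z1)" by (cases t1) blast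
    obtain x2 y2 z2 where t2: "t2 = (x2, y2, z2)" by (cases t2) blast
    obtain x3 y3 z3 where t3: "t3 = (x3, y3, z3)" by (cases t3) blast
    have S: "t1 \<in> S \<omega>" "t2 \<in> S \<omega>" "t3 \<in> S \<omega>" using t(1-3) unfolding I_def by blast+
    obtain \<alpha> \<beta> \<beta>' where wabc: "\<omega> = (\<alpha>, \<beta>, \<beta>')" by (cases \<omega>) blast
    obtain b1 where b1: "b1 \<in> B" "hashes_to Q \<kappa> \<alpha> \<beta> x1 b1" using S(1) by (auto simp: S_def sel_def wabc t1)
    obtain b2 where b2: "b2 \<in> B" "hashes_to Q \<kappa> \<alpha> \<beta>' y2 b2" using S(2) by (auto simp: S_def sel_def wabc t2)
    obtain b3 where b3: "b3 \<in> B" "hashes_to Q \<kappa> \<alpha> \<beta> x3 b3" "hashes_to Q \<kappa> \<alpha> \<beta>' y3 b3" using S(3) by (auto simp: S_def sel_def wabc t3)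
    have E3: "(x3, y3, z3) \<in> triangle_system m A" using S(3) by (simp add: S_def E_def t3)
    have E0: "(x1, y2, z3) \<in> triangle_system m A" using t(4) by (simp add: t1 t2 t3)
    have "b1 r + b2 r = 2 * b3 r" if r: "r < \<kappa>" for r
    proof -
      note h = b1(2)[unfolded hashes_to_def, rule_format, OF r] b2(2)[unfolded hashes_to_def, rule_format, OF r]
        b3(2)[unfolded hashes_to_def, rule_format, OF r] b3(3)[unfolded hashes_to_def, rule_format, OF r]
      have "int Q dvd ((hash \<alpha> x3 r + \<beta> r - b3 r) + (hash \<alpha> y3 r + \<beta>' r - b3 r)) - ((hash \<alpha> x1 r + \<beta> r - b1 r) + (hash \<alpha> y2 r + \<beta>' r - b2 r))"
        by (intro dvd_diff dvd_add h)
      also have "\<dots> = b1 r + b2 r - 2 * b3 r"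
        using triangle_system_hash[OF E3, of \<alpha> r] triangle_system_hash[OF E0, of \<alpha> r] unfolding mult_2 by linarith
      finally have dvd: "int Q dvd b1 r + b2 r - 2 * b3 r" .
      have bd: "0 \<le> b r" "b r < int q" if "b \<in> B" for b
        using PiE_mem[OF subsetD[OF B(1) that], of r] r by simp_all
      have "\<bar>b1 r + b2 r - 2 * b3 r\<bar> < int q + int q"
        using bd[OF b1(1)] bd[OF b2(1)] bd[OF b3(1)] unfolding mult_2 by linarith
      also have "int q + int q \<le> int Q" using q(2) by linarith
      finally have "\<bar>b1 r + b2 r - 2 * b3 r\<bar> < int Q" .
      hence "b1 r + b2 r - 2 * b3 r = 0" using dvd_imp_le_int[OF _ dvd] by linarith
      thus ?thesis by simp
    qed
    hence "b1 = b2 \<and> b2 = b3" by (intro B(3)[OF b1(1) b2(1) b3(1)]) blast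
    hence "sel \<omega> B (x1, y2, z3)" using b1 b2 unfolding sel_def wabc by auto
    hence S0: "(x1, y2, z3) \<in> S \<omega>" using E0 by (simp add: S_def E_def)
    have "(x1, y2, z3) = t1" by (rule iso[OF t(1) S0]) (simp add: adjacent_def t1)
    moreover have "(x1, y2, z3) = t2" by (rule iso[OF t(2) S0]) (simp add: adjacent_def t2)
    moreover have "(x1, y2, z3) = t3" by (rule iso[OF t(3) S0]) (simp add: adjacent_def t3)
    ultimately show "t1 = t2 \<and> t2 = t3" by simp
  qed
qed

section \<open>Large tricolored sets\<close>

definition residues :: "nat \<Rightarrow> nat list \<Rightarrow> nat \<Rightarrow> 'a::comm_ring_1" where
  "residues n x = (\<lambda>i. if i < n then of_nat (x ! i) else 0)"

lemma of_nat_mod_ring_eq_iff: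
  "(of_nat a = (of_nat b :: 'p::prime_card mod_ring)) \<longleftrightarrow> a mod CARD('p) = b mod CARD('p)"
  by (simp add: of_nat_eq_iff_cong_CHAR unique_euclidean_semiring_class.cong_def)

text \<open>Reduce the words modulo \<open>p\<close>, adding \<open>1\<close> to the third one. If three such vectors add up to zero, the digits sum to \<open>-1\<close> modulo
  \<open>p\<close>, hence to at least \<open>p - 1\<close>, in each position. Because the three words are rearrangements of \<open>A\<close>, their
  sums over all positions are fixed, and equality must hold throughout.\<close>

theorem tricolored_from_type:
  fixes A :: "nat multiset" and L :: "(nat \<times> nat \<times> nat) list" and \<kappa> :: nat and P :: "'p::prime_card itself"
  defines "p \<equiv> CARD('p)"
  assumes \<kappa>: "\<kappa> \<ge> 1" and A: "set_mset A \<subseteq> {..p - 1}" "size A > 0"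
    and L: "set L \<subseteq> triples (p - 1)" "mset (map fst L) = A" "mset (map (\<lambda>t. fst (snd t)) L) = A" "mset (map (\<lambda>t. snd (snd t)) L) = A"
  obtains S :: "((nat \<Rightarrow> 'p mod_ring) \<times> (nat \<Rightarrow> 'p mod_ring) \<times> (nat \<Rightarrow> 'p mod_ring)) set" and Q :: nat
    where "tricolored (size A) S" "card (permutations_of_multiset A) \<le> 12 * (3 * p) ^ \<kappa> * \<kappa> * Q ^ 2 * card S"
      "Q ^ \<kappa> \<le> 6 * p ^ \<kappa> * p ^ size A" "Q \<ge> 1"
proof -
  define n where "n = size A"
  define m where "m = p - 1"
  have p: "prime p" unfolding p_def by (rule prime_card)
  hence pm: "p = Suc m" using prime_gt_0_nat[OF p] by (simp add: m_def)
  have A': "set_mset A \<subseteq> {..<p}" using A(1) unfolding pm by (simp add: lessThan_Suc_atMost)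
  have lenL: "length L = size A" using arg_cong[OF L(2), of size] by simp
  have "(map fst L, map (\<lambda>t. fst (snd t)) L, map (\<lambda>t. snd (snd t)) L) \<in> triangle_system m A"
  proof -
    have "fst (L ! i) + fst (snd (L ! i)) + snd (snd (L ! i)) = m" if "i < size A" for i
    proof -
      have "L ! i \<in> triples m" using L(1) that nth_mem[of i L] unfolding lenL m_def by blast
      thus ?thesis by (auto simp: triples_def)
    qed
    thus ?thesis using L lenL by (simp add: triangle_system_def)
  qed
  hence ne: "triangle_system m A \<noteq> {}" by blast
  obtain I Q where I: "I \<subseteq> triangle_system m A"
    and iso: "\<And>t1 t2 t3. t1 \<in> I \<Longrightarrow> t2 \<in> I \<Longrightarrow> t3 \<in> I \<Longrightarrow> (fst t1, fst (snd t2), snd (snd t3)) \<in> triangle_system m A \<Longrightarrow> t1 = t2 \<and> t2 = t3"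
    and card: "card (permutations_of_multiset A) \<le> 12 * (3 * p) ^ \<kappa> * \<kappa> * Q ^ 2 * card I"
    and Q: "Q ^ \<kappa> \<le> 6 * p ^ \<kappa> * p ^ size A" "Q \<ge> 1"
    by (rule isolated_triangles[OF p \<kappa> A' A(2) ne]) (rule that)
  have total: "(\<Sum>i<n. x ! i) = sum_mset A" if "mset x = A" for x
    using that by (auto simp: n_def sum_mset_sum_list sum_list_sum_nth atLeast0LessThan)
  have tot3: "sum_mset A + sum_mset A + sum_mset A = n * m"
  proof -
    obtain x y z where xyz: "(x, y, z) \<in> triangle_system m A" using ne by auto
    have ms: "mset x = A" "mset y = A" "mset z = A" using xyz by (simp_all add: triangle_system_def)
    have "(\<Sum>i<n. x ! i + y ! i + z ! i) = (\<Sum>i<n. m)"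
      by (rule sum.cong[OF refl]) (use xyz in \<open>simp add: triangle_system_def n_def\<close>)
    thus ?thesis unfolding sum.distrib total[OF ms(1)] total[OF ms(2)] total[OF ms(3)] by simp
  qed
  have tri: "(x, y, z) \<in> triangle_system m A"
    if ms: "mset x = A" "mset y = A" "mset z = A" and cg: "\<And>i. i < n \<Longrightarrow> (x ! i + y ! i + z ! i + 1) mod p = 0" for x y z
  proof -
    have ge: "m \<le> x ! i + y ! i + z ! i" if "i < n" for i
    proof -
      have "p dvd x ! i + y ! i + z ! i + 1" using cg[OF that] by (simp only: mod_eq_0_iff_dvd)
      hence "p \<le> x ! i + y ! i + z ! i + 1" by (rule dvd_imp_le) simp
      thus ?thesis unfolding pm by simp
    qed
    have "(\<Sum>i<n. x ! i + y ! i + z ! i) = (\<Sum>i<n. m)"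
      unfolding sum.distrib total[OF ms(1)] total[OF ms(2)] total[OF ms(3)] using tot3 by simp
    have "x ! i + y ! i + z ! i = m" if i: "i < n" for i
    proof (rule ccontr)
      assume "x ! i + y ! i + z ! i \<noteq> m"
      hence "(\<Sum>i<n. m) < (\<Sum>i<n. x ! i + y ! i + z ! i)"
        using ge i by (intro sum_strict_mono_ex1) (auto intro!: bexI[of _ i] simp: le_neq_implies_less)
      thus False using \<open>(\<Sum>i<n. x ! i + y ! i + z ! i) = (\<Sum>i<n. m)\<close> by simp
    qed
    thus ?thesis using ms by (simp add: triangle_system_def n_def)
  qed
  define \<theta> :: "nat list \<times> nat list \<times> nat list \<Rightarrow> (nat \<Rightarrow> 'p mod_ring) \<times> (nat \<Rightarrow> 'p mod_ring) \<times> (nat \<Rightarrow> 'p mod_ring)"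
    where "\<theta> t = (residues n (fst t), residues n (fst (snd t)), residues n (map Suc (snd (snd t))))" for t
  have zero: "residues n x + residues n y + residues n (map Suc z) = (0 :: nat \<Rightarrow> 'p mod_ring) \<longleftrightarrow> (x, y, z) \<in> triangle_system m A"
    if ms: "mset x = A" "mset y = A" "mset z = A" for x y z
  proof -
    have lz: "length z = n" unfolding n_def ms(3)[symmetric] by simp
    have coord: "(residues n x + residues n y + residues n (map Suc z)) i = (of_nat (x ! i + y ! i + z ! i + 1) :: 'p mod_ring)" if "i < n" for i
      using that lz by (simp add: residues_def plus_fun_apply add_ac)
    have off: "(residues n x + residues n y + residues n (map Suc z)) i = (0 :: 'p mod_ring)" if "\<not> i < n" for i
      using that by (simp add: residues_def plus_fun_apply)
    have van: "(of_nat k :: 'p mod_ring) = 0 \<longleftrightarrow> k mod p = 0" for k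
      using of_nat_mod_ring_eq_iff[of k 0, where 'p = 'p] by (simp only: of_nat_0 mod_0 p_def)
    show ?thesis
    proof
      assume z0: "residues n x + residues n y + residues n (map Suc z) = (0 :: nat \<Rightarrow> 'p mod_ring)"
      show "(x, y, z) \<in> triangle_system m A"
      proof (rule tri[OF ms])
        fix i assume i: "i < n"
        have "(of_nat (x ! i + y ! i + z ! i + 1) :: 'p mod_ring) = 0"
          unfolding coord[OF i, symmetric] z0 by (simp only: zero_fun_apply)
        thus "(x ! i + y ! i + z ! i + 1) mod p = 0" by (simp only: van)
      qed
    next
      assume T: "(x, y, z) \<in> triangle_system m A"
      show "residues n x + residues n y + residues n (map Suc z) = (0 :: nat \<Rightarrow> 'p mod_ring)"
      proof (rule ext)
        fix i show "(residues n x + residues n y + residues n (map Suc z)) i = (0 :: nat \<Rightarrow> 'p mod_ring) i"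
        proof (cases "i < n")
          case True
          have "x ! i + y ! i + z ! i + 1 = p" using T True unfolding pm by (simp add: triangle_system_def n_def)
          hence "(of_nat (x ! i + y ! i + z ! i + 1) :: 'p mod_ring) = 0" unfolding van by simp
          thus ?thesis unfolding coord[OF True] by (simp only: zero_fun_apply)
        next
          case False thus ?thesis unfolding off[OF False] by (simp only: zero_fun_apply)
        qed
      qed
    qed
  qed
  have Imem: "mset (fst t) = A" "mset (fst (snd t)) = A" "mset (snd (snd t)) = A" if "t \<in> I" for t
    using subsetD[OF I that] by (auto simp: triangle_system_def)
  have key: "t1 = t2 \<and> t2 = t3"
    if t: "t1 \<in> I" "t2 \<in> I" "t3 \<in> I" and s: "fst (\<theta> t1) + fst (snd (\<theta> t2)) + snd (snd (\<theta> t3)) = 0" for t1 t2 t3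
  proof (rule iso[OF t])
    show "(fst t1, fst (snd t2), snd (snd t3)) \<in> triangle_system m A"
      using s unfolding \<theta>_def fst_conv snd_conv zero[OF Imem(1)[OF t(1)] Imem(2)[OF t(2)] Imem(3)[OF t(3)]] .
  qed
  have self: "fst (\<theta> t) + fst (snd (\<theta> t)) + snd (snd (\<theta> t)) = 0" if t: "t \<in> I" for t
    unfolding \<theta>_def fst_conv snd_conv zero[OF Imem(1)[OF t] Imem(2)[OF t] Imem(3)[OF t]] using subsetD[OF I t] by simp
  have inj: "inj_on \<theta> I"
  proof (rule inj_onI)
    fix t t' assume t: "t \<in> I" "t' \<in> I" "\<theta> t = \<theta> t'"
    have "t = t' \<and> t' = t'" by (rule key[OF t(1,2,2)]) (unfold t(3), rule self[OF t(2)])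
    thus "t = t'" ..
  qed
  show thesis
  proof (rule that[of "\<theta> ` I" Q])
    show "card (permutations_of_multiset A) \<le> 12 * (3 * p) ^ \<kappa> * \<kappa> * Q ^ 2 * card (\<theta> ` I)"
      unfolding card_image[OF inj] by (rule card)
    have supp: "residues n x \<in> supp_on {..<size A}" for x by (simp add: residues_def supp_on_def n_def)
    show "tricolored (size A) (\<theta> ` I)"
      unfolding tricolored_def
    proof (intro conjI ballI impI)
      fix s assume "s \<in> \<theta> ` I"
      then obtain t where t: "s = \<theta> t" "t \<in> I" by blast
      show "case s of (x, y, z) \<Rightarrow> x \<in> supp_on {..<size A} \<and> y \<in> supp_on {..<size A} \<and> z \<in> supp_on {..<size A} \<and> x + y + z = 0"
        using self[OF t(2)] supp unfolding t(1) \<theta>_def fst_conv snd_conv prod.case by blast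
    next
      fix s s' s'' assume "s \<in> \<theta> ` I" "s' \<in> \<theta> ` I" "s'' \<in> \<theta> ` I" and z: "fst s + fst (snd s') + snd (snd s'') = 0"
      then obtain t t' t'' where t: "s = \<theta> t" "s' = \<theta> t'" "s'' = \<theta> t''" "t \<in> I" "t' \<in> I" "t'' \<in> I" by blast
      have "t = t' \<and> t' = t''" by (rule key[OF t(4,5,6) z[unfolded t(1-3)]])
      thus "s = s'" "s' = s''" unfolding t(1-3) by blast+
    qed
  qed (rule Q)+
qed

text \<open>The loss \<open>Q ^ 2\<close> is at most of order \<open>p\<close> to the power \<open>2 n / \<kappa>\<close>, which is negligible for large \<open>\<kappa>\<close>; the
  constants depending on \<open>\<kappa>\<close> are absorbed by taking \<open>n\<close> large.\<close>

theorem large_tricolored: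
  fixes P :: "'p::prime_card itself" and \<eta> :: real
  defines "p \<equiv> CARD('p)"
  assumes \<eta>: "\<eta> > 0"
  obtains n and S :: "((nat \<Rightarrow> 'p mod_ring) \<times> (nat \<Rightarrow> 'p mod_ring) \<times> (nat \<Rightarrow> 'p mod_ring)) set"
    where "n > 0" "tricolored n S" "real p powr ((1 - removal_const p - \<eta>) * real n) \<le> real (card S)"
proof -
  have p2: "p \<ge> 2" using prime_ge_2_nat[OF prime_card[where 'a = 'p]] by (simp add: p_def)
  hence p1: "real p > 1" by simp
  \<comment> \<open>So that the exponent \<open>2 / \<kappa>\<close> of the loss is at most \<open>\<eta> / 4\<close>.\<close>
  define \<kappa> where "\<kappa> = Suc (nat \<lceil>8 / \<eta>\<rceil>)"
  have \<kappa>: "\<kappa> \<ge> 1" "8 / \<eta> \<le> real \<kappa>" unfolding \<kappa>_def by linarith+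
  define C where "C = 12 * (3 * real p) ^ \<kappa> * real \<kappa> * (6 * real p) ^ 2"
  have C: "C > 0" unfolding C_def using p1 \<kappa>(1) by simp
  define K where "K = nat \<lceil>4 * log (real p) C / \<eta>\<rceil>"
  have \<eta>2: "\<eta> / 2 > 0" using \<eta> by simp
  obtain A :: "nat multiset" and L where L: "set L \<subseteq> triples (p - 1)" "mset (map fst L) = A"
    "mset (map (\<lambda>t. fst (snd t)) L) = A" "mset (map (\<lambda>t. snd (snd t)) L) = A" "size A \<ge> K" "size A > 0" "set_mset A \<subseteq> {..p - 1}"
    "real (card (permutations_of_multiset A)) \<ge> real p powr ((1 - removal_const p - \<eta> / 2) * real (size A))"
    using coupled_type[where 'p = 'p, OF \<eta>2, folded p_def] by metis
  define n where "n = size A"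
  obtain S :: "((nat \<Rightarrow> 'p mod_ring) \<times> (nat \<Rightarrow> 'p mod_ring) \<times> (nat \<Rightarrow> 'p mod_ring)) set" and Q :: nat
    where S: "tricolored n S" "card (permutations_of_multiset A) \<le> 12 * (3 * p) ^ \<kappa> * \<kappa> * Q ^ 2 * card S"
      and Q: "Q ^ \<kappa> \<le> 6 * p ^ \<kappa> * p ^ n" "Q \<ge> 1"
    by (rule tricolored_from_type[OF \<kappa>(1) L(7)[unfolded p_def] L(6) L(1)[unfolded p_def] L(2-4), folded p_def, folded n_def]) (rule that)
  have "real Q \<le> 6 * real p * real p powr (real n / real \<kappa>)"
  proof (rule power_le_imp_le_base)
    have "real Q ^ \<kappa> \<le> 6 * real p ^ \<kappa> * real p ^ n"
      using Q(1) by (metis (mono_tags, lifting) of_nat_le_iff of_nat_mult of_nat_numeral of_nat_power)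
    also have "\<dots> \<le> 6 ^ \<kappa> * real p ^ \<kappa> * real p ^ n"
      using \<kappa>(1) self_le_power[of "6::real" \<kappa>] by (intro mult_right_mono) auto
    also have "real p ^ n = (real p powr (real n / real \<kappa>)) ^ \<kappa>"
      using p1 \<kappa>(1) by (simp add: powr_realpow[symmetric] powr_powr)
    also have "6 ^ \<kappa> * real p ^ \<kappa> * (real p powr (real n / real \<kappa>)) ^ \<kappa> = (6 * real p * real p powr (real n / real \<kappa>)) ^ \<kappa>"
      by (simp only: power_mult_distrib)
    finally show "real Q ^ Suc (\<kappa> - 1) \<le> (6 * real p * real p powr (real n / real \<kappa>)) ^ Suc (\<kappa> - 1)" using \<kappa>(1) by simp
  qed simp
  hence "real Q ^ 2 \<le> (6 * real p * real p powr (real n / real \<kappa>)) ^ 2" by (intro power_mono) auto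
  also have "\<dots> = (6 * real p) ^ 2 * real p powr (2 * (real n / real \<kappa>))"
  proof -
    have "(real p powr v) ^ 2 = real p powr (2 * v)" for v by (simp only: power2_eq_square powr_add[symmetric] mult_2)
    thus ?thesis by (simp only: power_mult_distrib)
  qed
  also have "\<dots> \<le> (6 * real p) ^ 2 * real p powr (\<eta> / 4 * real n)"
  proof (intro mult_left_mono powr_mono)
    have "8 \<le> real \<kappa> * \<eta>" using \<kappa>(2) \<eta> by (simp add: pos_divide_le_eq)
    hence "2 / real \<kappa> \<le> \<eta> / 4" using \<kappa>(1) by (simp add: pos_divide_le_eq mult.commute)
    thus "2 * (real n / real \<kappa>) \<le> \<eta> / 4 * real n" using mult_right_mono[of "2 / real \<kappa>" "\<eta> / 4" "real n"] by simp
  qed (use p1 in auto)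
  finally have Q2: "real Q ^ 2 \<le> (6 * real p) ^ 2 * real p powr (\<eta> / 4 * real n)" .
  have "4 * log (real p) C / \<eta> \<le> real n" using L(5) unfolding K_def n_def by linarith
  hence "log (real p) C \<le> \<eta> / 4 * real n" using \<eta> by (simp add: pos_divide_le_eq mult.commute)
  hence "real p powr log (real p) C \<le> real p powr (\<eta> / 4 * real n)" using p1 by (intro powr_mono) auto
  hence Cle: "C \<le> real p powr (\<eta> / 4 * real n)" using C p1 by simp
  have "real p powr ((1 - removal_const p - \<eta> / 2) * real n) \<le> real (card (permutations_of_multiset A))"
    using L(8) unfolding n_def .
  also have "\<dots> \<le> real (12 * (3 * p) ^ \<kappa> * \<kappa> * Q ^ 2 * card S)" using S(2) by (simp only: of_nat_le_iff)
  also have "\<dots> = 12 * (3 * real p) ^ \<kappa> * real \<kappa> * real Q ^ 2 * real (card S)" by simp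
  also have "\<dots> \<le> 12 * (3 * real p) ^ \<kappa> * real \<kappa> * ((6 * real p) ^ 2 * real p powr (\<eta> / 4 * real n)) * real (card S)"
    by (intro mult_right_mono mult_left_mono Q2) auto
  also have "\<dots> = C * (real p powr (\<eta> / 4 * real n) * real (card S))" by (simp add: C_def)
  also have "\<dots> \<le> real p powr (\<eta> / 4 * real n) * (real p powr (\<eta> / 4 * real n) * real (card S))"
    by (intro mult_right_mono Cle) auto
  also have "\<dots> = (real p powr (\<eta> / 4 * real n) * real p powr (\<eta> / 4 * real n)) * real (card S)" by (simp only: mult.assoc)
  also have "real p powr (\<eta> / 4 * real n) * real p powr (\<eta> / 4 * real n) = real p powr (\<eta> / 2 * real n)"
    unfolding powr_add[symmetric] distrib_right[symmetric] by simp
  also have "real p powr ((1 - removal_const p - \<eta> / 2) * real n) = real p powr (\<eta> / 2 * real n) * real p powr ((1 - removal_const p - \<eta>) * real n)"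
    unfolding powr_add[symmetric] distrib_right[symmetric] by simp
  finally have "real p powr ((1 - removal_const p - \<eta>) * real n) \<le> real (card S)" using p1 by simp
  moreover have "n > 0" using L(6) by (simp add: n_def)
  ultimately show thesis using that S(1) by blast
qed

text \<open>Tricolored sets multiply under direct sums, so a single good example serves in all multiples of its dimension.\<close>

lemma tricolored_product:
  fixes S T :: "((nat \<Rightarrow> 'p::prime_card mod_ring) \<times> (nat \<Rightarrow> 'p mod_ring) \<times> (nat \<Rightarrow> 'p mod_ring)) set"
  assumes S: "tricolored k S" and T: "tricolored l T"
  obtains U :: "((nat \<Rightarrow> 'p mod_ring) \<times> (nat \<Rightarrow> 'p mod_ring) \<times> (nat \<Rightarrow> 'p mod_ring)) set"
    where "tricolored (k + l) U" "card U = card S * card T"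
proof -
  define \<theta> where "\<theta> = (\<lambda>(s :: (nat \<Rightarrow> 'p mod_ring) \<times> (nat \<Rightarrow> 'p mod_ring) \<times> (nat \<Rightarrow> 'p mod_ring),
      t :: (nat \<Rightarrow> 'p mod_ring) \<times> (nat \<Rightarrow> 'p mod_ring) \<times> (nat \<Rightarrow> 'p mod_ring)).
      (juxtapose k (fst s) (fst t), juxtapose k (fst (snd s)) (fst (snd t)), juxtapose k (snd (snd s)) (snd (snd t))))"
  have S0: "fst s \<in> supp_on {..<k} \<and> fst (snd s) \<in> supp_on {..<k} \<and> snd (snd s) \<in> supp_on {..<k} \<and> fst s + fst (snd s) + snd (snd s) = 0"
    if "s \<in> S" for s using S that by (auto simp: tricolored_def)
  have T0: "fst s \<in> supp_on {..<l} \<and> fst (snd s) \<in> supp_on {..<l} \<and> snd (snd s) \<in> supp_on {..<l} \<and> fst s + fst (snd s) + snd (snd s) = 0"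
    if "s \<in> T" for s using T that by (auto simp: tricolored_def)
  have Siso: "s = s' \<and> s' = s''" if "s \<in> S" "s' \<in> S" "s'' \<in> S" "fst s + fst (snd s') + snd (snd s'') = 0" for s s' s''
    using S that by (simp add: tricolored_def)
  have Tiso: "s = s' \<and> s' = s''" if "s \<in> T" "s' \<in> T" "s'' \<in> T" "fst s + fst (snd s') + snd (snd s'') = 0" for s s' s''
    using T that by (simp add: tricolored_def)
  have sum: "fst (\<theta> (s, t)) + fst (snd (\<theta> (s', t'))) + snd (snd (\<theta> (s'', t'')))
      = juxtapose k (fst s + fst (snd s') + snd (snd s'')) (fst t + fst (snd t') + snd (snd t''))" for s t s' t' s'' t''
    by (simp only: \<theta>_def prod.case fst_conv snd_conv juxtapose_add)
  have key: "s = s' \<and> s' = s'' \<and> t = t' \<and> t' = t''"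
    if s: "s \<in> S" "s' \<in> S" "s'' \<in> S" and t: "t \<in> T" "t' \<in> T" "t'' \<in> T"
      and z: "fst (\<theta> (s, t)) + fst (snd (\<theta> (s', t'))) + snd (snd (\<theta> (s'', t''))) = 0" for s s' s'' t t' t''
  proof -
    have "fst s + fst (snd s') + snd (snd s'') \<in> supp_on {..<k}"
      using S0[OF s(1)] S0[OF s(2)] S0[OF s(3)] by (intro supp_on_closed) blast+
    note e = juxtapose_eq_zero[OF this z[unfolded sum]]
    show ?thesis using Siso[OF s e(1)] Tiso[OF t e(2)] by blast
  qed
  have zero: "juxtapose k (0 :: nat \<Rightarrow> 'p mod_ring) 0 = 0"
    by (rule ext) (simp only: juxtapose_def zero_fun_apply if_cancel)
  have self: "fst (\<theta> (s, t)) + fst (snd (\<theta> (s, t))) + snd (snd (\<theta> (s, t))) = 0" if "s \<in> S" "t \<in> T" for s t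
    using S0[OF that(1)] T0[OF that(2)] zero unfolding sum by simp
  have inj: "inj_on \<theta> (S \<times> T)"
  proof (rule inj_onI)
    fix u v assume u: "u \<in> S \<times> T" and v: "v \<in> S \<times> T" and e: "\<theta> u = \<theta> v"
    obtain s t where st: "s \<in> S" "t \<in> T" "u = (s, t)" using u by blast
    obtain s' t' where st': "s' \<in> S" "t' \<in> T" "v = (s', t')" using v by blast
    have "s = s' \<and> s' = s' \<and> t = t' \<and> t' = t'"
      by (rule key[OF st(1) st'(1,1) st(2) st'(2,2)]) (unfold e[unfolded st(3) st'(3)], rule self[OF st'(1,2)])
    thus "u = v" unfolding st(3) st'(3) by blast
  qed
  show thesis
  proof (rule that[of "\<theta> ` (S \<times> T)"])
    show "card (\<theta> ` (S \<times> T)) = card S * card T" unfolding card_image[OF inj] by (rule card_cartesian_product)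
    show "tricolored (k + l) (\<theta> ` (S \<times> T))"
      unfolding tricolored_def
    proof (intro conjI ballI impI)
      fix u assume "u \<in> \<theta> ` (S \<times> T)"
      then obtain s t where st: "s \<in> S" "t \<in> T" "u = \<theta> (s, t)" by blast
      have "fst u \<in> supp_on {..<k + l}" "fst (snd u) \<in> supp_on {..<k + l}" "snd (snd u) \<in> supp_on {..<k + l}"
        using T0[OF st(2)] unfolding st(3) \<theta>_def prod.case fst_conv snd_conv by (blast intro: juxtapose_in)+
      thus "case u of (x, y, z) \<Rightarrow> x \<in> supp_on {..<k + l} \<and> y \<in> supp_on {..<k + l} \<and> z \<in> supp_on {..<k + l} \<and> x + y + z = 0"
        using self[OF st(1,2)] unfolding st(3)[symmetric] case_prod_beta by blast
    next
      fix u u' u'' assume "u \<in> \<theta> ` (S \<times> T)" "u' \<in> \<theta> ` (S \<times> T)" "u'' \<in> \<theta> ` (S \<times> T)" and z: "fst u + fst (snd u') + snd (snd u'') = 0"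
      then obtain s t s' t' s'' t'' where st: "u = \<theta> (s, t)" "u' = \<theta> (s', t')" "u'' = \<theta> (s'', t'')"
        "s \<in> S" "s' \<in> S" "s'' \<in> S" "t \<in> T" "t' \<in> T" "t'' \<in> T" by (elim imageE SigmaE) blast
      have "s = s' \<and> s' = s'' \<and> t = t' \<and> t' = t''" by (rule key[OF st(4-9) z[unfolded st(1-3)]])
      thus "u = u'" "u' = u''" unfolding st(1-3) by blast+
    qed
  qed
qed

lemma tricolored_power:
  fixes S :: "((nat \<Rightarrow> 'p::prime_card mod_ring) \<times> (nat \<Rightarrow> 'p mod_ring) \<times> (nat \<Rightarrow> 'p mod_ring)) set"
  assumes S: "tricolored n S"
  shows "\<exists>U :: ((nat \<Rightarrow> 'p mod_ring) \<times> (nat \<Rightarrow> 'p mod_ring) \<times> (nat \<Rightarrow> 'p mod_ring)) set.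
    tricolored (j * n) U \<and> card U = card S ^ j"
proof (induction j)
  case 0
  have "tricolored (0 * n) {(0, 0, 0) :: (nat \<Rightarrow> 'p mod_ring) \<times> (nat \<Rightarrow> 'p mod_ring) \<times> (nat \<Rightarrow> 'p mod_ring)}"
    unfolding tricolored_def by simp
  thus ?case by (intro exI conjI) (assumption, simp)
next
  case (Suc j)
  then obtain U :: "((nat \<Rightarrow> 'p mod_ring) \<times> (nat \<Rightarrow> 'p mod_ring) \<times> (nat \<Rightarrow> 'p mod_ring)) set"
    where U: "tricolored (j * n) U" "card U = card S ^ j" by blast
  obtain V :: "((nat \<Rightarrow> 'p mod_ring) \<times> (nat \<Rightarrow> 'p mod_ring) \<times> (nat \<Rightarrow> 'p mod_ring)) set"
    where V: "tricolored (n + j * n) V" "card V = card S * card U"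
    by (rule tricolored_product[OF S U(1)]) (rule that)
  show ?case using V unfolding U(2) by (intro exI[of _ V]) simp
qed

section \<open>The exponents of the removal dimension\<close>

lemma removal_dim_exists:
  fixes P :: "'p::prime_card itself"
  assumes "0 < \<epsilon>" "\<epsilon> \<le> 1"
  shows "0 < removal_dim P \<epsilon>" "removal_dim_ok P \<epsilon> (removal_dim P \<epsilon>)"
proof -
  obtain \<kappa> where \<kappa>: "\<kappa> > 0" "\<And>m \<epsilon>. 0 < \<epsilon> \<Longrightarrow> \<epsilon> \<le> 1 \<Longrightarrow> 1 / (\<kappa> * \<epsilon> powr (1 + 1 / removal_const CARD('p))) ^ 2 \<le> real m \<Longrightarrow> removal_dim_ok P \<epsilon> m"
    using removal_dim_ok_upper[of P] by metis
  define b where "b = 1 / (\<kappa> * \<epsilon> powr (1 + 1 / removal_const CARD('p))) ^ 2"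
  have "removal_dim_ok P \<epsilon> (Suc (nat \<lceil>b\<rceil>))" by (rule \<kappa>(2)[OF assms, folded b_def]) linarith
  hence "0 < Suc (nat \<lceil>b\<rceil>) \<and> removal_dim_ok P \<epsilon> (Suc (nat \<lceil>b\<rceil>))" by simp
  hence "0 < removal_dim P \<epsilon> \<and> removal_dim_ok P \<epsilon> (removal_dim P \<epsilon>)" unfolding removal_dim_def by (rule LeastI)
  thus "0 < removal_dim P \<epsilon>" "removal_dim_ok P \<epsilon> (removal_dim P \<epsilon>)" by blast+
qed

lemma power_absorbs_constant:
  fixes C \<eta> :: real
  assumes "C > 0" "\<eta> > 0"
  obtains r where "r > 0" "r \<le> 1" "\<And>\<epsilon> a. 0 < \<epsilon> \<Longrightarrow> \<epsilon> < r \<Longrightarrow> \<epsilon> powr (a + \<eta>) \<le> C * \<epsilon> powr a"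
proof (rule that[of "min 1 (C powr (1 / \<eta>))"])
  fix \<epsilon> a :: real assume e: "0 < \<epsilon>" "\<epsilon> < min 1 (C powr (1 / \<eta>))"
  have "\<epsilon> powr \<eta> \<le> (C powr (1 / \<eta>)) powr \<eta>" using e assms by (intro powr_mono2) auto
  also have "\<dots> = C" using assms by (simp add: powr_powr)
  finally have "\<epsilon> powr \<eta> * \<epsilon> powr a \<le> C * \<epsilon> powr a" by (rule mult_right_mono) simp
  thus "\<epsilon> powr (a + \<eta>) \<le> C * \<epsilon> powr a" by (simp add: powr_add mult.commute)
qed (use assms in auto)

lemma removal_dim_le_powr:
  fixes P :: "'p::prime_card itself" and \<eta> :: real
  assumes \<eta>: "\<eta> > 0"
  shows "\<exists>r>0. \<forall>\<epsilon>. 0 < \<epsilon> \<and> \<epsilon> < r \<longrightarrow> real (removal_dim P \<epsilon>) \<le> \<epsilon> powr (- 2 / removal_const CARD('p) - 2 - \<eta>)"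
proof -
  define c where "c = removal_const CARD('p)"
  obtain \<kappa> where \<kappa>: "\<kappa> > 0" "\<And>m \<epsilon>. 0 < \<epsilon> \<Longrightarrow> \<epsilon> \<le> 1 \<Longrightarrow> 1 / (\<kappa> * \<epsilon> powr (1 + 1 / c)) ^ 2 \<le> real m \<Longrightarrow> removal_dim_ok P \<epsilon> m"
    using removal_dim_ok_upper[of P] unfolding c_def by metis
  define C where "C = 1 / \<kappa> ^ 2 + 2"
  have C: "C > 0" unfolding C_def by (intro add_nonneg_pos) auto
  have c: "0 < c" using removal_const_bounds(1)[of "CARD('p)"] prime_ge_2_nat[OF prime_card[where 'a = 'p]] by (simp add: c_def)
  obtain r where r: "r > 0" "r \<le> 1" "\<And>\<epsilon> a. 0 < \<epsilon> \<Longrightarrow> \<epsilon> < r \<Longrightarrow> \<epsilon> powr (a + \<eta>) \<le> (1 / C) * \<epsilon> powr a"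
    by (rule power_absorbs_constant[of "1 / C" \<eta>]) (use C \<eta> in auto)
  have "real (removal_dim P \<epsilon>) \<le> \<epsilon> powr (- 2 / c - 2 - \<eta>)" if e: "0 < \<epsilon>" "\<epsilon> < r" for \<epsilon>
  proof -
    define b where "b = 1 / (\<kappa> * \<epsilon> powr (1 + 1 / c)) ^ 2"
    have e1: "\<epsilon> \<le> 1" using e r(2) by simp
    have "removal_dim_ok P \<epsilon> (Suc (nat \<lceil>b\<rceil>))" by (rule \<kappa>(2)[OF e(1) e1, folded b_def]) linarith
    hence "removal_dim P \<epsilon> \<le> Suc (nat \<lceil>b\<rceil>)" unfolding removal_dim_def by (intro Least_le) simp
    moreover have "b \<ge> 0" by (simp add: b_def)
    ultimately have "real (removal_dim P \<epsilon>) \<le> b + 2" by linarith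
    also have "b = (1 / \<kappa> ^ 2) * \<epsilon> powr (- 2 / c - 2)"
    proof -
      have "(\<epsilon> powr (1 + 1 / c)) ^ 2 = \<epsilon> powr ((1 + 1 / c) + (1 + 1 / c))" by (simp only: power2_eq_square powr_add[symmetric])
      also have "(1 + 1 / c) + (1 + 1 / c) = - (- 2 / c - 2)" by simp
      finally have "(\<epsilon> powr (1 + 1 / c)) ^ 2 = inverse (\<epsilon> powr (- 2 / c - 2))" by (simp only: powr_minus)
      thus ?thesis unfolding b_def power_mult_distrib by (simp add: divide_inverse)
    qed
    also have "(1 / \<kappa> ^ 2) * \<epsilon> powr (- 2 / c - 2) + 2 \<le> (1 / \<kappa> ^ 2) * \<epsilon> powr (- 2 / c - 2) + 2 * \<epsilon> powr (- 2 / c - 2)"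
    proof -
      have "0 < 2 / c" using c by simp
      hence "- 2 / c - 2 \<le> 0" unfolding divide_minus_left by linarith
      hence "\<epsilon> powr 0 \<le> \<epsilon> powr (- 2 / c - 2)" using e(1) e1 by (intro powr_mono') auto
      thus ?thesis using e(1) by simp
    qed
    also have "\<dots> = C * \<epsilon> powr (- 2 / c - 2)" unfolding C_def by (rule distrib_right[symmetric])
    also have "\<dots> \<le> \<epsilon> powr (- 2 / c - 2 - \<eta>)"
    proof -
      have "\<epsilon> powr ((- 2 / c - 2 - \<eta>) + \<eta>) \<le> (1 / C) * \<epsilon> powr (- 2 / c - 2 - \<eta>)" by (rule r(3)[OF e])
      hence "\<epsilon> powr (- 2 / c - 2) \<le> \<epsilon> powr (- 2 / c - 2 - \<eta>) / C" by simp
      thus ?thesis using C by (simp add: pos_le_divide_eq mult.commute)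
    qed
    finally show ?thesis .
  qed
  thus ?thesis using r(1) unfolding c_def by blast
qed

text \<open>Fix \<open>u\<close> slightly above \<open>c\<close> and a tricolored set of size at least \<open>p^((1 - u) N)\<close>. Its \<open>j\<close>-th power lives in dimension \<open>k = j N\<close>. Choose \<open>j\<close> largest
  such that \<open>p^(u k)\<close> does not exceed \<open>1 / (6 p \<epsilon>)\<close>; then \<open>3 \<epsilon> p^(k+1)\<close> is at most half the size of the
  set, and the removal dimension is at least the other half, which is of order \<open>\<epsilon>\<close> to the power \<open>-(1 - u)/u\<close>.\<close>

lemma removal_dim_ge_powr:
  fixes P :: "'p::prime_card itself" and \<eta> :: real
  assumes \<eta>: "\<eta> > 0"
  shows "\<exists>r>0. \<forall>\<epsilon>. 0 < \<epsilon> \<and> \<epsilon> < r \<longrightarrow> \<epsilon> powr (- 1 / removal_const CARD('p) + 1 + \<eta>) \<le> real (removal_dim P \<epsilon>)"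
proof -
  define p where "p = CARD('p)"
  define c where "c = removal_const p"
  have p2: "p \<ge> 2" using prime_ge_2_nat[OF prime_card[where 'a = 'p]] by (simp add: p_def)
  hence p1: "real p > 1" by simp
  have c: "0 < c" "c < 1" using removal_const_bounds[OF p2] by (simp_all add: c_def)
  have "((\<lambda>u. 1 / u) \<longlongrightarrow> 1 / c) (at_right c)" using c by (intro tendsto_intros) auto
  hence "\<forall>\<^sub>F u in at_right c. 1 / c - \<eta> < 1 / u" using \<eta> by (intro order_tendstoD(1)) auto
  moreover have "\<forall>\<^sub>F u in at_right c. u \<in> {c<..<1}" by (rule eventually_at_right_real[OF c(2)])
  ultimately have "\<forall>\<^sub>F u in at_right c. 1 / c - \<eta> < 1 / u \<and> u \<in> {c<..<1}" by (rule eventually_conj)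
  then obtain u where u: "1 / c - \<eta> < 1 / u" "c < u" "u < 1"
    using eventually_happens'[OF trivial_limit_at_right_real] by fastforce
  have u0: "0 < u" using u(2) c(1) by simp
  define s where "s = 1 - u"
  have s: "0 < s" using u(3) by (simp add: s_def)
  have uc: "u - c > 0" using u(2) by simp
  obtain N and S :: "((nat \<Rightarrow> 'p mod_ring) \<times> (nat \<Rightarrow> 'p mod_ring) \<times> (nat \<Rightarrow> 'p mod_ring)) set"
    where S: "N > 0" "tricolored N S" "real p powr ((1 - removal_const p - (u - c)) * real N) \<le> real (card S)"
    by (rule large_tricolored[where 'p = 'p, OF uc, folded p_def]) (rule that)
  have "1 - removal_const p - (u - c) = s" by (simp add: s_def c_def)
  note S3 = S(3)[unfolded this]
  define \<delta> where "\<delta> = 1 / (6 * real p)"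
  have \<delta>: "\<delta> > 0" using p1 by (simp add: \<delta>_def)
  define C where "C = (\<delta> * real p powr (- (u * real N))) powr (s / u) / 2"
  have C: "C > 0" using \<delta> p1 by (simp add: C_def)
  have gap: "1 / u - 1 / c + \<eta> > 0" using u(1) by simp
  obtain r where r: "r > 0" "r \<le> 1" "\<And>\<epsilon> a. 0 < \<epsilon> \<Longrightarrow> \<epsilon> < r \<Longrightarrow> \<epsilon> powr (a + (1 / u - 1 / c + \<eta>)) \<le> C * \<epsilon> powr a"
    by (rule power_absorbs_constant[OF C gap]) (rule that)
  have "\<epsilon> powr (- 1 / c + 1 + \<eta>) \<le> real (removal_dim P \<epsilon>)" if e: "0 < \<epsilon>" "\<epsilon> < min r \<delta>" for \<epsilon>
  proof -
    have e1: "\<epsilon> \<le> 1" "\<epsilon> < r" "\<epsilon> < \<delta>" using e r(2) by auto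
    define x where "x = log (real p) (\<delta> / \<epsilon>) / (u * real N)"
    have uN: "0 < u * real N" using u0 S(1) by simp
    have ratio: "1 < \<delta> / \<epsilon>" using e e1 by (simp add: pos_less_divide_eq)
    have x0: "0 \<le> x" unfolding x_def using p1 ratio uN by (intro divide_nonneg_pos) auto
    have px: "real p powr (u * real N * x) = \<delta> / \<epsilon>"
      using u0 S(1) p1 ratio by (simp add: x_def)
    define j where "j = nat \<lfloor>x\<rfloor>"
    have j: "real j \<le> x" "x - 1 \<le> real j" unfolding j_def using x0 by linarith+
    obtain U :: "((nat \<Rightarrow> 'p mod_ring) \<times> (nat \<Rightarrow> 'p mod_ring) \<times> (nat \<Rightarrow> 'p mod_ring)) set"
      where U: "tricolored (j * N) U" "card U = card S ^ j" using tricolored_power[OF S(2), of j] by blast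
    define k where "k = j * N"
    have "(real p powr (s * real N)) ^ j \<le> real (card S) ^ j" by (rule power_mono[OF S3]) simp
    also have "(real p powr (s * real N)) ^ j = real p powr (s * real k)"
      using p1 by (simp add: powr_power k_def mult.commute mult.left_commute)
    also have "real (card S) ^ j = real (card U)" by (simp add: U(2))
    finally have cardU: "real p powr (s * real k) \<le> real (card U)" .
    have uk: "real p powr (u * real k) \<le> \<delta> / \<epsilon>"
    proof -
      have "u * real N * real j \<le> u * real N * x" using j(1) uN by (intro mult_left_mono) auto
      hence "u * real k \<le> u * real N * x" by (simp add: k_def mult_ac)
      thus ?thesis unfolding px[symmetric] using p1 by (intro powr_mono) auto
    qed
    have uk': "\<delta> * real p powr (- (u * real N)) / \<epsilon> \<le> real p powr (u * real k)"
    proof -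
      have "\<delta> * real p powr (- (u * real N)) / \<epsilon> = real p powr (u * real N * x) * real p powr (- (u * real N))"
        unfolding px by simp
      also have "\<dots> = real p powr (u * real N * (x - 1))"
        unfolding powr_add[symmetric] by (simp add: right_diff_distrib)
      also have "\<dots> \<le> real p powr (u * real N * real j)" using j(2) uN p1 by (intro powr_mono mult_left_mono) auto
      finally show ?thesis by (simp add: k_def mult_ac)
    qed
    have "real (card U) - real (removal_dim P \<epsilon>) \<le> 3 * \<epsilon> * real CARD('p) ^ (k + 1)"
      using removal_dim_exists(2)[OF e(1) e1(1), of P]
      by (intro removal_dim_lower[OF U(1)[folded k_def]]) (simp add: removal_dim_ok_def)
    also have "\<dots> = 3 * \<epsilon> * real p * real p powr (real k)" using p1 by (simp add: p_def[symmetric] powr_realpow)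
    also have "real p powr real k = real p powr (u * real k) * real p powr (s * real k)"
      unfolding powr_add[symmetric] distrib_right[symmetric] by (simp add: s_def)
    also have "3 * \<epsilon> * real p * (real p powr (u * real k) * real p powr (s * real k))
        \<le> 3 * \<epsilon> * real p * (\<delta> / \<epsilon> * real p powr (s * real k))"
      using e(1) by (intro mult_left_mono mult_right_mono uk) auto
    also have "\<dots> = 3 * \<epsilon> * real p * (\<delta> / \<epsilon>) * real p powr (s * real k)" by (rule mult.assoc[symmetric])
    also have "3 * \<epsilon> * real p * (\<delta> / \<epsilon>) = 3 * real p * \<delta>" using e(1) by simp
    also have "3 * real p * \<delta> = 1 / 2" using p1 by (simp add: \<delta>_def)
    finally have "real (card U) - real (removal_dim P \<epsilon>) \<le> 1 / 2 * real p powr (s * real k)" .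
    hence m: "real p powr (s * real k) / 2 \<le> real (removal_dim P \<epsilon>)" using cardU by linarith
    have exps: "- 1 / c + 1 + \<eta> = - (s / u) + (1 / u - 1 / c + \<eta>)" 
    proof -
      have "s / u = 1 / u - 1" using u0 unfolding s_def diff_divide_distrib by simp
      thus ?thesis unfolding divide_minus_left by linarith
    qed
    have "\<epsilon> powr (- 1 / c + 1 + \<eta>) \<le> C * \<epsilon> powr (- (s / u))" unfolding exps by (rule r(3)[OF e(1) e1(2)])
    also have "C * \<epsilon> powr (- (s / u)) = (\<delta> * real p powr (- (u * real N)) / \<epsilon>) powr (s / u) / 2"
    proof -
      have "(\<delta> * real p powr (- (u * real N)) / \<epsilon>) powr (s / u) = (\<delta> * real p powr (- (u * real N))) powr (s / u) / \<epsilon> powr (s / u)"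
        by (rule powr_divide)
      thus ?thesis unfolding C_def powr_minus_divide[of \<epsilon>] by simp
    qed
    also have "\<dots> \<le> (real p powr (u * real k)) powr (s / u) / 2"
      using uk' e(1) \<delta> s u0 by (intro divide_right_mono powr_mono2) auto
    also have "(real p powr (u * real k)) powr (s / u) = real p powr (s * real k)" 
    proof -
      have "u * real k * (s / u) = s * real k" using u0 by (simp add: mult.commute)
      thus ?thesis by (simp only: powr_powr)
    qed
    also note m
    finally show ?thesis .
  qed
  moreover have "min r \<delta> > 0" using r(1) \<delta> by simp
  ultimately show ?thesis unfolding c_def p_def by blast
qed

text \<open>Bounds with an arbitrary \<open>\<eta> > 0\<close> in the exponent are the same as one bound with an error tending to zero: take the positive part of the true error.\<close>

lemma exponent_error_tendsto_0:
  fixes D :: "real \<Rightarrow> real" and a :: real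
  assumes pos: "\<And>\<epsilon>. 0 < \<epsilon> \<Longrightarrow> \<epsilon> < 1 \<Longrightarrow> D \<epsilon> > 0"
    and ge: "\<And>\<eta>. \<eta> > 0 \<Longrightarrow> \<exists>r>0. \<forall>\<epsilon>. 0 < \<epsilon> \<and> \<epsilon> < r \<longrightarrow> \<epsilon> powr (a + \<eta>) \<le> D \<epsilon>"
  obtains f :: "real \<Rightarrow> real" where "(f \<longlongrightarrow> 0) (at_right 0)" "\<And>\<epsilon>. 0 < \<epsilon> \<Longrightarrow> \<epsilon> < 1 \<Longrightarrow> \<epsilon> powr (a + f \<epsilon>) \<le> D \<epsilon>"
proof -
  define h where "h \<epsilon> = ln (D \<epsilon>) / ln \<epsilon>" for \<epsilon>
  have h: "\<epsilon> powr h \<epsilon> = D \<epsilon>" if "0 < \<epsilon>" "\<epsilon> < 1" for \<epsilon>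
    using that pos[OF that] by (simp add: h_def powr_def)
  define f where "f \<epsilon> = max 0 (h \<epsilon> - a)" for \<epsilon>
  show thesis
  proof (rule that[of f])
    fix \<epsilon> :: real assume e: "0 < \<epsilon>" "\<epsilon> < 1"
    have "h \<epsilon> \<le> a + f \<epsilon>" by (simp add: f_def)
    hence "\<epsilon> powr (a + f \<epsilon>) \<le> \<epsilon> powr h \<epsilon>" using e by (intro powr_mono') auto
    thus "\<epsilon> powr (a + f \<epsilon>) \<le> D \<epsilon>" by (simp add: h e)
  next
    show "(f \<longlongrightarrow> 0) (at_right 0)"
    proof (rule tendstoI)
      fix \<eta> :: real assume \<eta>: "\<eta> > 0"
      then obtain r where r: "r > 0" "\<And>\<epsilon>. 0 < \<epsilon> \<Longrightarrow> \<epsilon> < r \<Longrightarrow> \<epsilon> powr (a + \<eta> / 2) \<le> D \<epsilon>" using ge[of "\<eta> / 2"] by auto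
      have "dist (f \<epsilon>) 0 < \<eta>" if e: "0 < \<epsilon>" "\<epsilon> < min r 1" for \<epsilon>
      proof -
        have e1: "\<epsilon> < r" "\<epsilon> < 1" using e(2) by auto
        have "\<epsilon> powr (a + \<eta> / 2) \<le> \<epsilon> powr h \<epsilon>" unfolding h[OF e(1) e1(2)] by (rule r(2)[OF e(1) e1(1)])
        hence "h \<epsilon> \<le> a + \<eta> / 2" using powr_less_mono'[of \<epsilon> "a + \<eta> / 2" "h \<epsilon>"] e(1) e1(2) by (meson not_le)
        thus ?thesis using \<eta> by (simp add: f_def dist_real_def)
      qed
      moreover have "min r 1 > 0" using r(1) by simp
      ultimately show "\<forall>\<^sub>F \<epsilon> in at_right 0. dist (f \<epsilon>) 0 < \<eta>"
        unfolding eventually_at_right_field by blast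
    qed
  qed
qed

theorem corollary1p26:
  shows "\<exists>f g :: real \<Rightarrow> real.
    (f \<longlongrightarrow> 0) (at_right 0) \<and> (g \<longlongrightarrow> 0) (at_right 0) \<and>
    (\<forall>\<^sub>F \<epsilon> in at_right 0.
       \<epsilon> powr (- 1 / removal_const CARD('p::prime_card) + 1 + f \<epsilon>)
         \<le> log (real CARD('p)) (real (removal_size TYPE('p) \<epsilon>)) \<and>
       log (real CARD('p)) (real (removal_size TYPE('p) \<epsilon>))
         \<le> \<epsilon> powr (- 2 / removal_const CARD('p) - 2 + g \<epsilon>))"
proof -
  define D where "D \<epsilon> = real (removal_dim TYPE('p) \<epsilon>)" for \<epsilon>
  define a where "a = - 1 / removal_const CARD('p) + 1"
  define b where "b = - 2 / removal_const CARD('p) - 2"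
  have p: "real CARD('p) > 1" using prime_ge_2_nat[OF prime_card[where 'a = 'p]] by simp
  have size: "log (real CARD('p)) (real (removal_size TYPE('p) \<epsilon>)) = D \<epsilon>" for \<epsilon>
    using p by (simp add: removal_size_def D_def log_nat_power)
  have pos: "D \<epsilon> > 0" if "0 < \<epsilon>" "\<epsilon> < 1" for \<epsilon>
    using removal_dim_exists(1)[of \<epsilon> "TYPE('p)"] that by (simp add: D_def)
  obtain f where f: "(f \<longlongrightarrow> 0) (at_right 0)" "\<And>\<epsilon>. 0 < \<epsilon> \<Longrightarrow> \<epsilon> < 1 \<Longrightarrow> \<epsilon> powr (a + f \<epsilon>) \<le> D \<epsilon>"
    using exponent_error_tendsto_0[of D a] pos removal_dim_ge_powr[where P = "TYPE('p)"] unfolding D_def a_def by blast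
  have inv: "\<exists>r>0. \<forall>\<epsilon>. 0 < \<epsilon> \<and> \<epsilon> < r \<longrightarrow> \<epsilon> powr (- b + \<eta>) \<le> 1 / D \<epsilon>" if \<eta>: "\<eta> > 0" for \<eta>
  proof -
    obtain r where r: "r > 0" "\<And>\<epsilon>. 0 < \<epsilon> \<Longrightarrow> \<epsilon> < r \<Longrightarrow> D \<epsilon> \<le> \<epsilon> powr (b - \<eta>)"
      using removal_dim_le_powr[OF \<eta>, where P = "TYPE('p)"] unfolding D_def b_def by blast
    have "\<epsilon> powr (- b + \<eta>) \<le> 1 / D \<epsilon>" if e: "0 < \<epsilon>" "\<epsilon> < min r 1" for \<epsilon>
    proof -
      have "\<epsilon> powr (- b + \<eta>) = 1 / \<epsilon> powr (b - \<eta>)" using powr_minus_divide[of \<epsilon> "b - \<eta>"] by simp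
      also have "\<dots> \<le> 1 / D \<epsilon>" using r(2) pos e by (intro divide_left_mono mult_pos_pos) auto
      finally show ?thesis .
    qed
    thus ?thesis using r(1) by (intro exI[of _ "min r 1"]) auto
  qed
  obtain g where g: "(g \<longlongrightarrow> 0) (at_right 0)" "\<And>\<epsilon>. 0 < \<epsilon> \<Longrightarrow> \<epsilon> < 1 \<Longrightarrow> \<epsilon> powr (- b + g \<epsilon>) \<le> 1 / D \<epsilon>"
    by (rule exponent_error_tendsto_0[of "\<lambda>\<epsilon>. 1 / D \<epsilon>" "- b"]) (use pos inv in auto)
  have lower: "\<epsilon> powr (b + - g \<epsilon>) \<ge> D \<epsilon>" if e: "0 < \<epsilon>" "\<epsilon> < 1" for \<epsilon>
  proof -
    have "inverse (\<epsilon> powr (b + - g \<epsilon>)) \<le> inverse (D \<epsilon>)"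
      using g(2)[OF e] powr_minus[of \<epsilon> "b + - g \<epsilon>"] by (simp add: inverse_eq_divide)
    thus ?thesis by (rule inverse_le_imp_le) (use e in simp)
  qed
  show ?thesis
  proof (intro exI conjI)
    show "(f \<longlongrightarrow> 0) (at_right 0)" by (rule f(1))
    show "((\<lambda>\<epsilon>. - g \<epsilon>) \<longlongrightarrow> 0) (at_right 0)" using tendsto_minus[OF g(1)] by simp
    have unit_pos: "(0::real) < 1" by simp
    have "\<epsilon> powr (- 1 / removal_const CARD('p) + 1 + f \<epsilon>) \<le> log (real CARD('p)) (real (removal_size TYPE('p) \<epsilon>)) \<and>
       log (real CARD('p)) (real (removal_size TYPE('p) \<epsilon>)) \<le> \<epsilon> powr (- 2 / removal_const CARD('p) - 2 + - g \<epsilon>)"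
      if e: "\<epsilon> \<in> {0<..<1}" for \<epsilon>
    proof -
      have e: "0 < \<epsilon>" "\<epsilon> < 1" using e by simp_all
      show ?thesis unfolding size by (rule conjI[OF f(2)[OF e, unfolded a_def] lower[OF e, unfolded b_def]])
    qed
    thus "\<forall>\<^sub>F \<epsilon> in at_right 0.
       \<epsilon> powr (- 1 / removal_const CARD('p) + 1 + f \<epsilon>) \<le> log (real CARD('p)) (real (removal_size TYPE('p) \<epsilon>)) \<and>
       log (real CARD('p)) (real (removal_size TYPE('p) \<epsilon>)) \<le> \<epsilon> powr (- 2 / removal_const CARD('p) - 2 + - g \<epsilon>)"
      by (rule eventually_mono[OF eventually_at_right_real[OF unit_pos]])
  qed
qed

end
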